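(* Let $n\ge1$ and let $$p_n(x;s|q,t)=\sum_{\theta\in M_n}c_n(\theta;s|q,t)\prod_{1\le i<j\le n}(x_j/x_i)^{\theta_{ij}}\in\mathbb{C}(s^{-Q_+})[[x^{-Q_+}]].$$ Then, with $\lambda$ such that $s_i=t^{n-i}q^{\lambda_i}$ $(1\le i\le n)$, $$D^x(u)\,x^\lambda p_n(x;s|q,t)=x^\lambda p_n(x;s|q,t)\prod_{i=1}^n(1-us_i).$$
   Context: Fix $q,t\in\mathbb{C}^*$ with $|q|<1$; $(z;q)_\infty=\prod_{k\ge0}(1-q^kz)$, $(z;q)_k=(z;q)_\infty/(q^kz;q)_\infty$. $M_n$ is the set of strictly upper triangular $n\times n$ matrices $\theta=(\theta_{ij})$ with entries in $\mathbb{N}=\{0,1,2,\ldots\}$ ($\theta_{ij}=0$ for $j\le i$). For $\theta\in M_n$, $$c_n(\theta;s|q,t)=\prod_{k=2}^{n}\prod_{1\le i<j\le k}\frac{(q^{\sum_{a>k}(\theta_{i,a}-\theta_{j,a})}ts_j/s_i;q)_{\theta_{i,k}}}{(q^{\sum_{a>k}(\theta_{i,a}-\theta_{j,a})}qs_j/s_i;q)_{\theta_{i,k}}}\cdot\prod_{k=2}^{n}\prod_{1\le i\le j<k}\frac{(q^{-\theta_{j,k}+\sum_{a>k}(\theta_{i,a}-\theta_{j,a})}qs_j/ts_i;q)_{\theta_{i,k}}}{(q^{-\theta_{j,k}+\sum_{a>k}(\theta_{i,a}-\theta_{j,a})}s_j/s_i;q)_{\theta_{i,k}}},$$ where $\sum_{a>k}=\sum_{a=k+1}^n$.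 The Ruijsenaars-Macdonald operators are $$D_r^{x}=t^{\binom{r}{2}}\sum_{|I|=r}\ \prod_{i\in I,\,j\notin I}\frac{tx_i-x_j}{x_i-x_j}\prod_{i\in I}T_{q,x_i},\qquad D^x(u)=\sum_{r=0}^n(-u)^rD^x_r ,$$ summed over $I\subseteq\{1,\ldots,n\}$, where $T_{q,x_i}$ is the $q$-shift $x_i\mapsto qx_i$. $\mathbb{C}[[x^{-Q_+}]]=\mathbb{C}[[x_2/x_1,\ldots,x_n/x_{n-1}]]$, $\mathbb{C}(s^{-Q_+})=\mathbb{C}(s_2/s_1,\ldots,s_n/s_{n-1})$; for $i<j$, $x_j/x_i$ denotes $\prod_{a=i}^{j-1}x_{a+1}/x_a$ (same for $s$). Formal conventions: $x^\lambda$ is a symbol with $T_{q,x_i}x^\lambda=q^{\lambda_i}x^\lambda=s_it^{i-n}x^\lambda$; coefficients of $D^x_r$ are expanded as power series in $x_j/x_i$ $(i<j)$; $T_{q,x_i}$ acts on power series by $x_i\mapsto qx_i$; $s_1,\ldots,s_n$ are indeterminates. *)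

theory Defs
  imports "HOL-Analysis.Analysis" "HOL-Library.Poly_Mapping"
    "HOL-Computational_Algebra.Fraction_Field"
begin

section \<open>Formal power series in several variables\<close>

text \<open>
  \<open>('v, 'a) mfps\<close> is the ring of formal power series over \<open>'a\<close> in variables indexed by \<open>'v\<close>;
  the monomials are the finitely supported exponents \<open>'v \<Rightarrow>\<^sub>0 nat\<close>.
\<close>

typedef ('v, 'a) mfps = "UNIV :: (('v \<Rightarrow>\<^sub>0 nat) \<Rightarrow> 'a) set"
  morphisms mfps_nth Abs_mfps by simp

lemma mfps_nth_Abs [simp]: "mfps_nth (Abs_mfps f) = f"
  by (simp add: Abs_mfps_inverse)

lemma mfps_eqI: "(\<And>m. mfps_nth f m = mfps_nth g m) \<Longrightarrow> f = g"
  by (metis ext mfps_nth_inject)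

definition splits :: "('v \<Rightarrow>\<^sub>0 nat) \<Rightarrow> (('v \<Rightarrow>\<^sub>0 nat) \<times> ('v \<Rightarrow>\<^sub>0 nat)) set" where
  "splits m = {(a, b). a + b = m}"

lemma finite_splits [simp]: "finite (splits (m :: 'v \<Rightarrow>\<^sub>0 nat))"
proof -
  let ?B = "{f. (\<forall>x\<in>Poly_Mapping.keys m. f x \<in> {..Max (Poly_Mapping.lookup m ` Poly_Mapping.keys m)}) \<and> (\<forall>x. x \<notin> Poly_Mapping.keys m \<longrightarrow> f x = 0)}"
  have "finite ?B"
    by (rule rev_finite_subset[OF finite_set_of_finite_funs[of "Poly_Mapping.keys m"
            "{..Max (Poly_Mapping.lookup m ` Poly_Mapping.keys m)}" 0]]) auto
  moreover have "Poly_Mapping.lookup ` fst ` splits m \<subseteq> ?B"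
  proof clarify
    fix a b :: "'v \<Rightarrow>\<^sub>0 nat" assume "(a, b) \<in> splits m"
    then have m: "m = a + b" by (simp add: splits_def)
    have le: "Poly_Mapping.lookup a x \<le> Poly_Mapping.lookup m x" for x by (simp add: m lookup_add)
    have "Poly_Mapping.lookup m x \<le> Max (Poly_Mapping.lookup m ` Poly_Mapping.keys m)" if "x \<in> Poly_Mapping.keys m" for x
      using that by (intro Max_ge) auto
    moreover have "Poly_Mapping.lookup a x = 0" if "x \<notin> Poly_Mapping.keys m" for x
      using le[of x] that by (simp add: in_keys_iff)
    ultimately show "(\<forall>x\<in>Poly_Mapping.keys m. Poly_Mapping.lookup (fst (a, b)) x \<in> {..Max (Poly_Mapping.lookup m ` Poly_Mapping.keys m)}) \<and>
        (\<forall>x. x \<notin> Poly_Mapping.keys m \<longrightarrow> Poly_Mapping.lookup (fst (a, b)) x = 0)"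
      by (auto intro: order_trans[OF le])
  qed
  ultimately have "finite (Poly_Mapping.lookup ` fst ` splits m)" using finite_subset by blast
  then have "finite (fst ` splits m)"
    by (rule finite_imageD) (auto intro: inj_onI simp: lookup_inject)
  moreover have "inj_on fst (splits m)" by (auto simp: inj_on_def splits_def)
  ultimately show ?thesis using finite_imageD by blast
qed

instantiation mfps :: (type, comm_ring_1) comm_ring_1
begin

definition zero_mfps :: "('a, 'b) mfps" where "0 = Abs_mfps (\<lambda>_. 0)"
definition one_mfps :: "('a, 'b) mfps" where "1 = Abs_mfps (\<lambda>m. if m = 0 then 1 else 0)"
definition plus_mfps :: "('a, 'b) mfps \<Rightarrow> ('a, 'b) mfps \<Rightarrow> ('a, 'b) mfps" where
  "f + g = Abs_mfps (\<lambda>m. mfps_nth f m + mfps_nth g m)"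
definition minus_mfps :: "('a, 'b) mfps \<Rightarrow> ('a, 'b) mfps \<Rightarrow> ('a, 'b) mfps" where
  "f - g = Abs_mfps (\<lambda>m. mfps_nth f m - mfps_nth g m)"
definition uminus_mfps :: "('a, 'b) mfps \<Rightarrow> ('a, 'b) mfps" where
  "- f = Abs_mfps (\<lambda>m. - mfps_nth f m)"
definition times_mfps :: "('a, 'b) mfps \<Rightarrow> ('a, 'b) mfps \<Rightarrow> ('a, 'b) mfps" where
  "f * g = Abs_mfps (\<lambda>m. \<Sum>(a, b)\<in>splits m. mfps_nth f a * mfps_nth g b)"

instance
proof
  fix f g h :: "('a, 'b) mfps"
  show "f * g * h = f * (g * h)"
  proof (rule mfps_eqI)
    fix m :: "'a \<Rightarrow>\<^sub>0 nat"
    have "mfps_nth (f * g * h) m = (\<Sum>(p, c)\<in>splits m. \<Sum>(a, b)\<in>splits p.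
        mfps_nth f a * mfps_nth g b * mfps_nth h c)"
      by (simp add: times_mfps_def sum_distrib_right case_prod_beta)
    also have "\<dots> = (\<Sum>((p, c), (a, b))\<in>(SIGMA x:splits m. splits (fst x)).
        mfps_nth f a * mfps_nth g b * mfps_nth h c)"
      by (subst sum.Sigma[symmetric]) (auto simp: case_prod_beta)
    also have "\<dots> = (\<Sum>((a, r), (b, c))\<in>(SIGMA x:splits m. splits (snd x)).
        mfps_nth f a * (mfps_nth g b * mfps_nth h c))"
      by (rule sum.reindex_bij_witness[of _ "\<lambda>((a, r), (b, c)). ((a + b, c), (a, b))"
            "\<lambda>((p, c), (a, b)). ((a, b + c), (b, c))"])
        (auto simp: splits_def add.assoc mult.assoc)
    also have "\<dots> = (\<Sum>(a, r)\<in>splits m. \<Sum>(b, c)\<in>splits r.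
        mfps_nth f a * (mfps_nth g b * mfps_nth h c))"
      by (subst sum.Sigma[symmetric]) (auto simp: case_prod_beta)
    also have "\<dots> = mfps_nth (f * (g * h)) m"
      by (simp add: times_mfps_def sum_distrib_left case_prod_beta)
    finally show "mfps_nth (f * g * h) m = mfps_nth (f * (g * h)) m" .
  qed
  show "f * g = g * f"
  proof (rule mfps_eqI)
    fix m :: "'a \<Rightarrow>\<^sub>0 nat"
    show "mfps_nth (f * g) m = mfps_nth (g * f) m"
      unfolding times_mfps_def mfps_nth_Abs
      by (rule sum.reindex_bij_witness[of _ prod.swap prod.swap])
        (auto simp: splits_def add.commute mult.commute)
  qed
  show "1 * f = f"
  proof (rule mfps_eqI)
    fix m :: "'a \<Rightarrow>\<^sub>0 nat"
    have "mfps_nth (1 * f) m = (\<Sum>x\<in>splits m. if x = (0, m) then mfps_nth f m else 0)"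
      unfolding times_mfps_def one_mfps_def mfps_nth_Abs
      by (intro sum.cong refl, clarify, case_tac "a = 0") (auto simp: splits_def)
    also have "\<dots> = mfps_nth f m"
      by (subst sum.delta[OF finite_splits]) (simp add: splits_def)
    finally show "mfps_nth (1 * f) m = mfps_nth f m" .
  qed
  show "(f + g) * h = f * h + g * h"
    by (rule mfps_eqI)
      (simp add: times_mfps_def plus_mfps_def case_prod_beta ring_distribs sum.distrib)
  show "(0 :: ('a, 'b) mfps) \<noteq> 1"
  proof
    assume "(0 :: ('a, 'b) mfps) = 1"
    then have "mfps_nth (0 :: ('a, 'b) mfps) 0 = mfps_nth 1 0" by (rule arg_cong)
    then show False by (simp add: zero_mfps_def one_mfps_def)
  qed
qed (auto intro!: mfps_eqI simp: zero_mfps_def plus_mfps_def minus_mfps_def uminus_mfps_def)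

end

lemma mfps_nth_times:
  "mfps_nth (f * g) m = (\<Sum>(a, b)\<in>splits m. mfps_nth f a * mfps_nth g b)"
  by (simp add: times_mfps_def)

lemma mfps_nth_simps [simp]:
  "mfps_nth 0 m = 0" "mfps_nth 1 m = (if m = 0 then 1 else 0)"
  "mfps_nth (f + g) m = mfps_nth f m + mfps_nth g m"
  "mfps_nth (f - g) m = mfps_nth f m - mfps_nth g m"
  "mfps_nth (- f) m = - mfps_nth f m"
  by (simp_all add: zero_mfps_def one_mfps_def plus_mfps_def minus_mfps_def uminus_mfps_def)

definition mfps_monom :: "('v \<Rightarrow>\<^sub>0 nat) \<Rightarrow> 'a :: comm_ring_1 \<Rightarrow> ('v, 'a) mfps" where
  "mfps_monom e c = Abs_mfps (\<lambda>m. if m = e then c else 0)"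

definition mfps_const :: "'a :: comm_ring_1 \<Rightarrow> ('v, 'a) mfps" where
  "mfps_const c = mfps_monom 0 c"

definition mfps_var :: "'v \<Rightarrow> ('v, 'a :: comm_ring_1) mfps" where
  "mfps_var v = mfps_monom (Poly_Mapping.single v 1) 1"

text \<open>
  The sum of a family in which every monomial has a nonzero coefficient in only finitely many
  members. (Coefficients violating this condition get the junk value 0; see the
  lemmas \<open>finite_p_series\<close> and \<open>mfps_geom_inverse\<close> for the two uses below.)
\<close>

definition mfps_sum :: "('b \<Rightarrow> ('v, 'a :: comm_ring_1) mfps) \<Rightarrow> 'b set \<Rightarrow> ('v, 'a) mfps" where
  "mfps_sum F A = Abs_mfps (\<lambda>m. \<Sum>x | x \<in> A \<and> mfps_nth (F x) m \<noteq> 0. mfps_nth (F x) m)"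

definition mfps_geom :: "('v, 'a :: comm_ring_1) mfps \<Rightarrow> ('v, 'a) mfps" where
  "mfps_geom z = mfps_sum (\<lambda>k. z ^ k) (UNIV :: nat set)"

lemma mfps_nth_monom: "mfps_nth (mfps_monom e c) m = (if m = e then c else 0)"
  by (simp add: mfps_monom_def)

lemma mfps_monom_mult: "mfps_monom a c * mfps_monom b d = mfps_monom (a + b) (c * d)"
proof (rule mfps_eqI)
  fix m
  have "mfps_nth (mfps_monom a c * mfps_monom b d) m =
      (\<Sum>x\<in>splits m. if x = (a, b) then c * d else 0)"
    unfolding mfps_nth_times mfps_monom_def mfps_nth_Abs
    by (intro sum.cong refl) (simp add: case_prod_beta prod_eq_iff)
  also have "\<dots> = mfps_nth (mfps_monom (a + b) (c * d)) m"
    by (subst sum.delta[OF finite_splits]) (auto simp: mfps_monom_def splits_def)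
  finally show "mfps_nth (mfps_monom a c * mfps_monom b d) m = mfps_nth (mfps_monom (a + b) (c * d)) m" .
qed

lemma mfps_one_monom: "1 = mfps_monom 0 1"
  by (simp add: one_mfps_def mfps_monom_def)

lemma mfps_prod_monom:
  "(\<Prod>x\<in>A. mfps_monom (e x) (c x)) = mfps_monom (\<Sum>x\<in>A. e x) (\<Prod>x\<in>A. c x)"
  by (induction A rule: infinite_finite_induct) (auto simp: mfps_one_monom mfps_monom_mult)

lemma mfps_power_monom: "mfps_monom e 1 ^ k = mfps_monom (\<Sum>_<k. e) 1"
  by (induction k) (auto simp: mfps_one_monom mfps_monom_mult add.commute)


section \<open>The coefficient field\<close>

text \<open>
  \<open>ratfun\<close> is the field \<open>C(s\<^sub>0, s\<^sub>1, s\<^sub>2, \<dots>)\<close> of rational functions in countably many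
  indeterminates, the fraction field of the polynomial ring \<open>(nat \<Rightarrow>\<^sub>0 nat) \<Rightarrow>\<^sub>0 complex\<close>.
\<close>

type_synonym ratfun = "((nat \<Rightarrow>\<^sub>0 nat) \<Rightarrow>\<^sub>0 complex) fract"

definition rc :: "complex \<Rightarrow> ratfun" where
  "rc c = Fract (Poly_Mapping.single 0 c) 1"

definition sv :: "nat \<Rightarrow> ratfun" where
  "sv i = Fract (Poly_Mapping.single (Poly_Mapping.single i 1) 1) 1"

text \<open>The subfield \<open>C(s\<^sub>2/s\<^sub>1, \<dots>, s\<^sub>n/s\<^bsub>n-1\<^esub>)\<close>, generated over the constants.\<close>

inductive_set ratfun_Q :: "nat \<Rightarrow> ratfun set" for n :: nat where
  const: "rc c \<in> ratfun_Q n"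
| gen: "1 \<le> a \<Longrightarrow> a < n \<Longrightarrow> sv (a + 1) / sv a \<in> ratfun_Q n"
| add: "f \<in> ratfun_Q n \<Longrightarrow> g \<in> ratfun_Q n \<Longrightarrow> f + g \<in> ratfun_Q n"
| mult: "f \<in> ratfun_Q n \<Longrightarrow> g \<in> ratfun_Q n \<Longrightarrow> f * g \<in> ratfun_Q n"
| inverse: "f \<in> ratfun_Q n \<Longrightarrow> inverse f \<in> ratfun_Q n"

text \<open>
  Power series in \<open>x\<^sub>2/x\<^sub>1, x\<^sub>3/x\<^sub>2, \<dots>\<close>: the variable with index \<open>a\<close> stands for \<open>x\<^bsub>a+1\<^esub>/x\<^sub>a\<close>.
  For a given \<open>n\<close> only the variables with \<open>1 \<le> a < n\<close> matter.
\<close>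

type_synonym xseries = "(nat, ratfun) mfps"

definition xseries_Q :: "nat \<Rightarrow> xseries set" where
  "xseries_Q n = {f. \<forall>m. mfps_nth f m \<in> ratfun_Q n \<and> (mfps_nth f m \<noteq> 0 \<longrightarrow> Poly_Mapping.keys m \<subseteq> {1..<n})}"

definition xratio :: "nat \<Rightarrow> nat \<Rightarrow> xseries" where
  "xratio i j = (\<Prod>a = i..<j. mfps_var a)"  \<comment> \<open>\<open>x\<^sub>j/x\<^sub>i\<close>, for \<open>i < j\<close>\<close>


section \<open>The series $p_n$\<close>

definition qpoch :: "'a :: comm_ring_1 \<Rightarrow> 'a \<Rightarrow> nat \<Rightarrow> 'a" where
  "qpoch q z k = (\<Prod>l<k. 1 - q ^ l * z)"

text \<open>
  Over the complex numbers this is \<open>(z;q)\<^sub>\<infinity> / (q\<^sup>k z;q)\<^sub>\<infinity>\<close> (lemma \<open>qpoch_eq_prodinf\<close>); the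
  finite product makes sense for \<open>z\<close> in the field of rational functions as well.
\<close>

definition Mtheta :: "nat \<Rightarrow> (nat \<Rightarrow> nat \<Rightarrow> nat) set" where
  "Mtheta n = {\<theta>. \<forall>i j. \<not> (1 \<le> i \<and> i < j \<and> j \<le> n) \<longrightarrow> \<theta> i j = 0}"

definition theta_diff :: "nat \<Rightarrow> (nat \<Rightarrow> nat \<Rightarrow> nat) \<Rightarrow> nat \<Rightarrow> nat \<Rightarrow> nat \<Rightarrow> int" where
  "theta_diff n \<theta> k i j = (\<Sum>a = k + 1..n. int (\<theta> i a) - int (\<theta> j a))"

definition c_coeff :: "nat \<Rightarrow> complex \<Rightarrow> complex \<Rightarrow> (nat \<Rightarrow> nat \<Rightarrow> nat) \<Rightarrow> ratfun" where
  "c_coeff n q t \<theta> =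
     (\<Prod>k = 2..n. \<Prod>(i, j) \<in> {(i, j). 1 \<le> i \<and> i < j \<and> j \<le> k}.
        qpoch (rc q) (rc (q powi theta_diff n \<theta> k i j * t) * sv j / sv i) (\<theta> i k) /
        qpoch (rc q) (rc (q powi theta_diff n \<theta> k i j * q) * sv j / sv i) (\<theta> i k)) *
     (\<Prod>k = 2..n. \<Prod>(i, j) \<in> {(i, j). 1 \<le> i \<and> i \<le> j \<and> j < k}.
        qpoch (rc q) (rc (q powi (- int (\<theta> j k) + theta_diff n \<theta> k i j) * q / t) * sv j / sv i) (\<theta> i k) /
        qpoch (rc q) (rc (q powi (- int (\<theta> j k) + theta_diff n \<theta> k i j)) * sv j / sv i) (\<theta> i k))"

definition xmonom :: "nat \<Rightarrow> (nat \<Rightarrow> nat \<Rightarrow> nat) \<Rightarrow> xseries" where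
  "xmonom n \<theta> = (\<Prod>(i, j) \<in> {(i, j). 1 \<le> i \<and> i < j \<and> j \<le> n}. xratio i j ^ \<theta> i j)"

definition p_series :: "nat \<Rightarrow> complex \<Rightarrow> complex \<Rightarrow> xseries" where
  "p_series n q t = mfps_sum (\<lambda>\<theta>. mfps_const (c_coeff n q t \<theta>) * xmonom n \<theta>) (Mtheta n)"


section \<open>The operators\<close>

text \<open>
  \<open>x\<^sub>i \<mapsto> q x\<^sub>i\<close> multiplies \<open>x\<^sub>i/x\<^bsub>i-1\<^esub>\<close> by \<open>q\<close> and \<open>x\<^bsub>i+1\<^esub>/x\<^sub>i\<close> by \<open>1/q\<close>.
\<close>

definition qshift :: "complex \<Rightarrow> nat \<Rightarrow> xseries \<Rightarrow> xseries" where
  "qshift q i f =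
     Abs_mfps (\<lambda>m. rc (q powi (int (Poly_Mapping.lookup m (i - 1)) - int (Poly_Mapping.lookup m i))) * mfps_nth f m)"

text \<open>
  Elements \<open>x\<^sup>\<lambda> f\<close> of the free rank one module generated by the symbol \<open>x\<^sup>\<lambda>\<close> are represented by
  \<open>f\<close>, and \<open>T_lam\<close>, \<open>D_op\<close>, \<open>D_gen\<close> are operators on this module in the coordinate \<open>f\<close>.
  Since \<open>T\<^bsub>q,x\<^sub>i\<^esub> x\<^sup>\<lambda> = q\<^bsup>\<lambda>\<^sub>i\<^esup> x\<^sup>\<lambda>\<close> and \<open>s\<^sub>i = t\<^bsup>n-i\<^esup> q\<^bsup>\<lambda>\<^sub>i\<^esup>\<close>, the operator \<open>T\<^bsub>q,x\<^sub>i\<^esub>\<close> sends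
  \<open>x\<^sup>\<lambda> f\<close> to \<open>x\<^sup>\<lambda> (s\<^sub>i t\<^bsup>i-n\<^esup> T\<^bsub>q,x\<^sub>i\<^esub> f)\<close>.
\<close>

definition T_lam :: "nat \<Rightarrow> complex \<Rightarrow> complex \<Rightarrow> nat \<Rightarrow> xseries \<Rightarrow> xseries" where
  "T_lam n q t i f = mfps_const (sv i * rc (t powi (int i - int n))) * qshift q i f"

text \<open>
  The power series expansion of \<open>(t x\<^sub>i - x\<^sub>j) / (x\<^sub>i - x\<^sub>j)\<close>: numerator and denominator are
  divided by \<open>x\<^sub>i\<close> if \<open>i < j\<close>, and by \<open>-x\<^sub>j\<close> if \<open>j < i\<close>.
\<close>

definition D_factor :: "complex \<Rightarrow> nat \<Rightarrow> nat \<Rightarrow> xseries" where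
  "D_factor t i j =
     (if i < j then (mfps_const (rc t) - xratio i j) * mfps_geom (xratio i j)
      else (1 - mfps_const (rc t) * xratio j i) * mfps_geom (xratio j i))"

text \<open>
  The \<open>T_lam n q t i\<close> commute (lemma \<open>comp_fun_commute_T_lam\<close>), so that
  \<^const>\<open>Finite_Set.fold\<close> composes them over \<open>i \<in> I\<close>.
\<close>

definition D_op :: "nat \<Rightarrow> complex \<Rightarrow> complex \<Rightarrow> nat \<Rightarrow> xseries \<Rightarrow> xseries" where
  "D_op n q t r f = mfps_const (rc (t ^ (r choose 2))) *
     (\<Sum>I | I \<subseteq> {1..n} \<and> card I = r.
        (\<Prod>(i, j) \<in> I \<times> ({1..n} - I). D_factor t i j) * Finite_Set.fold (T_lam n q t) f I)"

text \<open>
  The operators act linearly over the coefficient field, so the parameter \<open>u\<close> can be any of its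
  elements: a complex number, or, as an indeterminate, some \<open>s\<^sub>k\<close> with \<open>k\<close> outside \<open>{1..n}\<close>.
\<close>

definition D_gen :: "nat \<Rightarrow> complex \<Rightarrow> complex \<Rightarrow> ratfun \<Rightarrow> xseries \<Rightarrow> xseries" where
  "D_gen n q t u f = (\<Sum>r = 0..n. mfps_const ((- u) ^ r) * D_op n q t r f)"


section \<open>Well-definedness\<close>

lemma rc_mult: "rc (a * b) = rc a * rc b"
  by (simp add: rc_def mult_single)

lemma rc_1: "rc 1 = 1"
  by (simp add: rc_def One_fract_def)

lemma rc_power: "rc (a ^ k) = rc a ^ k"
  by (induction k) (simp_all add: rc_1 rc_mult)

lemma rc_eq_iff: "rc a = rc b \<longleftrightarrow> a = b"
  by (auto simp: rc_def eq_fract) (metis lookup_single_eq)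

lemma sv_nonzero [simp]: "sv i \<noteq> 0"
  by (simp add: sv_def Zero_fract_def eq_fract)
    (metis lookup_single_eq lookup_zero zero_neq_one)

lemma rc_sv_neq_1: "i \<noteq> j \<Longrightarrow> rc c * sv j / sv i \<noteq> 1"
proof
  assume ij: "i \<noteq> j" and "rc c * sv j / sv i = 1"
  then have "rc c * sv j = sv i" by (simp add: field_simps)
  then have "Poly_Mapping.single (Poly_Mapping.single j (1::nat)) c =
      Poly_Mapping.single (Poly_Mapping.single i 1) 1"
    by (simp add: rc_def sv_def eq_fract mult_single)
  then have "Poly_Mapping.lookup (Poly_Mapping.single (Poly_Mapping.single j (1::nat)) c)
        (Poly_Mapping.single i 1) = 1"
    by simp
  then show False using ij
    by (metis lookup_single_eq lookup_single_not_eq zero_neq_one)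
qed

text \<open>No denominator in \<^const>\<open>c_coeff\<close> vanishes.\<close>

lemma c_coeff_denominator_1:
  "i < j \<Longrightarrow> qpoch (rc q) (rc c * sv j / sv i) k \<noteq> 0"
  using rc_sv_neq_1[of i j "q ^ l * c" for l]
  by (auto simp: qpoch_def rc_mult rc_power mult.assoc)

lemma c_coeff_denominator_2:
  assumes "q \<noteq> 0" "norm q < 1" "i \<le> j"
  shows "qpoch (rc q) (rc (q powi (- int (\<theta> j k) + theta_diff n \<theta> k i j)) * sv j / sv i) (\<theta> i k) \<noteq> 0"
proof (cases "i = j")
  case True
  have "q ^ l * q powi (- int (\<theta> i k)) \<noteq> 1" if "l < \<theta> i k" for l
  proof
    assume "q ^ l * q powi (- int (\<theta> i k)) = 1"
    then have "q ^ (\<theta> i k - l) = 1"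
      using that assms(1) by (simp add: power_int_minus field_simps power_diff)
    then have "norm q ^ (\<theta> i k - l) = 1" by (metis norm_one norm_power)
    then show False using that assms(2) using power_strict_decreasing[of 0 "\<theta> i k - l" "norm q"] assms(1) by simp
  qed
  then have "rc q ^ l * rc (q powi (- int (\<theta> i k))) \<noteq> 1" if "l < \<theta> i k" for l
    using that by (metis rc_1 rc_eq_iff rc_mult rc_power)
  then show ?thesis using True by (auto simp: qpoch_def theta_diff_def)
next
  case False
  then show ?thesis using assms(3) c_coeff_denominator_1 by simp
qed

lemma xratio_monom: "xratio i j = mfps_monom (\<Sum>a = i..<j. Poly_Mapping.single a 1) 1"
  by (simp add: xratio_def mfps_var_def mfps_prod_monom)

lemma finite_p_series:
  "finite {\<theta> \<in> Mtheta n. mfps_nth (mfps_const (c \<theta>) * xmonom n \<theta>) m \<noteq> 0}"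
proof -
  let ?P = "{(i, j). 1 \<le> i \<and> i < j \<and> j \<le> n}"
  let ?e = "\<lambda>\<theta>. \<Sum>(i, j)\<in>?P. \<Sum>_<\<theta> i j. \<Sum>a = i..<j. Poly_Mapping.single a (1::nat)"
  have fin: "finite ?P" by (rule finite_subset[of _ "{1..n} \<times> {1..n}"]) auto
  have mon: "xmonom n \<theta> = mfps_monom (?e \<theta>) 1" for \<theta>
    by (simp add: xmonom_def xratio_monom mfps_power_monom mfps_prod_monom case_prod_beta)
  have bound: "\<theta> i j \<le> Poly_Mapping.lookup (?e \<theta>) i" if "(i, j) \<in> ?P" for \<theta> i j
  proof -
    have "\<theta> i j = (\<Sum>_<\<theta> i j. \<Sum>a = i..<j. Poly_Mapping.lookup (Poly_Mapping.single a (1::nat)) i)"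
      using that by (simp add: lookup_single when_def)
    also have "\<dots> \<le> (\<Sum>(i', j)\<in>?P. \<Sum>_<\<theta> i' j. \<Sum>a = i'..<j. Poly_Mapping.lookup (Poly_Mapping.single a (1::nat)) i)"
      using member_le_sum[OF that, of "\<lambda>(i', j). \<Sum>_<\<theta> i' j. \<Sum>a = i'..<j.
          Poly_Mapping.lookup (Poly_Mapping.single a (1::nat)) i"] fin by simp
    also have "\<dots> = Poly_Mapping.lookup (?e \<theta>) i"
      by (simp add: lookup_sum case_prod_beta del: sum_constant)
    finally show ?thesis .
  qed
  let ?N = "Max (Poly_Mapping.lookup m ` {1..n})"
  have "{\<theta> \<in> Mtheta n. mfps_nth (mfps_const (c \<theta>) * xmonom n \<theta>) m \<noteq> 0} \<subseteq>
      (\<lambda>f i j. f (i, j)) ` {f. (\<forall>x\<in>?P. f x \<in> {..?N}) \<and> (\<forall>x. x \<notin> ?P \<longrightarrow> f x = 0)}"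
  proof clarify
    fix \<theta> assume \<theta>: "\<theta> \<in> Mtheta n" and nz: "mfps_nth (mfps_const (c \<theta>) * xmonom n \<theta>) m \<noteq> 0"
    have "m = ?e \<theta>"
      using nz unfolding mon mfps_const_def mfps_monom_mult mfps_nth_monom
      by (simp only: add_0 simp_thms split: if_splits)
    then have "\<theta> i j \<le> ?N" if "(i, j) \<in> ?P" for i j
      using bound[OF that, of \<theta>] that by (intro order_trans[OF _ Max_ge[of _ "Poly_Mapping.lookup m i"]]) auto
    with \<theta> show "\<theta> \<in> (\<lambda>f i j. f (i, j)) `
        {f. (\<forall>x\<in>?P. f x \<in> {..?N}) \<and> (\<forall>x. x \<notin> ?P \<longrightarrow> f x = 0)}"
      by (intro image_eqI[of _ _ "\<lambda>(i, j). \<theta> i j"]) (auto simp: Mtheta_def)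
  qed
  moreover have "finite {f. (\<forall>x\<in>?P. f x \<in> {..?N}) \<and> (\<forall>x. x \<notin> ?P \<longrightarrow> f x = 0)}"
    by (rule rev_finite_subset[OF finite_set_of_finite_funs[OF fin, of "{..?N}" 0]]) auto
  ultimately show ?thesis using finite_subset by blast
qed

lemma mfps_geom_inverse: "i < j \<Longrightarrow> (1 - xratio i j) * mfps_geom (xratio i j) = 1"
proof -
  assume ij: "i < j"
  define e where "e = (\<Sum>a = i..<j. Poly_Mapping.single a (1::nat))"
  have z: "xratio i j = mfps_monom e 1" by (simp add: xratio_monom e_def)
  have "Poly_Mapping.lookup e i = 1"
    using ij by (simp add: e_def lookup_sum lookup_single when_def)
  then have lk: "Poly_Mapping.lookup (\<Sum>_<k. e) i = k" for k :: nat
    by (subst lookup_sum) simp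
  then have inj: "(\<Sum>_<k. e) = (\<Sum>_<l. e) \<longleftrightarrow> k = l" for k l :: nat by metis
  have Suc_e: "(\<Sum>_<Suc k. e) = e + (\<Sum>_<k. e)" for k :: nat
    by (simp only: sum.lessThan_Suc add.commute)
  let ?g = "mfps_geom (xratio i j)"
  have g: "mfps_nth ?g m = (if \<exists>k::nat. m = (\<Sum>_<k. e) then 1 else 0)" for m
  proof (cases "\<exists>k::nat. m = (\<Sum>_<k. e)")
    case True
    then obtain k :: nat where k: "m = (\<Sum>_<k. e)" by blast
    have "{l. mfps_nth (xratio i j ^ l) m \<noteq> 0} = {k}"
      by (auto simp: z mfps_power_monom mfps_nth_monom k inj simp del: sum_constant)
    then show ?thesis using k
      by (auto simp: mfps_geom_def mfps_sum_def z mfps_power_monom mfps_nth_monom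
          simp del: sum_constant)
  qed (auto simp: mfps_geom_def mfps_sum_def z mfps_power_monom mfps_nth_monom
          simp del: sum_constant)
  have zg: "mfps_nth (xratio i j * ?g) m = (if \<exists>k::nat. m = (\<Sum>_<Suc k. e) then 1 else 0)" for m
  proof -
    have "mfps_nth (xratio i j * ?g) m =
        (\<Sum>x\<in>splits m. if fst x = e then mfps_nth ?g (snd x) else 0)"
      unfolding mfps_nth_times by (intro sum.cong) (auto simp: z mfps_monom_def)
    also have "\<dots> = (\<Sum>x\<in>{x \<in> splits m. fst x = e}. mfps_nth ?g (snd x))"
      by (simp add: sum.If_cases Int_def)
    also have "\<dots> = (if \<exists>k::nat. m = (\<Sum>_<Suc k. e) then 1 else 0)"
    proof (cases "\<exists>r. m = e + r")
      case True
      then obtain r where r: "m = e + r" by blast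
      then have "{x \<in> splits m. fst x = e} = {(e, r)}" by (auto simp: splits_def)
      then show ?thesis by (simp add: g r Suc_e del: sum.lessThan_Suc sum_constant)
    next
      case False
      then have "{x \<in> splits m. fst x = e} = {}" by (auto simp: splits_def)
      then have "(\<Sum>x\<in>{x \<in> splits m. fst x = e}. mfps_nth ?g (snd x)) = 0"
        by (simp only: sum.empty)
      with False show ?thesis by (simp add: Suc_e del: sum.lessThan_Suc sum_constant)
    qed
    finally show ?thesis .
  qed
  show ?thesis
  proof (rule mfps_eqI)
    fix m
    have "(\<exists>k::nat. m = (\<Sum>_<k. e)) \<longleftrightarrow> m = 0 \<or> (\<exists>k::nat. m = (\<Sum>_<Suc k. e))"
      by (metis lessThan_0 sum.empty not0_implies_Suc)
    moreover have "0 \<noteq> (\<Sum>_<Suc k. e)" for k :: nat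
      using inj[of 0 "Suc k"] by simp
    ultimately show "mfps_nth ((1 - xratio i j) * ?g) m = mfps_nth 1 m"
      by (auto simp: left_diff_distrib g zg simp del: sum.lessThan_Suc sum_constant)
  qed
qed

lemma comp_fun_commute_T_lam: "comp_fun_commute (T_lam n q t)"
proof -
  have const_mult: "mfps_nth (mfps_const c * f) m = c * mfps_nth f m" for c :: ratfun and f :: xseries and m
  proof -
    have "mfps_nth (mfps_const c * f) m =
        (\<Sum>x\<in>splits m. if x = (0, m) then c * mfps_nth f m else 0)"
      unfolding mfps_nth_times
      by (intro sum.cong refl, clarify, case_tac "a = 0")
        (auto simp: mfps_const_def mfps_monom_def splits_def)
    also have "\<dots> = c * mfps_nth f m"
      by (subst sum.delta[OF finite_splits]) (simp add: splits_def)
    finally show ?thesis .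
  qed
  show ?thesis
    by (standard, rule ext, rule mfps_eqI) (simp add: T_lam_def qshift_def const_mult mult_ac)
qed

lemma qpoch_eq_prodinf:
  fixes q z :: complex
  assumes q: "norm q < 1" and nz: "\<And>l. q ^ l * (q ^ k * z) \<noteq> 1"
  shows "qpoch q z k = prodinf (\<lambda>l. 1 - q ^ l * z) / prodinf (\<lambda>l. 1 - q ^ l * (q ^ k * z))"
proof -
  have conv: "convergent_prod (\<lambda>l. 1 - q ^ l * w)" for w
  proof (rule abs_convergent_prod_imp_convergent_prod, rule summable_imp_abs_convergent_prod)
    have "summable (\<lambda>l. norm q ^ l * norm w)"
      using q by (intro summable_mult2 summable_geometric) simp
    then show "summable (\<lambda>l. norm (1 - q ^ l * w - 1))"
      by (simp add: norm_mult norm_power)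
  qed
  have "prodinf (\<lambda>l. 1 - q ^ l * (q ^ k * z)) \<noteq> 0"
    using nz by (intro prodinf_nonzero conv) (metis eq_iff_diff_eq_0)
  moreover have "prodinf (\<lambda>l. 1 - q ^ l * z) =
      qpoch q z k * prodinf (\<lambda>l. 1 - q ^ l * (q ^ k * z))"
    using has_prod_ignore_initial_segment'[OF conv[of z], of k]
    by (simp add: qpoch_def has_prod_iff power_add mult.assoc)
  ultimately show ?thesis by simp
qed

end

theory Submission
  imports Defs "HOL-Computational_Algebra.Polynomial_Factorial"
begin

text \<open>
  Let \<open>p\<^sub>n(s)\<close> denote the series with spectral parameters \<open>s\<close>. Splitting off the last column of
  \<open>\<theta>\<close> writes \<open>p\<^bsub>N+1\<^esub>(s)\<close> as a sum of the \<open>p\<^sub>N(q\<^bsup>-\<mu>\<^esup> s)\<close> over \<open>\<mu> \<in> \<nat>\<^sup>N\<close>. A rational function identity for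
  sums over subsets shows by induction on \<open>n\<close> that \<open>p\<^sub>n\<close> satisfies the Pieri formula, which expands
  \<open>e\<^sub>r(x) p\<^sub>n(s)\<close> in the series \<open>p\<^sub>n\<close> with some of the \<open>s\<^sub>i\<close> multiplied by \<open>q\<close>. For generic \<open>t\<close> the eigenvalue
  equation of \<open>D\<^sub>1\<close> follows by induction on \<open>n\<close>: multiplied by \<open>\<Prod>(x\<^sub>j - x\<^bsub>N+1\<^esub>)\<close>, the operator \<open>D\<^sub>1\<close> in \<open>N + 1\<close>
  variables is expressed through the one in \<open>N\<close> variables and multiplication by symmetric polynomials,
  to which the Pieri formula applies.

  The operators \<open>D\<^sub>r\<close> commute with \<open>D\<^sub>1\<close>, and a series with constant term \<open>0\<close> that satisfies the eigenvalue
  equation of \<open>D\<^sub>1\<close> vanishes. Comparing constant terms, \<open>p\<^sub>n\<close> is an eigenfunction of every \<open>D\<^sub>r\<close> with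
  eigenvalue \<open>e\<^sub>r(s)\<close>. Finally all coefficients are Laurent polynomials in \<open>t\<close>, which removes the genericity
  assumption.
\<close>

section \<open>Two sums over subsets\<close>

text \<open>The obstacle is that \<open>D_factor t i (Suc N)\<close> has a pole at x_i = x_(N+1), so
  the operator in N variables cannot simply be applied to the summands of the branching sum.
  Clearing the poles brings in the elementary symmetric polynomials of x_1, ..., x_N, and the Pieri
  formula keeps their products with p_N inside the span of such series. Sorting all terms by their
  final spectrum then leaves, for each exponent \<rho>, a finite identity between rational functions
  of \<sigma>_i and y_i = \<sigma>_i/q^\<rho>_i. Divided by the branching coefficient at \<rho>, it
  depends on t only through \<kappa> = t/q, and on the spectrum only through the sets S and Y. In
  this form it can be proved by interpolation in one element of S. Genericity of t, not an integral
  power of q, keeps the divisors nonzero: for other t the branching coefficients may vanish. Only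
  D_1 is treated by such identities. For higher r, commutation with D_1 and the linear independence
  of the s_i take their place.\<close>

definition polyf :: "nat \<Rightarrow> ('a::idom \<Rightarrow> 'a) \<Rightarrow> bool" where
  "polyf d F \<longleftrightarrow> (\<exists>p. degree p \<le> d \<and> (\<forall>z. F z = poly p z))"

lemma polyf_const: "polyf d (\<lambda>_. c)"
  unfolding polyf_def by (rule exI[of _ "[:c:]"]) auto

lemma polyf_linear: "polyf 1 (\<lambda>z. a + b * z)"
  unfolding polyf_def by (rule exI[of _ "[:a, b:]"]) auto

lemma polyf_linear_diff: "polyf 1 (\<lambda>z. a - b * z)" "polyf 1 (\<lambda>z. a - z)"
  using polyf_linear[of a "- b"] polyf_linear[of a "- 1"] by simp_all

lemma polyf_mult: "polyf d F \<Longrightarrow> polyf e G \<Longrightarrow> polyf (d + e) (\<lambda>z. F z * G z)"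
  unfolding polyf_def by (metis add_mono degree_mult_le order_trans poly_mult)

lemma polyf_cmult: "polyf d F \<Longrightarrow> polyf d (\<lambda>z. c * F z)"
  using polyf_mult[OF polyf_const[of 0 c]] by simp

lemma polyf_add: "polyf d F \<Longrightarrow> polyf d G \<Longrightarrow> polyf d (\<lambda>z. F z + G z)"
  unfolding polyf_def by (metis degree_add_le poly_add)

lemma polyf_diff: "polyf d F \<Longrightarrow> polyf d G \<Longrightarrow> polyf d (\<lambda>z. F z - G z)"
  unfolding polyf_def by (metis degree_diff_le poly_diff)

lemma polyf_sum: "(\<And>x. x \<in> A \<Longrightarrow> polyf d (F x)) \<Longrightarrow> polyf d (\<lambda>z. \<Sum>x\<in>A. F x z)"
  by (induction A rule: infinite_finite_induct) (auto intro: polyf_const polyf_add)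

lemma polyf_prod: "finite A \<Longrightarrow> (\<And>x. x \<in> A \<Longrightarrow> polyf 1 (F x)) \<Longrightarrow> polyf (card A) (\<lambda>z. \<Prod>x\<in>A. F x z)"
proof (induction A rule: finite_induct)
  case (insert x A)
  then show ?case using polyf_mult[of 1 "F x" "card A" "\<lambda>z. \<Prod>x\<in>A. F x z"] by simp
qed (auto intro: polyf_const)

lemma polyf_eq_0:
  assumes "polyf d F" "finite Z" "d < card Z" "\<And>z. z \<in> Z \<Longrightarrow> F z = 0"
  shows "F z = 0"
proof -
  obtain p where p: "degree p \<le> d" "\<And>z. F z = poly p z" using assms(1) unfolding polyf_def by blast
  have "p = 0"
  proof (rule ccontr)
    assume "p \<noteq> 0"
    then have "card {x. poly p x = 0} \<le> degree p" "finite {x. poly p x = 0}"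
      by (auto simp: card_poly_roots_bound poly_roots_finite)
    moreover have "Z \<subseteq> {x. poly p x = 0}" using assms(4) p by auto
    ultimately have "card Z \<le> degree p" by (meson card_mono order_trans)
    then show False using p(1) assms(3) by simp
  qed
  then show ?thesis using p by simp
qed

section \<open>Sums over the subsets of an enlarged set\<close>

lemma sum_Pow_insert:
  assumes "finite A" "b \<notin> A"
  shows "(\<Sum>J\<in>Pow (insert b A). f J) = (\<Sum>J\<in>Pow A. f J) + (\<Sum>J\<in>Pow A. f (insert b J))"
proof -
  have "inj_on (insert b) (Pow A)" using assms(2) by (intro inj_onI) (metis Diff_insert_absorb PowD subset_iff)
  moreover have "Pow A \<inter> insert b ` Pow A = {}" using assms(2) by blast
  ultimately show ?thesis
    using assms(1) by (simp add: Pow_insert sum.union_disjoint sum.reindex)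
qed

lemma sum_Pow_insert_left:
  assumes "finite A" "b \<notin> A" "\<And>J. J \<subseteq> A \<Longrightarrow> f (insert b J) = 0"
  shows "(\<Sum>J\<in>Pow (insert b A). f J) = (\<Sum>J\<in>Pow A. f J)"
  by (subst sum_Pow_insert[OF assms(1,2)]) (use assms(3) in \<open>simp\<close>)

lemma sum_Pow_insert_right:
  assumes "finite A" "b \<notin> A" "\<And>J. J \<subseteq> A \<Longrightarrow> f J = 0"
  shows "(\<Sum>J\<in>Pow (insert b A). f J) = (\<Sum>J\<in>Pow A. f (insert b J))"
  by (subst sum_Pow_insert[OF assms(1,2)]) (use assms(3) in \<open>simp\<close>)

text \<open>
  With \<open>\<kappa> = t/q\<close>, \<open>S = {\<sigma>\<^sub>1, \<dots>, \<sigma>\<^bsub>N+1\<^esub>}\<close> and \<open>Y = {\<sigma>\<^sub>i / q\<^bsup>\<rho>\<^sub>i\<^esup> | i \<le> N}\<close>, the weights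
  \<open>wL\<close> and \<open>wR\<close> are, up to a factor independent of \<open>J\<close>, the products of a branching coefficient and
  a Pieri coefficient taken in the two possible orders (lemmas \<open>branch_pieri_eq_wL\<close> and
  \<open>pieri_branch_eq_wR\<close>).
\<close>

definition wL :: "'a::field \<Rightarrow> 'a set \<Rightarrow> 'a set \<Rightarrow> 'a set \<Rightarrow> 'a" where
  "wL \<kappa> S Y J = \<kappa> ^ (Suc (card J) choose 2) * (\<Prod>a\<in>Y-J. \<Prod>b\<in>J. (\<kappa> * a - b) / (a - b)) *
     (\<Prod>a\<in>Y-J. \<Prod>m\<in>S. a - \<kappa> * m) * (\<Prod>a\<in>J. \<Prod>m\<in>S. a - m)"

definition wR :: "'a::field \<Rightarrow> 'a set \<Rightarrow> 'a set \<Rightarrow> 'a set \<Rightarrow> 'a" where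
  "wR \<kappa> S Y J = \<kappa> ^ (card J choose 2) * (\<Prod>a\<in>S-J. \<Prod>b\<in>J. (a - \<kappa> * b) / (a - b)) *
     (\<Prod>m\<in>S-J. \<Prod>y\<in>Y. y - \<kappa> * m) * (\<Prod>m\<in>J. \<Prod>y\<in>Y. y - m)"

section \<open>Change of the weights when one element joins S or Y\<close>

lemma Suc_choose_2: "Suc n choose 2 = n + (n choose 2)"
  by (simp add: numeral_2_eq_2)

lemma insert_Diff_notin: "b \<notin> J \<Longrightarrow> insert b A - J = insert b (A - J)"
  "b \<notin> A \<Longrightarrow> insert b A - insert b J = A - J" by auto

lemma wL_insert_S:
  assumes "finite S" "m \<notin> S"
  shows "wL \<kappa> (insert m S) Y J = wL \<kappa> S Y J * ((\<Prod>a\<in>Y-J. a - \<kappa> * m) * (\<Prod>a\<in>J. a - m))"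
  using assms by (simp add: wL_def prod.distrib)

lemma wL_insert_Y_out:
  assumes "finite Y" "b \<notin> Y" "J \<subseteq> Y"
  shows "wL \<kappa> S (insert b Y) J = wL \<kappa> S Y J * ((\<Prod>c\<in>J. (\<kappa> * b - c) / (b - c)) * (\<Prod>m\<in>S. b - \<kappa> * m))"
proof -
  have "b \<notin> J" using assms by auto
  then show ?thesis using assms by (simp add: wL_def insert_Diff_notin)
qed

lemma wL_insert_Y_in:
  assumes "finite Y" "b \<notin> Y" "J \<subseteq> Y"
  shows "wL \<kappa> S (insert b Y) (insert b J) =
    wL \<kappa> S Y J * (\<kappa> ^ Suc (card J) * (\<Prod>a\<in>Y-J. (\<kappa> * a - b) / (a - b)) * (\<Prod>m\<in>S. b - m))"
proof -
  have "b \<notin> J" "finite J" using assms finite_subset by auto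
  then show ?thesis using assms
    by (simp add: wL_def insert_Diff_notin Suc_choose_2 power_add prod.distrib mult_ac
        del: times_divide_eq_left times_divide_eq_right)
qed

lemma wR_insert_Y:
  assumes "finite Y" "b \<notin> Y"
  shows "wR \<kappa> S (insert b Y) J = wR \<kappa> S Y J * ((\<Prod>m\<in>S-J. b - \<kappa> * m) * (\<Prod>m\<in>J. b - m))"
  using assms by (simp add: wR_def prod.distrib)

lemma wR_insert_S_out:
  assumes "finite S" "m \<notin> S" "J \<subseteq> S"
  shows "wR \<kappa> (insert m S) Y J = wR \<kappa> S Y J * ((\<Prod>b\<in>J. (m - \<kappa> * b) / (m - b)) * (\<Prod>y\<in>Y. y - \<kappa> * m))"
proof -
  have "m \<notin> J" using assms by auto
  then show ?thesis using assms by (simp add: wR_def insert_Diff_notin)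
qed

lemma wR_insert_S_in:
  assumes "finite S" "m \<notin> S" "J \<subseteq> S"
  shows "wR \<kappa> (insert m S) Y (insert m J) =
    wR \<kappa> S Y J * (\<kappa> ^ card J * (\<Prod>a\<in>S-J. (a - \<kappa> * m) / (a - m)) * (\<Prod>y\<in>Y. y - m))"
proof -
  have "m \<notin> J" "finite J" using assms finite_subset by auto
  then show ?thesis using assms
    by (simp add: wR_def insert_Diff_notin power_add prod.distrib Suc_choose_2 mult_ac
        del: times_divide_eq_left times_divide_eq_right)
qed

lemma prod_split: "finite A \<Longrightarrow> J \<subseteq> A \<Longrightarrow> (\<Prod>a\<in>A-J. f a) * (\<Prod>a\<in>J. f a) = (\<Prod>a\<in>A. f a)"
  using prod.subset_diff[of J A f] by simp

lemma diff_mult_divide_cancel: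
  fixes b :: "'a::field"
  assumes "b \<noteq> c"
  shows "(c - b) * (x / (b - c)) = - x" "(b - c) * (x / (b - c)) = x"
proof -
  have "b - c \<noteq> 0" using assms by simp
  then show "(b - c) * (x / (b - c)) = x" by simp
  then show "(c - b) * (x / (b - c)) = - x" by (metis minus_diff_eq mult_minus_left)
qed

text \<open>For b common to S and Y, a set J containing b picks up the factor b - b. For the other J
  the quotients (\<kappa> b - c)/(b - c) turn the factors c - b into c - \<kappa> b, so the
  additional factor no longer depends on J. \<open>wR_diag\<close> produces the same constant, which
  is what the induction needs.\<close>

lemma wL_diag:
  assumes "finite S" "finite Y" "b \<notin> S" "b \<notin> Y" "J \<subseteq> Y"
  shows "wL \<kappa> (insert b S) (insert b Y) J =
      wL \<kappa> S Y J * ((\<Prod>a\<in>Y. a - \<kappa> * b) * (\<Prod>m\<in>S. b - \<kappa> * m) * (b - \<kappa> * b))"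
    and "wL \<kappa> (insert b S) (insert b Y) (insert b J) = 0"
proof -
  have "(\<Prod>a\<in>J. a - b) * (\<Prod>c\<in>J. (\<kappa> * b - c) / (b - c)) = (\<Prod>c\<in>J. c - \<kappa> * b)"
    unfolding prod.distrib[symmetric] using assms
    by (intro prod.cong refl, subst diff_mult_divide_cancel) auto
  then have "(\<Prod>a\<in>Y-J. a - \<kappa> * b) * (\<Prod>a\<in>J. a - b) * (\<Prod>c\<in>J. (\<kappa> * b - c) / (b - c)) = (\<Prod>a\<in>Y. a - \<kappa> * b)"
    using prod_split[OF assms(2,5), of "\<lambda>a. a - \<kappa> * b"] by (simp add: mult.assoc)
  note e = this[symmetric]
  show "wL \<kappa> (insert b S) (insert b Y) J =
      wL \<kappa> S Y J * ((\<Prod>a\<in>Y. a - \<kappa> * b) * (\<Prod>m\<in>S. b - \<kappa> * m) * (b - \<kappa> * b))"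
    unfolding e using assms
    by (subst wL_insert_Y_out, simp, simp, simp, subst wL_insert_S, simp, simp) (simp add: mult_ac)
  show "wL \<kappa> (insert b S) (insert b Y) (insert b J) = 0"
    using assms by (subst wL_insert_Y_in) auto
qed

lemma wR_diag:
  assumes "finite S" "finite Y" "b \<notin> S" "b \<notin> Y" "J \<subseteq> S"
  shows "wR \<kappa> (insert b S) (insert b Y) J =
      wR \<kappa> S Y J * ((\<Prod>a\<in>Y. a - \<kappa> * b) * (\<Prod>m\<in>S. b - \<kappa> * m) * (b - \<kappa> * b))"
    and "wR \<kappa> (insert b S) (insert b Y) (insert b J) = 0"
proof -
  have "(\<Prod>a\<in>J. b - a) * (\<Prod>c\<in>J. (b - \<kappa> * c) / (b - c)) = (\<Prod>c\<in>J. b - \<kappa> * c)"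
    unfolding prod.distrib[symmetric] using assms
    by (intro prod.cong refl, subst diff_mult_divide_cancel) auto
  then have "(\<Prod>a\<in>S-J. b - \<kappa> * a) * (\<Prod>a\<in>J. b - a) * (\<Prod>c\<in>J. (b - \<kappa> * c) / (b - c)) = (\<Prod>a\<in>S. b - \<kappa> * a)"
    using prod_split[OF assms(1,5), of "\<lambda>a. b - \<kappa> * a"] by (simp add: mult.assoc)
  note e = this[symmetric]
  show "wR \<kappa> (insert b S) (insert b Y) J =
      wR \<kappa> S Y J * ((\<Prod>a\<in>Y. a - \<kappa> * b) * (\<Prod>m\<in>S. b - \<kappa> * m) * (b - \<kappa> * b))"
    unfolding e using assms
    by (subst wR_insert_S_out, simp, simp, simp, subst wR_insert_Y, simp, simp) (simp add: mult_ac)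
  show "wR \<kappa> (insert b S) (insert b Y) (insert b J) = 0"
    using assms by (subst wR_insert_S_in) auto
qed

text \<open>Here \<kappa> m in Y meets m in S. Now the sets without \<kappa> m vanish, through the
  factor a - \<kappa> m at a = \<kappa> m, so every surviving set is larger by one element. The
  powers of \<kappa> here and in \<open>wR_scaled\<close> agree because
  \<open>card S = Suc (card Y)\<close> where the two are compared.\<close>

lemma wL_scaled:
  assumes "finite S" "finite Y" "m \<notin> S" "\<kappa> * m \<notin> Y" "J \<subseteq> Y"
  shows "wL \<kappa> (insert m S) (insert (\<kappa> * m) Y) (insert (\<kappa> * m) J) =
      wL \<kappa> S Y J * (\<kappa> ^ Suc (card Y) * (\<Prod>a\<in>Y. a - m) * (\<Prod>c\<in>S. \<kappa> * m - c) * (\<kappa> * m - m))"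
    and "wL \<kappa> (insert m S) (insert (\<kappa> * m) Y) J = 0"
proof -
  have fJ: "finite J" using assms finite_subset by auto
  have "(\<Prod>a\<in>Y-J. a - \<kappa> * m) * (\<Prod>a\<in>Y-J. (\<kappa> * a - \<kappa> * m) / (a - \<kappa> * m)) = (\<Prod>a\<in>Y-J. \<kappa> * (a - m))"
    unfolding prod.distrib[symmetric] using assms
    by (intro prod.cong refl, subst diff_mult_divide_cancel) (auto simp: right_diff_distrib)
  also have "\<dots> = \<kappa> ^ card (Y - J) * (\<Prod>a\<in>Y-J. a - m)" by (simp add: prod.distrib)
  finally have e: "(\<Prod>a\<in>Y-J. a - \<kappa> * m) * (\<Prod>a\<in>Y-J. (\<kappa> * a - \<kappa> * m) / (a - \<kappa> * m)) = \<dots>" .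
  have "card Y = card (Y - J) + card J"
    using assms fJ by (metis card_Diff_subset card_mono le_add_diff_inverse2)
  then have k: "\<kappa> ^ Suc (card Y) = \<kappa> ^ Suc (card J) * \<kappa> ^ card (Y - J)"
    by (simp add: power_add)
  have "wL \<kappa> (insert m S) (insert (\<kappa> * m) Y) (insert (\<kappa> * m) J) =
     wL \<kappa> S Y J * (\<Prod>a\<in>J. a - m) * ((\<Prod>a\<in>Y-J. a - \<kappa> * m) * (\<Prod>a\<in>Y-J. (\<kappa> * a - \<kappa> * m) / (a - \<kappa> * m)))
      * \<kappa> ^ Suc (card J) * ((\<Prod>c\<in>S. \<kappa> * m - c) * (\<kappa> * m - m))"
    using assms by (subst wL_insert_Y_in, simp, simp, simp, subst wL_insert_S) (auto simp: mult_ac)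
  also have "\<dots> = wL \<kappa> S Y J * ((\<Prod>a\<in>Y-J. a - m) * (\<Prod>a\<in>J. a - m)) * \<kappa> ^ Suc (card Y) * ((\<Prod>c\<in>S. \<kappa> * m - c) * (\<kappa> * m - m))"
    unfolding e k by (simp only: mult_ac)
  finally show "wL \<kappa> (insert m S) (insert (\<kappa> * m) Y) (insert (\<kappa> * m) J) =
      wL \<kappa> S Y J * (\<kappa> ^ Suc (card Y) * (\<Prod>a\<in>Y. a - m) * (\<Prod>c\<in>S. \<kappa> * m - c) * (\<kappa> * m - m))"
    unfolding prod_split[OF assms(2,5)] by (simp only: mult_ac)
  show "wL \<kappa> (insert m S) (insert (\<kappa> * m) Y) J = 0"
    using assms by (subst wL_insert_Y_out) auto
qed

lemma wR_scaled:
  assumes "finite S" "finite Y" "m \<notin> S" "\<kappa> * m \<notin> Y" "J \<subseteq> S"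
  shows "wR \<kappa> (insert m S) (insert (\<kappa> * m) Y) (insert m J) =
      wR \<kappa> S Y J * (\<kappa> ^ card S * (\<Prod>a\<in>Y. a - m) * (\<Prod>c\<in>S. \<kappa> * m - c) * (\<kappa> * m - m))"
    and "wR \<kappa> (insert m S) (insert (\<kappa> * m) Y) J = 0"
proof -
  have fJ: "finite J" using assms finite_subset by auto
  have "(\<Prod>a\<in>S-J. \<kappa> * m - \<kappa> * a) * (\<Prod>a\<in>S-J. (a - \<kappa> * m) / (a - m)) = (\<Prod>a\<in>S-J. \<kappa> * (\<kappa> * m - a))"
    unfolding prod.distrib[symmetric] using assms
    by (intro prod.cong refl, unfold right_diff_distrib[symmetric] mult.assoc, subst diff_mult_divide_cancel)
      (auto simp: right_diff_distrib)
  also have "\<dots> = \<kappa> ^ card (S - J) * (\<Prod>a\<in>S-J. \<kappa> * m - a)" by (simp add: prod.distrib)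
  finally have e: "(\<Prod>a\<in>S-J. \<kappa> * m - \<kappa> * a) * (\<Prod>a\<in>S-J. (a - \<kappa> * m) / (a - m)) = \<dots>" .
  have "card S = card (S - J) + card J"
    using assms fJ by (metis card_Diff_subset card_mono le_add_diff_inverse2)
  then have k: "\<kappa> ^ card S = \<kappa> ^ card J * \<kappa> ^ card (S - J)"
    by (simp add: power_add)
  have "wR \<kappa> (insert m S) (insert (\<kappa> * m) Y) (insert m J) =
     wR \<kappa> S Y J * (\<Prod>a\<in>J. \<kappa> * m - a) * ((\<Prod>a\<in>S-J. \<kappa> * m - \<kappa> * a) * (\<Prod>a\<in>S-J. (a - \<kappa> * m) / (a - m)))
      * \<kappa> ^ card J * ((\<Prod>a\<in>Y. a - m) * (\<kappa> * m - m))"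
    using assms by (subst wR_insert_S_in, simp, simp, simp, subst wR_insert_Y) (auto simp: mult_ac)
  also have "\<dots> = wR \<kappa> S Y J * ((\<Prod>a\<in>S-J. \<kappa> * m - a) * (\<Prod>a\<in>J. \<kappa> * m - a)) * \<kappa> ^ card S * ((\<Prod>a\<in>Y. a - m) * (\<kappa> * m - m))"
    unfolding e k by (simp only: mult_ac)
  finally show "wR \<kappa> (insert m S) (insert (\<kappa> * m) Y) (insert m J) =
      wR \<kappa> S Y J * (\<kappa> ^ card S * (\<Prod>a\<in>Y. a - m) * (\<Prod>c\<in>S. \<kappa> * m - c) * (\<kappa> * m - m))"
    unfolding prod_split[OF assms(1,5)] by (simp only: mult_ac)
  show "wR \<kappa> (insert m S) (insert (\<kappa> * m) Y) J = 0"
    using assms by (subst wR_insert_S_out) auto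
qed

text \<open>
  Both sides are polynomials in one element \<open>z\<close> of \<open>S\<close> after multiplication by
  \<open>\<Prod>(s - z)\<close> over the other elements \<open>s\<close>. The difference vanishes at each such \<open>s\<close>, where the
  two poles of the right-hand side cancel, and by induction at \<open>z \<in> Y\<close> and at \<open>z = b / \<kappa>\<close> for one
  \<open>b \<in> Y\<close>, because there the weights factor through smaller sets. These are more zeros than the
  degree permits.
\<close>

theorem wL_wR_duality:
  fixes \<kappa> :: "'a::field"
  assumes \<kappa>: "\<kappa> \<noteq> 0"
  shows "finite S \<Longrightarrow> finite Y \<Longrightarrow> card S = Suc (card Y) \<Longrightarrow> (\<And>a b. a \<in> Y \<Longrightarrow> b \<in> Y \<Longrightarrow> a \<noteq> \<kappa> * b) \<Longrightarrow>
    (\<Sum>J\<in>Pow Y. (g (card J) + g (Suc (card J))) * wL \<kappa> S Y J) = (\<Sum>J\<in>Pow S. g (card J) * wR \<kappa> S Y J)"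
proof (induction "card Y" arbitrary: S Y g)
  case 0
  then obtain s where "Y = {}" "S = {s}" by (auto simp: card_Suc_eq)
  then show ?case by (simp add: wL_def wR_def Pow_insert binomial_eq_0)
next
  case (Suc N Y S g)
  note finY = \<open>finite Y\<close> and gen = Suc.prems(4)
  let ?L = "\<lambda>S. \<Sum>J\<in>Pow Y. (g (card J) + g (Suc (card J))) * wL \<kappa> S Y J"
  let ?R = "\<lambda>S. \<Sum>J\<in>Pow S. g (card J) * wR \<kappa> S Y J"
  have diag: "?L S' = ?R S'" if S': "finite S'" "card S' = Suc (card Y)" and b: "b \<in> S'" "b \<in> Y" for S' b
  proof -
    obtain Y0 where Y0: "Y = insert b Y0" "b \<notin> Y0" by (metis b(2) Set.set_insert)
    obtain S0 where S0: "S' = insert b S0" "b \<notin> S0" by (metis b(1) Set.set_insert)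
    have fin: "finite S0" "finite Y0" using finY S' S0 Y0 by auto
    define C where "C = (\<Prod>a\<in>Y0. a - \<kappa> * b) * (\<Prod>m\<in>S0. b - \<kappa> * m) * (b - \<kappa> * b)"
    have "?L S' = (\<Sum>J\<in>Pow Y0. (g (card J) + g (Suc (card J))) * wL \<kappa> S' Y J)"
      unfolding Y0(1) S0(1) using fin Y0 S0
      by (subst sum_Pow_insert_left) (auto simp: wL_diag(2))
    also have "\<dots> = C * (\<Sum>J\<in>Pow Y0. (g (card J) + g (Suc (card J))) * wL \<kappa> S0 Y0 J)"
      unfolding sum_distrib_left C_def Y0(1) S0(1)
      by (intro sum.cong refl, subst wL_diag(1)) (use fin Y0 S0 in \<open>auto simp: mult_ac\<close>)
    also have "\<dots> = C * (\<Sum>J\<in>Pow S0. g (card J) * wR \<kappa> S0 Y0 J)"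
      using Suc(2) S' finY fin Y0 S0 gen by (subst Suc(1)) auto
    also have "\<dots> = (\<Sum>J\<in>Pow S0. g (card J) * wR \<kappa> S' Y J)"
      unfolding sum_distrib_left C_def Y0(1) S0(1)
      by (intro sum.cong refl, subst wR_diag(1)) (use fin Y0 S0 in \<open>auto simp: mult_ac\<close>)
    also have "\<dots> = ?R S'"
      unfolding Y0(1) S0(1) using fin Y0 S0
      by (subst sum_Pow_insert_left) (auto simp: wR_diag(2))
    finally show ?thesis .
  qed
  have scaled: "?L S' = ?R S'" if S': "finite S'" "card S' = Suc (card Y)" and b: "m \<in> S'" "\<kappa> * m \<in> Y" for S' m
  proof -
    obtain Y0 where Y0: "Y = insert (\<kappa> * m) Y0" "\<kappa> * m \<notin> Y0" by (metis b(2) Set.set_insert)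
    obtain S0 where S0: "S' = insert m S0" "m \<notin> S0" by (metis b(1) Set.set_insert)
    have fin: "finite S0" "finite Y0" using finY S' S0 Y0 by auto
    have card: "card S0 = Suc (card Y0)" using S' Y0 S0 fin by auto
    define C where "C = \<kappa> ^ card S0 * (\<Prod>a\<in>Y0. a - m) * (\<Prod>c\<in>S0. \<kappa> * m - c) * (\<kappa> * m - m)"
    have ins: "card (insert (\<kappa> * m) J) = Suc (card J)" if "J \<subseteq> Y0" for J
      using that Y0(2) finite_subset[OF _ fin(2)] by (subst card_insert_disjoint) auto
    have ins': "card (insert m J) = Suc (card J)" if "J \<subseteq> S0" for J
      using that S0(2) finite_subset[OF _ fin(1)] by (subst card_insert_disjoint) auto
    have "?L S' = (\<Sum>J\<in>Pow Y0. (g (card (insert (\<kappa> * m) J)) + g (Suc (card (insert (\<kappa> * m) J)))) * wL \<kappa> S' Y (insert (\<kappa> * m) J))"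
      unfolding Y0(1) S0(1) using fin Y0 S0
      by (subst sum_Pow_insert_right) (auto simp: wL_scaled(2))
    also have "\<dots> = C * (\<Sum>J\<in>Pow Y0. (g (Suc (card J)) + g (Suc (Suc (card J)))) * wL \<kappa> S0 Y0 J)"
      unfolding sum_distrib_left C_def Y0(1) S0(1) card
      by (intro sum.cong refl, subst wL_scaled(1)) (use fin Y0 S0 in \<open>auto simp: mult_ac ins\<close>)
    \<comment> \<open>All surviving subsets contain the distinguished element, so the weight
      \<open>g\<close> is shifted by one; this is why \<open>g\<close> is arbitrary in the
      induction.\<close>
    also have "\<dots> = C * (\<Sum>J\<in>Pow S0. g (Suc (card J)) * wR \<kappa> S0 Y0 J)"
      using Suc(2) S' finY fin Y0 S0 gen by (subst Suc(1)[where g = "\<lambda>i. g (Suc i)"]) auto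
    also have "\<dots> = (\<Sum>J\<in>Pow S0. g (card (insert m J)) * wR \<kappa> S' Y (insert m J))"
      unfolding sum_distrib_left C_def Y0(1) S0(1)
      by (intro sum.cong refl, subst wR_scaled(1)) (use fin Y0 S0 in \<open>auto simp: mult_ac ins'\<close>)
    also have "\<dots> = ?R S'"
      unfolding Y0(1) S0(1) using fin Y0 S0
      by (subst sum_Pow_insert_right) (auto simp: wR_scaled(2))
    finally show ?thesis .
  qed
  show ?case
  proof (cases "(\<exists>b\<in>S. b \<in> Y) \<or> (\<exists>m\<in>S. \<kappa> * m \<in> Y)")
    case True
    then show ?thesis using diag scaled Suc.prems by blast
  next
    case False
    obtain z0 where z0: "z0 \<in> S" using Suc.prems by fastforce
    then obtain S0 where S0: "S = insert z0 S0" "z0 \<notin> S0" by (metis Set.set_insert)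
    obtain b where b: "b \<in> Y" using Suc(2) by fastforce
    have fin: "finite S0" using S0 Suc.prems by auto
    define M where "M = card Y"
    have cM: "card S0 = M" using S0 fin Suc.prems by (simp add: M_def)
    \<comment> \<open>\<open>FL\<close> and \<open>R1 + R2\<close> are the two sides for
      \<open>insert z S0\<close>, the right one multiplied by \<Prod>(s - z): \<open>R1\<close>
      collects the sets without z, \<open>R2\<close> those with z.\<close>
    define FL where "FL = (\<lambda>z. \<Sum>J\<in>Pow Y. (g (card J) + g (Suc (card J))) *
        (wL \<kappa> S0 Y J * ((\<Prod>a\<in>Y-J. a - \<kappa> * z) * (\<Prod>a\<in>J. a - z))))"
    define R1 where "R1 = (\<lambda>z. \<Sum>J\<in>Pow S0. g (card J) * (wR \<kappa> S0 Y J *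
        ((\<Prod>b\<in>J. \<kappa> * b - z) * (\<Prod>s\<in>S0-J. s - z) * (\<Prod>y\<in>Y. y - \<kappa> * z))))"
    define R2 where "R2 = (\<lambda>z. \<Sum>J\<in>Pow S0. g (Suc (card J)) * (wR \<kappa> S0 Y J * \<kappa> ^ card J *
        ((\<Prod>s\<in>S0-J. s - \<kappa> * z) * (\<Prod>b\<in>J. b - z) * (\<Prod>y\<in>Y. y - z))))"
    define F where "F = (\<lambda>z. (\<Prod>s\<in>S0. s - z) * FL z - (R1 z + R2 z))"
    have poly: "polyf (M + M) F"
      unfolding F_def FL_def R1_def R2_def
    proof (intro polyf_diff polyf_add polyf_sum polyf_cmult)
      show "polyf (M + M) (\<lambda>z. (\<Prod>s\<in>S0. s - z) * (\<Sum>J\<in>Pow Y. (g (card J) + g (Suc (card J))) *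
        (wL \<kappa> S0 Y J * ((\<Prod>a\<in>Y-J. a - \<kappa> * z) * (\<Prod>a\<in>J. a - z)))))"
      proof (intro polyf_mult polyf_sum polyf_cmult)
        show "polyf M (\<lambda>z. \<Prod>s\<in>S0. s - z)"
          unfolding cM[symmetric] using fin by (intro polyf_prod polyf_linear_diff)
        fix J assume J: "J \<in> Pow Y"
        then have fJ: "finite J" using finY finite_subset by auto
        have "card (Y - J) + card J = M"
          using J finY fJ card_mono[OF finY, of J] by (auto simp: card_Diff_subset M_def)
        then show "polyf M (\<lambda>z. (\<Prod>a\<in>Y-J. a - \<kappa> * z) * (\<Prod>a\<in>J. a - z))"
          using polyf_mult[OF polyf_prod[of "Y - J" "\<lambda>a z. a - \<kappa> * z"] polyf_prod[OF fJ, of "\<lambda>a z. a - z"]] finY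
          by (simp add: polyf_linear_diff[unfolded One_nat_def])
      qed
      fix J assume J: "J \<in> Pow S0"
      then have fJ: "finite J" using fin finite_subset by auto
      have c: "card (S0 - J) + card J = M" "card J + card (S0 - J) = M"
        using J fin fJ card_mono[OF fin, of J] by (auto simp: card_Diff_subset cM)
      show "polyf (M + M) (\<lambda>z. (\<Prod>b\<in>J. \<kappa> * b - z) * (\<Prod>s\<in>S0-J. s - z) * (\<Prod>y\<in>Y. y - \<kappa> * z))"
        using polyf_mult[OF polyf_mult[OF polyf_prod[OF fJ, of "\<lambda>b z. \<kappa> * b - z"] polyf_prod[of "S0 - J" "\<lambda>s z. s - z"]]
            polyf_prod[OF finY, of "\<lambda>y z. y - \<kappa> * z"]] fin
        by (simp add: polyf_linear_diff[unfolded One_nat_def] c flip: M_def)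
      show "polyf (M + M) (\<lambda>z. (\<Prod>s\<in>S0-J. s - \<kappa> * z) * (\<Prod>b\<in>J. b - z) * (\<Prod>y\<in>Y. y - z))"
        using polyf_mult[OF polyf_mult[OF polyf_prod[of "S0 - J" "\<lambda>s z. s - \<kappa> * z"] polyf_prod[OF fJ, of "\<lambda>b z. b - z"]]
            polyf_prod[OF finY, of "\<lambda>y z. y - z"]] fin
        by (simp add: polyf_linear_diff[unfolded One_nat_def] c flip: M_def)
    qed
    have F_eq: "F z = (\<Prod>s\<in>S0. s - z) * (?L (insert z S0) - ?R (insert z S0))" if z: "z \<notin> S0" for z
    proof -
      have nz: "s - z \<noteq> 0" if "s \<in> S0" for s using that z by auto
      have L: "?L (insert z S0) = FL z"
        unfolding FL_def using fin z by (intro sum.cong refl, subst wL_insert_S) auto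
      have ci: "card (insert z J) = Suc (card J)" if "J \<subseteq> S0" for J
        using that z finite_subset[OF _ fin] by (subst card_insert_disjoint) auto
      have "(\<Prod>s\<in>S0. s - z) * wR \<kappa> (insert z S0) Y J =
        wR \<kappa> S0 Y J * ((\<Prod>b\<in>J. \<kappa> * b - z) * (\<Prod>s\<in>S0-J. s - z) * (\<Prod>y\<in>Y. y - \<kappa> * z))" if J: "J \<subseteq> S0" for J
      proof -
        have "(\<Prod>b\<in>J. b - z) * (\<Prod>b\<in>J. (z - \<kappa> * b) / (z - b)) = (\<Prod>b\<in>J. \<kappa> * b - z)"
          unfolding prod.distrib[symmetric] using J z
          by (intro prod.cong refl, subst diff_mult_divide_cancel) auto
        note e = this[symmetric]
        show ?thesis
          unfolding e prod_split[OF fin J, symmetric] using fin z J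
          by (subst wR_insert_S_out) (auto simp: mult_ac)
      qed
      moreover have "(\<Prod>s\<in>S0. s - z) * wR \<kappa> (insert z S0) Y (insert z J) =
        wR \<kappa> S0 Y J * \<kappa> ^ card J * ((\<Prod>s\<in>S0-J. s - \<kappa> * z) * (\<Prod>b\<in>J. b - z) * (\<Prod>y\<in>Y. y - z))" if J: "J \<subseteq> S0" for J
      proof -
        have "(\<Prod>b\<in>S0-J. b - z) * (\<Prod>b\<in>S0-J. (b - \<kappa> * z) / (b - z)) = (\<Prod>b\<in>S0-J. b - \<kappa> * z)"
          unfolding prod.distrib[symmetric] using J z
          by (intro prod.cong refl, subst diff_mult_divide_cancel) auto
        note e = this[symmetric]
        show ?thesis
          unfolding e prod_split[OF fin J, symmetric] using fin z J
          by (subst wR_insert_S_in) (auto simp: mult_ac)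
      qed
      ultimately have R: "(\<Prod>s\<in>S0. s - z) * ?R (insert z S0) = R1 z + R2 z"
        unfolding R1_def R2_def sum_Pow_insert[OF fin z] distrib_left sum_distrib_left
        by (intro arg_cong2[of _ _ _ _ "(+)"] sum.cong refl) (auto simp: ci mult.left_commute)
      show ?thesis by (simp add: F_def right_diff_distrib L R)
    qed
    have zeroY: "F z = 0" if "z \<in> Y" for z
      using that diag[of "insert z S0" z] False S0 fin Suc.prems by (subst F_eq) auto
    have "b / \<kappa> \<notin> S0" using False S0 b \<kappa> by force
    then have zeroB: "F (b / \<kappa>) = 0"
      using scaled[of "insert (b / \<kappa>) S0" "b / \<kappa>"] False S0 fin Suc.prems b \<kappa> by (subst F_eq) auto
    have zeroS: "F s = 0" if s: "s \<in> S0" for s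
    proof -
      obtain S1 where S1: "S0 = insert s S1" "s \<notin> S1" by (metis s Set.set_insert)
      have fin1: "finite S1" using S1 fin by auto
      have ci: "card (insert s J) = Suc (card J)" if "J \<subseteq> S1" for J
        using that S1(2) finite_subset[OF _ fin1] by (subst card_insert_disjoint) auto
      \<comment> \<open>At z = s a factor s - z kills the sets without s in \<open>R1\<close> and
        those with s in \<open>R2\<close>. The survivors are paired as \<open>insert s J\<close> and
        J.\<close>
      have A: "R1 s = (\<Sum>J\<in>Pow S1. g (Suc (card J)) * (wR \<kappa> S0 Y (insert s J) *
        ((\<Prod>b\<in>insert s J. \<kappa> * b - s) * (\<Prod>c\<in>S1-J. c - s) * (\<Prod>y\<in>Y. y - \<kappa> * s))))"
        unfolding R1_def
        by (subst S1(1), subst sum_Pow_insert_right[OF fin1 S1(2)], use S1 fin1 in force)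
          (intro sum.cong refl, use S1 fin1 in \<open>simp add: ci insert_Diff_notin\<close>)
      have iD: "insert s S1 - J = insert s (S1 - J)" if "J \<in> Pow S1" for J
        using that S1(2) by auto
      have B: "R2 s = (\<Sum>J\<in>Pow S1. g (Suc (card J)) * (wR \<kappa> S0 Y J * \<kappa> ^ card J *
        ((\<Prod>c\<in>insert s (S1-J). c - \<kappa> * s) * (\<Prod>b\<in>J. b - s) * (\<Prod>y\<in>Y. y - s))))"
        unfolding R2_def
        by (subst S1(1), subst sum_Pow_insert_left[OF fin1 S1(2)], use S1 fin1 finite_subset[OF _ fin1] in force)
          (intro sum.cong refl, use S1 fin1 iD in simp)
      have "R1 s + R2 s = 0"
        unfolding A B sum.distrib[symmetric]
      proof (intro sum.neutral ballI)
        fix J assume J: "J \<in> Pow S1"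
        then have sJ: "s \<notin> J" "J \<subseteq> S1" "finite J" using S1 fin1 finite_subset by auto
        have "(\<Prod>b\<in>J. b - s) * (\<Prod>b\<in>J. (s - \<kappa> * b) / (s - b)) = (\<Prod>b\<in>J. \<kappa> * b - s)"
          unfolding prod.distrib[symmetric] using sJ
          by (intro prod.cong refl, subst diff_mult_divide_cancel) auto
        note e1 = this[symmetric]
        have "(\<Prod>b\<in>S1-J. b - s) * (\<Prod>b\<in>S1-J. (b - \<kappa> * s) / (b - s)) = (\<Prod>b\<in>S1-J. b - \<kappa> * s)"
          unfolding prod.distrib[symmetric] using S1
          by (intro prod.cong refl, subst diff_mult_divide_cancel) auto
        note e2 = this[symmetric]
        have r1: "wR \<kappa> S0 Y (insert s J) = wR \<kappa> S1 Y J *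
            (\<kappa> ^ card J * (\<Prod>a\<in>S1-J. (a - \<kappa> * s) / (a - s)) * (\<Prod>y\<in>Y. y - s))"
          unfolding S1(1) using S1 fin1 sJ by (subst wR_insert_S_in) auto
        have r2: "wR \<kappa> S0 Y J = wR \<kappa> S1 Y J *
            ((\<Prod>b\<in>J. (s - \<kappa> * b) / (s - b)) * (\<Prod>y\<in>Y. y - \<kappa> * s))"
          unfolding S1(1) using S1 fin1 sJ by (subst wR_insert_S_out) auto
        have i1: "(\<Prod>b\<in>insert s J. \<kappa> * b - s) = (\<kappa> * s - s) * (\<Prod>b\<in>J. \<kappa> * b - s)"
          using sJ by simp
        have i2: "(\<Prod>c\<in>insert s (S1-J). c - \<kappa> * s) = - (\<kappa> * s - s) * (\<Prod>c\<in>S1-J. c - \<kappa> * s)"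
          using sJ S1 fin1 by simp
        show "g (Suc (card J)) * (wR \<kappa> S0 Y (insert s J) *
            ((\<Prod>b\<in>insert s J. \<kappa> * b - s) * (\<Prod>c\<in>S1-J. c - s) * (\<Prod>y\<in>Y. y - \<kappa> * s))) +
          g (Suc (card J)) * (wR \<kappa> S0 Y J * \<kappa> ^ card J *
            ((\<Prod>c\<in>insert s (S1-J). c - \<kappa> * s) * (\<Prod>b\<in>J. b - s) * (\<Prod>y\<in>Y. y - s))) = 0"
          unfolding r1 r2 i1 i2 unfolding e1 e2 by (simp only: mult_minus_left mult_minus_right mult_ac) simp
      qed
      then show ?thesis using s fin by (auto simp: F_def)
    qed
    \<comment> \<open>M zeros from Y, M from \<open>S0\<close> and the single point b/\<kappa>: one
      more than the degree bound 2M.\<close>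
    let ?Z = "insert (b / \<kappa>) (Y \<union> S0)"
    have "b / \<kappa> \<notin> Y \<union> S0" "Y \<inter> S0 = {}"
      using False S0 b \<kappa> gen[of b "b / \<kappa>"] by auto
    then have card: "card ?Z = Suc (M + M)"
      using fin finY by (simp add: card_Un_disjoint cM M_def)
    have "F z0 = 0"
      by (rule polyf_eq_0[OF poly, of ?Z]) (use card fin finY zeroY zeroB zeroS in auto)
    moreover have "(\<Prod>s\<in>S0. s - z0) \<noteq> 0" using S0 fin by auto
    ultimately show ?thesis using F_eq[of z0] S0 by simp
  qed
qed

text \<open>The bracket is unchanged when a pair b, b or \<kappa> m, m is removed from Y and S, so
  the reductions of \<open>wL_wR_duality\<close> apply again. In one element z of S everything is
  now polynomial, of degree at most \<open>card Y + 1\<close>, with zeros at Y and at Y/\<kappa>.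
  These 2 \<open>card Y\<close> points suffice only from \<open>card Y = 2\<close> on; hence the
  direct calculation for a single element.\<close>

theorem wL_alternating_sum:
  fixes \<kappa> :: "'a::field"
  assumes \<kappa>: "\<kappa> \<noteq> 0"
  shows "finite S \<Longrightarrow> finite Y \<Longrightarrow> card S = Suc (card Y) \<Longrightarrow> (\<And>a b. a \<in> Y \<Longrightarrow> b \<in> Y \<Longrightarrow> a \<noteq> \<kappa> * b) \<Longrightarrow>
    (\<Sum>J\<in>Pow Y. (-1) ^ card J * wL \<kappa> S Y J * (\<Sum>(Y-J) + \<Sum>J / \<kappa> + \<kappa> ^ card J * \<Prod>S / \<Prod>Y - \<Sum>S)) = 0"
proof (induction "card Y" arbitrary: S Y)
  case 0
  then obtain s where "Y = {}" "S = {s}" by (auto simp: card_Suc_eq)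
  then show ?case by simp
next
  case (Suc N Y S)
  note finY = \<open>finite Y\<close> and gen = Suc.prems(4)
  \<comment> \<open>\<open>gen\<close> applied to equal arguments excludes 0, since 0 = \<kappa> *
    0. The division by \<Prod>Y is therefore genuine.\<close>
  have nzY: "a \<noteq> 0" if "a \<in> Y" for a using gen[OF that that] by auto
  let ?L = "\<lambda>S. \<Sum>J\<in>Pow Y. (-1) ^ card J * wL \<kappa> S Y J * (\<Sum>(Y-J) + \<Sum>J / \<kappa> + \<kappa> ^ card J * \<Prod>S / \<Prod>Y - \<Sum>S)"
  have diag: "?L S' = 0" if S': "finite S'" "card S' = Suc (card Y)" and b: "b \<in> S'" "b \<in> Y" for S' b
  proof -
    obtain Y0 where Y0: "Y = insert b Y0" "b \<notin> Y0" by (metis b(2) Set.set_insert)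
    obtain S0 where S0: "S' = insert b S0" "b \<notin> S0" by (metis b(1) Set.set_insert)
    have fin: "finite S0" "finite Y0" using finY S' S0 Y0 by auto
    define C where "C = (\<Prod>a\<in>Y0. a - \<kappa> * b) * (\<Prod>m\<in>S0. b - \<kappa> * m) * (b - \<kappa> * b)"
    have "?L S' = (\<Sum>J\<in>Pow Y0. (-1) ^ card J * wL \<kappa> S' Y J * (\<Sum>(Y-J) + \<Sum>J / \<kappa> + \<kappa> ^ card J * \<Prod>S' / \<Prod>Y - \<Sum>S'))"
      unfolding Y0(1) S0(1) using fin Y0 S0
      by (subst sum_Pow_insert_left) (auto simp: wL_diag(2))
    also have "\<dots> = C * (\<Sum>J\<in>Pow Y0. (-1) ^ card J * wL \<kappa> S0 Y0 J * (\<Sum>(Y0-J) + \<Sum>J / \<kappa> + \<kappa> ^ card J * \<Prod>S0 / \<Prod>Y0 - \<Sum>S0))"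
      unfolding sum_distrib_left
    proof (intro sum.cong refl)
      fix J assume J: "J \<in> Pow Y0"
      have "b \<notin> J" using J Y0 by auto
      then have "\<Sum>(Y-J) + \<Sum>J / \<kappa> + \<kappa> ^ card J * \<Prod>S' / \<Prod>Y - \<Sum>S' = \<Sum>(Y0-J) + \<Sum>J / \<kappa> + \<kappa> ^ card J * \<Prod>S0 / \<Prod>Y0 - \<Sum>S0"
        unfolding Y0(1) S0(1) using fin Y0(2) S0(2) nzY[OF b(2)] by (simp add: insert_Diff_notin)
      moreover have "wL \<kappa> S' Y J = C * wL \<kappa> S0 Y0 J"
        unfolding C_def Y0(1) S0(1) by (subst wL_diag(1)) (use fin Y0 S0 J in \<open>auto simp: mult_ac\<close>)
      ultimately show "(-1) ^ card J * wL \<kappa> S' Y J * (\<Sum>(Y-J) + \<Sum>J / \<kappa> + \<kappa> ^ card J * \<Prod>S' / \<Prod>Y - \<Sum>S') =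
         C * ((-1) ^ card J * wL \<kappa> S0 Y0 J * (\<Sum>(Y0-J) + \<Sum>J / \<kappa> + \<kappa> ^ card J * \<Prod>S0 / \<Prod>Y0 - \<Sum>S0))"
        by (simp only: mult_ac)
    qed
    also have "\<dots> = 0"
      using Suc(2) S' finY fin Y0 S0 gen by (subst Suc(1)) auto
    finally show ?thesis .
  qed
  have scaled: "?L S' = 0" if S': "finite S'" "card S' = Suc (card Y)" and b: "m \<in> S'" "\<kappa> * m \<in> Y" for S' m
  proof -
    obtain Y0 where Y0: "Y = insert (\<kappa> * m) Y0" "\<kappa> * m \<notin> Y0" by (metis b(2) Set.set_insert)
    obtain S0 where S0: "S' = insert m S0" "m \<notin> S0" by (metis b(1) Set.set_insert)
    have fin: "finite S0" "finite Y0" using finY S' S0 Y0 by auto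
    define C where "C = \<kappa> ^ Suc (card Y0) * (\<Prod>a\<in>Y0. a - m) * (\<Prod>c\<in>S0. \<kappa> * m - c) * (\<kappa> * m - m)"
    have "?L S' = (\<Sum>J\<in>Pow Y0. (-1) ^ card (insert (\<kappa> * m) J) * wL \<kappa> S' Y (insert (\<kappa> * m) J) *
        (\<Sum>(Y - insert (\<kappa> * m) J) + \<Sum>(insert (\<kappa> * m) J) / \<kappa> + \<kappa> ^ card (insert (\<kappa> * m) J) * \<Prod>S' / \<Prod>Y - \<Sum>S'))"
      unfolding Y0(1) S0(1) using fin Y0 S0
      by (subst sum_Pow_insert_right) (auto simp: wL_scaled(2))
    also have "\<dots> = - C * (\<Sum>J\<in>Pow Y0. (-1) ^ card J * wL \<kappa> S0 Y0 J * (\<Sum>(Y0-J) + \<Sum>J / \<kappa> + \<kappa> ^ card J * \<Prod>S0 / \<Prod>Y0 - \<Sum>S0))"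
      unfolding sum_distrib_left
    proof (intro sum.cong refl)
      fix J assume J: "J \<in> Pow Y0"
      have bJ: "\<kappa> * m \<notin> J" "finite J" using J Y0 fin finite_subset by auto
      have "\<Sum>(Y - insert (\<kappa> * m) J) + \<Sum>(insert (\<kappa> * m) J) / \<kappa> + \<kappa> ^ card (insert (\<kappa> * m) J) * \<Prod>S' / \<Prod>Y - \<Sum>S' =
          \<Sum>(Y0-J) + \<Sum>J / \<kappa> + \<kappa> ^ card J * \<Prod>S0 / \<Prod>Y0 - \<Sum>S0"
        unfolding Y0(1) S0(1) using fin Y0(2) S0(2) nzY[OF b(2)] bJ \<kappa>
        by (simp add: insert_Diff_notin add_divide_distrib)
      moreover have "wL \<kappa> S' Y (insert (\<kappa> * m) J) = C * wL \<kappa> S0 Y0 J"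
        unfolding C_def Y0(1) S0(1) by (subst wL_scaled(1)) (use fin Y0 S0 J in \<open>auto simp: mult_ac\<close>)
      moreover have "(-1::'a) ^ card (insert (\<kappa> * m) J) = - ((-1) ^ card J)" using bJ by simp
      ultimately show "(-1) ^ card (insert (\<kappa> * m) J) * wL \<kappa> S' Y (insert (\<kappa> * m) J) *
        (\<Sum>(Y - insert (\<kappa> * m) J) + \<Sum>(insert (\<kappa> * m) J) / \<kappa> + \<kappa> ^ card (insert (\<kappa> * m) J) * \<Prod>S' / \<Prod>Y - \<Sum>S') =
         - C * ((-1) ^ card J * wL \<kappa> S0 Y0 J * (\<Sum>(Y0-J) + \<Sum>J / \<kappa> + \<kappa> ^ card J * \<Prod>S0 / \<Prod>Y0 - \<Sum>S0))"
        by (simp only: mult_ac mult_minus_left mult_minus_right)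
    qed
    also have "\<dots> = 0"
      using Suc(2) S' finY fin Y0 S0 gen by (subst Suc(1)) auto
    finally show ?thesis .
  qed
  show ?case
  proof (cases "(\<exists>b\<in>S. b \<in> Y) \<or> (\<exists>m\<in>S. \<kappa> * m \<in> Y)")
    case True
    then show ?thesis using diag scaled Suc.prems by blast
  next
    case False
    show ?thesis
    proof (cases N)
      case 0
      then have "card Y = 1" "card S = 2" using Suc(2) Suc.prems by auto
      then obtain y s1 s2 where ys: "Y = {y}" "S = {s1, s2}" "s1 \<noteq> s2"
        by (metis card_1_singletonE card_2_iff)
      have "y \<noteq> 0" using nzY ys by auto
      then show ?thesis using \<kappa> ys(3) unfolding ys(1,2)
        by (simp add: wL_def Pow_insert binomial_eq_0 Suc_choose_2) (simp add: divide_simps, simp add: algebra_simps)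
    next
      case (Suc N')
      obtain z0 where z0: "z0 \<in> S" using Suc.prems by fastforce
      then obtain S0 where S0: "S = insert z0 S0" "z0 \<notin> S0" by (metis Set.set_insert)
      have fin: "finite S0" using S0 Suc.prems by auto
      define M where "M = card Y"
      define F where "F = (\<lambda>z. \<Sum>J\<in>Pow Y. (-1) ^ card J *
          (wL \<kappa> S0 Y J * ((\<Prod>a\<in>Y-J. a - \<kappa> * z) * (\<Prod>a\<in>J. a - z) *
          ((\<Sum>(Y-J) + \<Sum>J / \<kappa> - \<Sum>S0) + (\<kappa> ^ card J * \<Prod>S0 / \<Prod>Y - 1) * z))))"
      have poly: "polyf (Suc M) F"
        unfolding F_def
      proof (intro polyf_sum polyf_cmult)
        fix J assume J: "J \<in> Pow Y"
        then have fJ: "finite J" using finY finite_subset by auto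
        have c: "card (Y - J) + card J = M"
          using J finY fJ card_mono[OF finY, of J] by (auto simp: card_Diff_subset M_def)
        show "polyf (Suc M) (\<lambda>z. (\<Prod>a\<in>Y-J. a - \<kappa> * z) * (\<Prod>a\<in>J. a - z) *
          ((\<Sum>(Y-J) + \<Sum>J / \<kappa> - \<Sum>S0) + (\<kappa> ^ card J * \<Prod>S0 / \<Prod>Y - 1) * z))"
          using polyf_mult[OF polyf_mult[OF polyf_prod[of "Y - J" "\<lambda>a z. a - \<kappa> * z"] polyf_prod[OF fJ, of "\<lambda>a z. a - z"]] polyf_linear] finY
          by (simp add: polyf_linear_diff[unfolded One_nat_def] c)
      qed
      have F_eq: "F z = ?L (insert z S0)" if z: "z \<notin> S0" for z
        unfolding F_def using fin z
        by (intro sum.cong refl, subst wL_insert_S) (auto simp: algebra_simps)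
      have zeroY: "F z = 0" if "z \<in> Y" for z
        using that diag[of "insert z S0" z] False S0 fin Suc.prems by (subst F_eq) auto
      have "b / \<kappa> \<notin> S0" if "b \<in> Y" for b using that False S0 \<kappa> by force
      then have zeroB: "F (b / \<kappa>) = 0" if "b \<in> Y" for b
        using scaled[of "insert (b / \<kappa>) S0" "b / \<kappa>"] that False S0 fin Suc.prems \<kappa> by (subst F_eq) auto
      let ?Z = "Y \<union> (\<lambda>b. b / \<kappa>) ` Y"
      have "Y \<inter> (\<lambda>b. b / \<kappa>) ` Y = {}" using gen \<kappa> by fastforce
      moreover have "card ((\<lambda>b. b / \<kappa>) ` Y) = M" unfolding M_def using \<kappa> by (intro card_image inj_onI) simp
      ultimately have card: "card ?Z = M + M"
        using finY by (simp add: card_Un_disjoint M_def)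
      have M2: "M \<ge> 2" using Suc(1) \<open>Suc N = card Y\<close> by (simp add: M_def)
      have "F z0 = 0"
        by (rule polyf_eq_0[OF poly, of ?Z]) (use card M2 finY zeroY zeroB in auto)
      then show ?thesis using F_eq[of z0] S0 by simp
    qed
  qed
qed

section \<open>Ratios of $q$-Pochhammer symbols\<close>

lemma qpoch_0 [simp]: "qpoch q z 0 = 1"
  by (simp add: qpoch_def)

lemma qpoch_Suc: "qpoch q z (Suc k) = qpoch q z k * (1 - q ^ k * z)"
  by (simp add: qpoch_def)

lemma qpoch_Suc_shift: "qpoch q z (Suc k) = (1 - z) * qpoch q (q * z) k"
  unfolding qpoch_def prod.lessThan_Suc_shift by (simp add: mult_ac)

lemma qpoch_neq_0: "(\<And>l. q ^ l * z \<noteq> 1) \<Longrightarrow> qpoch q z k \<noteq> (0 :: 'a :: field)"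
  by (simp add: qpoch_def)

text \<open>The two kinds of quotient in c_n for column k. Here r is the ratio s_j/s_i with the
  powers of q from the later columns included, a is \<theta>_ik and, in \<open>coupling2\<close>, b
  is \<theta>_jk.\<close>

definition coupling :: "'a::field \<Rightarrow> 'a \<Rightarrow> 'a \<Rightarrow> nat \<Rightarrow> 'a" where
  "coupling q t r a = qpoch q (t * r) a / qpoch q (q * r) a"

definition coupling2 :: "'a::field \<Rightarrow> 'a \<Rightarrow> 'a \<Rightarrow> nat \<Rightarrow> nat \<Rightarrow> 'a" where
  "coupling2 q t r a b = qpoch q (q / t * (r / q ^ b)) a / qpoch q (r / q ^ b) a"

text \<open>Macdonald's \<psi>' factor for multiplication by an elementary symmetric polynomial,
  with r = s_j/s_i for a pair i < j of which only s_j is multiplied by q.\<close>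

definition pieri_factor :: "'a::field \<Rightarrow> 'a \<Rightarrow> 'a \<Rightarrow> 'a" where
  "pieri_factor q t r = (1 - t * r) * (1 - q * r / t) / ((1 - r) * (1 - q * r))"

text \<open>r is not a product of integral powers of q and t. Distributing the exponents over both
  sides avoids negative powers, and one condition covers all q-shifts of r.\<close>

definition generic_ratio :: "'a::field \<Rightarrow> 'a \<Rightarrow> 'a \<Rightarrow> bool" where
  "generic_ratio q t r \<longleftrightarrow> (\<forall>a b c d::nat. q ^ a * t ^ b * r \<noteq> q ^ c * t ^ d)"

lemma generic_ratioD: "generic_ratio q t r \<Longrightarrow> q ^ a * t ^ b * r \<noteq> q ^ c * t ^ d"
  by (simp add: generic_ratio_def)

context
  fixes q t r :: "'a::field"
  assumes q: "q \<noteq> 0" and t: "t \<noteq> 0" and gen: "generic_ratio q t r"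
begin

lemma generic_ratio_neqs:
  "r \<noteq> 1" "q * r \<noteq> 1" "t * r \<noteq> 1" "q * r \<noteq> t" "t * r \<noteq> q" "r \<noteq> q" "r \<noteq> t"
  "q ^ a * r \<noteq> q ^ b" "q * (q ^ a * r) \<noteq> q ^ b" "q * (q ^ a * r) \<noteq> 1" "q ^ a * r \<noteq> 1"
  "q ^ a * r \<noteq> q * q ^ b" "t * (q ^ a * r) \<noteq> 1" "t * (q ^ a * r) \<noteq> q * q ^ b"
  "q * (q ^ a * r) \<noteq> t * q ^ b" "q ^ a * r \<noteq> t * q ^ b" "t * (q ^ a * r) \<noteq> q ^ b" "t * (q ^ a * r) \<noteq> q"
  "r \<noteq> q ^ b" "r \<noteq> q * q ^ b" "r \<noteq> t * q ^ b" "q * r \<noteq> t * q ^ b" "q * r \<noteq> q ^ b"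
  using gen[THEN generic_ratioD, of 0 0 0 0] gen[THEN generic_ratioD, of 1 0 0 0]
    gen[THEN generic_ratioD, of 0 1 0 0] gen[THEN generic_ratioD, of 1 0 0 1]
    gen[THEN generic_ratioD, of 0 1 1 0] gen[THEN generic_ratioD, of 0 0 1 0] gen[THEN generic_ratioD, of 0 0 0 1]
    gen[THEN generic_ratioD, of a 0 b 0] gen[THEN generic_ratioD, of "Suc a" 0 b 0]
    gen[THEN generic_ratioD, of "Suc a" 0 0 0] gen[THEN generic_ratioD, of a 0 0 0]
    gen[THEN generic_ratioD, of a 0 "Suc b" 0] gen[THEN generic_ratioD, of a 1 0 0]
    gen[THEN generic_ratioD, of a 1 "Suc b" 0] gen[THEN generic_ratioD, of "Suc a" 0 b 1]
    gen[THEN generic_ratioD, of a 0 b 1] gen[THEN generic_ratioD, of a 1 b 0] gen[THEN generic_ratioD, of a 1 1 0]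
    gen[THEN generic_ratioD, of 0 0 b 0] gen[THEN generic_ratioD, of 0 0 "Suc b" 0]
    gen[THEN generic_ratioD, of 0 0 b 1] gen[THEN generic_ratioD, of 1 0 b 1] gen[THEN generic_ratioD, of 1 0 b 0]
  by (auto simp: mult_ac)

section \<open>Nonvanishing and one-step recurrences\<close>

lemma qpoch_nz: "qpoch q (q * r) a \<noteq> 0" "qpoch q (r / q ^ b) a \<noteq> 0" "qpoch q r a \<noteq> 0"
  "qpoch q (t * r) a \<noteq> 0" "qpoch q (q / t * (r / q ^ b)) a \<noteq> 0"
proof -
  have "q ^ l * (q * r) \<noteq> 1" for l using generic_ratio_neqs(10)[of l] by (simp add: mult_ac)
  then show "qpoch q (q * r) a \<noteq> 0" by (intro qpoch_neq_0) 
  have "q ^ l * (r / q ^ b) \<noteq> 1" for l using generic_ratio_neqs(8)[of l b] q by (simp add: field_simps)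
  then show "qpoch q (r / q ^ b) a \<noteq> 0" by (intro qpoch_neq_0) 
  show "qpoch q r a \<noteq> 0" using generic_ratio_neqs(11) by (intro qpoch_neq_0) 
  have "q ^ l * (t * r) \<noteq> 1" for l using generic_ratio_neqs(13)[of l] by (simp add: mult_ac)
  then show "qpoch q (t * r) a \<noteq> 0" by (intro qpoch_neq_0) 
  have "q ^ l * (q / t * (r / q ^ b)) \<noteq> 1" for l using generic_ratio_neqs(15)[of l b] q t by (simp add: field_simps)
  then show "qpoch q (q / t * (r / q ^ b)) a \<noteq> 0" by (intro qpoch_neq_0) 
qed

text \<open>The recurrences express the value at a through the one at \<open>Suc a\<close>, because
  the exponents \<rho> are kept fixed later and the branching exponents are \<rho> lowered by one on
  J.\<close>

lemma coupling_down:
  "coupling q t r a = coupling q t r (Suc a) * ((1 - q * q ^ a * r) / (1 - t * q ^ a * r))"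
proof -
  have "1 - q * (q ^ a * r) \<noteq> 0" "1 - t * (q ^ a * r) \<noteq> 0" using generic_ratio_neqs(10,13) by auto
  then show ?thesis unfolding coupling_def qpoch_Suc using qpoch_nz(1)[of a] 
    by (simp add: mult_ac)
qed

lemma coupling2_down_left:
  "coupling2 q t r a b = coupling2 q t r (Suc a) b *
     ((1 - q ^ a * r / q ^ b) / (1 - q * q ^ a * r / (t * q ^ b)))"
proof -
  have "1 - q ^ a * (r / q ^ b) \<noteq> 0" "1 - q ^ a * (q / t * (r / q ^ b)) \<noteq> 0"
    using generic_ratio_neqs(8,15)[of a b] q t by (auto simp: field_simps)
  then show ?thesis unfolding coupling2_def qpoch_Suc using qpoch_nz(2)[of b a]
    by (simp add: mult_ac)
qed

text \<open>Raising b divides the arguments by q. Splitting a q-Pochhammer symbol of length a + 1 at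
  its first or at its last factor gives (1 - z) (qz;q)_a = (z;q)_a (1 - q^a z), which is applied to
  numerator and denominator.\<close>

lemma coupling2_down_right:
  "coupling2 q t r a b = coupling2 q t r a (Suc b) *
     ((1 - q ^ a * r / (t * q ^ b)) * (1 - r / (q * q ^ b)) / ((1 - r / (t * q ^ b)) * (1 - q ^ a * r / (q * q ^ b))))"
proof -
  define z where "z = q / t * (r / q ^ Suc b)"
  define w where "w = r / q ^ Suc b"
  have nz: "1 - z \<noteq> 0" "1 - w \<noteq> 0" "1 - q ^ a * z \<noteq> 0" "1 - q ^ a * w \<noteq> 0" "qpoch q w a \<noteq> 0"
    using generic_ratio_neqs(21)[of b] generic_ratio_neqs(20)[of b] generic_ratio_neqs(12)[of a b] generic_ratio_neqs(16)[of a b] qpoch_nz(2)[of "Suc b" a] q t by (auto simp: field_simps z_def w_def)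
  have z: "q / t * (r / q ^ b) = q * z" "r / q ^ b = q * w" using q by (simp_all add: z_def w_def)
  have "(1 - z) * qpoch q (q * z) a = qpoch q z a * (1 - q ^ a * z)"
    "(1 - w) * qpoch q (q * w) a = qpoch q w a * (1 - q ^ a * w)"
    by (metis qpoch_Suc qpoch_Suc_shift)+
  then have "qpoch q (q * z) a = qpoch q z a * (1 - q ^ a * z) / (1 - z)"
    "qpoch q (q * w) a = qpoch q w a * (1 - q ^ a * w) / (1 - w)"
    using nz by (simp_all add: field_simps)
  moreover have "coupling2 q t r a b = qpoch q (q * z) a / qpoch q (q * w) a"
    "coupling2 q t r a (Suc b) = qpoch q z a / qpoch q w a"
    by (simp only: coupling2_def flip: z) (simp only: coupling2_def z_def w_def)
  ultimately have "coupling2 q t r a b = coupling2 q t r a (Suc b) *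
      ((1 - q ^ a * z) * (1 - w) / ((1 - z) * (1 - q ^ a * w)))"
    using nz by (simp add: mult_ac)
  moreover have "q ^ a * z = q ^ a * r / (t * q ^ b)" "z = r / (t * q ^ b)"
    "w = r / (q * q ^ b)" "q ^ a * w = q ^ a * r / (q * q ^ b)"
    using q by (simp_all add: z_def w_def)
  ultimately show ?thesis by (simp only:)
qed

lemma coupling_scaled:
  "coupling q t (q * r) a = coupling q t r (Suc a) * ((1 - q * r) / (1 - t * r))"
proof -
  have "1 - q * r \<noteq> 0" "1 - t * r \<noteq> 0" using generic_ratio_neqs by auto
  then show ?thesis unfolding coupling_def qpoch_Suc_shift by (simp add: mult_ac)
qed

lemma coupling2_scaled:
  "coupling2 q t (q * r) a b = coupling2 q t r (Suc a) b * ((1 - r / q ^ b) / (1 - q * r / (t * q ^ b)))"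
proof -
  have "1 - r / q ^ b \<noteq> 0" "1 - q * r / (t * q ^ b) \<noteq> 0" using generic_ratio_neqs(19)[of b] generic_ratio_neqs(22)[of b] q t by (auto simp: field_simps)
  moreover have "q / t * (q * r / q ^ b) = q * (q / t * (r / q ^ b))" "q * r / q ^ b = q * (r / q ^ b)"
    "q * r / (t * q ^ b) = q / t * (r / q ^ b)" by simp_all
  moreover have "X / Y = (u * X) / (v * Y) * (v / u)" if "u \<noteq> 0" "v \<noteq> 0" for X Y u v :: 'a
    using that by simp
  ultimately show ?thesis unfolding coupling2_def qpoch_Suc_shift by metis
qed

lemma coupling_unscaled:
  "coupling q t (r / q) a = coupling q t r a *
     ((1 - t * r / q) * (1 - q ^ a * r) / ((1 - t * q ^ a * r / q) * (1 - r)))"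
proof -
  define z where "z = t * r / q"
  have nz: "1 - z \<noteq> 0" "1 - r \<noteq> 0" "1 - q ^ a * z \<noteq> 0" "1 - q ^ a * r \<noteq> 0" "qpoch q (q * r) a \<noteq> 0" "qpoch q r a \<noteq> 0"
    using generic_ratio_neqs(1,5,11) generic_ratio_neqs(18)[of a] qpoch_nz(1,3)[of a] q t by (auto simp: field_simps z_def)
  have "(1 - z) * qpoch q (q * z) a = qpoch q z a * (1 - q ^ a * z)"
    "(1 - r) * qpoch q (q * r) a = qpoch q r a * (1 - q ^ a * r)"
    by (metis qpoch_Suc qpoch_Suc_shift)+
  then have "qpoch q (q * z) a = qpoch q z a * (1 - q ^ a * z) / (1 - z)"
    "qpoch q (q * r) a = qpoch q r a * (1 - q ^ a * r) / (1 - r)"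
    using nz by (simp_all add: field_simps)
  then have "coupling q t (r / q) a = coupling q t r a * ((1 - z) * (1 - q ^ a * r) / ((1 - q ^ a * z) * (1 - r)))"
    unfolding coupling_def using nz q by (simp add: z_def)
  then show ?thesis by (simp add: z_def mult_ac)
qed

lemma coupling2_unscaled: "coupling2 q t (r / q) a b = coupling2 q t r a (Suc b)"
  by (simp add: coupling2_def)

section \<open>The factors of one pair of indices after lowering\<close>

lemma pieri_factor_shift:
  "(1 - q * q ^ a * r) / (1 - t * q ^ a * r) * ((1 - q ^ a * r / q ^ b) / (1 - q * q ^ a * r / (t * q ^ b))) *
     pieri_factor q t (q ^ a * r / q ^ b) =
   (t / q * (q * q ^ a * r / q ^ b) - 1) / (q * q ^ a * r / q ^ b - 1) * ((1 - q * q ^ a * r) / (1 - t * q ^ a * r))"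
proof -
  have eq: "P / T * (U / V) * (W * V / (U * Z)) = - W / - Z * (P / T)" if "U \<noteq> 0" "V \<noteq> 0" for P T U V W Z :: 'a
    using that by (simp add: mult_ac)
  define A B where "A = q ^ a * r" and "B = q ^ b"
  have nz: "B \<noteq> 0" "A \<noteq> B" "q * A \<noteq> t * B"
    using generic_ratio_neqs(8,15)[of a b] q by (auto simp: A_def B_def)
  have "1 - A / B \<noteq> 0" "1 - q * A / (t * B) \<noteq> 0"
    using nz q t by (auto simp: field_simps)
  note e = eq[OF this, of "1 - q * A" "1 - t * A" "1 - t * (A / B)" "1 - q * (A / B)"]
  have "q * (A / B) / t = q * A / (t * B)" "t / q * (q * A / B) = t * (A / B)" "q * A / B = q * (A / B)"
    using q by simp_all
  then show ?thesis using e
    unfolding pieri_factor_def mult.assoc A_def[symmetric] B_def[symmetric] minus_diff_eq by (simp only:)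
qed

text \<open>The names tell which of the indices i, j of r = \<sigma>_j/\<sigma>_i lie in J: left is
  i, right is j. The quotients on the right-hand side are those later called \<open>cross\<close>
  and \<open>hop\<close>: the factor of y_j and y_i in \<open>wL\<close>, and the change of the
  factor of y_i against \<sigma>_j.\<close>

lemma pair_left:
  "coupling q t r a * coupling2 q t r a b * pieri_factor q t (q ^ a * r / q ^ b) =
   coupling q t r (Suc a) * coupling2 q t r (Suc a) b *
     ((t / q * (q ^ Suc a * r / q ^ b) - 1) / (q ^ Suc a * r / q ^ b - 1) *
      ((1 - q ^ Suc a * r) / (1 - t / q * (q ^ Suc a * r))))"
proof -
  have "coupling q t r a * coupling2 q t r a b * pieri_factor q t (q ^ a * r / q ^ b) =
     coupling q t r (Suc a) * coupling2 q t r (Suc a) b *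
      ((1 - q * q ^ a * r) / (1 - t * q ^ a * r) * ((1 - q ^ a * r / q ^ b) / (1 - q * q ^ a * r / (t * q ^ b))) *
      pieri_factor q t (q ^ a * r / q ^ b))"
    unfolding coupling_down[of a] coupling2_down_left[of a b] by (simp only: mult_ac)
  also note pieri_factor_shift[of a b]
  also have "t * q ^ a * r = t / q * (q ^ Suc a * r)" using q by simp
  finally show ?thesis by (simp only: power_Suc)
qed

lemma pair_right:
  "coupling q t r a * coupling2 q t r a b =
   coupling q t r a * coupling2 q t r a (Suc b) *
     ((t / q - q ^ a * r / q ^ Suc b) / (1 - q ^ a * r / q ^ Suc b) *
      ((r - q ^ Suc b) / (r - t / q * q ^ Suc b)))"
proof -
  define A B where "A = q ^ a * r" and "B = q ^ b"
  have B0: "B \<noteq> 0" using q by (simp add: B_def)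
  have "(1 - A / (t * B)) * (1 - r / (q * B)) / ((1 - r / (t * B)) * (1 - A / (q * B))) =
     (t / q - A / (q * B)) / (1 - A / (q * B)) * ((r - q * B) / (r - t * B))"
  proof -
    have r1: "t / q - A / (q * B) = t / q * (1 - A / (t * B))" using q t B0 by (simp add: field_simps)
    have r2: "r - q * B = - (q * B) * (1 - r / (q * B))" using q t B0 by (simp add: field_simps)
    have r3: "r - t * B = - (t * B) * (1 - r / (t * B))" using q t B0 by (simp add: field_simps)
    have "U * V / (W * Z) = t / q * U / Z * (- (q * B) * V / (- (t * B) * W))" for U V W Z :: 'a
      using q t B0 by (simp add: mult_ac)
    then show ?thesis unfolding r1 r2 r3 .
  qed
  then show ?thesis using q unfolding coupling2_down_right[of a b] A_def B_def by simp
qed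

text \<open>With i and j both in J the Pieri step leaves their ratio alone, so this one identity
  serves both orders. The factor t/q is the share of the pair in the power of \<kappa>.\<close>

lemma pair_both:
  "coupling q t r a * coupling2 q t r a b =
   coupling q t r (Suc a) * coupling2 q t r (Suc a) (Suc b) *
     (t / q * ((1 - q ^ Suc a * r) / (1 - t / q * (q ^ Suc a * r))) *
      ((r - q ^ Suc b) / (r - t / q * q ^ Suc b)))"
proof -
  define A B where "A = q ^ a * r" and "B = q ^ b"
  have B0: "B \<noteq> 0" using q by (simp add: B_def)
  have AB: "A \<noteq> q * B" "A \<noteq> t * B" using generic_ratio_neqs(12,16)[of a b] by (auto simp: A_def B_def)
  have c1: "coupling q t r a = coupling q t r (Suc a) * ((1 - q * A) / (1 - t * A))"
    using coupling_down[of a] by (simp add: A_def mult_ac)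
  have c2: "coupling2 q t r a (Suc b) = coupling2 q t r (Suc a) (Suc b) * ((1 - A / (q * B)) / (1 - A / (t * B)))"
    using coupling2_down_left[of a "Suc b"] q by (simp add: A_def B_def mult_ac)
  have c3: "coupling2 q t r a b = coupling2 q t r a (Suc b) *
     ((1 - A / (t * B)) * (1 - r / (q * B)) / ((1 - r / (t * B)) * (1 - A / (q * B))))"
    using coupling2_down_right[of a b] by (simp add: A_def B_def)
  have nz: "1 - A / (q * B) \<noteq> 0" "1 - A / (t * B) \<noteq> 0" using AB q t B0 by (auto simp: field_simps)
  have eq: "p * X * (p' * (U / V) * (V * Y / (Z * U))) = p * p' * (X * (Y / Z))"
    if "U \<noteq> 0" "V \<noteq> 0" for p p' X Y Z U V :: 'a
    using that by (simp add: mult_ac)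
  have r1: "r - q * B = - (q * B) * (1 - r / (q * B))" using q t B0 by (simp add: field_simps)
  have r2: "r - t * B = - (t * B) * (1 - r / (t * B))" using q t B0 by (simp add: field_simps)
  have "coupling q t r a * coupling2 q t r a b = coupling q t r (Suc a) * coupling2 q t r (Suc a) (Suc b) *
      ((1 - q * A) / (1 - t * A) * ((1 - r / (q * B)) / (1 - r / (t * B))))"
    unfolding c1 c3 unfolding c2 by (rule eq[OF nz])
  also have "\<dots> = coupling q t r (Suc a) * coupling2 q t r (Suc a) (Suc b) *
      (t / q * ((1 - q * A) / (1 - t * A)) * ((r - q * B) / (r - t * B)))"
    unfolding r1 r2 using q t B0 by simp
  finally show ?thesis using q by (simp add: A_def B_def mult.assoc)
qed

text \<open>From here on the Pieri step comes first: the ratio is multiplied or divided by q before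
  the branching coefficient is taken.\<close>

lemma pair_left_scaled:
  "coupling q t (q * r) a * coupling2 q t (q * r) a b * pieri_factor q t r =
   coupling q t r (Suc a) * coupling2 q t r (Suc a) b *
     ((r - t / q) / (r - 1) * ((r - q ^ b) / (r - t / q * q ^ b)))"
proof -
  define B where "B = q ^ b"
  have B0: "B \<noteq> 0" using q by (simp add: B_def)
  have nz: "1 - q * r \<noteq> 0" "1 - t * r \<noteq> 0" using generic_ratio_neqs(2,3) by auto
  have r1: "r - B = - B * (1 - r / B)" using B0 by (simp add: field_simps)
  have r2: "r - t / q * B = - (t / q * B) * (1 - q * r / (t * B))" using q t B0 by (simp add: field_simps)
  have r3: "r - t / q = - (t / q) * (1 - q * r / t)" using q t by (simp add: field_simps)
  have r4: "r - 1 = - (1 - r)" by simp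
  show ?thesis
    unfolding coupling_scaled coupling2_scaled pieri_factor_def B_def[symmetric] r1 r2 r3 r4
    using nz q t B0 by (simp add: mult_ac minus_divide_left[symmetric] del: minus_diff_eq)
qed

lemma pair_right_scaled:
  "coupling q t (r / q) a * coupling2 q t (r / q) a b =
   coupling q t r a * coupling2 q t r a (Suc b) *
     ((1 - t / q * r) / (1 - r) * ((1 - q ^ a * r) / (1 - t / q * (q ^ a * r))))"
  unfolding coupling_unscaled coupling2_unscaled by (simp add: mult_ac)

lemma last_left_scaled:
  "coupling q t (q * r) a * pieri_factor q t r =
   coupling q t r (Suc a) * (q / t * ((r - t / q) / (r - 1)))"
proof -
  have nz: "1 - q * r \<noteq> 0" "1 - t * r \<noteq> 0" using generic_ratio_neqs(2,3) by auto
  have r3: "r - t / q = - (t / q) * (1 - q * r / t)" using q t by (simp add: field_simps)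
  have r4: "r - 1 = - (1 - r)" by simp
  show ?thesis
    unfolding coupling_scaled pieri_factor_def r3 r4
    using nz q t by (simp add: mult_ac del: minus_diff_eq)
qed

lemma last_right_scaled:
  "coupling q t (r / q) a =
   coupling q t r a * ((1 - t / q * r) / (1 - r) * ((1 - q ^ a * r) / (1 - t / q * (q ^ a * r))))"
  unfolding coupling_unscaled by (simp add: mult_ac)

lemma last_left:
  "coupling q t r a = coupling q t r (Suc a) * ((1 - q ^ Suc a * r) / (1 - t / q * (q ^ Suc a * r)))"
  using coupling_down[of a] q by (simp add: mult_ac)

end

text \<open>The diagonal i = j of the second product in c_n, that is \<open>coupling2\<close> at r =
  1 with equal exponents. As r = 1 is not generic, its recurrence \<open>self_down\<close> requires
  conditions on q and t themselves.\<close>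

definition self_coupling :: "'a::field \<Rightarrow> 'a \<Rightarrow> nat \<Rightarrow> 'a" where
  "self_coupling q t a = qpoch q (q / t / q ^ a) a / qpoch q (1 / q ^ a) a"

lemma self_down:
  fixes q t :: "'a::field"
  assumes q: "q \<noteq> 0" and t: "t \<noteq> 0" and "q ^ Suc a \<noteq> 1" "t * q ^ a \<noteq> 1"
  shows "self_coupling q t a = self_coupling q t (Suc a) * (t / q * ((1 - q ^ Suc a) / (1 - t / q * q ^ Suc a)))"
proof -
  define A where "A = q ^ Suc a"
  have A0: "A \<noteq> 0" using q by (simp add: A_def)
  have A1: "A \<noteq> 1" "t * A \<noteq> q" using assms(3,4) q by (auto simp: A_def)
  have e: "q / t / q ^ a = q * (q / t / A)" "1 / q ^ a = q * (1 / A)" using q by (simp_all add: A_def)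
  have "self_coupling q t (Suc a) = self_coupling q t a * ((1 - q / t / A) / (1 - 1 / A))"
    unfolding self_coupling_def A_def[symmetric] qpoch_Suc_shift e by (simp add: mult_ac)
  moreover have "(1 - q / t / A) \<noteq> 0" "1 - 1 / A \<noteq> 0" using A1 A0 t by (auto simp: field_simps)
  moreover have "1 - A = - A * (1 - 1 / A)" using A0 by (simp add: field_simps)
  moreover have "1 - t / q * A = - (t / q * A) * (1 - q / t / A)" using A0 q t by (simp add: field_simps)
  ultimately show ?thesis unfolding A_def[symmetric] using q t A0 by simp
qed

section \<open>Branching and Pieri coefficients\<close>

definition pairs :: "nat \<Rightarrow> (nat \<times> nat) set" where
  "pairs n = {(i, j). 1 \<le> i \<and> i < j \<and> j \<le> n}"

lemma finite_pairs [simp]: "finite (pairs n)"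
  by (rule finite_subset[of _ "{1..n} \<times> {1..n}"]) (auto simp: pairs_def)

lemma prod_pairs_Suc:
  "(\<Prod>p\<in>pairs (Suc n). f p) = (\<Prod>p\<in>pairs n. f p) * (\<Prod>i\<in>{1..n}. f (i, Suc n))"
proof -
  have "pairs (Suc n) = pairs n \<union> (\<lambda>i. (i, Suc n)) ` {1..n}"
    by (auto simp: pairs_def image_iff le_Suc_eq)
  moreover have "pairs n \<inter> (\<lambda>i. (i, Suc n)) ` {1..n} = {}" by (auto simp: pairs_def)
  moreover have "inj_on (\<lambda>i. (i, Suc n)) {1..n}" by (auto simp: inj_on_def)
  ultimately show ?thesis by (simp add: prod.union_disjoint prod.reindex)
qed

lemma prod_square:
  "(\<Prod>i\<in>{1..n::nat}. \<Prod>j\<in>{1..n}. f i j) =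
     (\<Prod>i\<in>{1..n}. f i i) * (\<Prod>(i, j)\<in>pairs n. f i j * (f j i :: 'a :: comm_monoid_mult))"
proof (induction n)
  case (Suc n)
  have "{1..Suc n} = insert (Suc n) {1..n}" by auto
  then show ?case using Suc by (simp add: prod_pairs_Suc prod.distrib mult_ac)
qed (auto simp: pairs_def intro!: prod.neutral)

text \<open>\<open>card J choose 2\<close> counts the pairs inside J. In this form the power of
  \<kappa> can be compared with the coefficients pair by pair.\<close>

lemma power_choose_2_eq_prod:
  "J \<subseteq> {1..n} \<Longrightarrow> x ^ (card J choose 2) = (\<Prod>(i, j)\<in>pairs n. if i \<in> J \<and> j \<in> J then x else (1 :: 'a :: comm_monoid_mult))"
proof (induction n arbitrary: J)
  case (Suc n)
  define J0 where "J0 = J - {Suc n}"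
  have J0: "J0 \<subseteq> {1..n}" "finite J0" using Suc.prems finite_subset by (fastforce simp: J0_def)+
  have "(\<Prod>(i, j)\<in>pairs n. if i \<in> J \<and> j \<in> J then x else 1) = (\<Prod>(i, j)\<in>pairs n. if i \<in> J0 \<and> j \<in> J0 then x else 1)"
    by (rule prod.cong) (auto simp: pairs_def J0_def)
  also have "\<dots> = x ^ (card J0 choose 2)" using Suc.IH[OF J0(1)] by simp
  finally have A: "(\<Prod>(i, j)\<in>pairs n. if i \<in> J \<and> j \<in> J then x else 1) = x ^ (card J0 choose 2)" .
  have B: "(\<Prod>i\<in>{1..n}. if i \<in> J then x else 1) = x ^ card J0"
  proof -
    have "(\<Prod>i\<in>{1..n}. if i \<in> J then x else 1) = (\<Prod>i\<in>J0. x)"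
      by (intro prod.mono_neutral_cong_right) (use Suc.prems in \<open>auto simp: J0_def\<close>)
    then show ?thesis by simp
  qed
  show ?case
  proof (cases "Suc n \<in> J")
    case True
    then have "J = insert (Suc n) J0" "Suc n \<notin> J0" by (auto simp: J0_def)
    then have "card J = Suc (card J0)" using J0 by simp
    then show ?thesis using A B True by (simp add: prod_pairs_Suc Suc_choose_2 power_add mult.commute)
  next
    case False
    then have "J0 = J" by (simp add: J0_def)
    then show ?thesis using A False by (simp add: prod_pairs_Suc)
  qed
qed (auto simp: pairs_def binomial_eq_0)

lemma prod_subset_if:
  "J \<subseteq> A \<Longrightarrow> finite A \<Longrightarrow> (\<Prod>i\<in>J. f i) = (\<Prod>i\<in>A. if i \<in> J then f i else 1)"
  by (intro prod.mono_neutral_cong_left) auto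

text \<open>
  The factor of \<open>c\<^bsub>N+1\<^esub>(\<theta>; \<sigma>)\<close> that belongs to the last column \<open>\<mu>\<^sub>i = \<theta>\<^bsub>i,N+1\<^esub>\<close>; the remaining
  factors form \<open>c\<^sub>N\<close> at the spectral parameters \<open>\<sigma>\<^sub>i / q\<^bsup>\<mu>\<^sub>i\<^esup>\<close>.
\<close>

definition branch_coeff :: "'a::field \<Rightarrow> 'a \<Rightarrow> nat \<Rightarrow> (nat \<Rightarrow> 'a) \<Rightarrow> (nat \<Rightarrow> nat) \<Rightarrow> 'a" where
  "branch_coeff q t N \<sigma> \<mu> =
     (\<Prod>(i, j)\<in>pairs N. coupling q t (\<sigma> j / \<sigma> i) (\<mu> i) * coupling2 q t (\<sigma> j / \<sigma> i) (\<mu> i) (\<mu> j)) *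
     (\<Prod>i\<in>{1..N}. coupling q t (\<sigma> (Suc N) / \<sigma> i) (\<mu> i) * self_coupling q t (\<mu> i))"

text \<open>J is the set of indices whose parameter stays fixed, so there is one factor for each i <
  j of which only \<sigma>_j is raised.\<close>

definition pieri_coeff :: "'a::field \<Rightarrow> 'a \<Rightarrow> nat \<Rightarrow> nat set \<Rightarrow> (nat \<Rightarrow> 'a) \<Rightarrow> 'a" where
  "pieri_coeff q t n J \<sigma> = (\<Prod>(i, j)\<in>pairs n. if i \<in> J \<and> j \<notin> J then pieri_factor q t (\<sigma> j / \<sigma> i) else 1)"

text \<open>At \<rho> i = 0 the subtraction is truncated. For indices up to N this case is excluded
  by a positivity test on J, and the corresponding values of \<open>wL\<close> and \<open>wR\<close>
  vanish by themselves.\<close>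

definition lower :: "nat set \<Rightarrow> (nat \<Rightarrow> nat) \<Rightarrow> nat \<Rightarrow> nat" where
  "lower J \<rho> i = (if i \<in> J then \<rho> i - 1 else \<rho> i)"

text \<open>
  The Pieri formula multiplies the spectral parameters outside \<open>J\<close> by \<open>q\<close>. For a fixed final spectrum
  \<open>q \<sigma>\<^sub>i / q\<^bsup>\<rho>\<^sub>i\<^esup>\<close> the branching exponent is therefore \<open>\<rho>\<close> lowered by one on \<open>J\<close>.
\<close>

definition raise_spectrum :: "'a::field \<Rightarrow> (nat \<Rightarrow> 'a) \<Rightarrow> nat set \<Rightarrow> nat \<Rightarrow> 'a" where
  "raise_spectrum q \<sigma> J i = (if i \<in> J then \<sigma> i else q * \<sigma> i)"

locale generic_spectrum =
  fixes q t :: "'a::field" and \<sigma> :: "nat \<Rightarrow> 'a"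
  assumes q: "q \<noteq> 0" and t: "t \<noteq> 0"
    and q_gen: "\<And>a. q ^ Suc a \<noteq> 1" and t_gen: "\<And>a b. t * q ^ a \<noteq> q ^ b"
    and \<sigma>_nz: "\<And>i. \<sigma> i \<noteq> 0" and gen: "\<And>i j. i \<noteq> j \<Longrightarrow> generic_ratio q t (\<sigma> j / \<sigma> i)"
begin

text \<open>The change of the factor between y_i and \<sigma>_m when y_i enters J in
  \<open>wL\<close>, and equally when \<sigma>_m enters J in \<open>wR\<close>. This common quotient
  makes the two weights comparable.\<close>

definition hop :: "(nat \<Rightarrow> nat) \<Rightarrow> nat \<Rightarrow> nat \<Rightarrow> 'a" where
  "hop \<rho> i m = (\<sigma> i / q ^ \<rho> i - \<sigma> m) / (\<sigma> i / q ^ \<rho> i - t / q * \<sigma> m)"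

text \<open>One form in \<sigma>_j/\<sigma>_i and one in its inverse: for a pair i < j, both
  \<open>hop \<rho> i j\<close> and \<open>hop \<rho> j i\<close> thus become functions of the same
  r.\<close>

lemma hop_eq:
  "hop \<rho> i j = (1 - q ^ \<rho> i * (\<sigma> j / \<sigma> i)) / (1 - t / q * (q ^ \<rho> i * (\<sigma> j / \<sigma> i)))"
  "hop \<rho> i j = (\<sigma> i / \<sigma> j - q ^ \<rho> i) / (\<sigma> i / \<sigma> j - t / q * q ^ \<rho> i)"
proof -
  define A where "A = q ^ \<rho> i"
  have A: "A \<noteq> 0" using q by (simp add: A_def)
  have "\<sigma> i / A - \<sigma> j = \<sigma> i / A * (1 - A * (\<sigma> j / \<sigma> i))"
    "\<sigma> i / A - t / q * \<sigma> j = \<sigma> i / A * (1 - t / q * (A * (\<sigma> j / \<sigma> i)))"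
    using A \<sigma>_nz[of i] q by (simp_all add: field_simps)
  then show "hop \<rho> i j = (1 - q ^ \<rho> i * (\<sigma> j / \<sigma> i)) / (1 - t / q * (q ^ \<rho> i * (\<sigma> j / \<sigma> i)))"
    unfolding hop_def A_def[symmetric] using A \<sigma>_nz[of i] by simp
  have "\<sigma> i / A - \<sigma> j = \<sigma> j / A * (\<sigma> i / \<sigma> j - A)"
    "\<sigma> i / A - t / q * \<sigma> j = \<sigma> j / A * (\<sigma> i / \<sigma> j - t / q * A)"
    using A \<sigma>_nz[of j] q by (simp_all add: field_simps)
  then show "hop \<rho> i j = (\<sigma> i / \<sigma> j - q ^ \<rho> i) / (\<sigma> i / \<sigma> j - t / q * q ^ \<rho> i)"
    unfolding hop_def A_def[symmetric] using A \<sigma>_nz[of j] by simp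
qed

lemma hop_self: "hop \<rho> i i = (1 - q ^ \<rho> i) / (1 - t / q * q ^ \<rho> i)"
  using \<sigma>_nz[of i] by (simp add: hop_eq(1))

definition cross :: "(nat \<Rightarrow> nat) \<Rightarrow> nat \<Rightarrow> nat \<Rightarrow> 'a" where
  "cross \<rho> i j = (t / q * (\<sigma> i / q ^ \<rho> i) - \<sigma> j / q ^ \<rho> j) / (\<sigma> i / q ^ \<rho> i - \<sigma> j / q ^ \<rho> j)"

lemma cross_eq:
  "cross \<rho> i j = (t / q - q ^ \<rho> i * (\<sigma> j / \<sigma> i) / q ^ \<rho> j) / (1 - q ^ \<rho> i * (\<sigma> j / \<sigma> i) / q ^ \<rho> j)"
  "cross \<rho> j i = (t / q * (q ^ \<rho> i * (\<sigma> j / \<sigma> i) / q ^ \<rho> j) - 1) / (q ^ \<rho> i * (\<sigma> j / \<sigma> i) / q ^ \<rho> j - 1)"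
proof -
  define x where "x = \<sigma> i / q ^ \<rho> i"
  have x: "x \<noteq> 0" using \<sigma>_nz[of i] q by (simp add: x_def)
  define r where "r = q ^ \<rho> i * (\<sigma> j / \<sigma> i) / q ^ \<rho> j"
  have y: "\<sigma> j / q ^ \<rho> j = x * r" using \<sigma>_nz[of i] q by (simp add: x_def r_def)
  have "t / q * x - x * r = x * (t / q - r)" "x - x * r = x * (1 - r)"
    "t / q * (x * r) - x = x * (t / q * r - 1)" "x * r - x = x * (r - 1)"
    by (simp_all add: algebra_simps)
  then show "cross \<rho> i j = (t / q - q ^ \<rho> i * (\<sigma> j / \<sigma> i) / q ^ \<rho> j) / (1 - q ^ \<rho> i * (\<sigma> j / \<sigma> i) / q ^ \<rho> j)"
    "cross \<rho> j i = (t / q * (q ^ \<rho> i * (\<sigma> j / \<sigma> i) / q ^ \<rho> j) - 1) / (q ^ \<rho> i * (\<sigma> j / \<sigma> i) / q ^ \<rho> j - 1)"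
    unfolding cross_def r_def[symmetric] y x_def[symmetric] using x by simp_all
qed

section \<open>Branching followed by the Pieri formula\<close>

lemma branch_pieri_pair:
  assumes ij: "i \<noteq> j" and pos: "i \<in> J \<Longrightarrow> \<rho> i > 0" "j \<in> J \<Longrightarrow> \<rho> j > 0"
  shows "coupling q t (\<sigma> j / \<sigma> i) (lower J \<rho> i) * coupling2 q t (\<sigma> j / \<sigma> i) (lower J \<rho> i) (lower J \<rho> j) *
     (if i \<in> J \<and> j \<notin> J then pieri_factor q t (\<sigma> j / q ^ lower J \<rho> j / (\<sigma> i / q ^ lower J \<rho> i)) else 1) =
   coupling q t (\<sigma> j / \<sigma> i) (\<rho> i) * coupling2 q t (\<sigma> j / \<sigma> i) (\<rho> i) (\<rho> j) *
    ((if i \<notin> J \<and> j \<in> J then cross \<rho> i j else 1) * (if j \<notin> J \<and> i \<in> J then cross \<rho> j i else 1) *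
     ((if i \<in> J then hop \<rho> i j else 1) * (if j \<in> J then hop \<rho> j i else 1)) *
     (if i \<in> J \<and> j \<in> J then t / q else 1))"
proof -
  note g = q t gen[OF ij]
  have a: "\<rho> i = Suc (\<rho> i - 1)" if "i \<in> J" using pos(1)[OF that] by simp
  have b: "\<rho> j = Suc (\<rho> j - 1)" if "j \<in> J" using pos(2)[OF that] by simp
  consider "i \<in> J" "j \<in> J" | "i \<in> J" "j \<notin> J" | "i \<notin> J" "j \<in> J" | "i \<notin> J" "j \<notin> J" by blast
  then show ?thesis
  proof cases
    case 1
    have "coupling q t (\<sigma> j / \<sigma> i) (\<rho> i - 1) * coupling2 q t (\<sigma> j / \<sigma> i) (\<rho> i - 1) (\<rho> j - 1) =
       coupling q t (\<sigma> j / \<sigma> i) (\<rho> i) * coupling2 q t (\<sigma> j / \<sigma> i) (\<rho> i) (\<rho> j) *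
         (t / q * hop \<rho> i j * hop \<rho> j i)"
      using pair_both[OF g, of "\<rho> i - 1" "\<rho> j - 1"] unfolding a[OF 1(1), symmetric] b[OF 1(2), symmetric]
      unfolding hop_eq(1)[of \<rho> i j] hop_eq(2)[of \<rho> j i] .
    with 1 show ?thesis by (simp add: lower_def mult_ac)
  next
    case 2
    have "\<sigma> j / q ^ \<rho> j / (\<sigma> i / q ^ (\<rho> i - 1)) = q ^ (\<rho> i - 1) * (\<sigma> j / \<sigma> i) / q ^ \<rho> j"
      by (simp add: mult_ac)
    then have "coupling q t (\<sigma> j / \<sigma> i) (\<rho> i - 1) * coupling2 q t (\<sigma> j / \<sigma> i) (\<rho> i - 1) (\<rho> j) *
         pieri_factor q t (\<sigma> j / q ^ \<rho> j / (\<sigma> i / q ^ (\<rho> i - 1))) =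
       coupling q t (\<sigma> j / \<sigma> i) (\<rho> i) * coupling2 q t (\<sigma> j / \<sigma> i) (\<rho> i) (\<rho> j) * (cross \<rho> j i * hop \<rho> i j)"
      using pair_left[OF g, of "\<rho> i - 1" "\<rho> j"] unfolding a[OF 2(1), symmetric]
      unfolding hop_eq(1)[of \<rho> i j] cross_eq(2)[of \<rho> j i] by (simp only:)
    with 2 show ?thesis by (simp add: lower_def)
  next
    case 3
    have "coupling q t (\<sigma> j / \<sigma> i) (\<rho> i) * coupling2 q t (\<sigma> j / \<sigma> i) (\<rho> i) (\<rho> j - 1) =
       coupling q t (\<sigma> j / \<sigma> i) (\<rho> i) * coupling2 q t (\<sigma> j / \<sigma> i) (\<rho> i) (\<rho> j) * (cross \<rho> i j * hop \<rho> j i)"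
      using pair_right[OF g, of "\<rho> i" "\<rho> j - 1"] unfolding b[OF 3(2), symmetric]
      unfolding hop_eq(2)[of \<rho> j i] cross_eq(1)[of \<rho> i j] .
    with 3 show ?thesis by (simp add: lower_def)
  qed (simp add: lower_def)
qed

lemma self_coupling_lower:
  assumes "i \<in> J \<Longrightarrow> \<rho> i > 0"
  shows "self_coupling q t (lower J \<rho> i) = self_coupling q t (\<rho> i) * (if i \<in> J then t / q * hop \<rho> i i else 1)"
proof (cases "i \<in> J")
  case True
  then obtain a where a: "\<rho> i = Suc a" using assms gr0_implies_Suc by blast
  have "t * q ^ a \<noteq> 1" using t_gen[of a 0] by simp
  then show ?thesis using self_down[OF q t q_gen[of a]] True unfolding hop_self
    by (simp add: lower_def a del: power_Suc)
qed (simp add: lower_def)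

lemma coupling_lower:
  assumes "i \<noteq> n" "i \<in> J \<Longrightarrow> \<rho> i > 0"
  shows "coupling q t (\<sigma> n / \<sigma> i) (lower J \<rho> i) =
     coupling q t (\<sigma> n / \<sigma> i) (\<rho> i) * (if i \<in> J then hop \<rho> i n else 1)"
proof (cases "i \<in> J")
  case True
  then obtain a where a: "\<rho> i = Suc a" using assms gr0_implies_Suc by blast
  then show ?thesis using last_left[OF q t gen[OF assms(1)], of a] True unfolding hop_eq(1)
    by (simp add: lower_def a del: power_Suc)
qed (simp add: lower_def)

abbreviation S_set :: "nat \<Rightarrow> 'a set" where "S_set N \<equiv> \<sigma> ` {1..Suc N}"
abbreviation Y_set :: "nat \<Rightarrow> (nat \<Rightarrow> nat) \<Rightarrow> 'a set" where "Y_set N \<rho> \<equiv> (\<lambda>i. \<sigma> i / q ^ \<rho> i) ` {1..N}"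

lemma inj_\<sigma>: "inj_on \<sigma> A"
proof (rule inj_onI)
  fix i j assume "\<sigma> i = \<sigma> j"
  then show "i = j" using gen[of i j, THEN generic_ratioD, of 0 0 0 0] \<sigma>_nz by fastforce
qed

lemma y_neq:
  assumes "i \<noteq> j"
  shows "\<sigma> i / q ^ \<rho> i \<noteq> \<sigma> j / q ^ \<rho> j" "\<sigma> i / q ^ \<rho> i \<noteq> t / q * (\<sigma> j / q ^ \<rho> j)"
    "\<sigma> i / q ^ \<rho> i \<noteq> t / q * \<sigma> j"
  using gen[OF assms, THEN generic_ratioD, of "\<rho> i" 0 "\<rho> j" 0]
    gen[OF assms, THEN generic_ratioD, of "\<rho> i" 1 "Suc (\<rho> j)" 0]
    gen[OF assms, THEN generic_ratioD, of "\<rho> i" 1 1 0] q \<sigma>_nz[of i]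
  by (auto simp: field_simps)

lemma inj_y: "inj_on (\<lambda>i. \<sigma> i / q ^ \<rho> i) A"
  using y_neq(1) by (fastforce intro!: inj_onI)

text \<open>At the empty set only the product of all y - \<kappa> \<sigma> remains; it normalises
  both weights. A factor with y and \<sigma> of the same index could vanish only if t were a power
  of q.\<close>

lemma wL_empty_nz: "wL (t / q) (S_set N) (Y_set N \<rho>) {} \<noteq> 0"
proof -
  have "\<sigma> i / q ^ \<rho> i \<noteq> t / q * \<sigma> m" for i m
  proof (cases "i = m")
    case True
    then show ?thesis using t_gen[of "\<rho> i" 1] q \<sigma>_nz[of i] by (auto simp: field_simps)
  qed (use y_neq(3) in auto)
  then show ?thesis by (auto simp: wL_def)
qed

lemma Y_set_gen: "a \<in> Y_set N \<rho> \<Longrightarrow> b \<in> Y_set N \<rho> \<Longrightarrow> a \<noteq> t / q * b"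
proof clarify
  fix i j assume "\<sigma> i / q ^ \<rho> i = t / q * (\<sigma> j / q ^ \<rho> j)"
  then show False using y_neq(2)[of i j \<rho>] t_gen[of 0 1] q \<sigma>_nz[of i] by (cases "i = j") (auto simp: field_simps)
qed

text \<open>A product over pairs and single indices has the shape of \<open>branch_coeff\<close> and
  \<open>pieri_coeff\<close>, so \<open>branch_pieri_eq_wL\<close> can be checked factor by
  factor.\<close>

lemma wL_ratio:
  assumes J: "J \<subseteq> {1..N}"
  shows "wL (t / q) (S_set N) (Y_set N \<rho>) ((\<lambda>i. \<sigma> i / q ^ \<rho> i) ` J) = wL (t / q) (S_set N) (Y_set N \<rho>) {} *
     ((\<Prod>(i, j)\<in>pairs N. (if i \<notin> J \<and> j \<in> J then cross \<rho> i j else 1) * (if j \<notin> J \<and> i \<in> J then cross \<rho> j i else 1) *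
     ((if i \<in> J then hop \<rho> i j else 1) * (if j \<in> J then hop \<rho> j i else 1)) *
     (if i \<in> J \<and> j \<in> J then t / q else 1)) *
     (\<Prod>i\<in>{1..N}. if i \<in> J then hop \<rho> i (Suc N) * (t / q * hop \<rho> i i) else 1))"
proof -
  let ?y = "\<lambda>i. \<sigma> i / q ^ \<rho> i"
  let ?N = "{1..N}"
  have fJ: "finite J" using J finite_subset by blast
  have nz: "?y i - t / q * \<sigma> m \<noteq> 0" if "i \<in> ?N" "m \<in> {1..Suc N}" for i m
    using wL_empty_nz[of N \<rho>] that by (auto simp: wL_def)
  have d: "?y ` ?N - ?y ` J = ?y ` (?N - J)" using J inj_y by (subst inj_on_image_set_diff[of ?y ?N]) auto
  have re: "(\<Prod>a\<in>?y ` A. f a) = (\<Prod>i\<in>A. f (?y i))" for A and f :: "'a \<Rightarrow> 'a"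
    by (subst prod.reindex[OF inj_y]) (simp add: o_def)
  have re': "(\<Prod>a\<in>\<sigma> ` A. f a) = (\<Prod>i\<in>A. f (\<sigma> i))" for A and f :: "'a \<Rightarrow> 'a"
    by (subst prod.reindex[OF inj_\<sigma>]) (simp add: o_def)
  have c: "card (?y ` J) = card J" by (rule card_image[OF inj_y])
  have split_all: "(\<Prod>i\<in>?N. \<Prod>m\<in>{1..Suc N}. ?y i - t / q * \<sigma> m) =
      (\<Prod>i\<in>?N-J. \<Prod>m\<in>{1..Suc N}. ?y i - t / q * \<sigma> m) * (\<Prod>i\<in>J. \<Prod>m\<in>{1..Suc N}. ?y i - t / q * \<sigma> m)"
    by (rule prod_split[symmetric]) (use J in auto)
  have hops: "(\<Prod>i\<in>J. \<Prod>m\<in>{1..Suc N}. ?y i - t / q * \<sigma> m) * (\<Prod>i\<in>J. \<Prod>m\<in>{1..Suc N}. hop \<rho> i m) =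
      (\<Prod>i\<in>J. \<Prod>m\<in>{1..Suc N}. ?y i - \<sigma> m)"
    unfolding prod.distrib[symmetric] hop_def
    by (intro prod.cong refl) (use J nz in \<open>auto simp: subset_iff\<close>)
  have A: "wL (t / q) (S_set N) (Y_set N \<rho>) (?y ` J) = wL (t / q) (S_set N) (Y_set N \<rho>) {} *
      ((t / q) ^ (Suc (card J) choose 2) * (\<Prod>i\<in>?N-J. \<Prod>j\<in>J. cross \<rho> i j) * (\<Prod>i\<in>J. \<Prod>m\<in>{1..Suc N}. hop \<rho> i m))"
    unfolding wL_def d Diff_empty re re' c cross_def hops[symmetric] split_all
    by (simp add: binomial_eq_0 mult_ac)
  have h: "(\<Prod>i\<in>J. \<Prod>m\<in>{1..Suc N}. hop \<rho> i m) =
      (\<Prod>i\<in>?N. if i \<in> J then hop \<rho> i (Suc N) * hop \<rho> i i else 1) *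
      (\<Prod>(i, j)\<in>pairs N. (if i \<in> J then hop \<rho> i j else 1) * (if j \<in> J then hop \<rho> j i else 1))"
  proof -
    have "(\<Prod>i\<in>J. \<Prod>m\<in>{1..Suc N}. hop \<rho> i m) =
       (\<Prod>i\<in>?N. (if i \<in> J then hop \<rho> i (Suc N) else 1) * (\<Prod>j\<in>?N. if i \<in> J then hop \<rho> i j else 1))"
      unfolding prod_subset_if[OF J finite_atLeastAtMost]
      by (intro prod.cong refl) (simp add: mult.commute)
    also have "\<dots> = (\<Prod>i\<in>?N. if i \<in> J then hop \<rho> i (Suc N) else 1) * ((\<Prod>i\<in>?N. if i \<in> J then hop \<rho> i i else 1) *
      (\<Prod>(i, j)\<in>pairs N. (if i \<in> J then hop \<rho> i j else 1) * (if j \<in> J then hop \<rho> j i else 1)))"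
      unfolding prod.distrib prod_square ..
    also have "\<dots> = (\<Prod>i\<in>?N. if i \<in> J then hop \<rho> i (Suc N) * hop \<rho> i i else 1) *
      (\<Prod>(i, j)\<in>pairs N. (if i \<in> J then hop \<rho> i j else 1) * (if j \<in> J then hop \<rho> j i else 1))"
      unfolding mult.assoc[symmetric] prod.distrib[symmetric]
      by (intro arg_cong2[of _ _ _ _ "(*)"] prod.cong refl) auto
    finally show ?thesis .
  qed
  have cr: "(\<Prod>i\<in>?N-J. \<Prod>j\<in>J. cross \<rho> i j) =
     (\<Prod>(i, j)\<in>pairs N. (if i \<notin> J \<and> j \<in> J then cross \<rho> i j else 1) * (if j \<notin> J \<and> i \<in> J then cross \<rho> j i else 1))"
  proof -
    have "(\<Prod>i\<in>?N-J. \<Prod>j\<in>J. cross \<rho> i j) = (\<Prod>i\<in>?N. \<Prod>j\<in>?N. if i \<notin> J \<and> j \<in> J then cross \<rho> i j else 1)"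
      unfolding prod_subset_if[OF Diff_subset finite_atLeastAtMost] prod_subset_if[OF J finite_atLeastAtMost]
      by (intro prod.cong refl) auto
    also have "\<dots> = (\<Prod>(i, j)\<in>pairs N. (if i \<notin> J \<and> j \<in> J then cross \<rho> i j else 1) * (if j \<notin> J \<and> i \<in> J then cross \<rho> j i else 1))"
      unfolding prod_square by (simp add: if_distrib cong: if_cong)
    finally show ?thesis .
  qed
  \<comment> \<open>\<open>Suc (card J) choose 2\<close> counts the pairs inside J and, once each,
    its elements; the latter account for the t/q in \<open>self_coupling_lower\<close>.\<close>
  have k: "(t / q) ^ (Suc (card J) choose 2) = (\<Prod>i\<in>?N. if i \<in> J then t / q else 1) * (\<Prod>(i, j)\<in>pairs N. if i \<in> J \<and> j \<in> J then t / q else 1)"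
    unfolding power_choose_2_eq_prod[OF J, symmetric] Suc_choose_2 power_add
    using prod_subset_if[OF J finite_atLeastAtMost, of "\<lambda>_. t / q"] by simp
  have "(t / q) ^ (Suc (card J) choose 2) * (\<Prod>i\<in>?N-J. \<Prod>j\<in>J. cross \<rho> i j) * (\<Prod>i\<in>J. \<Prod>m\<in>{1..Suc N}. hop \<rho> i m) =
    (\<Prod>(i, j)\<in>pairs N. (if i \<notin> J \<and> j \<in> J then cross \<rho> i j else 1) * (if j \<notin> J \<and> i \<in> J then cross \<rho> j i else 1) *
     ((if i \<in> J then hop \<rho> i j else 1) * (if j \<in> J then hop \<rho> j i else 1)) *
     (if i \<in> J \<and> j \<in> J then t / q else 1)) *
     ((\<Prod>i\<in>?N. if i \<in> J then t / q else 1) * (\<Prod>i\<in>?N. if i \<in> J then hop \<rho> i (Suc N) * hop \<rho> i i else 1))"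
    unfolding k cr h case_prod_beta prod.distrib by (simp only: mult_ac)
  also have "(\<Prod>i\<in>?N. if i \<in> J then t / q else 1) * (\<Prod>i\<in>?N. if i \<in> J then hop \<rho> i (Suc N) * hop \<rho> i i else 1) =
     (\<Prod>i\<in>?N. if i \<in> J then hop \<rho> i (Suc N) * (t / q * hop \<rho> i i) else 1)"
    unfolding prod.distrib[symmetric] by (intro prod.cong refl) auto
  finally show ?thesis unfolding A by (simp only:)
qed

lemma branch_pieri_eq_wL:
  assumes J: "J \<subseteq> {1..N}" and pos: "\<And>i. i \<in> J \<Longrightarrow> \<rho> i > 0"
  shows "branch_coeff q t N \<sigma> (lower J \<rho>) * pieri_coeff q t N J (\<lambda>i. \<sigma> i / q ^ lower J \<rho> i) =
    branch_coeff q t N \<sigma> \<rho> / wL (t / q) (S_set N) (Y_set N \<rho>) {} *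
      wL (t / q) (S_set N) (Y_set N \<rho>) ((\<lambda>i. \<sigma> i / q ^ \<rho> i) ` J)"
proof -
  let ?b = "\<lambda>\<mu> (i, j). coupling q t (\<sigma> j / \<sigma> i) (\<mu> i) * coupling2 q t (\<sigma> j / \<sigma> i) (\<mu> i) (\<mu> j)"
  let ?p = "\<lambda>(i, j). if i \<in> J \<and> j \<notin> J then pieri_factor q t (\<sigma> j / q ^ lower J \<rho> j / (\<sigma> i / q ^ lower J \<rho> i)) else 1"
  let ?R = "\<lambda>(i, j). (if i \<notin> J \<and> j \<in> J then cross \<rho> i j else 1) * (if j \<notin> J \<and> i \<in> J then cross \<rho> j i else 1) *
     ((if i \<in> J then hop \<rho> i j else 1) * (if j \<in> J then hop \<rho> j i else 1)) *
     (if i \<in> J \<and> j \<in> J then t / q else 1)"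
  let ?s = "\<lambda>\<mu> i. coupling q t (\<sigma> (Suc N) / \<sigma> i) (\<mu> i) * self_coupling q t (\<mu> i)"
  let ?T = "\<lambda>i. if i \<in> J then hop \<rho> i (Suc N) * (t / q * hop \<rho> i i) else 1"
  have 1: "(\<Prod>p\<in>pairs N. ?b (lower J \<rho>) p) * (\<Prod>p\<in>pairs N. ?p p) = (\<Prod>p\<in>pairs N. ?b \<rho> p) * (\<Prod>p\<in>pairs N. ?R p)"
    unfolding prod.distrib[symmetric]
  proof (intro prod.cong refl)
    fix p assume p: "p \<in> pairs N"
    obtain i j where ij: "p = (i, j)" by force
    with p have "i \<noteq> j" by (auto simp: pairs_def)
    then show "?b (lower J \<rho>) p * ?p p = ?b \<rho> p * ?R p"
      using branch_pieri_pair[of i j J \<rho>] pos unfolding ij case_prod_conv by blast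
  qed
  have 2: "(\<Prod>i\<in>{1..N}. ?s (lower J \<rho>) i) = (\<Prod>i\<in>{1..N}. ?s \<rho> i) * (\<Prod>i\<in>{1..N}. ?T i)"
    unfolding prod.distrib[symmetric]
    by (intro prod.cong refl) (use pos in \<open>auto simp: coupling_lower self_coupling_lower\<close>)
  have "branch_coeff q t N \<sigma> (lower J \<rho>) * pieri_coeff q t N J (\<lambda>i. \<sigma> i / q ^ lower J \<rho> i) =
     ((\<Prod>p\<in>pairs N. ?b (lower J \<rho>) p) * (\<Prod>p\<in>pairs N. ?p p)) * (\<Prod>i\<in>{1..N}. ?s (lower J \<rho>) i)"
    unfolding branch_coeff_def pieri_coeff_def by (simp only: mult_ac)
  also have "\<dots> = branch_coeff q t N \<sigma> \<rho> * ((\<Prod>p\<in>pairs N. ?R p) * (\<Prod>i\<in>{1..N}. ?T i))"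
    unfolding 1 2 unfolding branch_coeff_def by (simp only: mult_ac)
  finally show ?thesis unfolding wL_ratio[OF J] using wL_empty_nz by simp
qed

section \<open>The Pieri formula followed by branching\<close>

abbreviation raise :: "nat set \<Rightarrow> nat \<Rightarrow> 'a" where
  "raise \<equiv> raise_spectrum q \<sigma>"

definition cross_out :: "nat \<Rightarrow> nat \<Rightarrow> 'a" where
  "cross_out i j = (\<sigma> i - t / q * \<sigma> j) / (\<sigma> i - \<sigma> j)"

lemma cross_out_eq:
  "cross_out i j = (1 - t / q * (\<sigma> j / \<sigma> i)) / (1 - \<sigma> j / \<sigma> i)"
  "cross_out i j = (\<sigma> i / \<sigma> j - t / q) / (\<sigma> i / \<sigma> j - 1)"
proof -
  have "\<sigma> i - t / q * \<sigma> j = \<sigma> i * (1 - t / q * (\<sigma> j / \<sigma> i))" "\<sigma> i - \<sigma> j = \<sigma> i * (1 - \<sigma> j / \<sigma> i)"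
    using \<sigma>_nz[of i] by (simp_all add: field_simps)
  then show "cross_out i j = (1 - t / q * (\<sigma> j / \<sigma> i)) / (1 - \<sigma> j / \<sigma> i)"
    unfolding cross_out_def using \<sigma>_nz[of i] by simp
  have "\<sigma> i - t / q * \<sigma> j = \<sigma> j * (\<sigma> i / \<sigma> j - t / q)" "\<sigma> i - \<sigma> j = \<sigma> j * (\<sigma> i / \<sigma> j - 1)"
    using \<sigma>_nz[of j] by (simp_all add: field_simps)
  then show "cross_out i j = (\<sigma> i / \<sigma> j - t / q) / (\<sigma> i / \<sigma> j - 1)"
    unfolding cross_out_def using \<sigma>_nz[of j] by simp
qed

lemma raise_ratio:
  "raise J j / raise J i = (if i \<in> J \<and> j \<notin> J then q * (\<sigma> j / \<sigma> i)
     else if i \<notin> J \<and> j \<in> J then \<sigma> j / \<sigma> i / q else \<sigma> j / \<sigma> i)"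
  using q by (simp add: raise_spectrum_def)

lemma pieri_branch_pair:
  assumes ij: "i \<noteq> j" and pos: "i \<in> J \<Longrightarrow> \<rho> i > 0" "j \<in> J \<Longrightarrow> \<rho> j > 0"
  shows "coupling q t (raise J j / raise J i) (lower J \<rho> i) * coupling2 q t (raise J j / raise J i) (lower J \<rho> i) (lower J \<rho> j) *
     (if i \<in> J \<and> j \<notin> J then pieri_factor q t (\<sigma> j / \<sigma> i) else 1) =
   coupling q t (\<sigma> j / \<sigma> i) (\<rho> i) * coupling2 q t (\<sigma> j / \<sigma> i) (\<rho> i) (\<rho> j) *
    ((if i \<notin> J \<and> j \<in> J then cross_out i j else 1) * (if j \<notin> J \<and> i \<in> J then cross_out j i else 1) *
     ((if i \<in> J then hop \<rho> j i else 1) * (if j \<in> J then hop \<rho> i j else 1)) *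
     (if i \<in> J \<and> j \<in> J then t / q else 1))"
proof -
  note g = q t gen[OF ij]
  have a: "\<rho> i = Suc (\<rho> i - 1)" if "i \<in> J" using pos(1)[OF that] by simp
  have b: "\<rho> j = Suc (\<rho> j - 1)" if "j \<in> J" using pos(2)[OF that] by simp
  consider "i \<in> J" "j \<in> J" | "i \<in> J" "j \<notin> J" | "i \<notin> J" "j \<in> J" | "i \<notin> J" "j \<notin> J" by blast
  then show ?thesis
  proof cases
    case 1
    have "coupling q t (\<sigma> j / \<sigma> i) (\<rho> i - 1) * coupling2 q t (\<sigma> j / \<sigma> i) (\<rho> i - 1) (\<rho> j - 1) =
       coupling q t (\<sigma> j / \<sigma> i) (\<rho> i) * coupling2 q t (\<sigma> j / \<sigma> i) (\<rho> i) (\<rho> j) *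
         (t / q * hop \<rho> i j * hop \<rho> j i)"
      using pair_both[OF g, of "\<rho> i - 1" "\<rho> j - 1"] unfolding a[OF 1(1), symmetric] b[OF 1(2), symmetric]
      unfolding hop_eq(1)[of \<rho> i j] hop_eq(2)[of \<rho> j i] .
    with 1 show ?thesis by (simp add: lower_def raise_ratio mult_ac)
  next
    case 2
    have "coupling q t (q * (\<sigma> j / \<sigma> i)) (\<rho> i - 1) * coupling2 q t (q * (\<sigma> j / \<sigma> i)) (\<rho> i - 1) (\<rho> j) * pieri_factor q t (\<sigma> j / \<sigma> i) =
       coupling q t (\<sigma> j / \<sigma> i) (\<rho> i) * coupling2 q t (\<sigma> j / \<sigma> i) (\<rho> i) (\<rho> j) * (cross_out j i * hop \<rho> j i)"
      using pair_left_scaled[OF g, of "\<rho> i - 1" "\<rho> j"] unfolding a[OF 2(1), symmetric]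
      unfolding hop_eq(2)[of \<rho> j i] cross_out_eq(2)[of j i] .
    with 2 show ?thesis by (simp add: lower_def raise_ratio del: times_divide_eq_right)
  next
    case 3
    have "coupling q t (\<sigma> j / \<sigma> i / q) (\<rho> i) * coupling2 q t (\<sigma> j / \<sigma> i / q) (\<rho> i) (\<rho> j - 1) =
       coupling q t (\<sigma> j / \<sigma> i) (\<rho> i) * coupling2 q t (\<sigma> j / \<sigma> i) (\<rho> i) (\<rho> j) * (cross_out i j * hop \<rho> i j)"
      using pair_right_scaled[OF g, of "\<rho> i" "\<rho> j - 1"] unfolding b[OF 3(2), symmetric]
      unfolding hop_eq(1)[of \<rho> i j] cross_out_eq(1)[of i j] .
    with 3 show ?thesis by (simp add: lower_def raise_ratio del: divide_divide_eq_left)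
  qed (simp add: lower_def raise_ratio)
qed

text \<open>Pairs with the last index have no \<open>coupling2\<close> and are grouped with the
  self-coupling. If i is in J and n is not, the q/t of \<open>last_left_scaled\<close> cancels the
  t/q of the self-coupling; this is why \<open>wR\<close> has \<open>card J choose 2\<close> where
  \<open>wL\<close> has \<open>Suc (card J) choose 2\<close>.\<close>

lemma pieri_branch_last:
  assumes i: "i \<noteq> n" and pos: "i \<in> J \<Longrightarrow> \<rho> i > 0"
  shows "coupling q t (raise J n / raise J i) (lower J \<rho> i) * self_coupling q t (lower J \<rho> i) *
     (if i \<in> J \<and> n \<notin> J then pieri_factor q t (\<sigma> n / \<sigma> i) else 1) =
   coupling q t (\<sigma> n / \<sigma> i) (\<rho> i) * self_coupling q t (\<rho> i) *
    ((if i \<notin> J \<and> n \<in> J then cross_out i n else 1) * (if n \<notin> J \<and> i \<in> J then cross_out n i else 1) *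
     (if i \<in> J then hop \<rho> i i else 1) * (if n \<in> J then hop \<rho> i n else 1) *
     (if i \<in> J \<and> n \<in> J then t / q else 1))"
proof -
  note g = q t gen[OF i]
  have a: "\<rho> i = Suc (\<rho> i - 1)" if "i \<in> J" using pos that by simp
  note self = self_coupling_lower[of i J \<rho>, OF pos]
  consider "i \<in> J" "n \<in> J" | "i \<in> J" "n \<notin> J" | "i \<notin> J" "n \<in> J" | "i \<notin> J" "n \<notin> J" by blast
  then show ?thesis
  proof cases
    case 1
    with coupling_lower[OF i, of J \<rho>] pos self show ?thesis by (simp add: raise_ratio mult_ac)
  next
    case 2
    have "coupling q t (q * (\<sigma> n / \<sigma> i)) (lower J \<rho> i) * pieri_factor q t (\<sigma> n / \<sigma> i) =
       coupling q t (\<sigma> n / \<sigma> i) (\<rho> i) * (q / t * cross_out n i)"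
      using last_left_scaled[OF g, of "\<rho> i - 1"] 2 unfolding a[OF 2(1), symmetric]
      unfolding cross_out_eq(2)[of n i] by (simp add: lower_def)
    then have "coupling q t (q * (\<sigma> n / \<sigma> i)) (lower J \<rho> i) * self_coupling q t (lower J \<rho> i) * pieri_factor q t (\<sigma> n / \<sigma> i) =
       coupling q t (\<sigma> n / \<sigma> i) (\<rho> i) * (q / t * cross_out n i) * (self_coupling q t (\<rho> i) * (t / q * hop \<rho> i i))"
      using 2 self by (simp add: mult_ac)
    also have "\<dots> = coupling q t (\<sigma> n / \<sigma> i) (\<rho> i) * self_coupling q t (\<rho> i) * (cross_out n i * hop \<rho> i i)"
      using q t by simp
    finally show ?thesis using 2 by (simp add: raise_ratio del: times_divide_eq_right)
  next
    case 3
    have "coupling q t (\<sigma> n / \<sigma> i / q) (\<rho> i) = coupling q t (\<sigma> n / \<sigma> i) (\<rho> i) * (cross_out i n * hop \<rho> i n)"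
      using last_right_scaled[OF g, of "\<rho> i"] unfolding hop_eq(1)[of \<rho> i n] cross_out_eq(1)[of i n] .
    with 3 show ?thesis by (simp add: lower_def raise_ratio mult_ac del: divide_divide_eq_left)
  qed (simp add: lower_def raise_ratio)
qed

text \<open>\<open>wR\<close> and \<open>wL\<close> agree at the empty set, so the same
  normalisation serves both. The index N + 1 occurs in S but not in Y, whence the separate product
  over the pairs (i, N + 1).\<close>

lemma wR_ratio:
  assumes J: "J \<subseteq> {1..Suc N}"
  shows "wR (t / q) (S_set N) (Y_set N \<rho>) (\<sigma> ` J) = wL (t / q) (S_set N) (Y_set N \<rho>) {} *
     ((\<Prod>(i, j)\<in>pairs N. (if i \<notin> J \<and> j \<in> J then cross_out i j else 1) * (if j \<notin> J \<and> i \<in> J then cross_out j i else 1) *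
     ((if i \<in> J then hop \<rho> j i else 1) * (if j \<in> J then hop \<rho> i j else 1)) *
     (if i \<in> J \<and> j \<in> J then t / q else 1)) *
     (\<Prod>i\<in>{1..N}. (if i \<notin> J \<and> Suc N \<in> J then cross_out i (Suc N) else 1) * (if Suc N \<notin> J \<and> i \<in> J then cross_out (Suc N) i else 1) *
     (if i \<in> J then hop \<rho> i i else 1) * (if Suc N \<in> J then hop \<rho> i (Suc N) else 1) *
     (if i \<in> J \<and> Suc N \<in> J then t / q else 1)))"
proof -
  let ?y = "\<lambda>i. \<sigma> i / q ^ \<rho> i"
  let ?N = "{1..N}" and ?n = "{1..Suc N}"
  have n_insert: "?n = insert (Suc N) ?N" by auto
  have nz: "?y i - t / q * \<sigma> m \<noteq> 0" if "i \<in> ?N" "m \<in> ?n" for i m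
    using wL_empty_nz[of N \<rho>] that by (auto simp: wL_def)
  have d: "\<sigma> ` ?n - \<sigma> ` J = \<sigma> ` (?n - J)" using J inj_\<sigma> by (subst inj_on_image_set_diff[of \<sigma> ?n]) auto
  have re: "(\<Prod>a\<in>?y ` A. f a) = (\<Prod>i\<in>A. f (?y i))" for A and f :: "'a \<Rightarrow> 'a"
    by (subst prod.reindex[OF inj_y]) (simp add: o_def)
  have re': "(\<Prod>a\<in>\<sigma> ` A. f a) = (\<Prod>i\<in>A. f (\<sigma> i))" for A and f :: "'a \<Rightarrow> 'a"
    by (subst prod.reindex[OF inj_\<sigma>]) (simp add: o_def)
  have c: "card (\<sigma> ` J) = card J" by (rule card_image[OF inj_\<sigma>])
  have split_all: "(\<Prod>i\<in>?N. \<Prod>m\<in>?n. ?y i - t / q * \<sigma> m) =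
      (\<Prod>m\<in>?n-J. \<Prod>i\<in>?N. ?y i - t / q * \<sigma> m) * (\<Prod>m\<in>J. \<Prod>i\<in>?N. ?y i - t / q * \<sigma> m)"
    by (subst prod.swap, rule prod_split[symmetric]) (use J in auto)
  have hops: "(\<Prod>m\<in>J. \<Prod>i\<in>?N. ?y i - t / q * \<sigma> m) * (\<Prod>m\<in>J. \<Prod>i\<in>?N. hop \<rho> i m) =
      (\<Prod>m\<in>J. \<Prod>i\<in>?N. ?y i - \<sigma> m)"
    unfolding prod.distrib[symmetric] hop_def
    by (intro prod.cong refl) (use J nz in \<open>auto simp: subset_iff\<close>)
  have A: "wR (t / q) (S_set N) (Y_set N \<rho>) (\<sigma> ` J) = wL (t / q) (S_set N) (Y_set N \<rho>) {} *
      ((t / q) ^ (card J choose 2) * (\<Prod>i\<in>?n-J. \<Prod>j\<in>J. cross_out i j) * (\<Prod>m\<in>J. \<Prod>i\<in>?N. hop \<rho> i m))"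
    unfolding wL_def wR_def d Diff_empty re re' c cross_out_def hops[symmetric] split_all
    by (simp add: binomial_eq_0 mult_ac)
  have h: "(\<Prod>m\<in>J. \<Prod>i\<in>?N. hop \<rho> i m) =
      ((\<Prod>i\<in>?N. if i \<in> J then hop \<rho> i i else 1) * (\<Prod>i\<in>?N. if Suc N \<in> J then hop \<rho> i (Suc N) else 1)) *
      (\<Prod>(i, j)\<in>pairs N. (if i \<in> J then hop \<rho> j i else 1) * (if j \<in> J then hop \<rho> i j else 1))"
  proof -
    have "(\<Prod>m\<in>J. \<Prod>i\<in>?N. hop \<rho> i m) = (\<Prod>m\<in>?n. \<Prod>i\<in>?N. if m \<in> J then hop \<rho> i m else 1)"
      unfolding prod_subset_if[OF J finite_atLeastAtMost]
      by (intro prod.cong refl) simp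
    also have "\<dots> = (\<Prod>m\<in>?N. \<Prod>i\<in>?N. if m \<in> J then hop \<rho> i m else 1) * (\<Prod>i\<in>?N. if Suc N \<in> J then hop \<rho> i (Suc N) else 1)"
      unfolding n_insert by (simp add: mult.commute)
    finally show ?thesis unfolding prod_square by (simp only: mult_ac)
  qed
  let ?c = "\<lambda>(i, j). (if i \<notin> J \<and> j \<in> J then cross_out i j else 1) * (if j \<notin> J \<and> i \<in> J then cross_out j i else 1)"
  have cr: "(\<Prod>i\<in>?n-J. \<Prod>j\<in>J. cross_out i j) = (\<Prod>p\<in>pairs (Suc N). ?c p)"
  proof -
    have "(\<Prod>i\<in>?n-J. \<Prod>j\<in>J. cross_out i j) = (\<Prod>i\<in>?n. \<Prod>j\<in>?n. if i \<notin> J \<and> j \<in> J then cross_out i j else 1)"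
      unfolding prod_subset_if[OF Diff_subset finite_atLeastAtMost] prod_subset_if[OF J finite_atLeastAtMost]
      by (intro prod.cong refl) auto
    also have "\<dots> = (\<Prod>p\<in>pairs (Suc N). ?c p)"
      unfolding prod_square by (simp add: if_distrib cong: if_cong)
    finally show ?thesis .
  qed
  note k = power_choose_2_eq_prod[OF J, of "t / q"]
  show ?thesis unfolding A k cr h prod_pairs_Suc case_prod_beta prod.distrib fst_conv snd_conv by (simp only: mult_ac)
qed

lemma pieri_branch_eq_wR:
  assumes J: "J \<subseteq> {1..Suc N}" and pos: "\<And>i. i \<in> J \<Longrightarrow> i \<le> N \<Longrightarrow> \<rho> i > 0"
  shows "pieri_coeff q t (Suc N) J \<sigma> * branch_coeff q t N (raise J) (lower J \<rho>) =
    branch_coeff q t N \<sigma> \<rho> / wL (t / q) (S_set N) (Y_set N \<rho>) {} *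
      wR (t / q) (S_set N) (Y_set N \<rho>) (\<sigma> ` J)"
proof -
  let ?b = "\<lambda>\<tau> \<mu> (i, j). coupling q t (\<tau> j / \<tau> i) (\<mu> i) * coupling2 q t (\<tau> j / \<tau> i) (\<mu> i) (\<mu> j)"
  let ?p = "\<lambda>(i, j). if i \<in> J \<and> j \<notin> J then pieri_factor q t (\<sigma> j / \<sigma> i) else 1"
  let ?R = "\<lambda>(i, j). (if i \<notin> J \<and> j \<in> J then cross_out i j else 1) * (if j \<notin> J \<and> i \<in> J then cross_out j i else 1) *
     ((if i \<in> J then hop \<rho> j i else 1) * (if j \<in> J then hop \<rho> i j else 1)) *
     (if i \<in> J \<and> j \<in> J then t / q else 1)"
  let ?s = "\<lambda>\<tau> \<mu> i. coupling q t (\<tau> (Suc N) / \<tau> i) (\<mu> i) * self_coupling q t (\<mu> i)"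
  let ?T = "\<lambda>i. (if i \<notin> J \<and> Suc N \<in> J then cross_out i (Suc N) else 1) * (if Suc N \<notin> J \<and> i \<in> J then cross_out (Suc N) i else 1) *
     (if i \<in> J then hop \<rho> i i else 1) * (if Suc N \<in> J then hop \<rho> i (Suc N) else 1) *
     (if i \<in> J \<and> Suc N \<in> J then t / q else 1)"
  have 1: "(\<Prod>p\<in>pairs N. ?b (raise J) (lower J \<rho>) p) * (\<Prod>p\<in>pairs N. ?p p) = (\<Prod>p\<in>pairs N. ?b \<sigma> \<rho> p) * (\<Prod>p\<in>pairs N. ?R p)"
    unfolding prod.distrib[symmetric]
  proof (intro prod.cong refl)
    fix p assume p: "p \<in> pairs N"
    obtain i j where ij: "p = (i, j)" by force
    with p have "i \<noteq> j" "i \<le> N" "j \<le> N" by (auto simp: pairs_def)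
    then show "?b (raise J) (lower J \<rho>) p * ?p p = ?b \<sigma> \<rho> p * ?R p"
      using pieri_branch_pair[of i j J \<rho>] pos unfolding ij case_prod_conv by blast
  qed
  have 2: "(\<Prod>i\<in>{1..N}. ?s (raise J) (lower J \<rho>) i) * (\<Prod>i\<in>{1..N}. ?p (i, Suc N)) = (\<Prod>i\<in>{1..N}. ?s \<sigma> \<rho> i) * (\<Prod>i\<in>{1..N}. ?T i)"
    unfolding prod.distrib[symmetric] case_prod_conv
    by (intro prod.cong refl pieri_branch_last) (use pos in auto)
  have "pieri_coeff q t (Suc N) J \<sigma> * branch_coeff q t N (raise J) (lower J \<rho>) =
     ((\<Prod>p\<in>pairs N. ?b (raise J) (lower J \<rho>) p) * (\<Prod>p\<in>pairs N. ?p p)) *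
     ((\<Prod>i\<in>{1..N}. ?s (raise J) (lower J \<rho>) i) * (\<Prod>i\<in>{1..N}. ?p (i, Suc N)))"
    unfolding branch_coeff_def pieri_coeff_def prod_pairs_Suc by (simp only: mult_ac)
  also have "\<dots> = branch_coeff q t N \<sigma> \<rho> * ((\<Prod>p\<in>pairs N. ?R p) * (\<Prod>i\<in>{1..N}. ?T i))"
    unfolding 1 2 unfolding branch_coeff_def by (simp only: mult_ac)
  finally show ?thesis unfolding wR_ratio[OF J] using wL_empty_nz by simp
qed

text \<open>If \<rho> i = 0, then y_i = \<sigma>_i lies in S. The inadmissible J, whose lowered
  exponent would be negative, thus drop out by themselves, and the identities may run over all
  subsets.\<close>

lemma wL_image_zero:
  assumes "J \<subseteq> {1..N}" "i \<in> J" "\<rho> i = 0"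
  shows "wL (t / q) (S_set N) (Y_set N \<rho>) ((\<lambda>i. \<sigma> i / q ^ \<rho> i) ` J) = 0"
proof -
  have "finite J" "i \<in> {1..Suc N}" using assms finite_subset by auto
  moreover have "\<sigma> i = \<sigma> i / q ^ \<rho> i" using assms by simp
  ultimately have "(\<Prod>a\<in>(\<lambda>i. \<sigma> i / q ^ \<rho> i) ` J. \<Prod>m\<in>S_set N. a - m) = 0"
    using assms(2) by (intro prod_zero) (auto intro!: bexI[of _ i])
  then show ?thesis by (simp add: wL_def)
qed

lemma wR_image_zero:
  assumes "J \<subseteq> {1..Suc N}" "i \<in> J" "i \<le> N" "\<rho> i = 0"
  shows "wR (t / q) (S_set N) (Y_set N \<rho>) (\<sigma> ` J) = 0"
proof -
  have "finite J" "i \<in> {1..N}" using assms finite_subset by auto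
  moreover have "\<sigma> i = \<sigma> i / q ^ \<rho> i" using assms by simp
  ultimately have "(\<Prod>m\<in>\<sigma> ` J. \<Prod>y\<in>Y_set N \<rho>. y - m) = 0"
    using assms(2) by (intro prod_zero) (auto intro!: bexI[of _ i])
  then show ?thesis by (simp add: wR_def)
qed

section \<open>Comparison at a fixed final spectrum\<close>

lemma sum_Pow_image:
  assumes "inj_on f A"
  shows "(\<Sum>J\<in>Pow (f ` A). g J) = (\<Sum>J\<in>Pow A. g (f ` J))"
  using sum.reindex[OF inj_on_image_Pow[OF assms], of g] by (simp add: image_Pow_surj[OF refl] o_def)

text \<open>The summand \<open>h (card J) + h (Suc (card J))\<close> reflects that the monomial of
  an elementary symmetric polynomial in N + 1 variables may or may not contain x_(N+1). With the
  common factor \<open>B\<close> taken out, the claim is \<open>wL_wR_duality\<close> at \<kappa> =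
  t/q.\<close>

theorem branch_pieri_commute:
  "(\<Sum>J\<in>Pow {1..N}. (h (card J) + h (Suc (card J))) *
     (if \<forall>i\<in>J. \<rho> i > 0 then branch_coeff q t N \<sigma> (lower J \<rho>) * pieri_coeff q t N J (\<lambda>i. \<sigma> i / q ^ lower J \<rho> i) else 0)) =
   (\<Sum>J\<in>Pow {1..Suc N}. h (card J) *
     (if \<forall>i\<in>J. i \<le> N \<longrightarrow> \<rho> i > 0 then pieri_coeff q t (Suc N) J \<sigma> * branch_coeff q t N (raise J) (lower J \<rho>) else 0))"
proof -
  let ?y = "\<lambda>i. \<sigma> i / q ^ \<rho> i"
  define B where "B = branch_coeff q t N \<sigma> \<rho> / wL (t / q) (S_set N) (Y_set N \<rho>) {}"
  have L: "(if \<forall>i\<in>J. \<rho> i > 0 then branch_coeff q t N \<sigma> (lower J \<rho>) * pieri_coeff q t N J (\<lambda>i. \<sigma> i / q ^ lower J \<rho> i) else 0) =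
      B * wL (t / q) (S_set N) (Y_set N \<rho>) (?y ` J)" if "J \<in> Pow {1..N}" for J
    using that branch_pieri_eq_wL[of J N \<rho>] wL_image_zero[of J N _ \<rho>] by (auto simp: B_def)
  have R: "(if \<forall>i\<in>J. i \<le> N \<longrightarrow> \<rho> i > 0 then pieri_coeff q t (Suc N) J \<sigma> * branch_coeff q t N (raise J) (lower J \<rho>) else 0) =
      B * wR (t / q) (S_set N) (Y_set N \<rho>) (\<sigma> ` J)" if "J \<in> Pow {1..Suc N}" for J
    using that pieri_branch_eq_wR[of J N \<rho>] wR_image_zero[of J N _ \<rho>] by (auto simp: B_def)
  have "(\<Sum>J\<in>Pow {1..N}. (h (card J) + h (Suc (card J))) * (B * wL (t / q) (S_set N) (Y_set N \<rho>) (?y ` J))) =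
      B * (\<Sum>J\<in>Pow (Y_set N \<rho>). (h (card J) + h (Suc (card J))) * wL (t / q) (S_set N) (Y_set N \<rho>) J)"
    unfolding sum_Pow_image[OF inj_y] sum_distrib_left card_image[OF inj_y]
    by (intro sum.cong refl) (simp only: mult_ac)
  also have "\<dots> = B * (\<Sum>J\<in>Pow (S_set N). h (card J) * wR (t / q) (S_set N) (Y_set N \<rho>) J)"
    using q t Y_set_gen by (subst wL_wR_duality) (auto simp: card_image inj_\<sigma> inj_y)
  also have "\<dots> = (\<Sum>J\<in>Pow {1..Suc N}. h (card J) * (B * wR (t / q) (S_set N) (Y_set N \<rho>) (\<sigma> ` J)))"
    unfolding sum_Pow_image[OF inj_\<sigma>] sum_distrib_left card_image[OF inj_\<sigma>]
    by (intro sum.cong refl) (simp only: mult_ac)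
  finally show ?thesis by (simp only: L R cong: sum.cong)
qed

text \<open>The signs come from the expansion of \<Prod>(x_j - x_(N+1)). The bracket, times q - 1,
  is what the eigenvalue equation of D_1 contributes for each J at a fixed final spectrum.\<close>

theorem branch_pieri_alternating:
  "(\<Sum>J\<in>Pow {1..N}. (-1) ^ card J *
     (if \<forall>i\<in>J. \<rho> i > 0 then branch_coeff q t N \<sigma> (lower J \<rho>) * pieri_coeff q t N J (\<lambda>i. \<sigma> i / q ^ lower J \<rho> i) else 0) *
     ((\<Sum>i\<in>{1..N}-J. \<sigma> i / q ^ \<rho> i) + (\<Sum>i\<in>J. \<sigma> i / q ^ \<rho> i) / (t / q) +
       (t / q) ^ card J * (\<Prod>i\<in>{1..Suc N}. \<sigma> i) / (\<Prod>i\<in>{1..N}. \<sigma> i / q ^ \<rho> i) - (\<Sum>i\<in>{1..Suc N}. \<sigma> i))) = 0"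
proof -
  let ?y = "\<lambda>i. \<sigma> i / q ^ \<rho> i"
  define B where "B = branch_coeff q t N \<sigma> \<rho> / wL (t / q) (S_set N) (Y_set N \<rho>) {}"
  have L: "(if \<forall>i\<in>J. \<rho> i > 0 then branch_coeff q t N \<sigma> (lower J \<rho>) * pieri_coeff q t N J (\<lambda>i. \<sigma> i / q ^ lower J \<rho> i) else 0) =
      B * wL (t / q) (S_set N) (Y_set N \<rho>) (?y ` J)" if "J \<in> Pow {1..N}" for J
    using that branch_pieri_eq_wL[of J N \<rho>] wL_image_zero[of J N _ \<rho>] by (auto simp: B_def)
  have sums: "\<Sum>(Y_set N \<rho> - ?y ` J) = (\<Sum>i\<in>{1..N}-J. ?y i)" "\<Sum>(?y ` J) = (\<Sum>i\<in>J. ?y i)" if "J \<in> Pow {1..N}" for J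
  proof -
    have "Y_set N \<rho> - ?y ` J = ?y ` ({1..N} - J)"
      using that by (intro inj_on_image_set_diff[OF inj_y, symmetric]) auto
    then show "\<Sum>(Y_set N \<rho> - ?y ` J) = (\<Sum>i\<in>{1..N}-J. ?y i)" "\<Sum>(?y ` J) = (\<Sum>i\<in>J. ?y i)"
      by (simp_all only: sum.reindex[OF inj_y] o_def)
  qed
  have all: "\<Prod>(S_set N) = (\<Prod>i\<in>{1..Suc N}. \<sigma> i)" "\<Sum>(S_set N) = (\<Sum>i\<in>{1..Suc N}. \<sigma> i)"
    "\<Prod>(Y_set N \<rho>) = (\<Prod>i\<in>{1..N}. ?y i)"
    by (simp_all only: prod.reindex[OF inj_y] prod.reindex[OF inj_\<sigma>] sum.reindex[OF inj_\<sigma>] o_def)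
  have "0 = B * (\<Sum>J\<in>Pow (Y_set N \<rho>). (-1) ^ card J * wL (t / q) (S_set N) (Y_set N \<rho>) J *
      (\<Sum>(Y_set N \<rho> - J) + \<Sum>J / (t / q) + (t / q) ^ card J * \<Prod>(S_set N) / \<Prod>(Y_set N \<rho>) - \<Sum>(S_set N)))"
    using q t Y_set_gen by (subst wL_alternating_sum) (auto simp: card_image inj_\<sigma> inj_y)
  also have "\<dots> = (\<Sum>J\<in>Pow {1..N}. (-1) ^ card J * (B * wL (t / q) (S_set N) (Y_set N \<rho>) (?y ` J)) *
      ((\<Sum>i\<in>{1..N}-J. ?y i) + (\<Sum>i\<in>J. ?y i) / (t / q) +
       (t / q) ^ card J * (\<Prod>i\<in>{1..Suc N}. \<sigma> i) / (\<Prod>i\<in>{1..N}. ?y i) - (\<Sum>i\<in>{1..Suc N}. \<sigma> i)))"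
    unfolding sum_Pow_image[OF inj_y] sum_distrib_left card_image[OF inj_y] all
    by (intro sum.cong refl, subst sums, assumption, subst sums, assumption) (simp only: mult_ac)
  finally show ?thesis by (simp only: L cong: sum.cong)
qed

end

section \<open>The ring of power series\<close>

lemma mfps_const_mult_nth [simp]: "mfps_nth (mfps_const c * f) m = c * mfps_nth f m"
proof -
  have "mfps_nth (mfps_const c * f) m = (\<Sum>x\<in>splits m. if x = (0, m) then c * mfps_nth f m else 0)"
    unfolding mfps_nth_times
    by (intro sum.cong refl, clarify, case_tac "a = 0")
      (auto simp: mfps_const_def mfps_monom_def splits_def)
  also have "\<dots> = c * mfps_nth f m"
    by (subst sum.delta[OF finite_splits]) (simp add: splits_def)
  finally show ?thesis .
qed

lemma mfps_const_nth: "mfps_nth (mfps_const c) m = (if m = 0 then c else 0)"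
  by (simp add: mfps_const_def mfps_nth_monom)

lemma mfps_const_0 [simp]: "mfps_const 0 = 0"
  and mfps_const_1 [simp]: "mfps_const 1 = 1"
  and mfps_const_add: "mfps_const (a + b) = mfps_const a + mfps_const b"
  and mfps_const_diff: "mfps_const (a - b) = mfps_const a - mfps_const b"
  and mfps_const_uminus: "mfps_const (- a) = - mfps_const a"
  and mfps_const_mult: "mfps_const (a * b) = mfps_const a * mfps_const b"
  by (auto intro!: mfps_eqI simp: mfps_const_nth)

lemma mfps_const_sum: "mfps_const (\<Sum>x\<in>A. f x) = (\<Sum>x\<in>A. mfps_const (f x))"
  by (induction A rule: infinite_finite_induct) (auto simp: mfps_const_add)

lemma mfps_const_prod: "mfps_const (\<Prod>x\<in>A. f x) = (\<Prod>x\<in>A. mfps_const (f x))"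
  by (induction A rule: infinite_finite_induct) (auto simp: mfps_const_mult)

lemma mfps_const_power: "mfps_const (a ^ k) = mfps_const a ^ k"
  by (induction k) (auto simp: mfps_const_mult)

lemma mfps_const_eq_0_iff [simp]: "(mfps_const c :: ('v, 'a :: comm_ring_1) mfps) = 0 \<longleftrightarrow> c = 0"
proof
  assume "(mfps_const c :: ('v, 'a) mfps) = 0"
  then have "mfps_nth (mfps_const c :: ('v, 'a) mfps) 0 = mfps_nth (0 :: ('v, 'a) mfps) 0"
    by (rule arg_cong[of _ _ "\<lambda>f. mfps_nth f 0"])
  then show "c = 0" by (simp add: mfps_const_nth)
qed simp

lemma mfps_nth_sum: "mfps_nth (\<Sum>x\<in>A. F x) m = (\<Sum>x\<in>A. mfps_nth (F x) m)"
  by (induction A rule: infinite_finite_induct) auto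

lemma mfps_mult_nonzero:
  assumes "mfps_nth (g * f) m \<noteq> 0"
  obtains a b where "(a, b) \<in> splits m" "mfps_nth g a \<noteq> 0" "mfps_nth f b \<noteq> 0"
proof -
  obtain p where p: "p \<in> splits m" "(case p of (a, b) \<Rightarrow> mfps_nth g a * mfps_nth f b) \<noteq> 0"
    using assms unfolding mfps_nth_times by (meson sum.not_neutral_contains_not_neutral)
  then have "mfps_nth g (fst p) * mfps_nth f (snd p) \<noteq> 0" by (simp add: case_prod_beta)
  then have "mfps_nth g (fst p) \<noteq> 0" "mfps_nth f (snd p) \<noteq> 0" by auto
  then show ?thesis using that[of "fst p" "snd p"] p(1) by simp
qed

lemma mfps_monom_mult_nonzero:
  assumes "mfps_nth (mfps_monom e c * f) m \<noteq> 0"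
  obtains r where "m = e + r" "mfps_nth f r \<noteq> 0"
proof (rule mfps_mult_nonzero[OF assms])
  fix a b assume "(a, b) \<in> splits m" "mfps_nth (mfps_monom e c) a \<noteq> 0" "mfps_nth f b \<noteq> 0"
  then show thesis using that[of b] by (auto simp: splits_def mfps_nth_monom split: if_splits)
qed

lemma mfps_monom_eq_0_iff: "mfps_monom e c = 0 \<longleftrightarrow> c = 0"
proof
  assume "mfps_monom e c = 0"
  then have "mfps_nth (mfps_monom e c) e = mfps_nth 0 e" by (rule arg_cong[of _ _ "\<lambda>f. mfps_nth f e"])
  then show "c = 0" by (simp add: mfps_nth_monom)
qed (rule mfps_eqI, simp add: mfps_nth_monom)

text \<open>
  The product of two nonzero series has a nonzero coefficient at the sum of the two exponents that
  are least in this order; restricting to finitely many variables makes least exponents exist.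
\<close>

lemma exists_least_exponent:
  fixes A :: "('v::linorder \<Rightarrow>\<^sub>0 nat) set"
  assumes "finite V" "A \<noteq> {}" "\<And>m. m \<in> A \<Longrightarrow> Poly_Mapping.keys m \<subseteq> V"
  obtains m where "m \<in> A" "\<And>m'. m' \<in> A \<Longrightarrow> (\<Sum>v\<in>V. Poly_Mapping.lookup m v) < (\<Sum>v\<in>V. Poly_Mapping.lookup m' v) \<or>
     (\<Sum>v\<in>V. Poly_Mapping.lookup m v) = (\<Sum>v\<in>V. Poly_Mapping.lookup m' v) \<and> m \<le> m'"
proof -
  define deg where "deg m = (\<Sum>v\<in>V. Poly_Mapping.lookup m v)" for m :: "'v \<Rightarrow>\<^sub>0 nat"
  define d where "d = (LEAST k. \<exists>m\<in>A. deg m = k)"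
  have d: "\<exists>m\<in>A. deg m = d" unfolding d_def by (rule LeastI_ex) (use assms(2) in blast)
  have d_le: "d \<le> deg m" if "m \<in> A" for m unfolding d_def by (rule Least_le, rule bexI[OF refl that])
  define B where "B = {m \<in> A. deg m = d}"
  have "Poly_Mapping.lookup ` B \<subseteq> {f. (\<forall>x\<in>V. f x \<in> {..d}) \<and> (\<forall>x. x \<notin> V \<longrightarrow> f x = 0)}"
  proof clarify
    fix m assume m: "m \<in> B"
    have "Poly_Mapping.lookup m v \<le> d" if "v \<in> V" for v
      using m member_le_sum[OF that, of "Poly_Mapping.lookup m"] assms(1) by (simp add: B_def deg_def)
    moreover have "Poly_Mapping.lookup m v = 0" if "v \<notin> V" for v
      using m assms(3)[of m] that by (auto simp: B_def in_keys_iff)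
    ultimately show "(\<forall>x\<in>V. Poly_Mapping.lookup m x \<in> {..d}) \<and> (\<forall>x. x \<notin> V \<longrightarrow> Poly_Mapping.lookup m x = 0)"
      by auto
  qed
  moreover have "finite {f. (\<forall>x\<in>V. f x \<in> {..d}) \<and> (\<forall>x. x \<notin> V \<longrightarrow> f x = (0::nat))}"
    by (rule rev_finite_subset[OF finite_set_of_finite_funs[OF assms(1), of "{..d}" 0]]) auto
  ultimately have "finite (Poly_Mapping.lookup ` B)" using finite_subset by blast
  moreover have "inj_on Poly_Mapping.lookup B" by (rule inj_onI) (simp only: lookup_inject)
  ultimately have fin: "finite B" by (rule finite_imageD)
  have ne: "B \<noteq> {}" using d by (auto simp: B_def)
  show thesis
  proof (rule that[of "Min B"])
    have "Min B \<in> B" using fin ne by simp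
    then show "Min B \<in> A" by (simp add: B_def)
    fix m' assume m': "m' \<in> A"
    have deg_Min: "deg (Min B) = d" using \<open>Min B \<in> B\<close> by (simp add: B_def)
    show "(\<Sum>v\<in>V. Poly_Mapping.lookup (Min B) v) < (\<Sum>v\<in>V. Poly_Mapping.lookup m' v) \<or>
     (\<Sum>v\<in>V. Poly_Mapping.lookup (Min B) v) = (\<Sum>v\<in>V. Poly_Mapping.lookup m' v) \<and> Min B \<le> m'"
    proof (cases "deg m' = d")
      case True
      then have "m' \<in> B" using m' by (simp add: B_def)
      with fin have "Min B \<le> m'" by (rule Min_le)
      with True deg_Min show ?thesis unfolding deg_def by simp
    next
      case False
      then have "deg (Min B) < deg m'" using d_le[OF m'] deg_Min by simp
      then show ?thesis unfolding deg_def ..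
    qed
  qed
qed

text \<open>Integrality permits cancelling powers of x_(N+1) and the product \<Prod>(x_j - x_(N+1)),
  and it provides the fraction field in which the coefficients of the operators are
  compared.\<close>

instance mfps :: (linorder, idom) idom
proof
  fix f g :: "('a, 'b) mfps"
  assume "f \<noteq> 0" "g \<noteq> 0"
  then obtain mf mg where nz: "mfps_nth f mf \<noteq> 0" "mfps_nth g mg \<noteq> 0"
    using mfps_eqI[of f 0] mfps_eqI[of g 0] by auto
  define V where "V = Poly_Mapping.keys mf \<union> Poly_Mapping.keys mg"
  define deg where "deg m = (\<Sum>v\<in>V. Poly_Mapping.lookup m v)" for m :: "'a \<Rightarrow>\<^sub>0 nat"
  have V: "finite V" by (simp add: V_def)
  have deg_add: "deg (a + b) = deg a + deg b" for a b by (simp add: deg_def lookup_add sum.distrib)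
  have least: "\<exists>a. mfps_nth h a \<noteq> 0 \<and> Poly_Mapping.keys a \<subseteq> V \<and>
      (\<forall>m. mfps_nth h m \<noteq> 0 \<longrightarrow> Poly_Mapping.keys m \<subseteq> V \<longrightarrow> deg a < deg m \<or> deg a = deg m \<and> a \<le> m)"
    if "mfps_nth h m0 \<noteq> 0" "Poly_Mapping.keys m0 \<subseteq> V" for h :: "('a, 'b) mfps" and m0
  proof -
    let ?A = "{m. mfps_nth h m \<noteq> 0 \<and> Poly_Mapping.keys m \<subseteq> V}"
    have ne: "?A \<noteq> {}" and sub: "\<And>m. m \<in> ?A \<Longrightarrow> Poly_Mapping.keys m \<subseteq> V" using that by blast+
    show ?thesis unfolding deg_def by (rule exists_least_exponent[OF V ne sub]) blast+
  qed
  obtain a where a: "mfps_nth f a \<noteq> 0" "Poly_Mapping.keys a \<subseteq> V"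
    and a_min: "\<And>m. mfps_nth f m \<noteq> 0 \<Longrightarrow> Poly_Mapping.keys m \<subseteq> V \<Longrightarrow> deg a < deg m \<or> deg a = deg m \<and> a \<le> m"
    using least[OF nz(1) Un_upper1[of "Poly_Mapping.keys mf" "Poly_Mapping.keys mg", folded V_def]] by metis
  obtain b where b: "mfps_nth g b \<noteq> 0" "Poly_Mapping.keys b \<subseteq> V"
    and b_min: "\<And>m. mfps_nth g m \<noteq> 0 \<Longrightarrow> Poly_Mapping.keys m \<subseteq> V \<Longrightarrow> deg b < deg m \<or> deg b = deg m \<and> b \<le> m"
    using least[OF nz(2) Un_upper2[of "Poly_Mapping.keys mg" "Poly_Mapping.keys mf", folded V_def]] by metis
  have only: "x = a \<and> y = b" if xy: "x + y = a + b" "mfps_nth f x \<noteq> 0" "mfps_nth g y \<noteq> 0" for x y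
  proof -
    have "Poly_Mapping.keys x \<subseteq> Poly_Mapping.keys (x + y)" "Poly_Mapping.keys y \<subseteq> Poly_Mapping.keys (x + y)"
      by (simp_all add: subset_iff in_keys_iff lookup_add)
    moreover have "Poly_Mapping.keys (x + y) \<subseteq> V"
      unfolding xy(1) using Poly_Mapping.keys_add[of a b] a(2) b(2) by blast
    ultimately have xV: "Poly_Mapping.keys x \<subseteq> V" and yV: "Poly_Mapping.keys y \<subseteq> V" by blast+
    have ab: "deg a < deg x \<or> deg a = deg x \<and> a \<le> x" "deg b < deg y \<or> deg b = deg y \<and> b \<le> y"
      by (rule a_min[OF xy(2) xV], rule b_min[OF xy(3) yV])
    have "deg a + deg b = deg (a + b)" by (simp only: deg_add)
    also have "a + b = x + y" by (simp only: xy(1))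
    also have "deg (x + y) = deg x + deg y" by (rule deg_add)
    finally have "\<not> deg a < deg x" "\<not> deg b < deg y" using ab by linarith+
    then have le: "a \<le> x" "b \<le> y" using ab by blast+
    have "\<not> a < x"
    proof
      assume "a < x"
      from add_less_le_mono[OF this le(2)] show False by (simp only: xy(1) less_irrefl)
    qed
    then have "a = x" using le(1) by (simp only: order.order_iff_strict) blast
    with xy(1) show ?thesis by (simp only: add_left_cancel)
  qed
  have "mfps_nth (f * g) (a + b) = (\<Sum>p\<in>splits (a + b). if p = (a, b) then mfps_nth f a * mfps_nth g b else 0)"
    unfolding mfps_nth_times
  proof (intro sum.cong refl, clarify)
    fix x y assume "(x, y) \<in> splits (a + b)"
    then have xy: "x + y = a + b" by (simp only: splits_def mem_Collect_eq case_prod_conv)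
    show "mfps_nth f x * mfps_nth g y = (if (x, y) = (a, b) then mfps_nth f a * mfps_nth g b else 0)"
    proof (cases "x = a \<and> y = b")
      case False
      then have "mfps_nth f x = 0 \<or> mfps_nth g y = 0" using only[OF xy] by blast
      with False show ?thesis by force
    qed simp
  qed
  also have "\<dots> = mfps_nth f a * mfps_nth g b"
    by (subst sum.delta[OF finite_splits]) (simp add: splits_def)
  finally have "mfps_nth (f * g) (a + b) \<noteq> 0" using a b by simp
  then show "f * g \<noteq> 0" by auto
qed

section \<open>Locally finite sums of power series\<close>

definition mfps_summable :: "('b \<Rightarrow> ('v, 'a :: comm_ring_1) mfps) \<Rightarrow> 'b set \<Rightarrow> bool" where
  "mfps_summable F A \<longleftrightarrow> (\<forall>m. finite {x \<in> A. mfps_nth (F x) m \<noteq> 0})"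

text \<open>Any finite set containing the contributing indices computes the coefficient. With one
  such set for several families, identities of infinite sums reduce to finite ones.\<close>

lemma mfps_nth_mfps_sum:
  assumes "finite B" "{x \<in> A. mfps_nth (F x) m \<noteq> 0} \<subseteq> B" "B \<subseteq> A"
  shows "mfps_nth (mfps_sum F A) m = (\<Sum>x\<in>B. mfps_nth (F x) m)"
  unfolding mfps_sum_def mfps_nth_Abs
  by (rule sum.mono_neutral_left) (use assms in auto)

lemma mfps_sum_cong: "(\<And>x. x \<in> A \<Longrightarrow> F x = G x) \<Longrightarrow> mfps_sum F A = mfps_sum G A"
  unfolding mfps_sum_def by (auto intro!: arg_cong[where f = Abs_mfps] sum.cong)

lemma mfps_sum_eq_0: "(\<And>x. x \<in> A \<Longrightarrow> F x = 0) \<Longrightarrow> mfps_sum F A = 0"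
  by (intro mfps_eqI) (simp add: mfps_sum_def)

text \<open>A coefficient of a product involves only the finitely many splittings of its exponent,
  so one finite index set \<open>B m\<close> serves all of them.\<close>

lemma
  assumes F: "mfps_summable F A"
  shows mfps_summable_mult: "mfps_summable (\<lambda>x. g * F x) A"
    and mfps_sum_mult: "g * mfps_sum F A = mfps_sum (\<lambda>x. g * F x) A"
proof -
  define B where "B m = (\<Union>p\<in>splits m. {x \<in> A. mfps_nth (F x) (snd p) \<noteq> 0})" for m
  have B: "finite (B m)" "B m \<subseteq> A" for m using F by (auto simp: B_def mfps_summable_def)
  have sub: "{x \<in> A. mfps_nth (g * F x) m \<noteq> 0} \<subseteq> B m" for m
    by (auto simp: B_def elim!: mfps_mult_nonzero intro!: bexI)
  show "mfps_summable (\<lambda>x. g * F x) A"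
    unfolding mfps_summable_def using sub B(1) finite_subset by blast
  show "g * mfps_sum F A = mfps_sum (\<lambda>x. g * F x) A"
  proof (rule mfps_eqI)
    fix m
    have "mfps_nth (mfps_sum F A) b = (\<Sum>x\<in>B m. mfps_nth (F x) b)" if "(a, b) \<in> splits m" for a b
      by (rule mfps_nth_mfps_sum[OF B(1) _ B(2)]) (use that in \<open>auto simp: B_def intro!: bexI[of _ "(a, b)"]\<close>)
    then have "mfps_nth (g * mfps_sum F A) m = (\<Sum>(a, b)\<in>splits m. \<Sum>x\<in>B m. mfps_nth g a * mfps_nth (F x) b)"
      unfolding mfps_nth_times by (intro sum.cong refl) (auto simp: sum_distrib_left)
    also have "\<dots> = (\<Sum>x\<in>B m. mfps_nth (g * F x) m)"
      unfolding mfps_nth_times case_prod_beta by (rule sum.swap)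
    also have "\<dots> = mfps_nth (mfps_sum (\<lambda>x. g * F x) A) m"
      by (rule mfps_nth_mfps_sum[OF B(1) sub B(2), symmetric])
    finally show "mfps_nth (g * mfps_sum F A) m = mfps_nth (mfps_sum (\<lambda>x. g * F x) A) m" .
  qed
qed

lemma
  assumes "mfps_summable F A" "mfps_summable G A"
  shows mfps_summable_add: "mfps_summable (\<lambda>x. F x + G x) A"
    and mfps_sum_add: "mfps_sum (\<lambda>x. F x + G x) A = mfps_sum F A + mfps_sum G A"
proof -
  define B where "B m = {x \<in> A. mfps_nth (F x) m \<noteq> 0} \<union> {x \<in> A. mfps_nth (G x) m \<noteq> 0}" for m
  have B: "finite (B m)" "B m \<subseteq> A" for m using assms by (auto simp: B_def mfps_summable_def)
  have sub: "{x \<in> A. mfps_nth (F x + G x) m \<noteq> 0} \<subseteq> B m" for m by (auto simp: B_def)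
  show "mfps_summable (\<lambda>x. F x + G x) A"
    unfolding mfps_summable_def using sub B(1) finite_subset by blast
  show "mfps_sum (\<lambda>x. F x + G x) A = mfps_sum F A + mfps_sum G A"
  proof (rule mfps_eqI)
    fix m
    have "mfps_nth (mfps_sum F A) m = (\<Sum>x\<in>B m. mfps_nth (F x) m)"
      "mfps_nth (mfps_sum G A) m = (\<Sum>x\<in>B m. mfps_nth (G x) m)"
      by (rule mfps_nth_mfps_sum[OF B(1) _ B(2)]; unfold B_def; blast)+
    then show "mfps_nth (mfps_sum (\<lambda>x. F x + G x) A) m = mfps_nth (mfps_sum F A + mfps_sum G A) m"
      using mfps_nth_mfps_sum[OF B(1) sub B(2), of m] by (simp add: sum.distrib)
  qed
qed

lemma
  assumes "\<And>k. k \<in> K \<Longrightarrow> mfps_summable (F k) A"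
  shows mfps_summable_sum: "mfps_summable (\<lambda>x. \<Sum>k\<in>K. F k x) A"
    and mfps_sum_sum: "mfps_sum (\<lambda>x. \<Sum>k\<in>K. F k x) A = (\<Sum>k\<in>K. mfps_sum (F k) A)"
proof -
  have 0: "mfps_summable (\<lambda>x. 0) A" by (simp add: mfps_summable_def)
  have "mfps_summable (\<lambda>x. \<Sum>k\<in>K. F k x) A \<and> mfps_sum (\<lambda>x. \<Sum>k\<in>K. F k x) A = (\<Sum>k\<in>K. mfps_sum (F k) A)"
    using assms
  proof (induction K rule: infinite_finite_induct)
    case (insert k K)
    then show ?case by (simp add: mfps_summable_add mfps_sum_add)
  qed (simp_all add: 0 mfps_sum_eq_0)
  then show "mfps_summable (\<lambda>x. \<Sum>k\<in>K. F k x) A" "mfps_sum (\<lambda>x. \<Sum>k\<in>K. F k x) A = (\<Sum>k\<in>K. mfps_sum (F k) A)"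
    by blast+
qed

lemma mfps_sum_reindex:
  assumes "inj_on h A"
  shows "mfps_sum F (h ` A) = mfps_sum (\<lambda>x. F (h x)) A"
proof (rule mfps_eqI)
  fix m
  have "{x. x \<in> h ` A \<and> mfps_nth (F x) m \<noteq> 0} = h ` {x. x \<in> A \<and> mfps_nth (F (h x)) m \<noteq> 0}" by auto
  moreover have "inj_on h {x. x \<in> A \<and> mfps_nth (F (h x)) m \<noteq> 0}" using assms by (auto simp: inj_on_def)
  ultimately show "mfps_nth (mfps_sum F (h ` A)) m = mfps_nth (mfps_sum (\<lambda>x. F (h x)) A) m"
    by (simp add: mfps_sum_def sum.reindex)
qed

lemma mfps_sum_mono_neutral:
  assumes "A \<subseteq> B" "\<And>x. x \<in> B \<Longrightarrow> x \<notin> A \<Longrightarrow> F x = 0"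
  shows "mfps_sum F A = mfps_sum F B"
proof (rule mfps_eqI)
  fix m
  have "{x. x \<in> A \<and> mfps_nth (F x) m \<noteq> 0} = {x. x \<in> B \<and> mfps_nth (F x) m \<noteq> 0}"
    using assms(1) assms(2)[THEN arg_cong[of _ _ "\<lambda>f. mfps_nth f m"]] by auto
  then show "mfps_nth (mfps_sum F A) m = mfps_nth (mfps_sum F B) m" by (simp add: mfps_sum_def)
qed

text \<open>The projections of the finite support span a finite rectangle, on which the order of
  summation can be exchanged.\<close>

lemma mfps_sum_Times:
  assumes "\<And>m. finite {p \<in> A \<times> B. mfps_nth (F (fst p) (snd p)) m \<noteq> 0}"
  shows "mfps_sum (\<lambda>p. F (fst p) (snd p)) (A \<times> B) = mfps_sum (\<lambda>x. mfps_sum (F x) B) A"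
proof (rule mfps_eqI)
  fix m
  let ?P = "{p \<in> A \<times> B. mfps_nth (F (fst p) (snd p)) m \<noteq> 0}"
  have fin: "finite (fst ` ?P)" "finite (snd ` ?P)" using assms by auto
  have in1: "mfps_nth (mfps_sum (F x) B) m = (\<Sum>y\<in>snd ` ?P. mfps_nth (F x y) m)" if "x \<in> A" for x
    by (rule mfps_nth_mfps_sum[OF fin(2)]) (use that in \<open>force\<close>)+
  have sub: "{x \<in> A. mfps_nth (mfps_sum (F x) B) m \<noteq> 0} \<subseteq> fst ` ?P"
  proof clarify
    fix x assume x: "x \<in> A" and "mfps_nth (mfps_sum (F x) B) m \<noteq> 0"
    then obtain y where "y \<in> snd ` ?P" "mfps_nth (F x y) m \<noteq> 0"
      unfolding in1[OF x] by (meson sum.not_neutral_contains_not_neutral)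
    then show "x \<in> fst ` ?P" using x by force
  qed
  have "mfps_nth (mfps_sum (\<lambda>x. mfps_sum (F x) B) A) m = (\<Sum>x\<in>fst ` ?P. mfps_nth (mfps_sum (F x) B) m)"
    by (rule mfps_nth_mfps_sum[OF fin(1) sub]) auto
  also have "\<dots> = (\<Sum>x\<in>fst ` ?P. \<Sum>y\<in>snd ` ?P. mfps_nth (F x y) m)"
    by (intro sum.cong refl in1) auto
  also have "\<dots> = (\<Sum>p\<in>fst ` ?P \<times> snd ` ?P. mfps_nth (F (fst p) (snd p)) m)"
    by (simp add: sum.cartesian_product case_prod_beta)
  also have "\<dots> = mfps_nth (mfps_sum (\<lambda>p. F (fst p) (snd p)) (A \<times> B)) m"
  proof (rule mfps_nth_mfps_sum[symmetric])
    show "?P \<subseteq> fst ` ?P \<times> snd ` ?P" by force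
  qed (use fin in auto)
  finally show "mfps_nth (mfps_sum (\<lambda>p. F (fst p) (snd p)) (A \<times> B)) m = mfps_nth (mfps_sum (\<lambda>x. mfps_sum (F x) B) A) m" ..
qed

section \<open>Shifts and sums over the last column\<close>

lemma rc_0: "rc 0 = 0"
  by (simp add: rc_def Zero_fract_def)

lemma rc_add: "rc (a + b) = rc a + rc b"
  by (simp add: rc_def single_add)

lemma rc_uminus: "rc (- a) = - rc a"
  by (simp add: rc_def single_uminus)

lemma rc_diff: "rc (a - b) = rc a - rc b"
  using rc_add[of a "- b"] by (simp add: rc_uminus)

lemma rc_eq_0_iff [simp]: "rc a = 0 \<longleftrightarrow> a = 0"
  using rc_eq_iff[of a 0] by (simp add: rc_0)

lemma rc_inverse: "rc (inverse a) = inverse (rc a)"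
proof (cases "a = 0")
  case False
  then have "rc a * rc (inverse a) = 1" by (simp add: rc_1 flip: rc_mult)
  then show ?thesis by (metis inverse_unique)
qed (simp add: rc_0)

lemma rc_divide: "rc (a / b) = rc a / rc b"
  by (simp add: divide_inverse rc_mult rc_inverse)

lemma rc_powi: "rc (a powi k) = rc a powi k"
  by (simp add: power_int_def rc_power rc_inverse)

lemma rc_prod: "rc (\<Prod>x\<in>A. f x) = (\<Prod>x\<in>A. rc (f x))"
  by (induction A rule: infinite_finite_induct) (auto simp: rc_1 rc_mult)

text \<open>
  \<open>x\<^sub>i\<close> itself, with the otherwise unused variable of index \<open>0\<close> standing for \<open>x\<^sub>1\<close>; then
  \<^const>\<open>qshift\<close> acts on it as expected for \<open>i \<ge> 1\<close>.
\<close>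

definition xv :: "nat \<Rightarrow> xseries" where
  "xv i = (\<Prod>a<i. mfps_var a)"

lemma xv_monom: "xv i = mfps_monom (\<Sum>a<i. Poly_Mapping.single a 1) 1"
  by (simp add: xv_def mfps_var_def mfps_prod_monom)

lemma xv_nz [simp]: "xv i \<noteq> 0"
  by (simp add: xv_monom mfps_monom_eq_0_iff)

lemma xv_xratio: "i \<le> j \<Longrightarrow> xv i * xratio i j = xv j"
  unfolding xv_def xratio_def lessThan_atLeast0 by (rule prod.atLeastLessThan_concat) auto

lemma lookup_sum_single:
  "finite A \<Longrightarrow> Poly_Mapping.lookup (\<Sum>a\<in>A. Poly_Mapping.single a (1::nat)) v = (if v \<in> A then 1 else 0)"
  by (simp add: lookup_sum lookup_single when_def)

text \<open>The eigenvalue of the shift of x_i on the monomial m. For nonzero q it is multiplicative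
  in m, which makes the shift a ring homomorphism.\<close>

definition shift_weight :: "complex \<Rightarrow> nat \<Rightarrow> (nat \<Rightarrow>\<^sub>0 nat) \<Rightarrow> complex" where
  "shift_weight q i m = q powi (int (Poly_Mapping.lookup m (i - 1)) - int (Poly_Mapping.lookup m i))"

lemma qshift_nth: "mfps_nth (qshift q i f) m = rc (shift_weight q i m) * mfps_nth f m"
  by (simp add: qshift_def shift_weight_def)

lemma shift_weight_0 [simp]: "shift_weight q i 0 = 1"
  by (simp add: shift_weight_def)

lemma shift_weight_nz: "q \<noteq> 0 \<Longrightarrow> shift_weight q i m \<noteq> 0"
  by (simp add: shift_weight_def)

lemma shift_weight_add: "q \<noteq> 0 \<Longrightarrow> shift_weight q i (a + b) = shift_weight q i a * shift_weight q i b"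
  unfolding shift_weight_def lookup_add by (subst power_int_add[symmetric]) (auto simp: algebra_simps)

lemma qshift_mult: "q \<noteq> 0 \<Longrightarrow> qshift q i (f * g) = qshift q i f * qshift q i g"
proof (rule mfps_eqI)
  fix m assume q: "q \<noteq> 0"
  show "mfps_nth (qshift q i (f * g)) m = mfps_nth (qshift q i f * qshift q i g) m"
    unfolding qshift_nth mfps_nth_times sum_distrib_left
    by (intro sum.cong refl) (auto simp: splits_def shift_weight_add[OF q] rc_mult)
qed

lemma qshift_add: "qshift q i (f + g) = qshift q i f + qshift q i g"
  by (rule mfps_eqI) (simp add: qshift_nth distrib_left)

lemma qshift_diff: "qshift q i (f - g) = qshift q i f - qshift q i g"
  by (rule mfps_eqI) (simp add: qshift_nth right_diff_distrib)

lemma qshift_0 [simp]: "qshift q i 0 = 0"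
  by (rule mfps_eqI) (simp add: qshift_nth)

lemma qshift_monom: "qshift q i (mfps_monom e c) = mfps_monom e (rc (shift_weight q i e) * c)"
  by (rule mfps_eqI) (simp add: qshift_nth mfps_nth_monom)

lemma qshift_const [simp]: "qshift q i (mfps_const c) = mfps_const c"
  by (simp add: mfps_const_def qshift_monom rc_1)

lemma qshift_1 [simp]: "qshift q i 1 = 1"
  using qshift_const[of q i 1] by simp

lemma qshift_const_mult: "qshift q i (mfps_const c * f) = mfps_const c * qshift q i f"
  by (rule mfps_eqI) (simp add: qshift_nth)

lemma qshift_sum: "qshift q i (\<Sum>x\<in>A. F x) = (\<Sum>x\<in>A. qshift q i (F x))"
  by (induction A rule: infinite_finite_induct) (auto simp: qshift_add)

lemma qshift_prod: "q \<noteq> 0 \<Longrightarrow> qshift q i (\<Prod>x\<in>A. F x) = (\<Prod>x\<in>A. qshift q i (F x))"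
  by (induction A rule: infinite_finite_induct) (auto simp: qshift_mult)

lemma qshift_power: "q \<noteq> 0 \<Longrightarrow> qshift q i (f ^ k) = qshift q i f ^ k"
  by (induction k) (auto simp: qshift_mult)

lemma mfps_monom_const: "mfps_monom e c = mfps_const c * mfps_monom e 1"
  by (rule mfps_eqI) (simp add: mfps_nth_monom)

lemma qshift_xv:
  assumes "i \<ge> 1"
  shows "qshift q i (xv j) = (if i = j then mfps_const (rc q) * xv j else xv j)"
proof -
  have "shift_weight q i (\<Sum>a<j. Poly_Mapping.single a 1) = (if i = j then q else 1)"
    using assms by (auto simp: shift_weight_def lookup_sum_single[simplified])
  then show ?thesis
    by (simp add: xv_monom qshift_monom rc_1 flip: mfps_monom_const)
qed

lemma qshift_xratio:
  assumes "q \<noteq> 0" "k \<ge> 1" "i < j"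
  shows "qshift q k (xratio i j) = mfps_const (rc (if k = j then q else if k = i then 1 / q else 1)) * xratio i j"
proof -
  have "shift_weight q k (\<Sum>a=i..<j. Poly_Mapping.single a 1) = (if k = j then q else if k = i then 1 / q else 1)"
    using assms by (auto simp: shift_weight_def lookup_sum_single[simplified] power_int_minus divide_inverse)
  then show ?thesis
    by (simp add: xratio_monom qshift_monom flip: mfps_monom_const)
qed

lemma qshift_mfps_sum:
  assumes "q \<noteq> 0"
  shows "qshift q i (mfps_sum F A) = mfps_sum (\<lambda>x. qshift q i (F x)) A"
proof (rule mfps_eqI)
  fix m
  have "{x \<in> A. mfps_nth (qshift q i (F x)) m \<noteq> 0} = {x \<in> A. mfps_nth (F x) m \<noteq> 0}"
    using shift_weight_nz[OF assms] by (auto simp: qshift_nth)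
  then show "mfps_nth (qshift q i (mfps_sum F A)) m = mfps_nth (mfps_sum (\<lambda>x. qshift q i (F x)) A) m"
    by (simp add: mfps_sum_def qshift_nth sum_distrib_left)
qed

section \<open>Sums over the last column of the matrix\<close>

definition compositions :: "nat \<Rightarrow> (nat \<Rightarrow> nat) set" where
  "compositions N = {\<mu>. \<forall>i. i \<notin> {1..N} \<longrightarrow> \<mu> i = 0}"

definition last_monom :: "nat \<Rightarrow> (nat \<Rightarrow> nat) \<Rightarrow> xseries" where
  "last_monom N \<mu> = (\<Prod>i\<in>{1..N}. xratio i (Suc N) ^ \<mu> i)"

definition last_sum :: "nat \<Rightarrow> ((nat \<Rightarrow> nat) \<Rightarrow> xseries) \<Rightarrow> xseries" where
  "last_sum N g = mfps_sum (\<lambda>\<mu>. last_monom N \<mu> * g \<mu>) (compositions N)"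

lemma finite_compositions_le: "finite {\<mu> \<in> compositions N. (\<Sum>i\<in>{1..N}. \<mu> i) \<le> M}"
proof -
  have "finite {f. (\<forall>x\<in>{1..N}. f x \<in> {..M}) \<and> (\<forall>x. x \<notin> {1..N} \<longrightarrow> f x = (0::nat))}"
    by (rule rev_finite_subset[OF finite_set_of_finite_funs[of "{1..N}" "{..M}" 0]]) auto
  moreover have "{\<mu> \<in> compositions N. (\<Sum>i\<in>{1..N}. \<mu> i) \<le> M} \<subseteq> {f. (\<forall>x\<in>{1..N}. f x \<in> {..M}) \<and> (\<forall>x. x \<notin> {1..N} \<longrightarrow> f x = 0)}"
  proof clarify
    fix \<mu> assume \<mu>: "\<mu> \<in> compositions N" "(\<Sum>i\<in>{1..N}. \<mu> i) \<le> M"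
    then have "\<mu> x \<le> M" if "x \<in> {1..N}" for x
      using member_le_sum[OF that, of \<mu>] by simp
    with \<mu> show "(\<forall>x\<in>{1..N}. \<mu> x \<in> {..M}) \<and> (\<forall>x. x \<notin> {1..N} \<longrightarrow> \<mu> x = 0)"
      unfolding compositions_def by blast
  qed
  ultimately show ?thesis by (rule rev_finite_subset)
qed

text \<open>Each x_(N+1)/x_i contains the variable of index N exactly once, so the exponent of that
  variable is the total size of \<mu>. Hence only finitely many \<mu> reach a given monomial, and
  \<open>last_sum\<close> is summable for every family \<open>g\<close>.\<close>

lemma last_monom_monom:
  obtains e where "last_monom N \<mu> = mfps_monom e 1" "Poly_Mapping.lookup e N = (\<Sum>i\<in>{1..N}. \<mu> i)"
proof
  define e where "e = (\<Sum>i\<in>{1..N}. \<Sum>_<\<mu> i. \<Sum>a=i..<Suc N. Poly_Mapping.single a (1::nat))"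
  show "last_monom N \<mu> = mfps_monom e 1"
    by (simp add: last_monom_def e_def xratio_monom mfps_power_monom mfps_prod_monom)
  have "Poly_Mapping.lookup (\<Sum>a=i..<Suc N. Poly_Mapping.single a (1::nat)) N = 1" if "i \<in> {1..N}" for i
    using that by (subst lookup_sum_single) auto
  then have "Poly_Mapping.lookup (\<Sum>_<\<mu> i. \<Sum>a=i..<Suc N. Poly_Mapping.single a (1::nat)) N = \<mu> i" if "i \<in> {1..N}" for i
    using that by (subst lookup_sum) simp
  then show "Poly_Mapping.lookup e N = (\<Sum>i\<in>{1..N}. \<mu> i)"
    unfolding e_def by (subst lookup_sum) (intro sum.cong refl)
qed

lemma last_summable: "mfps_summable (\<lambda>\<mu>. last_monom N \<mu> * g \<mu>) (compositions N)"
  unfolding mfps_summable_def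
proof
  fix m
  have "{\<mu> \<in> compositions N. mfps_nth (last_monom N \<mu> * g \<mu>) m \<noteq> 0} \<subseteq>
     {\<mu> \<in> compositions N. (\<Sum>i\<in>{1..N}. \<mu> i) \<le> Poly_Mapping.lookup m N}"
  proof clarify
    fix \<mu> assume nz: "mfps_nth (last_monom N \<mu> * g \<mu>) m \<noteq> 0"
    obtain e where e: "last_monom N \<mu> = mfps_monom e 1" "Poly_Mapping.lookup e N = (\<Sum>i\<in>{1..N}. \<mu> i)"
      by (rule last_monom_monom)
    from nz obtain r where "m = e + r" unfolding e(1) by (rule mfps_monom_mult_nonzero)
    then show "(\<Sum>i\<in>{1..N}. \<mu> i) \<le> Poly_Mapping.lookup m N" by (simp add: lookup_add e(2))
  qed
  then show "finite {\<mu> \<in> compositions N. mfps_nth (last_monom N \<mu> * g \<mu>) m \<noteq> 0}"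
    by (rule finite_subset[OF _ finite_compositions_le])
qed

lemma last_sum_cong: "(\<And>\<mu>. \<mu> \<in> compositions N \<Longrightarrow> g \<mu> = h \<mu>) \<Longrightarrow> last_sum N g = last_sum N h"
  unfolding last_sum_def by (intro mfps_sum_cong) simp

lemma last_sum_mult: "h * last_sum N g = last_sum N (\<lambda>\<mu>. h * g \<mu>)"
  unfolding last_sum_def mfps_sum_mult[OF last_summable] by (intro mfps_sum_cong) (simp only: mult_ac)

lemma last_sum_sum: "(\<Sum>k\<in>K. last_sum N (g k)) = last_sum N (\<lambda>\<mu>. \<Sum>k\<in>K. g k \<mu>)"
  unfolding last_sum_def by (simp only: mfps_sum_sum[OF last_summable, symmetric] sum_distrib_left)

lemma last_sum_add: "last_sum N g + last_sum N h = last_sum N (\<lambda>\<mu>. g \<mu> + h \<mu>)"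
  unfolding last_sum_def by (simp only: mfps_sum_add[OF last_summable last_summable, symmetric] distrib_left)

lemma last_sum_0: "last_sum N (\<lambda>_. 0) = 0"
  by (simp add: last_sum_def mfps_sum_eq_0)

lemma qshift_last_monom:
  assumes "q \<noteq> 0" "k \<ge> 1"
  shows "qshift q k (last_monom N \<mu>) =
    mfps_const (rc (if k = Suc N then q ^ (\<Sum>i\<in>{1..N}. \<mu> i) else if k \<le> N then 1 / q ^ \<mu> k else 1)) * last_monom N \<mu>"
proof -
  let ?c = "\<lambda>i. if k = Suc N then q else if k = i then 1 / q else 1"
  have "qshift q k (last_monom N \<mu>) = (\<Prod>i\<in>{1..N}. mfps_const (rc (?c i ^ \<mu> i)) * xratio i (Suc N) ^ \<mu> i)"
    unfolding last_monom_def qshift_prod[OF assms(1)] qshift_power[OF assms(1)]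
    by (intro prod.cong refl, subst qshift_xratio[OF assms])
      (auto simp: power_mult_distrib rc_power mfps_const_power)
  also have "\<dots> = mfps_const (\<Prod>i\<in>{1..N}. rc (?c i ^ \<mu> i)) * last_monom N \<mu>"
    by (simp add: prod.distrib last_monom_def mfps_const_prod)
  also have "(\<Prod>i\<in>{1..N}. rc (?c i ^ \<mu> i)) = rc (if k = Suc N then q ^ (\<Sum>i\<in>{1..N}. \<mu> i) else if k \<le> N then 1 / q ^ \<mu> k else 1)"
  proof (cases "k = Suc N")
    case True
    then show ?thesis by (simp add: rc_power rc_prod power_sum)
  next
    case False
    have "(\<Prod>i\<in>{1..N}. rc (?c i ^ \<mu> i)) = (\<Prod>i\<in>{1..N}. if i = k then rc (1 / q ^ \<mu> k) else 1)"
      using False by (intro prod.cong refl) (auto simp: power_divide rc_1)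
    then show ?thesis using False assms by (simp add: rc_1)
  qed
  finally show ?thesis .
qed

lemma qshift_last_sum:
  assumes "q \<noteq> 0" "k \<ge> 1"
  shows "qshift q k (last_sum N g) = last_sum N (\<lambda>\<mu>.
    mfps_const (rc (if k = Suc N then q ^ (\<Sum>i\<in>{1..N}. \<mu> i) else if k \<le> N then 1 / q ^ \<mu> k else 1)) * qshift q k (g \<mu>))"
  unfolding last_sum_def qshift_mfps_sum[OF assms(1)]
  by (intro mfps_sum_cong) (simp only: qshift_mult[OF assms(1)] qshift_last_monom[OF assms] mult_ac)

text \<open>Multiplication by x_(N+1)/x_i adds one to \<mu>_i, so the sum is reindexed by the
  enlarged exponent \<rho>; the default 0 fills in those \<rho> that do not arise in this
  way.\<close>

lemma last_sum_shift:
  assumes J: "J \<subseteq> {1..N}"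
  shows "(\<Prod>i\<in>J. xratio i (Suc N)) * last_sum N g = last_sum N (\<lambda>\<rho>. if \<forall>i\<in>J. \<rho> i > 0 then g (lower J \<rho>) else 0)"
proof -
  define up where "up \<mu> i = (if i \<in> J then Suc (\<mu> i) else \<mu> i)" for \<mu> :: "nat \<Rightarrow> nat" and i
  have lower_up: "lower J (up \<mu>) = \<mu>" for \<mu> by (rule ext) (simp add: up_def lower_def)
  then have inj: "inj_on up (compositions N)" by (metis inj_onI)
  have up_pos: "\<forall>i\<in>J. up \<mu> i > 0" for \<mu> by (simp add: up_def)
  have up_lower: "up (lower J \<rho>) = \<rho>" if "\<forall>i\<in>J. \<rho> i > 0" for \<rho>
    using that by (intro ext) (auto simp: up_def lower_def)
  have up_in: "up \<mu> \<in> compositions N" if "\<mu> \<in> compositions N" for \<mu>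
    using that J by (auto simp: compositions_def up_def)
  have lower_in: "lower J \<rho> \<in> compositions N" if "\<rho> \<in> compositions N" for \<rho>
    using that by (auto simp: compositions_def lower_def)
  have mon: "(\<Prod>i\<in>J. xratio i (Suc N)) * last_monom N \<mu> = last_monom N (up \<mu>)" for \<mu>
    unfolding prod_subset_if[OF J finite_atLeastAtMost] last_monom_def prod.distrib[symmetric]
    by (intro prod.cong refl) (simp add: up_def)
  let ?G = "\<lambda>\<rho>. if \<forall>i\<in>J. \<rho> i > 0 then g (lower J \<rho>) else 0"
  have "(\<Prod>i\<in>J. xratio i (Suc N)) * last_sum N g = mfps_sum (\<lambda>\<mu>. last_monom N (up \<mu>) * ?G (up \<mu>)) (compositions N)"
    unfolding last_sum_def mfps_sum_mult[OF last_summable] mult.assoc[symmetric] mon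
    using up_pos by (simp add: lower_up)
  also have "\<dots> = mfps_sum (\<lambda>\<rho>. last_monom N \<rho> * ?G \<rho>) (up ` compositions N)"
    by (rule mfps_sum_reindex[OF inj, symmetric])
  also have "\<dots> = last_sum N ?G"
    unfolding last_sum_def
  proof (rule mfps_sum_mono_neutral)
    fix \<rho> assume \<rho>: "\<rho> \<in> compositions N" "\<rho> \<notin> up ` compositions N"
    then have "\<not> (\<forall>i\<in>J. \<rho> i > 0)" using up_lower[of \<rho>] lower_in[of \<rho>] by force
    then show "last_monom N \<rho> * ?G \<rho> = 0" by (simp only: if_False mult_zero_right)
  qed (use up_in in auto)
  finally show ?thesis .
qed

text \<open>Trades a monomial of an elementary symmetric polynomial for the product of all x_i, the
  same for every J, times the factors that \<open>last_sum_shift\<close> absorbs.\<close>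

lemma prod_xv_complement:
  assumes J: "J \<subseteq> {1..N}"
  shows "(\<Prod>i\<in>{1..N}-J. xv i) * xv (Suc N) ^ card J = (\<Prod>i\<in>{1..N}. xv i) * (\<Prod>i\<in>J. xratio i (Suc N))"
proof -
  have "(\<Prod>i\<in>J. xv i) * (\<Prod>i\<in>J. xratio i (Suc N)) = (\<Prod>i\<in>J. xv (Suc N))"
    unfolding prod.distrib[symmetric] by (intro prod.cong refl xv_xratio) (use J in auto)
  also have "\<dots> = xv (Suc N) ^ card J" by simp
  finally have "(\<Prod>i\<in>{1..N}-J. xv i) * xv (Suc N) ^ card J =
      ((\<Prod>i\<in>{1..N}-J. xv i) * (\<Prod>i\<in>J. xv i)) * (\<Prod>i\<in>J. xratio i (Suc N))"
    by (simp only: mult.assoc)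
  then show ?thesis by (simp only: prod_split[OF finite_atLeastAtMost J])
qed

section \<open>Branching and the Pieri formula\<close>

lemma branch_coeff_cong:
  assumes "\<And>i. i \<in> {1..Suc N} \<Longrightarrow> \<sigma> i = \<tau> i" "\<And>i. i \<in> {1..N} \<Longrightarrow> \<mu> i = \<nu> i"
  shows "branch_coeff q t N \<sigma> \<mu> = branch_coeff q t N \<tau> \<nu>"
  unfolding branch_coeff_def
  by (intro arg_cong2[of _ _ _ _ "(*)"] prod.cong refl) (auto simp: assms pairs_def)

text \<open>The identity is linear in \<open>h\<close>. Testing it on the indicators of the finitely
  many values that occur lifts it from scalar weights to weights in the ring of series.\<close>

lemma balanced_weights:
  fixes w :: "'b \<Rightarrow> ratfun" and H :: "nat \<Rightarrow> xseries"
  assumes fin: "finite A" "finite B"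
    and bal: "\<And>h :: nat \<Rightarrow> ratfun. (\<Sum>J\<in>A. (h (f J) + h (g J)) * w J) = (\<Sum>J\<in>B. h (k J) * w' J)"
  shows "(\<Sum>J\<in>A. (H (f J) + H (g J)) * mfps_const (w J)) = (\<Sum>J\<in>B. H (k J) * mfps_const (w' J))"
proof -
  define M where "M = Suc (Max (insert 0 (f ` A \<union> g ` A \<union> k ` B)))"
  have less: "f J < M" "g J < M" if "J \<in> A" for J
    using that fin unfolding M_def less_Suc_eq_le by (intro Max_ge; auto)+
  have less': "k J < M" if "J \<in> B" for J
    using that fin unfolding M_def less_Suc_eq_le by (intro Max_ge; auto)
  have H: "H j = (\<Sum>i<M. H i * mfps_const (if j = i then 1 else 0))" if "j < M" for j
  proof -
    have "(\<Sum>i<M. H i * mfps_const (if j = i then 1 else 0)) = (\<Sum>i<M. if i = j then H j else 0)"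
      by (intro sum.cong refl) auto
    then show ?thesis using that by simp
  qed
  have "(\<Sum>J\<in>A. (H (f J) + H (g J)) * mfps_const (w J)) =
     (\<Sum>J\<in>A. \<Sum>i<M. H i * mfps_const (((if f J = i then 1 else 0) + (if g J = i then 1 else 0)) * w J))"
    by (intro sum.cong refl, subst H[OF less(1)], assumption, subst H[OF less(2)], assumption)
      (simp add: sum.distrib[symmetric] sum_distrib_right mfps_const_add mfps_const_mult distrib_left distrib_right mult.assoc)
  also have "\<dots> = (\<Sum>i<M. H i * mfps_const (\<Sum>J\<in>A. ((if f J = i then 1 else 0) + (if g J = i then 1 else 0)) * w J))"
    by (subst sum.swap) (simp only: sum_distrib_left mfps_const_sum)
  also have "\<dots> = (\<Sum>i<M. H i * mfps_const (\<Sum>J\<in>B. (if k J = i then 1 else 0) * w' J))"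
    by (intro sum.cong refl) (simp only: bal[where h = "\<lambda>j. if j = i then 1 else 0" for i])
  also have "\<dots> = (\<Sum>J\<in>B. \<Sum>i<M. H i * mfps_const ((if k J = i then 1 else 0) * w' J))"
    by (subst sum.swap) (simp only: sum_distrib_left mfps_const_sum)
  also have "\<dots> = (\<Sum>J\<in>B. H (k J) * mfps_const (w' J))"
    by (intro sum.cong refl, subst H[OF less'], assumption)
      (simp add: sum_distrib_right mfps_const_mult mult.assoc)
  finally show ?thesis .
qed

text \<open>p_n by recursion on n. The spectrum is arbitrary because removing the last column
  rescales it; \<open>p_series_eq_branch_series\<close> makes the connection to the sum over
  matrices.\<close>

fun branch_series :: "complex \<Rightarrow> complex \<Rightarrow> nat \<Rightarrow> (nat \<Rightarrow> ratfun) \<Rightarrow> xseries" where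
  "branch_series q t 0 \<sigma> = 1"
| "branch_series q t (Suc N) \<sigma> = last_sum N (\<lambda>\<mu>. mfps_const (branch_coeff (rc q) (rc t) N \<sigma> \<mu>) *
     branch_series q t N (\<lambda>i. \<sigma> i / rc q ^ \<mu> i))"

lemma branch_series_cong:
  "(\<And>i. i \<in> {1..N} \<Longrightarrow> \<sigma> i = \<tau> i) \<Longrightarrow> branch_series q t N \<sigma> = branch_series q t N \<tau>"
proof (induction N arbitrary: \<sigma> \<tau>)
  case (Suc N)
  have "branch_coeff (rc q) (rc t) N \<sigma> \<mu> = branch_coeff (rc q) (rc t) N \<tau> \<mu>" for \<mu>
    using Suc.prems by (intro branch_coeff_cong) auto
  moreover have "branch_series q t N (\<lambda>i. \<sigma> i / rc q ^ \<mu> i) = branch_series q t N (\<lambda>i. \<tau> i / rc q ^ \<mu> i)" for \<mu>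
    using Suc.prems by (intro Suc.IH) auto
  ultimately show ?case by simp
qed simp

section \<open>Variables occurring in a series, and admissible spectra\<close>

definition supported :: "nat set \<Rightarrow> (nat, 'a :: comm_ring_1) mfps \<Rightarrow> bool" where
  "supported V f \<longleftrightarrow> (\<forall>m. mfps_nth f m \<noteq> 0 \<longrightarrow> Poly_Mapping.keys m \<subseteq> V)"

lemma supported_mult: "supported V f \<Longrightarrow> supported V g \<Longrightarrow> supported V (f * g)"
  unfolding supported_def
proof (intro allI impI)
  fix m assume *: "\<forall>m. mfps_nth f m \<noteq> 0 \<longrightarrow> Poly_Mapping.keys m \<subseteq> V" "\<forall>m. mfps_nth g m \<noteq> 0 \<longrightarrow> Poly_Mapping.keys m \<subseteq> V"
    and "mfps_nth (f * g) m \<noteq> 0"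
  from this(3) obtain a b where "(a, b) \<in> splits m" "mfps_nth f a \<noteq> 0" "mfps_nth g b \<noteq> 0"
    by (rule mfps_mult_nonzero)
  then show "Poly_Mapping.keys m \<subseteq> V" using * Poly_Mapping.keys_add[of a b] by (fastforce simp: splits_def)
qed

lemma supported_monom: "Poly_Mapping.keys e \<subseteq> V \<Longrightarrow> supported V (mfps_monom e c)"
  by (simp add: supported_def mfps_nth_monom)

lemma supported_const [simp]: "supported V (mfps_const c)"
  by (simp add: mfps_const_def supported_monom)

lemma supported_1 [simp]: "supported V 1"
  using supported_const[of V 1] by simp

lemma supported_prod: "(\<And>x. x \<in> A \<Longrightarrow> supported V (F x)) \<Longrightarrow> supported V (\<Prod>x\<in>A. F x)"
  by (induction A rule: infinite_finite_induct) (auto intro: supported_mult)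

lemma supported_power: "supported V f \<Longrightarrow> supported V (f ^ k)"
  by (induction k) (auto intro: supported_mult)

lemma supported_add: "supported V f \<Longrightarrow> supported V g \<Longrightarrow> supported V (f + g)"
  unfolding supported_def by (metis add.right_neutral mfps_nth_simps(3))

lemma supported_uminus: "supported V f \<Longrightarrow> supported V (- f)"
  by (simp add: supported_def)

lemma supported_diff: "supported V f \<Longrightarrow> supported V g \<Longrightarrow> supported V (f - g)"
  using supported_add[of V f "- g"] by (simp add: supported_uminus)

lemma supported_sum: "(\<And>x. x \<in> A \<Longrightarrow> supported V (F x)) \<Longrightarrow> supported V (\<Sum>x\<in>A. F x)"
  by (induction A rule: infinite_finite_induct) (auto intro: supported_add simp: supported_def[of V 0])

lemma supported_mfps_sum:
  assumes "\<And>x. x \<in> A \<Longrightarrow> supported V (F x)"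
  shows "supported V (mfps_sum F A)"
  unfolding supported_def
proof (intro allI impI)
  fix m assume "mfps_nth (mfps_sum F A) m \<noteq> 0"
  then obtain x where "x \<in> A" "mfps_nth (F x) m \<noteq> 0"
    unfolding mfps_sum_def mfps_nth_Abs by (metis (mono_tags, lifting) mem_Collect_eq sum.not_neutral_contains_not_neutral)
  then show "Poly_Mapping.keys m \<subseteq> V" using assms[of x] by (auto simp: supported_def)
qed

lemma supported_xratio: "supported {i..<j} (xratio i j)"
proof -
  have "Poly_Mapping.keys (\<Sum>a=i..<j. Poly_Mapping.single a (1::nat)) \<subseteq> {i..<j}"
    by (auto simp: in_keys_iff lookup_sum_single[simplified] split: if_splits)
  then show ?thesis unfolding xratio_monom by (rule supported_monom)
qed

lemma supported_mono: "supported V f \<Longrightarrow> V \<subseteq> W \<Longrightarrow> supported W f"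
  unfolding supported_def by blast

lemma supported_branch_series: "supported {1..<N} (branch_series q t N \<sigma>)"
proof (induction N arbitrary: \<sigma>)
  case (Suc N)
  have "supported {1..<Suc N} (last_monom N \<mu>)" for \<mu>
    unfolding last_monom_def
    by (intro supported_prod supported_power supported_mono[OF supported_xratio]) auto
  moreover have "supported {1..<Suc N} (branch_series q t N \<tau>)" for \<tau>
    by (rule supported_mono[OF Suc.IH]) auto
  ultimately show ?case
    by (auto simp: last_sum_def intro!: supported_mfps_sum supported_mult)
qed simp

text \<open>The shift of x_(N+1) sees only the variables of index N and N + 1, while the series
  involves only those below N.\<close>

lemma qshift_branch_series: "qshift q (Suc N) (branch_series q t N \<sigma>) = branch_series q t N \<sigma>"
proof (rule mfps_eqI)
  fix m
  have "shift_weight q (Suc N) m = 1" if "mfps_nth (branch_series q t N \<sigma>) m \<noteq> 0"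
  proof -
    have "Poly_Mapping.keys m \<subseteq> {1..<N}" using that supported_branch_series by (auto simp: supported_def)
    then have "N \<notin> Poly_Mapping.keys m" "Suc N \<notin> Poly_Mapping.keys m" by auto
    then show ?thesis by (simp add: shift_weight_def in_keys_iff)
  qed
  then show "mfps_nth (qshift q (Suc N) (branch_series q t N \<sigma>)) m = mfps_nth (branch_series q t N \<sigma>) m"
    by (cases "mfps_nth (branch_series q t N \<sigma>) m = 0") (simp_all add: qshift_nth rc_1)
qed

text \<open>A class containing every spectrum that the recursions reach from the indeterminates. It
  is closed under rescaling by nonzero constants, and the ratio of parameters at two different
  indices is never a constant, so genericity persists through the inductions.\<close>

definition scaled_indets :: "(nat \<Rightarrow> ratfun) \<Rightarrow> bool" where
  "scaled_indets \<sigma> \<longleftrightarrow> (\<forall>i. \<exists>c. c \<noteq> 0 \<and> \<sigma> i = rc c * sv i)"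

lemma scaled_indets_sv: "scaled_indets sv"
  unfolding scaled_indets_def by (auto intro!: exI[of _ 1] simp: rc_1)

lemma scaled_indets_mult:
  assumes "scaled_indets \<sigma>" "\<And>i. c i \<noteq> 0"
  shows "scaled_indets (\<lambda>i. rc (c i) * \<sigma> i)"
  unfolding scaled_indets_def
proof
  fix i
  obtain d where "d \<noteq> 0" "\<sigma> i = rc d * sv i" using assms(1) unfolding scaled_indets_def by blast
  then show "\<exists>d. d \<noteq> 0 \<and> rc (c i) * \<sigma> i = rc d * sv i"
    using assms(2)[of i] by (intro exI[of _ "c i * d"]) (simp add: rc_mult mult.assoc)
qed

locale generic_params =
  fixes q t :: complex
  assumes q: "q \<noteq> 0" and t: "t \<noteq> 0"
    and q_gen: "\<And>a. q ^ Suc a \<noteq> 1" and t_gen: "\<And>a b. t * q ^ a \<noteq> q ^ b"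
begin

lemma scaled_indets_div: "scaled_indets \<sigma> \<Longrightarrow> scaled_indets (\<lambda>i. \<sigma> i / rc q ^ \<mu> i)"
  using scaled_indets_mult[of \<sigma> "\<lambda>i. 1 / q ^ \<mu> i"] q by (simp add: rc_divide rc_power rc_1)

lemma scaled_indets_raise: "scaled_indets \<sigma> \<Longrightarrow> scaled_indets (raise_spectrum (rc q) \<sigma> J)"
proof -
  assume "scaled_indets \<sigma>"
  moreover have "raise_spectrum (rc q) \<sigma> J = (\<lambda>i. rc (if i \<in> J then 1 else q) * \<sigma> i)"
    by (auto simp: raise_spectrum_def rc_1)
  ultimately show ?thesis using scaled_indets_mult[of \<sigma> "\<lambda>i. if i \<in> J then 1 else q"] q by simp
qed

lemma generic_spectrum:
  assumes "scaled_indets \<sigma>"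
  shows "generic_spectrum (rc q) (rc t) \<sigma>"
proof
  show "rc q \<noteq> 0" "rc t \<noteq> 0" using q t by auto
  show "rc q ^ Suc a \<noteq> 1" for a
  proof -
    have "rc (q ^ Suc a) \<noteq> rc 1" unfolding rc_eq_iff by (rule q_gen)
    then show ?thesis by (simp only: rc_power rc_1 not_False_eq_True)
  qed
  show "rc t * rc q ^ a \<noteq> rc q ^ b" for a b
  proof -
    have "rc (t * q ^ a) \<noteq> rc (q ^ b)" unfolding rc_eq_iff by (rule t_gen)
    then show ?thesis by (simp only: rc_power rc_mult not_False_eq_True)
  qed
  have nz: "\<sigma> i \<noteq> 0" for i
    using assms unfolding scaled_indets_def by (metis mult_eq_0_iff rc_eq_0_iff sv_nonzero)
  then show "\<sigma> i \<noteq> 0" for i .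
  show "generic_ratio (rc q) (rc t) (\<sigma> j / \<sigma> i)" if ij: "i \<noteq> j" for i j
    unfolding generic_ratio_def
  proof (intro allI notI)
    fix a b c d :: nat
    assume eq: "rc q ^ a * rc t ^ b * (\<sigma> j / \<sigma> i) = rc q ^ c * rc t ^ d"
    obtain u v where uv: "u \<noteq> 0" "v \<noteq> 0" "\<sigma> i = rc u * sv i" "\<sigma> j = rc v * sv j"
      using assms unfolding scaled_indets_def by metis
    have "rc (q ^ a * t ^ b * v / (q ^ c * t ^ d * u)) * sv j / sv i = 1"
      using eq q t uv by (simp add: rc_mult rc_divide rc_power field_simps)
    then show False using rc_sv_neq_1[OF ij] by blast
  qed
qed

text \<open>On J the exponent is lowered, off J the parameter is multiplied by q: either way the
  final parameter is q \<sigma>_i/q^\<rho>_i, independent of J. The next lemma gives the same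
  spectrum for the other order.\<close>

lemma branch_series_lower:
  assumes "J \<subseteq> {1..N}" "\<forall>i\<in>J. \<rho> i > 0"
  shows "branch_series q t N (raise_spectrum (rc q) (\<lambda>i. \<sigma> i / rc q ^ lower J \<rho> i) J) =
    branch_series q t N (\<lambda>i. rc q * \<sigma> i / rc q ^ \<rho> i)"
proof (rule branch_series_cong)
  fix i
  show "raise_spectrum (rc q) (\<lambda>i. \<sigma> i / rc q ^ lower J \<rho> i) J i = rc q * \<sigma> i / rc q ^ \<rho> i"
  proof (cases "i \<in> J")
    case True
    then obtain a where "\<rho> i = Suc a" using assms(2) gr0_implies_Suc by blast
    then show ?thesis using True q by (simp add: raise_spectrum_def lower_def)
  qed (simp add: raise_spectrum_def lower_def)
qed

lemma branch_series_lower':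
  assumes "\<forall>i\<in>J. i \<le> N \<longrightarrow> \<rho> i > 0"
  shows "branch_series q t N (\<lambda>i. raise_spectrum (rc q) \<sigma> J i / rc q ^ lower (J - {Suc N}) \<rho> i) =
    branch_series q t N (\<lambda>i. rc q * \<sigma> i / rc q ^ \<rho> i)"
proof (rule branch_series_cong)
  fix i assume i: "i \<in> {1..N}"
  show "raise_spectrum (rc q) \<sigma> J i / rc q ^ lower (J - {Suc N}) \<rho> i = rc q * \<sigma> i / rc q ^ \<rho> i"
  proof (cases "i \<in> J")
    case True
    then obtain a where "\<rho> i = Suc a" using assms i gr0_implies_Suc by auto
    then show ?thesis using True q i by (simp add: raise_spectrum_def lower_def)
  qed (simp add: raise_spectrum_def lower_def)
qed

lemma last_sum_shift_xv:
  assumes J: "J \<subseteq> {1..N}"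
  shows "(\<Prod>i\<in>{1..N}-J. xv i) * xv (Suc N) ^ card J * last_sum N g =
    (\<Prod>i\<in>{1..N}. xv i) * last_sum N (\<lambda>\<rho>. if \<forall>i\<in>J. \<rho> i > 0 then g (lower J \<rho>) else 0)"
  unfolding prod_xv_complement[OF J] mult.assoc last_sum_shift[OF J] ..

text \<open>
  Multiplying by \<open>x\<^bsub>N+1\<^esub>\<close> to a suitable power absorbs the factors \<open>x\<^bsub>N+1\<^esub>/x\<^sub>i\<close> of the branching sum, so that
  the coefficients for a fixed final spectrum can be compared; their equality is
  \<open>branch_pieri_commute\<close>. The arbitrary weight \<open>G\<close> of the cardinality makes the induction
  work.
\<close>

theorem pieri:
  "scaled_indets \<sigma> \<Longrightarrow>
   (\<Sum>J\<in>Pow {1..N}. G (card J) * (\<Prod>i\<in>{1..N}-J. xv i)) * branch_series q t N \<sigma> =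
   (\<Sum>J\<in>Pow {1..N}. G (card J) * (\<Prod>i\<in>{1..N}-J. xv i) *
      (mfps_const (pieri_coeff (rc q) (rc t) N J \<sigma>) * branch_series q t N (raise_spectrum (rc q) \<sigma> J)))"
proof (induction N arbitrary: \<sigma> G)
  case 0
  show ?case by (simp add: pieri_coeff_def pairs_def)
next
  case (Suc N)
  interpret generic_spectrum "rc q" "rc t" \<sigma> by (rule generic_spectrum[OF Suc.prems])
  let ?N = "{1..N}" and ?n = "{1..Suc N}"
  have n: "?n = insert (Suc N) ?N" "Suc N \<notin> ?N" "finite ?N" by auto
  define x where "x = xv (Suc N)"
  define XN where "XN = (\<Prod>i\<in>?N. xv i)"
  define P where "P \<rho> = branch_series q t N (\<lambda>i. rc q * \<sigma> i / rc q ^ \<rho> i)" for \<rho>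
  define b where "b = branch_coeff (rc q) (rc t) N"
  define wt where "wt J \<rho> = (if \<forall>i\<in>J. \<rho> i > 0 then b \<sigma> (lower J \<rho>) * pieri_coeff (rc q) (rc t) N J (\<lambda>i. \<sigma> i / rc q ^ lower J \<rho> i) else 0)"
    for J \<rho>
  define wt' where "wt' J \<rho> = (if \<forall>i\<in>J. i \<le> N \<longrightarrow> \<rho> i > 0 then pieri_coeff (rc q) (rc t) (Suc N) J \<sigma> * b (raise J) (lower J \<rho>) else 0)"
    for J \<rho>
  \<comment> \<open>The factor \<open>x ^ card J\<close> in the weight is what
    \<open>last_sum_shift_xv\<close> consumes; it is removed again at the end.\<close>
  have main: "(\<Sum>J\<in>Pow ?n. x ^ card J * H (card J) * (\<Prod>i\<in>?n-J. xv i)) * branch_series q t (Suc N) \<sigma> =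
     (\<Sum>J\<in>Pow ?n. x ^ card J * H (card J) * (\<Prod>i\<in>?n-J. xv i) *
      (mfps_const (pieri_coeff (rc q) (rc t) (Suc N) J \<sigma>) * branch_series q t (Suc N) (raise J)))" for H
  proof -
    \<comment> \<open>If N + 1 is outside J, the complement supplies an additional \<open>x\<close>;
      otherwise J has one element more than its part in {1..N}. Both cases give the same power of
      \<open>x\<close>.\<close>
    define F where "F j = x * x ^ j * (H j + H (Suc j))" for j
    have "(\<Sum>J\<in>Pow ?n. x ^ card J * H (card J) * (\<Prod>i\<in>?n-J. xv i)) = (\<Sum>J\<in>Pow ?N. F (card J) * (\<Prod>i\<in>?N-J. xv i))"
      unfolding n(1) sum_Pow_insert[OF n(3,2)] sum.distrib[symmetric]
    proof (intro sum.cong refl)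
      fix J assume "J \<in> Pow ?N"
      then have J: "Suc N \<notin> J" "finite J" using finite_subset by auto
      then show "x ^ card J * H (card J) * (\<Prod>i\<in>insert (Suc N) ?N - J. xv i) +
          x ^ card (insert (Suc N) J) * H (card (insert (Suc N) J)) * (\<Prod>i\<in>insert (Suc N) ?N - insert (Suc N) J. xv i) =
          F (card J) * (\<Prod>i\<in>?N-J. xv i)"
        by (simp add: insert_Diff_notin F_def x_def algebra_simps)
    qed
    then have "(\<Sum>J\<in>Pow ?n. x ^ card J * H (card J) * (\<Prod>i\<in>?n-J. xv i)) * branch_series q t (Suc N) \<sigma> =
       last_sum N (\<lambda>\<mu>. mfps_const (b \<sigma> \<mu>) * ((\<Sum>J\<in>Pow ?N. F (card J) * (\<Prod>i\<in>?N-J. xv i)) * branch_series q t N (\<lambda>i. \<sigma> i / rc q ^ \<mu> i)))"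
      unfolding branch_series.simps last_sum_mult b_def by (simp only: mult_ac)
    also have "\<dots> = last_sum N (\<lambda>\<mu>. \<Sum>J\<in>Pow ?N. F (card J) * (\<Prod>i\<in>?N-J. xv i) *
        (mfps_const (b \<sigma> \<mu> * pieri_coeff (rc q) (rc t) N J (\<lambda>i. \<sigma> i / rc q ^ \<mu> i)) *
          branch_series q t N (raise_spectrum (rc q) (\<lambda>i. \<sigma> i / rc q ^ \<mu> i) J)))"
      unfolding Suc.IH[OF scaled_indets_div[OF Suc.prems]] sum_distrib_left mfps_const_mult
      by (simp only: mult_ac)
    also have "\<dots> = (\<Sum>J\<in>Pow ?N. x * (H (card J) + H (Suc (card J))) * ((\<Prod>i\<in>?N-J. xv i) * x ^ card J *
        last_sum N (\<lambda>\<mu>. mfps_const (b \<sigma> \<mu> * pieri_coeff (rc q) (rc t) N J (\<lambda>i. \<sigma> i / rc q ^ \<mu> i)) *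
          branch_series q t N (raise_spectrum (rc q) (\<lambda>i. \<sigma> i / rc q ^ \<mu> i) J))))"
      unfolding last_sum_sum[symmetric] last_sum_mult F_def by (simp only: mult_ac)
    also have "\<dots> = (\<Sum>J\<in>Pow ?N. x * (H (card J) + H (Suc (card J))) * (XN * last_sum N (\<lambda>\<rho>. mfps_const (wt J \<rho>) * P \<rho>)))"
    proof (rule sum.cong[OF refl], rule arg_cong2[of _ _ _ _ "(*)", OF refl])
      fix J assume J: "J \<in> Pow ?N"
      show "(\<Prod>i\<in>?N-J. xv i) * x ^ card J *
        last_sum N (\<lambda>\<mu>. mfps_const (b \<sigma> \<mu> * pieri_coeff (rc q) (rc t) N J (\<lambda>i. \<sigma> i / rc q ^ \<mu> i)) *
          branch_series q t N (raise_spectrum (rc q) (\<lambda>i. \<sigma> i / rc q ^ \<mu> i) J)) =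
        XN * last_sum N (\<lambda>\<rho>. mfps_const (wt J \<rho>) * P \<rho>)"
        unfolding x_def XN_def last_sum_shift_xv[OF J[unfolded Pow_iff]]
        by (intro arg_cong2[of _ _ _ _ "(*)"] refl last_sum_cong)
          (use J branch_series_lower[of J N _ \<sigma>] in \<open>auto simp: wt_def P_def\<close>)
    qed
    also have "\<dots> = x * XN * last_sum N (\<lambda>\<rho>. (\<Sum>J\<in>Pow ?N. (H (card J) + H (Suc (card J))) * mfps_const (wt J \<rho>)) * P \<rho>)"
      unfolding sum_distrib_right last_sum_sum[symmetric] sum_distrib_left
      by (intro sum.cong refl) (simp only: last_sum_mult mult_ac)
    \<comment> \<open>The series \<open>P \<rho>\<close> is common to both orders, so only its
      scalar coefficients have to be compared.\<close>
    also have "\<dots> = x * XN * last_sum N (\<lambda>\<rho>. (\<Sum>J\<in>Pow ?n. H (card J) * mfps_const (wt' J \<rho>)) * P \<rho>)"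
      unfolding wt_def wt'_def b_def
      by (subst balanced_weights[OF _ _ branch_pieri_commute]) auto
    also have "\<dots> = (\<Sum>J\<in>Pow ?n. x * H (card J) * (XN * last_sum N (\<lambda>\<rho>. mfps_const (wt' J \<rho>) * P \<rho>)))"
      unfolding sum_distrib_right last_sum_sum[symmetric] sum_distrib_left
      by (intro sum.cong refl) (simp only: last_sum_mult mult_ac)
    also have "\<dots> = (\<Sum>J\<in>Pow ?n. x ^ card J * H (card J) * (\<Prod>i\<in>?n-J. xv i) *
      (mfps_const (pieri_coeff (rc q) (rc t) (Suc N) J \<sigma>) * branch_series q t (Suc N) (raise J)))"
    proof (intro sum.cong refl)
      fix J assume J: "J \<in> Pow ?n"
      define J0 where "J0 = J - {Suc N}"
      have J0: "J0 \<subseteq> ?N" "finite J0" using J finite_subset by (fastforce simp: J0_def)+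
      have e: "x ^ card J * (\<Prod>i\<in>?n-J. xv i) = x * ((\<Prod>i\<in>?N-J0. xv i) * x ^ card J0)"
      proof (cases "Suc N \<in> J")
        case True
        then have "J = insert (Suc N) J0" "Suc N \<notin> J0" by (auto simp: J0_def)
        moreover from this have "?n - J = ?N - J0" by auto
        ultimately show ?thesis using J0 by (simp add: x_def mult_ac)
      next
        case False
        then have "J0 = J" "?n - J = insert (Suc N) (?N - J)" using J by (auto simp: J0_def)
        then show ?thesis by (simp add: x_def mult_ac)
      qed
      have "(\<Prod>i\<in>?N-J0. xv i) * x ^ card J0 * (mfps_const (pieri_coeff (rc q) (rc t) (Suc N) J \<sigma>) * branch_series q t (Suc N) (raise J)) =
        XN * last_sum N (\<lambda>\<rho>. mfps_const (wt' J \<rho>) * P \<rho>)"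
        unfolding branch_series.simps last_sum_mult[of "mfps_const _"] x_def XN_def last_sum_shift_xv[OF J0(1)]
      proof (intro arg_cong2[of _ _ _ _ "(*)"] refl last_sum_cong)
        fix \<rho> :: "nat \<Rightarrow> nat"
        have c: "(\<forall>i\<in>J0. \<rho> i > 0) \<longleftrightarrow> (\<forall>i\<in>J. i \<le> N \<longrightarrow> \<rho> i > 0)" using J by (auto simp: J0_def subset_iff le_Suc_eq)
        have "branch_coeff (rc q) (rc t) N (raise J) (lower J0 \<rho>) = b (raise J) (lower J \<rho>)"
          unfolding b_def by (intro branch_coeff_cong) (auto simp: lower_def J0_def)
        then have coeff: "branch_coeff (rc q) (rc t) N (raise J) (lower J0 \<rho>) = b (raise J) (lower J \<rho>)" .
        show "(if \<forall>i\<in>J0. \<rho> i > 0 then mfps_const (pieri_coeff (rc q) (rc t) (Suc N) J \<sigma>) *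
             (mfps_const (branch_coeff (rc q) (rc t) N (raise J) (lower J0 \<rho>)) *
              branch_series q t N (\<lambda>i. raise J i / rc q ^ lower J0 \<rho> i)) else 0) = mfps_const (wt' J \<rho>) * P \<rho>"
        proof (cases "\<forall>i\<in>J. i \<le> N \<longrightarrow> \<rho> i > 0")
          case True
          show ?thesis
            unfolding c wt'_def P_def coeff branch_series_lower'[OF True, folded J0_def] if_P[OF True]
            by (simp only: mfps_const_mult mult.assoc)
        next
          case False
          show ?thesis unfolding c wt'_def if_not_P[OF False] by simp
        qed
      qed
      note eq = this
      have "x * H (card J) * (XN * last_sum N (\<lambda>\<rho>. mfps_const (wt' J \<rho>) * P \<rho>)) =
        (x * ((\<Prod>i\<in>?N-J0. xv i) * x ^ card J0)) * H (card J) *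
        (mfps_const (pieri_coeff (rc q) (rc t) (Suc N) J \<sigma>) * branch_series q t (Suc N) (raise J))"
        unfolding eq[symmetric] by (simp only: mult_ac)
      also have "\<dots> = x ^ card J * H (card J) * (\<Prod>i\<in>?n-J. xv i) *
        (mfps_const (pieri_coeff (rc q) (rc t) (Suc N) J \<sigma>) * branch_series q t (Suc N) (raise J))"
        unfolding e[symmetric] by (simp only: mult_ac)
      finally show "x * H (card J) * (XN * last_sum N (\<lambda>\<rho>. mfps_const (wt' J \<rho>) * P \<rho>)) =
        x ^ card J * H (card J) * (\<Prod>i\<in>?n-J. xv i) *
        (mfps_const (pieri_coeff (rc q) (rc t) (Suc N) J \<sigma>) * branch_series q t (Suc N) (raise J))" .
    qed
    finally show ?thesis .
  qed
  \<comment> \<open>With x^(N+1-j) G(j) as the weight in \<open>main\<close>, the power of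
    \<open>x\<close> becomes N + 1 for every J and can be cancelled.\<close>
  have G: "x ^ card J * (x ^ (Suc N - card J) * G (card J)) = x ^ Suc N * G (card J)" if "J \<in> Pow ?n" for J
  proof -
    have "card J \<le> Suc N" using that card_mono[of ?n J] by simp
    then have "x ^ card J * x ^ (Suc N - card J) = x ^ Suc N" by (simp flip: power_add)
    then show ?thesis by (simp only: mult.assoc[symmetric])
  qed
  have "x ^ Suc N * ((\<Sum>J\<in>Pow ?n. G (card J) * (\<Prod>i\<in>?n-J. xv i)) * branch_series q t (Suc N) \<sigma>) =
     x ^ Suc N * (\<Sum>J\<in>Pow ?n. G (card J) * (\<Prod>i\<in>?n-J. xv i) *
      (mfps_const (pieri_coeff (rc q) (rc t) (Suc N) J \<sigma>) * branch_series q t (Suc N) (raise J)))"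
    using main[of "\<lambda>j. x ^ (Suc N - j) * G j"]
    unfolding mult.assoc[symmetric] sum_distrib_left sum_distrib_right
    by (simp only: G mult.assoc cong: sum.cong)
  then show ?case by (simp add: x_def)
qed

end

section \<open>The first-order operator\<close>

lemma xv_eq_iff: "xv i = xv j \<longleftrightarrow> i = j"
proof
  assume eq: "xv i = xv j"
  let ?e = "\<lambda>i. \<Sum>a<i. Poly_Mapping.single a (1::nat)"
  have "mfps_nth (xv i) (?e i) = mfps_nth (xv j) (?e i)" by (simp only: eq)
  then have "?e i = ?e j" by (auto simp: xv_monom mfps_nth_monom split: if_splits)
  then have "Poly_Mapping.lookup (?e i) v = Poly_Mapping.lookup (?e j) v" for v by simp
  from this[of i] this[of j] show "i = j"
    by (auto simp: lookup_sum_single[simplified] split: if_splits)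
qed simp

text \<open>Multiplication by the denominator removes the distinction between the two expansions:
  both represent the same rational function.\<close>

lemma D_factor_mult:
  assumes "i \<noteq> j"
  shows "D_factor t i j * (xv i - xv j) = mfps_const (rc t) * xv i - xv j"
proof (cases "i < j")
  case True
  then have e: "xv j = xv i * xratio i j" by (simp add: xv_xratio)
  have "D_factor t i j * (xv i - xv j) =
    (mfps_const (rc t) - xratio i j) * ((1 - xratio i j) * mfps_geom (xratio i j)) * xv i"
    unfolding e using True by (simp add: D_factor_def algebra_simps)
  also have "\<dots> = mfps_const (rc t) * xv i - xv j"
    unfolding mfps_geom_inverse[OF True] e by (simp add: algebra_simps)
  finally show ?thesis .
next
  case False
  then have ji: "j < i" using assms by simp
  then have e: "xv i = xv j * xratio j i" by (simp add: xv_xratio)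
  have "D_factor t i j * (xv i - xv j) =
    (mfps_const (rc t) * xratio j i - 1) * ((1 - xratio j i) * mfps_geom (xratio j i)) * xv j"
    unfolding e using False by (simp add: D_factor_def algebra_simps)
  also have "\<dots> = mfps_const (rc t) * xv i - xv j"
    unfolding mfps_geom_inverse[OF ji] e by (simp add: algebra_simps)
  finally show ?thesis .
qed

text \<open>D_1 with a general spectrum in place of s, since the induction on n passes through
  rescaled spectra. The prefactor t^(1 choose 2) is 1.\<close>

definition macd1 :: "complex \<Rightarrow> complex \<Rightarrow> nat \<Rightarrow> (nat \<Rightarrow> ratfun) \<Rightarrow> xseries \<Rightarrow> xseries" where
  "macd1 q t n \<sigma> f = (\<Sum>i\<in>{1..n}. (\<Prod>j\<in>{1..n}-{i}. D_factor t i j) *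
     (mfps_const (\<sigma> i * rc (t powi (int i - int n))) * qshift q i f))"

context generic_params begin

lemma last_sum_const_mult: "mfps_const c * last_sum N (\<lambda>\<mu>. mfps_const (b \<mu>) * f \<mu>) = last_sum N (\<lambda>\<mu>. mfps_const (c * b \<mu>) * f \<mu>)"
  by (simp add: last_sum_mult mfps_const_mult mult.assoc)

text \<open>The part of D_1 in N + 1 variables that resembles D_1 in N variables. The exponent i -
  (N + 1) instead of i - N produces 1/t, the eigenvalues of \<open>U\<close> under the shifts move
  into the spectrum, and each summand is an eigenfunction by the induction hypothesis.\<close>

lemma macd1_lower_level:
  assumes U: "\<And>i. i \<in> {1..N} \<Longrightarrow> qshift q i U = mfps_const (u i) * U"
    and \<tau>: "\<And>\<mu> i. i \<in> {1..N} \<Longrightarrow> \<tau> \<mu> i = \<sigma> i * u i / rc q ^ \<mu> i"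
    and IH: "\<And>\<mu>. macd1 q t N (\<tau> \<mu>) (branch_series q t N (\<tau> \<mu>)) =
      mfps_const (\<Sum>i\<in>{1..N}. \<tau> \<mu> i) * branch_series q t N (\<tau> \<mu>)"
  shows "(\<Sum>i\<in>{1..N}. (\<Prod>j\<in>{1..N}-{i}. D_factor t i j) * (mfps_const (\<sigma> i * rc (t powi (int i - int (Suc N)))) *
       qshift q i (U * last_sum N (\<lambda>\<mu>. mfps_const (b \<mu>) * branch_series q t N (\<tau> \<mu>))))) =
    U * last_sum N (\<lambda>\<mu>. mfps_const (b \<mu> * ((\<Sum>i\<in>{1..N}. \<tau> \<mu> i) / rc t)) * branch_series q t N (\<tau> \<mu>))"
proof -
  let ?A = "\<lambda>i. \<Prod>j\<in>{1..N}-{i}. D_factor t i j"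
  let ?p = "\<lambda>\<mu>. branch_series q t N (\<tau> \<mu>)"
  have "?A i * (mfps_const (\<sigma> i * rc (t powi (int i - int (Suc N)))) *
       qshift q i (U * last_sum N (\<lambda>\<mu>. mfps_const (b \<mu>) * ?p \<mu>))) =
     U * last_sum N (\<lambda>\<mu>. mfps_const (b \<mu> / rc t) * (?A i * (mfps_const (\<tau> \<mu> i * rc (t powi (int i - int N))) * qshift q i (?p \<mu>))))"
    if i: "i \<in> {1..N}" for i
  proof -
    have c: "\<sigma> i * rc (t powi (int i - int (Suc N))) * u i * rc (1 / q ^ \<mu> i) * b \<mu> = b \<mu> / rc t * (\<tau> \<mu> i * rc (t powi (int i - int N)))" for \<mu>
    proof -
      have "t powi (int i - int (Suc N)) = t powi (int i - int N) / t"
        using t power_int_diff[of t "int i - int N" 1] by (simp add: algebra_simps)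
      then show ?thesis by (simp add: \<tau>[OF i] rc_divide rc_power rc_1)
    qed
    have "qshift q i (U * last_sum N (\<lambda>\<mu>. mfps_const (b \<mu>) * ?p \<mu>)) =
      U * last_sum N (\<lambda>\<mu>. mfps_const (u i * rc (1 / q ^ \<mu> i) * b \<mu>) * qshift q i (?p \<mu>))"
      unfolding qshift_mult[OF q] U[OF i] using i q
      by (simp add: qshift_last_sum qshift_const_mult last_sum_mult mfps_const_mult mult_ac)
    then have "?A i * (mfps_const (\<sigma> i * rc (t powi (int i - int (Suc N)))) *
       qshift q i (U * last_sum N (\<lambda>\<mu>. mfps_const (b \<mu>) * ?p \<mu>))) =
       U * (?A i * (mfps_const (\<sigma> i * rc (t powi (int i - int (Suc N)))) * last_sum N (\<lambda>\<mu>. mfps_const (u i * rc (1 / q ^ \<mu> i) * b \<mu>) * qshift q i (?p \<mu>))))"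
      by (simp only: mult_ac)
    also have "\<dots> = U * last_sum N (\<lambda>\<mu>. ?A i * (mfps_const (b \<mu> / rc t * (\<tau> \<mu> i * rc (t powi (int i - int N)))) * qshift q i (?p \<mu>)))"
      unfolding last_sum_const_mult c[symmetric] unfolding last_sum_mult[of "?A i"] by (simp only: mult.assoc)
    finally show ?thesis by (simp only: mfps_const_mult mult_ac)
  qed
  then have "(\<Sum>i\<in>{1..N}. ?A i * (mfps_const (\<sigma> i * rc (t powi (int i - int (Suc N)))) *
       qshift q i (U * last_sum N (\<lambda>\<mu>. mfps_const (b \<mu>) * ?p \<mu>)))) =
     U * last_sum N (\<lambda>\<mu>. mfps_const (b \<mu> / rc t) * macd1 q t N (\<tau> \<mu>) (?p \<mu>))"
    by (simp add: last_sum_sum macd1_def flip: sum_distrib_left)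
  then show ?thesis unfolding IH by (simp add: mult.assoc[symmetric] flip: mfps_const_mult)
qed

text \<open>
  The shift of \<open>x\<^sub>i\<close> acts on \<open>V = \<Prod>(x\<^sub>j - x\<^bsub>N+1\<^esub>)\<close>, taken over \<open>j \<le> N\<close>, so that \<open>V D_factor t i (N+1)\<close>
  is a combination of \<open>V\<close> and its shift. This reduces the first-order operator in \<open>N + 1\<close> variables to
  the one in \<open>N\<close> variables.
\<close>

lemma qshift_vandermonde_row:
  assumes i: "i \<in> {1..N}"
  shows "mfps_const (rc (q - 1)) * (\<Prod>j\<in>{1..N}. xv j - xv (Suc N)) * D_factor t i (Suc N) =
    mfps_const (rc (q - t)) * (\<Prod>j\<in>{1..N}. xv j - xv (Suc N)) +
    mfps_const (rc (t - 1)) * qshift q i (\<Prod>j\<in>{1..N}. xv j - xv (Suc N))"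
proof -
  let ?r = "\<Prod>j\<in>{1..N}-{i}. xv j - xv (Suc N)"
  have V: "(\<Prod>j\<in>{1..N}. xv j - xv (Suc N)) = (xv i - xv (Suc N)) * ?r"
    using i by (simp add: prod.remove)
  have "qshift q i (\<Prod>j\<in>{1..N}. xv j - xv (Suc N)) = (\<Prod>j\<in>{1..N}. (if i = j then mfps_const (rc q) * xv j else xv j) - xv (Suc N))"
    unfolding qshift_prod[OF q] qshift_diff using i by (intro prod.cong refl) (simp add: qshift_xv)
  also have "\<dots> = (mfps_const (rc q) * xv i - xv (Suc N)) * (\<Prod>j\<in>{1..N}-{i}. (if i = j then mfps_const (rc q) * xv j else xv j) - xv (Suc N))"
    using i by (subst prod.remove[of _ i]) auto
  also have "(\<Prod>j\<in>{1..N}-{i}. (if i = j then mfps_const (rc q) * xv j else xv j) - xv (Suc N)) = ?r"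
    by (intro prod.cong refl) auto
  finally have qV: "qshift q i (\<Prod>j\<in>{1..N}. xv j - xv (Suc N)) = (mfps_const (rc q) * xv i - xv (Suc N)) * ?r" .
  have "D_factor t i (Suc N) * (xv i - xv (Suc N)) = mfps_const (rc t) * xv i - xv (Suc N)"
    using i by (intro D_factor_mult) auto
  note D = this
  have "mfps_const (rc (q - 1)) * (\<Prod>j\<in>{1..N}. xv j - xv (Suc N)) * D_factor t i (Suc N) =
    mfps_const (rc (q - 1)) * (D_factor t i (Suc N) * (xv i - xv (Suc N))) * ?r"
    unfolding V by (simp only: mult_ac)
  also have "\<dots> = mfps_const (rc (q - t)) * ((xv i - xv (Suc N)) * ?r) +
      mfps_const (rc (t - 1)) * ((mfps_const (rc q) * xv i - xv (Suc N)) * ?r)"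
    unfolding D by (simp add: rc_diff rc_1 mfps_const_diff algebra_simps)
  finally show ?thesis unfolding qV unfolding V .
qed

lemma vandermonde_row_last:
  "(\<Prod>j\<in>{1..N}. xv j - xv (Suc N)) * (\<Prod>j\<in>{1..N}. D_factor t (Suc N) j) =
    (\<Prod>j\<in>{1..N}. xv j - mfps_const (rc t) * xv (Suc N))"
  unfolding prod.distrib[symmetric]
proof (intro prod.cong refl)
  fix j assume "j \<in> {1..N}"
  then have "D_factor t (Suc N) j * (xv (Suc N) - xv j) = mfps_const (rc t) * xv (Suc N) - xv j"
    by (intro D_factor_mult) auto
  moreover have "(xv j - xv (Suc N)) * D_factor t (Suc N) j = - (D_factor t (Suc N) j * (xv (Suc N) - xv j))"
    by (simp add: algebra_simps)
  ultimately show "(xv j - xv (Suc N)) * D_factor t (Suc N) j = xv j - mfps_const (rc t) * xv (Suc N)"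
    by (simp only: minus_diff_eq)
qed

lemma vandermonde_row_expand:
  "(\<Prod>j\<in>{1..N}. xv j - y) = (\<Sum>J\<in>Pow {1..N}. (- y) ^ card J * (\<Prod>i\<in>{1..N}-J. xv i))"
proof -
  have "(\<Prod>j\<in>{1..N}. xv j - y) = (\<Prod>j\<in>{1..N}. (- y) + xv j)" by (simp add: algebra_simps)
  also have "\<dots> = (\<Sum>J\<in>Pow {1..N}. (\<Prod>i\<in>J. - y) * (\<Prod>i\<in>{1..N}-J. xv i))"
    by (rule prod_add) simp
  finally show ?thesis by simp
qed

theorem macd1_branch_series:
  "scaled_indets \<sigma> \<Longrightarrow> macd1 q t n \<sigma> (branch_series q t n \<sigma>) =
     mfps_const (\<Sum>i\<in>{1..n}. \<sigma> i) * branch_series q t n \<sigma>"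
proof (induction n arbitrary: \<sigma>)
  case 0
  show ?case by (simp add: macd1_def)
next
  case (Suc N)
  note qc = q and tc = t and q1 = q_gen[of 0]
  interpret generic_spectrum "rc q" "rc t" \<sigma> by (rule generic_spectrum[OF Suc.prems])
  let ?N = "{1..N}" and ?n = "{1..Suc N}"
  have n: "?n = insert (Suc N) ?N" "Suc N \<notin> ?N" by auto
  define x where "x = xv (Suc N)"
  define XN where "XN = (\<Prod>i\<in>?N. xv i)"
  define V where "V = (\<Prod>j\<in>?N. xv j - x)"
  define P where "P \<rho> = branch_series q t N (\<lambda>i. rc q * \<sigma> i / rc q ^ \<rho> i)" for \<rho>
  define b where "b = branch_coeff (rc q) (rc t) N \<sigma>"
  define \<tau> where "\<tau> \<mu> i = \<sigma> i / rc q ^ \<mu> i" for \<mu> i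
  define a where "a J \<mu> = pieri_coeff (rc q) (rc t) N J (\<tau> \<mu>)" for J \<mu>
  define p where "p = branch_series q t (Suc N) \<sigma>"
  define A where "A i = (\<Prod>j\<in>?N-{i}. D_factor t i j)" for i
  define c :: "nat \<Rightarrow> xseries" where "c i = mfps_const (\<sigma> i * rc (t powi (int i - int (Suc N))))" for i
  define U where "U J = (\<Prod>i\<in>?N-J. xv i) * x ^ card J" for J
  define L where "L w J = last_sum N (\<lambda>\<mu>. mfps_const (b \<mu> * a J \<mu> * w \<mu>) * branch_series q t N (raise_spectrum (rc q) (\<tau> \<mu>) J))" for w J
  define E where "E = (\<Sum>i\<in>?n. \<sigma> i)"
  have p: "p = last_sum N (\<lambda>\<mu>. mfps_const (b \<mu>) * branch_series q t N (\<tau> \<mu>))"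
    by (simp add: p_def b_def \<tau>_def[abs_def])
  have \<tau>: "scaled_indets (\<tau> \<mu>)" for \<mu> unfolding \<tau>_def by (rule scaled_indets_div[OF Suc.prems])
  have xc: "V = (\<Sum>J\<in>Pow ?N. (- x) ^ card J * (\<Prod>i\<in>?N-J. xv i))"
    "(\<Prod>j\<in>?N. xv j - mfps_const (rc t) * x) = (\<Sum>J\<in>Pow ?N. (- (mfps_const (rc t) * x)) ^ card J * (\<Prod>i\<in>?N-J. xv i))"
    unfolding V_def by (rule vandermonde_row_expand)+
  \<comment> \<open>The Pieri formula with weight (k x)^j: k = -1 gives \<open>V\<close>, and k = -t
    gives the product that \<open>vandermonde_row_last\<close> leaves for the index N + 1.\<close>
  have VL: "(\<Sum>J\<in>Pow ?N. (mfps_const k * x) ^ card J * (\<Prod>i\<in>?N-J. xv i)) *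
      last_sum N (\<lambda>\<mu>. mfps_const (b \<mu> * w \<mu>) * branch_series q t N (\<tau> \<mu>)) =
      (\<Sum>J\<in>Pow ?N. mfps_const (k ^ card J) * (U J * L w J))" for w k
  proof -
    have "(\<Sum>J\<in>Pow ?N. (mfps_const k * x) ^ card J * (\<Prod>i\<in>?N-J. xv i)) *
      last_sum N (\<lambda>\<mu>. mfps_const (b \<mu> * w \<mu>) * branch_series q t N (\<tau> \<mu>)) =
      last_sum N (\<lambda>\<mu>. mfps_const (b \<mu> * w \<mu>) * ((\<Sum>J\<in>Pow ?N. (mfps_const k * x) ^ card J * (\<Prod>i\<in>?N-J. xv i)) * branch_series q t N (\<tau> \<mu>)))"
      unfolding last_sum_mult by (simp only: mult_ac)
    also have "\<dots> = last_sum N (\<lambda>\<mu>. \<Sum>J\<in>Pow ?N. (mfps_const k * x) ^ card J * (\<Prod>i\<in>?N-J. xv i) *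
        (mfps_const (b \<mu> * a J \<mu> * w \<mu>) * branch_series q t N (raise_spectrum (rc q) (\<tau> \<mu>) J)))"
      unfolding pieri[OF \<tau>] sum_distrib_left a_def mfps_const_mult by (simp only: mult_ac)
    also have "\<dots> = (\<Sum>J\<in>Pow ?N. mfps_const (k ^ card J) * (U J * L w J))"
      unfolding last_sum_sum[symmetric] last_sum_mult[symmetric] U_def L_def power_mult_distrib mfps_const_power
      by (simp only: mult_ac)
    finally show ?thesis .
  qed
  have Vw: "V * last_sum N (\<lambda>\<mu>. mfps_const (b \<mu> * w \<mu>) * branch_series q t N (\<tau> \<mu>)) =
      (\<Sum>J\<in>Pow ?N. mfps_const ((-1) ^ card J) * (U J * L w J))" for w
    using VL[of "-1" w] unfolding xc(1) mfps_const_uminus mfps_const_1 mult_minus1 .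
  have Vtw: "(\<Prod>j\<in>?N. xv j - mfps_const (rc t) * x) * last_sum N (\<lambda>\<mu>. mfps_const (b \<mu> * w \<mu>) * branch_series q t N (\<tau> \<mu>)) =
      (\<Sum>J\<in>Pow ?N. mfps_const ((- rc t) ^ card J) * (U J * L w J))" for w
    using VL[of "- rc t" w] unfolding xc(2) mfps_const_uminus mult_minus_left .
  have p1: "p = last_sum N (\<lambda>\<mu>. mfps_const (b \<mu> * 1) * branch_series q t N (\<tau> \<mu>))" by (simp add: p)
  \<comment> \<open>\<open>E1\<close> and \<open>E2\<close> are the eigenvalues of the N-variable
    operator before and after the Pieri step, divided by t; \<open>E3\<close> is the effect of
    shifting x_(N+1) on the monomial of the last column.\<close>
  define E1 where "E1 \<mu> = (\<Sum>i\<in>?N. \<tau> \<mu> i) / rc t" for \<mu>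
  define E2 where "E2 J \<mu> = (\<Sum>i\<in>?N. raise_spectrum (rc q) (\<tau> \<mu>) J i) / rc t" for J \<mu>
  define E3 where "E3 \<mu> = rc q ^ (\<Sum>i\<in>?N. \<mu> i)" for \<mu> :: "nat \<Rightarrow> nat"
  have s1: "(\<Sum>i\<in>?N. A i * (c i * qshift q i p)) = last_sum N (\<lambda>\<mu>. mfps_const (b \<mu> * E1 \<mu>) * branch_series q t N (\<tau> \<mu>))"
    using macd1_lower_level[of N 1 "\<lambda>_. 1" \<tau> \<sigma> b] Suc.IH[OF \<tau>]
    by (simp add: p A_def c_def E1_def \<tau>_def[abs_def])
  have s2: "(\<Sum>i\<in>?N. A i * (c i * qshift q i (V * p))) = (\<Sum>J\<in>Pow ?N. mfps_const ((-1) ^ card J) * (U J * L (E2 J) J))"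
  proof -
    have "(\<Sum>i\<in>?N. A i * (c i * qshift q i (U J * L (\<lambda>_. 1) J))) = U J * L (E2 J) J" if J: "J \<in> Pow ?N" for J
    proof -
      have "(\<Sum>i\<in>?N. A i * (c i * qshift q i (U J * last_sum N (\<lambda>\<mu>. mfps_const (b \<mu> * a J \<mu>) * branch_series q t N (raise_spectrum (rc q) (\<tau> \<mu>) J))))) =
        U J * last_sum N (\<lambda>\<mu>. mfps_const (b \<mu> * a J \<mu> * ((\<Sum>i\<in>?N. raise_spectrum (rc q) (\<tau> \<mu>) J i) / rc t)) * branch_series q t N (raise_spectrum (rc q) (\<tau> \<mu>) J))"
        unfolding A_def c_def
      proof (rule macd1_lower_level[where u = "\<lambda>i. if i \<in> J then 1 else rc q"])
        fix i assume i: "i \<in> ?N"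
        have "qshift q i (U J) = (\<Prod>j\<in>?N-J. if i = j then mfps_const (rc q) * xv j else xv j) * x ^ card J"
          unfolding U_def x_def using i qc
          by (simp add: qshift_mult qshift_prod qshift_power qshift_xv)
        also have "(\<Prod>j\<in>?N-J. if i = j then mfps_const (rc q) * xv j else xv j) = (\<Prod>j\<in>?N-J. (if j = i then mfps_const (rc q) else 1) * xv j)"
          by (intro prod.cong refl) auto
        also have "\<dots> = mfps_const (if i \<in> J then 1 else rc q) * (\<Prod>j\<in>?N-J. xv j)"
          using i by (simp add: prod.distrib)
        finally show "qshift q i (U J) = mfps_const (if i \<in> J then 1 else rc q) * U J"
          by (simp only: U_def mult.assoc)
        show "raise_spectrum (rc q) (\<tau> \<mu>) J i = \<sigma> i * (if i \<in> J then 1 else rc q) / rc q ^ \<mu> i" for \<mu>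
          by (simp add: raise_spectrum_def \<tau>_def)
      next
        show "macd1 q t N (raise_spectrum (rc q) (\<tau> \<mu>) J) (branch_series q t N (raise_spectrum (rc q) (\<tau> \<mu>) J)) =
          mfps_const (\<Sum>i\<in>?N. raise_spectrum (rc q) (\<tau> \<mu>) J i) * branch_series q t N (raise_spectrum (rc q) (\<tau> \<mu>) J)" for \<mu>
          by (rule Suc.IH[OF scaled_indets_raise[OF \<tau>]])
      qed
      then show ?thesis by (simp add: L_def E2_def)
    qed
    note D = this
    have "(\<Sum>i\<in>?N. A i * (c i * qshift q i (V * p))) =
      (\<Sum>J\<in>Pow ?N. mfps_const ((-1) ^ card J) * (\<Sum>i\<in>?N. A i * (c i * qshift q i (U J * L (\<lambda>_. 1) J))))"
      unfolding p1 Vw qshift_sum qshift_const_mult sum_distrib_left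
      by (subst sum.swap) (simp only: mult_ac)
    then show ?thesis by (simp only: D cong: sum.cong)
  qed
  have s3: "qshift q (Suc N) p = last_sum N (\<lambda>\<mu>. mfps_const (b \<mu> * E3 \<mu>) * branch_series q t N (\<tau> \<mu>))"
    unfolding p using qc
    by (simp add: qshift_last_sum qshift_const_mult qshift_branch_series E3_def rc_power mfps_const_mult mult_ac)
  \<comment> \<open>The coefficients q - t and t - 1 come from
    \<open>qshift_vandermonde_row\<close>, the third term from the index N + 1, and the last from
    the expected eigenvalue.\<close>
  define W where "W J \<mu> = rc (q - t) * E1 \<mu> + rc (t - 1) * E2 J \<mu> + rc (q - 1) * \<sigma> (Suc N) * rc t ^ card J * E3 \<mu> - rc (q - 1) * E" for J \<mu>
  have L_lin: "mfps_const k1 * L w1 J + mfps_const k2 * L w2 J = L (\<lambda>\<mu>. k1 * w1 \<mu> + k2 * w2 \<mu>) J" for k1 k2 w1 w2 J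
    unfolding L_def last_sum_const_mult last_sum_add
    by (intro last_sum_cong) (simp add: mfps_const_add algebra_simps)
  have step: "mfps_const (rc (q - 1)) * V * (macd1 q t (Suc N) \<sigma> p - mfps_const E * p) =
    (\<Sum>J\<in>Pow ?N. mfps_const ((-1) ^ card J) * (U J * L (W J) J))"
  proof -
    have An: "(\<Prod>j\<in>?n-{i}. D_factor t i j) = D_factor t i (Suc N) * A i" if "i \<in> ?N" for i
    proof -
      have "?n - {i} = insert (Suc N) (?N - {i})" using that by auto
      then show ?thesis by (simp add: A_def)
    qed
    have An': "?n - {Suc N} = ?N" by auto
    have cn: "c (Suc N) = mfps_const (\<sigma> (Suc N))" by (simp add: c_def rc_1)
    have m: "macd1 q t (Suc N) \<sigma> p = (\<Sum>i\<in>?N. D_factor t i (Suc N) * (A i * (c i * qshift q i p))) +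
       (\<Prod>j\<in>?N. D_factor t (Suc N) j) * (mfps_const (\<sigma> (Suc N)) * qshift q (Suc N) p)"
    proof -
      have "macd1 q t (Suc N) \<sigma> p = (\<Sum>i\<in>insert (Suc N) ?N. (\<Prod>j\<in>?n-{i}. D_factor t i j) * (c i * qshift q i p))"
        by (simp only: macd1_def c_def n(1))
      also have "\<dots> = (\<Prod>j\<in>?N. D_factor t (Suc N) j) * (mfps_const (\<sigma> (Suc N)) * qshift q (Suc N) p) +
         (\<Sum>i\<in>?N. (\<Prod>j\<in>?n-{i}. D_factor t i j) * (c i * qshift q i p))"
        by (subst sum.insert) (simp_all only: finite_atLeastAtMost n(2) not_False_eq_True An' cn)
      also have "(\<Sum>i\<in>?N. (\<Prod>j\<in>?n-{i}. D_factor t i j) * (c i * qshift q i p)) = (\<Sum>i\<in>?N. D_factor t i (Suc N) * (A i * (c i * qshift q i p)))"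
        by (intro sum.cong refl) (simp only: An mult.assoc)
      finally show ?thesis by (simp only: add.commute)
    qed
    have t1: "mfps_const (rc (q - 1)) * V * (\<Sum>i\<in>?N. D_factor t i (Suc N) * (A i * (c i * qshift q i p))) =
       mfps_const (rc (q - t)) * (V * (\<Sum>i\<in>?N. A i * (c i * qshift q i p))) +
       mfps_const (rc (t - 1)) * (\<Sum>i\<in>?N. A i * (c i * qshift q i (V * p)))"
    proof -
      have "mfps_const (rc (q - 1)) * V * (D_factor t i (Suc N) * (A i * (c i * qshift q i p))) =
        mfps_const (rc (q - t)) * (V * (A i * (c i * qshift q i p))) + mfps_const (rc (t - 1)) * (A i * (c i * qshift q i (V * p)))"
        if "i \<in> ?N" for i
      proof -
        have "mfps_const (rc (q - 1)) * V * (D_factor t i (Suc N) * (A i * (c i * qshift q i p))) =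
          (mfps_const (rc (q - 1)) * V * D_factor t i (Suc N)) * (A i * (c i * qshift q i p))" by (simp only: mult_ac)
        also have "\<dots> = (mfps_const (rc (q - t)) * V + mfps_const (rc (t - 1)) * qshift q i V) * (A i * (c i * qshift q i p))"
          unfolding V_def x_def qshift_vandermonde_row[OF that] ..
        finally show ?thesis unfolding qshift_mult[OF qc] distrib_right by (simp only: mult_ac)
      qed
      then show ?thesis unfolding sum_distrib_left sum.distrib[symmetric] by (intro sum.cong refl)
    qed
    have t2: "mfps_const (rc (q - 1)) * V * ((\<Prod>j\<in>?N. D_factor t (Suc N) j) * (mfps_const (\<sigma> (Suc N)) * qshift q (Suc N) p)) =
      mfps_const (rc (q - 1) * \<sigma> (Suc N)) * ((\<Prod>j\<in>?N. xv j - mfps_const (rc t) * x) * qshift q (Suc N) p)"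
      unfolding x_def vandermonde_row_last[symmetric] V_def mfps_const_mult by (simp only: mult_ac)
    have t1': "mfps_const (rc (q - 1)) * V * (\<Sum>i\<in>?N. D_factor t i (Suc N) * (A i * (c i * qshift q i p))) =
       mfps_const (rc (q - t)) * (\<Sum>J\<in>Pow ?N. mfps_const ((-1) ^ card J) * (U J * L E1 J)) +
       mfps_const (rc (t - 1)) * (\<Sum>J\<in>Pow ?N. mfps_const ((-1) ^ card J) * (U J * L (E2 J) J))"
      unfolding t1 unfolding s1 s2 Vw ..
    have t2': "mfps_const (rc (q - 1)) * V * ((\<Prod>j\<in>?N. D_factor t (Suc N) j) * (mfps_const (\<sigma> (Suc N)) * qshift q (Suc N) p)) =
      mfps_const (rc (q - 1) * \<sigma> (Suc N)) * (\<Sum>J\<in>Pow ?N. mfps_const ((- rc t) ^ card J) * (U J * L E3 J))"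
      unfolding t2 unfolding s3 Vtw ..
    have t3: "mfps_const (rc (q - 1)) * V * (mfps_const E * p) =
       mfps_const (rc (q - 1) * E) * (\<Sum>J\<in>Pow ?N. mfps_const ((-1) ^ card J) * (U J * L (\<lambda>_. 1) J))"
      unfolding Vw[symmetric] unfolding p1[symmetric] unfolding mfps_const_mult by (simp only: mult_ac)
    have "mfps_const (rc (q - 1)) * V * (macd1 q t (Suc N) \<sigma> p - mfps_const E * p) =
      mfps_const (rc (q - t)) * (\<Sum>J\<in>Pow ?N. mfps_const ((-1) ^ card J) * (U J * L E1 J)) +
      mfps_const (rc (t - 1)) * (\<Sum>J\<in>Pow ?N. mfps_const ((-1) ^ card J) * (U J * L (E2 J) J)) +
      mfps_const (rc (q - 1) * \<sigma> (Suc N)) * (\<Sum>J\<in>Pow ?N. mfps_const ((- rc t) ^ card J) * (U J * L E3 J)) -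
      mfps_const (rc (q - 1) * E) * (\<Sum>J\<in>Pow ?N. mfps_const ((-1) ^ card J) * (U J * L (\<lambda>_. 1) J))"
      unfolding right_diff_distrib m distrib_left t1' t2' t3 ..
    also have "\<dots> = (\<Sum>J\<in>Pow ?N. mfps_const ((-1) ^ card J) * (U J * L (W J) J))"
      unfolding sum_distrib_left sum.distrib[symmetric] sum_subtractf[symmetric]
    proof (intro sum.cong refl)
      fix J :: "nat set"
      define s where "s = (-1 :: ratfun) ^ card J"
      have ts: "(- rc t) ^ card J = s * rc t ^ card J" unfolding s_def by (rule power_minus)
      have LW: "L (W J) J = mfps_const (rc (q - t)) * L E1 J + mfps_const (rc (t - 1)) * L (E2 J) J +
        mfps_const (rc (q - 1) * \<sigma> (Suc N) * rc t ^ card J) * L E3 J - mfps_const (rc (q - 1) * E) * L (\<lambda>_. 1) J"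
      proof -
        have "L (W J) J = mfps_const 1 * (mfps_const 1 * (mfps_const (rc (q - t)) * L E1 J + mfps_const (rc (t - 1)) * L (E2 J) J) +
           mfps_const (rc (q - 1) * \<sigma> (Suc N) * rc t ^ card J) * L E3 J) + mfps_const (- (rc (q - 1) * E)) * L (\<lambda>_. 1) J"
          unfolding L_lin by (simp add: W_def[abs_def])
        then show ?thesis by (simp add: mfps_const_uminus)
      qed
      show "mfps_const (rc (q - t)) * (mfps_const s * (U J * L E1 J)) + mfps_const (rc (t - 1)) * (mfps_const s * (U J * L (E2 J) J)) +
         mfps_const (rc (q - 1) * \<sigma> (Suc N)) * (mfps_const ((- rc t) ^ card J) * (U J * L E3 J)) -
         mfps_const (rc (q - 1) * E) * (mfps_const s * (U J * L (\<lambda>_. 1) J)) = mfps_const s * (U J * L (W J) J)"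
        unfolding LW ts by (simp add: mfps_const_mult algebra_simps)
    qed
    finally show ?thesis .
  qed
  define wt where "wt J \<rho> = (if \<forall>i\<in>J. \<rho> i > 0 then b (lower J \<rho>) * a J (lower J \<rho>) else 0)" for J \<rho>
  define Q where "Q J \<rho> = (\<Sum>i\<in>?N-J. \<sigma> i / rc q ^ \<rho> i) + (\<Sum>i\<in>J. \<sigma> i / rc q ^ \<rho> i) / (rc t / rc q) +
       (rc t / rc q) ^ card J * (\<Prod>i\<in>?n. \<sigma> i) / (\<Prod>i\<in>?N. \<sigma> i / rc q ^ \<rho> i) - (\<Sum>i\<in>?n. \<sigma> i)" for J \<rho>
  have UL: "U J * L (W J) J = XN * last_sum N (\<lambda>\<rho>. mfps_const (wt J \<rho> * (rc (q - 1) * Q J \<rho>)) * P \<rho>)" if J: "J \<in> Pow ?N" for J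
  proof -
    have JN: "J \<subseteq> ?N" using J by simp
    \<comment> \<open>At the lowered exponents y_i has the coefficient q - 1 outside J and (q - 1)
      q/t on J; with the \<open>E3\<close> term this is the bracket of
      \<open>branch_pieri_alternating\<close>.\<close>
    have Wq: "W J (lower J \<rho>) = rc (q - 1) * Q J \<rho>" if pos: "\<forall>i\<in>J. \<rho> i > 0" for \<rho>
    proof -
      define y where "y i = \<sigma> i / rc q ^ \<rho> i" for i
      define SK SJ where "SK = (\<Sum>i\<in>?N-J. y i)" and "SJ = (\<Sum>i\<in>J. y i)"
      define R where "R = rc q ^ (\<Sum>i\<in>?N. \<rho> i)"
      have rq: "rc q \<noteq> 0" "rc t \<noteq> 0" using qc tc by auto
      have low: "rc q ^ lower J \<rho> i = (if i \<in> J then rc q ^ \<rho> i / rc q else rc q ^ \<rho> i)" for i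
      proof (cases "i \<in> J")
        case True
        then obtain m where "\<rho> i = Suc m" using pos gr0_implies_Suc by blast
        then show ?thesis using True rq by (simp add: lower_def)
      qed (simp add: lower_def)
      have \<tau>y: "\<tau> (lower J \<rho>) i = (if i \<in> J then rc q * y i else y i)" for i
        by (simp add: \<tau>_def low y_def)
      have "(\<Sum>i\<in>?N. \<tau> (lower J \<rho>) i) = SK + rc q * SJ"
        unfolding sum.subset_diff[OF JN finite_atLeastAtMost] SK_def SJ_def \<tau>y sum_distrib_left
        by (intro arg_cong2[of _ _ _ _ "(+)"] sum.cong refl) auto
      then have E1: "E1 (lower J \<rho>) = (SK + rc q * SJ) / rc t" by (simp only: E1_def)
      have "(\<Sum>i\<in>?N. raise_spectrum (rc q) (\<tau> (lower J \<rho>)) J i) = rc q * (SK + SJ)"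
        unfolding sum.subset_diff[OF JN finite_atLeastAtMost] SK_def SJ_def \<tau>y raise_spectrum_def distrib_left sum_distrib_left
        by (intro arg_cong2[of _ _ _ _ "(+)"] sum.cong refl) auto
      then have E2: "E2 J (lower J \<rho>) = rc q * (SK + SJ) / rc t" by (simp only: E2_def)
      have E3: "E3 (lower J \<rho>) = R / rc q ^ card J"
      proof -
        have "E3 (lower J \<rho>) = (\<Prod>i\<in>?N. if i \<in> J then rc q ^ \<rho> i / rc q else rc q ^ \<rho> i)"
          unfolding E3_def power_sum low ..
        also have "\<dots> = (\<Prod>i\<in>?N. rc q ^ \<rho> i) / (\<Prod>i\<in>?N. if i \<in> J then rc q else 1)"
          unfolding prod_dividef[symmetric] by (intro prod.cong refl) auto
        also have "(\<Prod>i\<in>?N. if i \<in> J then rc q else 1) = rc q ^ card J"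
          using prod_subset_if[OF JN finite_atLeastAtMost, of "\<lambda>_. rc q"] by simp
        finally show ?thesis by (simp only: R_def power_sum)
      qed
      have "(\<Prod>i\<in>?N. y i) = (\<Prod>i\<in>?N. \<sigma> i) / R"
        by (simp only: y_def prod_dividef R_def power_sum)
      moreover have "(\<Prod>i\<in>?n. \<sigma> i) = \<sigma> (Suc N) * (\<Prod>i\<in>?N. \<sigma> i)" unfolding n(1) by simp
      moreover have "(\<Prod>i\<in>?N. \<sigma> i) \<noteq> 0" using \<sigma>_nz by simp
      moreover have "R \<noteq> 0" using rq by (simp add: R_def)
      ultimately have ratio: "c * (\<Prod>i\<in>?n. \<sigma> i) / (\<Prod>i\<in>?N. y i) = c * (\<sigma> (Suc N) * R)" for c by simp
      have Q: "Q J \<rho> = SK + SJ / (rc t / rc q) + (rc t / rc q) ^ card J * (\<sigma> (Suc N) * R) - E"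
        unfolding Q_def y_def[symmetric] ratio SK_def SJ_def E_def ..
      show ?thesis unfolding W_def E1 E2 E3 Q rc_diff rc_1 power_divide
        using rq by (simp add: field_simps)
    qed
    show ?thesis unfolding U_def L_def x_def XN_def last_sum_shift_xv[OF JN]
    proof (intro arg_cong2[of _ _ _ _ "(*)"] refl last_sum_cong)
      fix \<rho> :: "nat \<Rightarrow> nat"
      show "(if \<forall>i\<in>J. 0 < \<rho> i then mfps_const (b (lower J \<rho>) * a J (lower J \<rho>) * W J (lower J \<rho>)) *
           branch_series q t N (raise_spectrum (rc q) (\<tau> (lower J \<rho>)) J) else 0) =
         mfps_const (wt J \<rho> * (rc (q - 1) * Q J \<rho>)) * P \<rho>"
      proof (cases "\<forall>i\<in>J. 0 < \<rho> i")
        case True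
        have "\<tau> (lower J \<rho>) = (\<lambda>i. \<sigma> i / rc q ^ lower J \<rho> i)" by (rule ext) (simp only: \<tau>_def)
        then show ?thesis
          unfolding wt_def if_P[OF True] Wq[OF True] P_def
          by (simp only: branch_series_lower[OF JN True])
      next
        case False
        show ?thesis unfolding wt_def if_not_P[OF False] by simp
      qed
    qed
  qed
  have "mfps_const (rc (q - 1)) * V * (macd1 q t (Suc N) \<sigma> p - mfps_const E * p) =
     XN * last_sum N (\<lambda>\<rho>. mfps_const (\<Sum>J\<in>Pow ?N. (-1) ^ card J * (wt J \<rho> * (rc (q - 1) * Q J \<rho>))) * P \<rho>)"
    unfolding step mfps_const_sum sum_distrib_right last_sum_sum[symmetric] sum_distrib_left
    by (intro sum.cong refl) (simp add: UL last_sum_mult mfps_const_mult mult_ac)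
  also have "(\<lambda>\<rho>. mfps_const (\<Sum>J\<in>Pow ?N. (-1) ^ card J * (wt J \<rho> * (rc (q - 1) * Q J \<rho>))) * P \<rho>) = (\<lambda>_. 0)"
  proof
    fix \<rho>
    have "(\<Sum>J\<in>Pow ?N. (-1) ^ card J * (wt J \<rho> * (rc (q - 1) * Q J \<rho>))) = rc (q - 1) * (\<Sum>J\<in>Pow ?N. (-1) ^ card J * wt J \<rho> * Q J \<rho>)"
      unfolding sum_distrib_left by (simp only: mult_ac)
    also have "\<dots> = 0"
      unfolding wt_def Q_def b_def a_def \<tau>_def branch_pieri_alternating by simp
    finally show "mfps_const (\<Sum>J\<in>Pow ?N. (-1) ^ card J * (wt J \<rho> * (rc (q - 1) * Q J \<rho>))) * P \<rho> = 0" by simp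
  qed
  finally have "mfps_const (rc (q - 1)) * V * (macd1 q t (Suc N) \<sigma> p - mfps_const E * p) = 0"
    by (simp add: last_sum_0)
  moreover have "V \<noteq> 0" unfolding V_def x_def by (auto simp: xv_eq_iff)
  moreover have "q \<noteq> 1" using q1 by simp
  then have "mfps_const (rc (q - 1)) \<noteq> (0 :: xseries)" by simp
  ultimately show ?case by (simp add: p_def E_def)
qed

end

section \<open>The residue identity\<close>

text \<open>The interpolation polynomial at d + 1 nodes is p itself, and its coefficient of order d
  is read off because the unnormalised basis polynomials are monic of degree d. This is the residue
  theorem for p divided by the product over the nodes.\<close>

lemma lagrange_leading_coeff:
  fixes p :: "'a::field poly"
  assumes "finite A" "card A = Suc d" "degree p \<le> d"
  shows "(\<Sum>a\<in>A. poly p a / (\<Prod>b\<in>A-{a}. a - b)) = coeff p d"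
proof -
  define l where "l a = (\<Prod>b\<in>A-{a}. [:- b, 1:])" for a
  define r where "r = (\<Sum>a\<in>A. smult (poly p a / (\<Prod>b\<in>A-{a}. a - b)) (l a))"
  have deg: "degree (l a) = d" "coeff (l a) d = 1" if "a \<in> A" for a
  proof -
    have "degree (l a) = (\<Sum>b\<in>A-{a}. degree [:- b, 1:])"
      unfolding l_def by (rule degree_prod_eq_sum_degree) auto
    then show 1: "degree (l a) = d" using that assms by simp
    have "lead_coeff (l a) = 1" unfolding l_def by (simp add: lead_coeff_prod)
    then show "coeff (l a) d = 1" by (simp add: 1)
  qed
  have "degree r \<le> d" unfolding r_def by (intro degree_sum_le assms(1)) (auto simp: deg)
  then have "degree (p - r) \<le> d" using assms(3) by (rule degree_diff_le[rotated])
  moreover have "poly (p - r) a = 0" if a: "a \<in> A" for a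
  proof -
    have "poly r a = (\<Sum>a'\<in>A. poly p a' / (\<Prod>b\<in>A-{a'}. a' - b) * (\<Prod>b\<in>A-{a'}. a - b))"
      by (simp add: r_def poly_sum l_def poly_prod)
    also have "\<dots> = (\<Sum>a'\<in>A. if a' = a then poly p a else 0)"
    proof (intro sum.cong refl)
      fix a' assume a': "a' \<in> A"
      show "poly p a' / (\<Prod>b\<in>A-{a'}. a' - b) * (\<Prod>b\<in>A-{a'}. a - b) = (if a' = a then poly p a else 0)"
      proof (cases "a' = a")
        case False
        then have "(\<Prod>b\<in>A-{a'}. a - b) = 0" using a assms(1) by (intro prod_zero) auto
        then show ?thesis using False by simp
      next
        case True
        have "(\<Prod>b\<in>A-{a}. a - b) \<noteq> 0" using assms(1) by auto
        then show ?thesis using True by simp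
      qed
    qed
    also have "\<dots> = poly p a" using a assms(1) by simp
    finally show ?thesis by simp
  qed
  ultimately have "p - r = 0"
    using assms card_poly_roots_bound[of "p - r"] poly_roots_finite[of "p - r"]
      card_mono[of "{x. poly (p - r) x = 0}" A] by fastforce
  then have "coeff p d = coeff r d" by simp
  also have "\<dots> = (\<Sum>a\<in>A. poly p a / (\<Prod>b\<in>A-{a}. a - b))"
    unfolding r_def by (simp add: coeff_sum deg)
  finally show ?thesis ..
qed

definition mac_weight :: "'a::field \<Rightarrow> 'a \<Rightarrow> 'a \<Rightarrow> 'a" where
  "mac_weight t x y = (t * x - y) / (x - y)"

text \<open>
  The residues of a rational function with poles at \<open>0\<close>, at the points of \<open>Z\<close> and at the points of
  \<open>Z/q\<close>, in the form of Lagrange interpolation.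
\<close>

lemma mac_weight_identity:
  fixes q t :: "'a::field"
  assumes fin: "finite Z" and q: "q \<noteq> 0" "q \<noteq> 1" and t: "t \<noteq> 0" "t \<noteq> 1" "t \<noteq> q"
    and Z: "\<And>x. x \<in> Z \<Longrightarrow> x \<noteq> 0" "\<And>x y. x \<in> Z \<Longrightarrow> y \<in> Z \<Longrightarrow> x \<noteq> q * y"
  shows "(\<Sum>x\<in>Z. \<Prod>y\<in>Z-{x}. mac_weight t x y * mac_weight t y (q * x)) =
    (\<Sum>x\<in>Z. \<Prod>y\<in>Z-{x}. mac_weight t y x * mac_weight t x (q * y))"
proof (cases "Z = {}")
  case False
  define m where "m = card Z"
  have m0: "m > 0" using False fin by (simp add: m_def card_gt_0_iff)
  \<comment> \<open>The numerators of both sides in one polynomial of degree 2m; the nodes 0, Z and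
    Z/q are one more in number.\<close>
  define p where "p = (\<Prod>y\<in>Z. [:- y, t:] * [:t * y, - q:])"
  have poly_p: "poly p z = (\<Prod>y\<in>Z. (t * z - y) * (t * y - q * z))" for z
    by (simp add: p_def poly_prod algebra_simps)
  have nzp: "[:- y, t:] * [:t * y, - q:] \<noteq> 0" for y using q t by auto
  have dp: "degree ([:- y, t:] * [:t * y, - q:]) = 2" for y
    using q t by (subst degree_mult_eq) auto
  have degp: "degree p = 2 * m"
    unfolding p_def using nzp dp by (subst degree_prod_eq_sum_degree) (auto simp: m_def)
  have "lead_coeff p = (\<Prod>y\<in>Z. - (t * q))"
    unfolding p_def lead_coeff_prod using q t by (intro prod.cong refl) (simp add: lead_coeff_mult)
  then have lead: "coeff p (2 * m) = (- (t * q)) ^ m" by (simp add: degp m_def)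
  define Z' where "Z' = (\<lambda>x. x / q) ` Z"
  have inj: "inj_on (\<lambda>x. x / q) Z" using q by (auto intro: inj_onI)
  have fin': "finite Z'" "card Z' = m" using fin by (auto simp: Z'_def card_image[OF inj] m_def)
  have disj: "Z \<inter> Z' = {}" using Z(2) q by (fastforce simp: Z'_def)
  have n0: "0 \<notin> Z" "0 \<notin> Z'" using Z(1) q by (auto simp: Z'_def)
  define A where "A = insert 0 (Z \<union> Z')"
  have cardA: "finite A" "card A = Suc (2 * m)"
    using fin fin' disj n0 by (auto simp: A_def card_Un_disjoint m_def)
  have prodZ': "(\<Prod>b\<in>Z'. f b) = (\<Prod>y\<in>Z. f (y / q))" for f :: "'a \<Rightarrow> 'a"
    unfolding Z'_def by (subst prod.reindex[OF inj]) simp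
  \<comment> \<open>The factors that involve x alone, (t x - x) (t x - q x)/(x (x - x/q)), do not
    depend on x; at the node x/q they give the negative.\<close>
  define \<gamma> where "\<gamma> = q * (t - 1) * (t - q) / (q - 1)"
  have \<gamma>: "\<gamma> \<noteq> 0" using q t by (simp add: \<gamma>_def)
  \<comment> \<open>The term at 0 equals the leading coefficient, the contribution of infinity. The
    two cancel, which leaves the sums over Z and Z/q.\<close>
  have term0: "poly p 0 / (\<Prod>b\<in>A-{0}. 0 - b) = (- (t * q)) ^ m"
  proof -
    have "A - {0} = Z \<union> Z'" using n0 by (auto simp: A_def)
    then have "(\<Prod>b\<in>A-{0}. 0 - b) = (\<Prod>y\<in>Z. 0 - y) * (\<Prod>y\<in>Z. 0 - y / q)"
      by (simp only: prod.union_disjoint[OF fin fin'(1) disj] prodZ')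
    then have "(\<Prod>b\<in>A-{0}. 0 - b) = (\<Prod>y\<in>Z. (- y) * (- (y / q)))"
      by (simp only: prod.distrib diff_0)
    note den = this
    have "poly p 0 / (\<Prod>b\<in>A-{0}. 0 - b) = (\<Prod>y\<in>Z. - (t * q))"
      unfolding poly_p den prod_dividef[symmetric]
      using Z(1) q by (intro prod.cong refl) (simp add: field_simps)
    then show ?thesis by (simp add: m_def)
  qed
  have term1: "poly p x / (\<Prod>b\<in>A-{x}. x - b) =
      \<gamma> * (- q) ^ (m - 1) * (\<Prod>y\<in>Z-{x}. mac_weight t x y * mac_weight t y (q * x))" if x: "x \<in> Z" for x
  proof -
    have Ax: "A - {x} = insert 0 ((Z - {x}) \<union> Z')" "0 \<notin> (Z - {x}) \<union> Z'" "(Z - {x}) \<inter> Z' = {}"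
      using x n0 disj by (auto simp: A_def)
    have fx: "finite (Z - {x})" "finite ((Z - {x}) \<union> Z')" using fin fin' by auto
    have "(\<Prod>b\<in>A-{x}. x - b) = x * ((\<Prod>y\<in>Z-{x}. x - y) * (\<Prod>y\<in>Z. x - y / q))"
      by (simp only: Ax(1) prod.insert[OF fx(2) Ax(2)] prod.union_disjoint[OF fx(1) fin'(1) Ax(3)] prodZ' diff_0_right)
    also have "(\<Prod>y\<in>Z. x - y / q) = (x - x / q) * (\<Prod>y\<in>Z-{x}. x - y / q)"
      using x fin by (simp add: prod.remove)
    finally have den: "(\<Prod>b\<in>A-{x}. x - b) = x * (x - x / q) * (\<Prod>y\<in>Z-{x}. (x - y) * (x - y / q))"
      by (simp add: prod.distrib)
    have num: "poly p x = (t * x - x) * (t * x - q * x) * (\<Prod>y\<in>Z-{x}. (t * x - y) * (t * y - q * x))"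
      unfolding poly_p using x fin by (simp add: prod.remove)
    have "(t * x - x) * (t * x - q * x) / (x * (x - x / q)) = \<gamma>"
    proof -
      have "x * (x - x / q) = x * x * (q - 1) / q" using q by (simp add: field_simps)
      moreover have "(t * x - x) * (t * x - q * x) = x * x * ((t - 1) * (t - q))" by (simp add: algebra_simps)
      ultimately show ?thesis using Z(1)[OF x] by (simp add: \<gamma>_def)
    qed
    moreover have "(\<Prod>y\<in>Z-{x}. (t * x - y) * (t * y - q * x)) / (\<Prod>y\<in>Z-{x}. (x - y) * (x - y / q)) =
      (\<Prod>y\<in>Z-{x}. - q * (mac_weight t x y * mac_weight t y (q * x)))"
      unfolding prod_dividef[symmetric]
    proof (intro prod.cong refl)
      fix y assume y: "y \<in> Z - {x}"
      have "x - y / q = - (y - q * x) / q" using q by (simp add: field_simps)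
      then show "(t * x - y) * (t * y - q * x) / ((x - y) * (x - y / q)) = - q * (mac_weight t x y * mac_weight t y (q * x))"
        using q by (simp add: mac_weight_def del: minus_diff_eq)
    qed
    moreover have "card (Z - {x}) = m - 1" using x fin by (simp add: m_def)
    ultimately show ?thesis unfolding num den times_divide_times_eq[symmetric]
      by (simp only: prod.distrib prod_constant mult_ac)
  qed
  have term2: "poly p (x / q) / (\<Prod>b\<in>A-{x / q}. x / q - b) =
      - (\<gamma> * (- q) ^ (m - 1) * (\<Prod>y\<in>Z-{x}. mac_weight t y x * mac_weight t x (q * y)))" if x: "x \<in> Z" for x
  proof -
    have inj': "(\<lambda>x. x / q) ` (Z - {x}) = Z' - {x / q}" using q by (auto simp: Z'_def)
    have "x / q \<in> Z'" using x by (auto simp: Z'_def)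
    then have Ax: "A - {x / q} = insert 0 (Z \<union> (Z' - {x / q}))" "0 \<notin> Z \<union> (Z' - {x / q})" "Z \<inter> (Z' - {x / q}) = {}"
      using n0 disj by (auto simp: A_def)
    have fx: "finite (Z' - {x / q})" "finite (Z \<union> (Z' - {x / q}))" using fin fin' by auto
    have "(\<Prod>b\<in>A-{x / q}. x / q - b) = x / q * ((\<Prod>y\<in>Z. x / q - y) * (\<Prod>b\<in>Z'-{x / q}. x / q - b))"
      by (simp only: Ax(1) prod.insert[OF fx(2) Ax(2)] prod.union_disjoint[OF fin fx(1) Ax(3)] diff_0_right)
    also have "(\<Prod>b\<in>Z'-{x / q}. x / q - b) = (\<Prod>y\<in>Z-{x}. x / q - y / q)"
      unfolding inj'[symmetric] by (subst prod.reindex[OF inj_on_subset[OF inj]]) auto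
    also have "(\<Prod>y\<in>Z. x / q - y) = (x / q - x) * (\<Prod>y\<in>Z-{x}. x / q - y)"
      using x fin by (simp add: prod.remove)
    finally have den: "(\<Prod>b\<in>A-{x / q}. x / q - b) = x / q * (x / q - x) * (\<Prod>y\<in>Z-{x}. (x / q - y) * (x / q - y / q))"
      by (simp add: prod.distrib)
    have num: "poly p (x / q) = (t * (x / q) - x) * (t * x - q * (x / q)) * (\<Prod>y\<in>Z-{x}. (t * (x / q) - y) * (t * y - q * (x / q)))"
      unfolding poly_p using x fin by (simp add: prod.remove)
    have "(t * (x / q) - x) * (t * x - q * (x / q)) / (x / q * (x / q - x)) = - \<gamma>"
    proof -
      have "x / q * (x / q - x) = - (x * x * (q - 1) / (q * q))" using q by (simp add: field_simps)
      moreover have "(t * (x / q) - x) * (t * x - q * (x / q)) = x * x * ((t - 1) * (t - q)) / q" using q by (simp add: field_simps)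
      ultimately show ?thesis using Z(1)[OF x] q by (simp add: \<gamma>_def)
    qed
    moreover have "(\<Prod>y\<in>Z-{x}. (t * (x / q) - y) * (t * y - q * (x / q))) / (\<Prod>y\<in>Z-{x}. (x / q - y) * (x / q - y / q)) =
      (\<Prod>y\<in>Z-{x}. - q * (mac_weight t y x * mac_weight t x (q * y)))"
      unfolding prod_dividef[symmetric]
    proof (intro prod.cong refl)
      fix y assume y: "y \<in> Z - {x}"
      have "x / q - y = (x - q * y) / q" "x / q - y / q = - (y - x) / q" "t * (x / q) - y = (t * x - q * y) / q" "t * y - q * (x / q) = t * y - x"
        using q by (simp_all add: field_simps)
      then show "(t * (x / q) - y) * (t * y - q * (x / q)) / ((x / q - y) * (x / q - y / q)) = - q * (mac_weight t y x * mac_weight t x (q * y))"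
        using q by (simp add: mac_weight_def mult_ac del: minus_diff_eq)
    qed
    moreover have "card (Z - {x}) = m - 1" using x fin by (simp add: m_def)
    ultimately show ?thesis unfolding num den times_divide_times_eq[symmetric]
      by (simp only: prod.distrib prod_constant minus_mult_left mult_ac)
  qed
  have "(\<Sum>a\<in>A. poly p a / (\<Prod>b\<in>A-{a}. a - b)) = coeff p (2 * m)"
    using cardA degp by (intro lagrange_leading_coeff) auto
  moreover have "(\<Sum>a\<in>A. poly p a / (\<Prod>b\<in>A-{a}. a - b)) = poly p 0 / (\<Prod>b\<in>A-{0}. 0 - b) +
     ((\<Sum>x\<in>Z. poly p x / (\<Prod>b\<in>A-{x}. x - b)) + (\<Sum>x\<in>Z. poly p (x / q) / (\<Prod>b\<in>A-{x / q}. x / q - b)))"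
  proof -
    have "(\<Sum>a\<in>Z'. poly p a / (\<Prod>b\<in>A-{a}. a - b)) = (\<Sum>x\<in>Z. poly p (x / q) / (\<Prod>b\<in>A-{x / q}. x / q - b))"
      unfolding Z'_def by (subst sum.reindex[OF inj]) simp
    moreover have "(\<Sum>a\<in>A. f a) = f 0 + ((\<Sum>x\<in>Z. f x) + (\<Sum>x\<in>Z'. f x))" for f :: "'a \<Rightarrow> 'a"
      unfolding A_def using fin fin' n0 disj by (simp add: sum.union_disjoint)
    ultimately show ?thesis by simp
  qed
  ultimately have "(\<Sum>x\<in>Z. poly p x / (\<Prod>b\<in>A-{x}. x - b)) + (\<Sum>x\<in>Z. poly p (x / q) / (\<Prod>b\<in>A-{x / q}. x / q - b)) = 0"
    unfolding term0 lead by simp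
  then have "\<gamma> * (- q) ^ (m - 1) * ((\<Sum>x\<in>Z. \<Prod>y\<in>Z-{x}. mac_weight t x y * mac_weight t y (q * x)) -
    (\<Sum>x\<in>Z. \<Prod>y\<in>Z-{x}. mac_weight t y x * mac_weight t x (q * y))) = 0"
    by (simp add: term1 term2 sum_negf right_diff_distrib sum_distrib_left cong: sum.cong)
  then show ?thesis using \<gamma> q by simp
qed simp

text \<open>The composite of the shifts over I as one factor on each coefficient, so that the order
  of composition does not enter.\<close>

definition qshift_set :: "complex \<Rightarrow> nat set \<Rightarrow> xseries \<Rightarrow> xseries" where
  "qshift_set q I f = Abs_mfps (\<lambda>m. rc (\<Prod>i\<in>I. shift_weight q i m) * mfps_nth f m)"

lemma qshift_set_nth: "mfps_nth (qshift_set q I f) m = rc (\<Prod>i\<in>I. shift_weight q i m) * mfps_nth f m"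
  by (simp add: qshift_set_def)

lemma qshift_set_empty [simp]: "qshift_set q {} f = f"
  by (rule mfps_eqI) (simp add: qshift_set_nth rc_1)

lemma qshift_set_insert: "finite I \<Longrightarrow> i \<notin> I \<Longrightarrow> qshift_set q (insert i I) f = qshift q i (qshift_set q I f)"
  by (rule mfps_eqI) (simp add: qshift_set_nth qshift_nth rc_mult mult.assoc)

lemma qshift_set_singleton: "qshift_set q {i} f = qshift q i f"
  by (simp add: qshift_set_insert)

lemma qshift_commute_set: "qshift q i (qshift_set q I f) = qshift_set q I (qshift q i f)"
  by (rule mfps_eqI) (simp add: qshift_set_nth qshift_nth mult_ac)

lemma qshift_set_mult: "finite I \<Longrightarrow> q \<noteq> 0 \<Longrightarrow> qshift_set q I (f * g) = qshift_set q I f * qshift_set q I g"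
  by (induction I rule: finite_induct) (auto simp: qshift_set_insert qshift_mult)

lemma qshift_set_const [simp]: "finite I \<Longrightarrow> qshift_set q I (mfps_const c) = mfps_const c"
  by (induction I rule: finite_induct) (auto simp: qshift_set_insert)

lemma qshift_set_diff: "finite I \<Longrightarrow> qshift_set q I (f - g) = qshift_set q I f - qshift_set q I g"
  by (induction I rule: finite_induct) (auto simp: qshift_set_insert qshift_diff)

lemma qshift_set_sum: "finite I \<Longrightarrow> qshift_set q I (\<Sum>x\<in>A. F x) = (\<Sum>x\<in>A. qshift_set q I (F x))"
  by (induction I rule: finite_induct) (auto simp: qshift_set_insert qshift_sum)

lemma qshift_set_prod: "finite I \<Longrightarrow> q \<noteq> 0 \<Longrightarrow> qshift_set q I (\<Prod>x\<in>A. F x) = (\<Prod>x\<in>A. qshift_set q I (F x))"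
  by (induction I rule: finite_induct) (auto simp: qshift_set_insert qshift_prod)

lemma qshift_set_xv:
  "finite I \<Longrightarrow> I \<subseteq> {1..} \<Longrightarrow> qshift_set q I (xv j) = mfps_const (rc (if j \<in> I then q else 1)) * xv j"
  by (induction I rule: finite_induct) (auto simp: qshift_set_insert qshift_const_mult qshift_xv rc_1)

section \<open>Commutation of the operators\<close>

definition mac_coeff :: "complex \<Rightarrow> nat \<Rightarrow> nat set \<Rightarrow> xseries" where
  "mac_coeff t n I = (\<Prod>(i, j)\<in>I \<times> ({1..n} - I). D_factor t i j)"

definition mac_scalar :: "complex \<Rightarrow> nat \<Rightarrow> nat set \<Rightarrow> ratfun" where
  "mac_scalar t n I = (\<Prod>i\<in>I. sv i * rc (t powi (int i - int n)))"

definition mac_op :: "complex \<Rightarrow> complex \<Rightarrow> nat \<Rightarrow> nat \<Rightarrow> xseries \<Rightarrow> xseries" where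
  "mac_op q t n r f = (\<Sum>I | I \<subseteq> {1..n} \<and> card I = r. mac_coeff t n I * (mfps_const (mac_scalar t n I) * qshift_set q I f))"

lemma fold_T_lam:
  "finite I \<Longrightarrow> Finite_Set.fold (T_lam n q t) f I = mfps_const (mac_scalar t n I) * qshift_set q I f"
proof (induction I rule: finite_induct)
  case empty
  show ?case by (simp add: mac_scalar_def)
next
  case (insert i I)
  interpret comp_fun_commute "T_lam n q t" by (rule comp_fun_commute_T_lam)
  show ?case unfolding fold_insert[OF insert.hyps] insert.IH unfolding T_lam_def qshift_set_insert[OF insert.hyps]
      qshift_const_mult mac_scalar_def prod.insert[OF insert.hyps] mfps_const_mult
    by (simp only: mult_ac)
qed

lemma D_op_eq: "D_op n q t r f = mfps_const (rc (t ^ (r choose 2))) * mac_op q t n r f"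
proof -
  have "finite I" if "I \<subseteq> {1..n}" for I using that finite_subset by blast
  then show ?thesis
    unfolding D_op_def mac_op_def mac_coeff_def
    by (intro arg_cong2[of _ _ _ _ "(*)"] sum.cong refl) (auto simp: fold_T_lam)
qed

lemma mac_coeff_singleton: "mac_coeff t n {i} = (\<Prod>j\<in>{1..n}-{i}. D_factor t i j)"
  unfolding mac_coeff_def by (subst prod.cartesian_product[symmetric]) simp

lemma macd1_eq: "macd1 q t n sv f = (\<Sum>i\<in>{1..n}. mac_coeff t n {i} * (mfps_const (mac_scalar t n {i}) * qshift q i f))"
  by (simp add: macd1_def mac_coeff_singleton mac_scalar_def)

lemma const_xv_neq:
  assumes "i \<noteq> j" "a \<noteq> 0"
  shows "mfps_const a * xv i \<noteq> mfps_const b * xv j"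
proof
  assume eq: "mfps_const a * xv i = mfps_const b * xv j"
  let ?e = "\<lambda>i. \<Sum>a<i. Poly_Mapping.single a (1::nat)"
  have "mfps_nth (mfps_const a * xv i) (?e i) = mfps_nth (mfps_const b * xv j) (?e i)" by (simp only: eq)
  then have "?e i = ?e j" using assms(2) by (auto simp: xv_monom mfps_nth_monom split: if_splits)
  then have "xv i = xv j" by (simp only: xv_monom)
  then show False using assms(1) by (simp add: xv_eq_iff)
qed

text \<open>x_i after the shifts in S, in the fraction field of the series ring. There
  \<open>D_factor\<close> is a genuine quotient, and its products can be handled as rational
  functions.\<close>

definition xfrac :: "complex \<Rightarrow> nat set \<Rightarrow> nat \<Rightarrow> xseries fract" where
  "xfrac q S i = to_fract (mfps_const (rc (if i \<in> S then q else 1)) * xv i)"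

abbreviation const_frac :: "complex \<Rightarrow> xseries fract" where
  "const_frac c \<equiv> to_fract (mfps_const (rc c))"

lemma to_fract_prod: "to_fract (\<Prod>x\<in>A. f x) = (\<Prod>x\<in>A. to_fract (f x))"
  by (induction A rule: infinite_finite_induct) auto

lemma to_fract_sum: "to_fract (\<Sum>x\<in>A. f x) = (\<Sum>x\<in>A. to_fract (f x))"
  by (induction A rule: infinite_finite_induct) auto

lemma to_fract_D_factor:
  assumes "q \<noteq> 0" "finite S" "S \<subseteq> {1..}" "i \<noteq> j"
  shows "to_fract (qshift_set q S (D_factor t i j)) = mac_weight (const_frac t) (xfrac q S i) (xfrac q S j)"
proof -
  let ?c = "\<lambda>i. mfps_const (rc (if i \<in> S then q else 1)) * xv i"
  have ne: "?c i \<noteq> ?c j" using assms by (intro const_xv_neq) auto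
  have "qshift_set q S (D_factor t i j * (xv i - xv j)) = qshift_set q S (mfps_const (rc t) * xv i - xv j)"
    by (simp only: D_factor_mult[OF assms(4)])
  then have "qshift_set q S (D_factor t i j) * (?c i - ?c j) = mfps_const (rc t) * ?c i - ?c j"
    using assms by (simp add: qshift_set_mult qshift_set_diff qshift_set_xv)
  then have "to_fract (qshift_set q S (D_factor t i j)) * (xfrac q S i - xfrac q S j) = const_frac t * xfrac q S i - xfrac q S j"
    unfolding xfrac_def to_fract_diff[symmetric] to_fract_mult[symmetric] by (simp only: mult.assoc)
  moreover have "xfrac q S i - xfrac q S j \<noteq> 0" using ne by (simp add: xfrac_def del: to_fract_mult)
  ultimately show ?thesis unfolding mac_weight_def by (simp add: eq_divide_eq)
qed

lemma to_fract_mac_coeff: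
  assumes "q \<noteq> 0" "finite S" "S \<subseteq> {1..}"
  shows "to_fract (qshift_set q S (mac_coeff t n I)) =
    (\<Prod>a\<in>I. \<Prod>b\<in>{1..n}-I. mac_weight (const_frac t) (xfrac q S a) (xfrac q S b))"
  unfolding mac_coeff_def qshift_set_prod[OF assms(2,1)] to_fract_prod prod.cartesian_product case_prod_beta
  by (intro prod.cong refl to_fract_D_factor assms) auto

lemma mac_weight_scale: "c \<noteq> 0 \<Longrightarrow> mac_weight t (c * x) (c * y) = mac_weight t x y"
proof -
  assume c: "c \<noteq> 0"
  have "t * (c * x) - c * y = c * (t * x - y)" "c * x - c * y = c * (x - y)" by (simp_all add: algebra_simps)
  then show ?thesis using c by (simp add: mac_weight_def)
qed

context generic_params begin

abbreviation "\<xi> i \<equiv> xfrac q {} i"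
abbreviation "W \<equiv> mac_weight (const_frac t)"

lemma xfrac_in: "i \<in> S \<Longrightarrow> xfrac q S i = const_frac q * \<xi> i"
  and xfrac_out: "i \<notin> S \<Longrightarrow> xfrac q S i = \<xi> i"
  by (simp_all add: xfrac_def rc_1)

lemma const_frac_nz: "const_frac q \<noteq> 0" "const_frac q \<noteq> 1" "const_frac t \<noteq> 0" "const_frac t \<noteq> 1" "const_frac t \<noteq> const_frac q"
proof -
  have "mfps_const (rc a) = (mfps_const (rc b) :: xseries) \<longleftrightarrow> a = b" for a b
    using mfps_const_eq_0_iff[of "rc (a - b)"] by (simp add: rc_diff mfps_const_diff rc_eq_iff)
  note inj = this and inj1 = this[of _ 1, unfolded rc_1 mfps_const_1]
  have "to_fract (a :: xseries) = 1 \<longleftrightarrow> a = 1" for a using to_fract_eq_iff[of a 1] by simp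
  then show "const_frac q \<noteq> 0" "const_frac q \<noteq> 1" "const_frac t \<noteq> 0" "const_frac t \<noteq> 1" "const_frac t \<noteq> const_frac q"
    using q t q_gen[of 0] t_gen[of 0 0] t_gen[of 0 1] by (simp_all add: inj inj1)
qed

lemma \<xi>_neq: "\<xi> i \<noteq> 0" "i \<noteq> j \<Longrightarrow> \<xi> i \<noteq> \<xi> j" "\<xi> i \<noteq> const_frac q * \<xi> j"
proof -
  show nz: "\<xi> i \<noteq> 0" for i by (simp add: xfrac_def rc_1)
  show "i \<noteq> j \<Longrightarrow> \<xi> i \<noteq> \<xi> j" by (simp add: xfrac_def rc_1 xv_eq_iff)
  show "\<xi> i \<noteq> const_frac q * \<xi> j"
  proof (cases "i = j")
    case True
    then show ?thesis using nz[of j] const_frac_nz(2) by auto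
  next
    case False
    then have "mfps_const (rc 1) * xv i \<noteq> mfps_const (rc q) * xv j" by (intro const_xv_neq) auto
    then show ?thesis by (simp add: xfrac_def rc_1 flip: to_fract_mult)
  qed
qed

lemma to_fract_mac_coeff_0: "to_fract (mac_coeff t n I) = (\<Prod>a\<in>I. \<Prod>b\<in>{1..n}-I. W (\<xi> a) (\<xi> b))"
  using to_fract_mac_coeff[OF q, of "{}" t n I] by simp

text \<open>For i in I the two orders agree termwise: inside I all variables are multiplied by q
  together and the weights are homogeneous of degree 0, while between I and its complement the same
  factors occur.\<close>

lemma mac_coeff_commute_in:
  assumes I: "I \<subseteq> {1..n}" and i: "i \<in> I"
  shows "mac_coeff t n {i} * qshift q i (mac_coeff t n I) = mac_coeff t n I * qshift_set q I (mac_coeff t n {i})"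
proof -
  let ?C = "{1..n} - I" and ?I = "I - {i}"
  have finI: "finite I" using I finite_subset by blast
  have S: "{i} \<subseteq> {1..}" "I \<subseteq> {1..}" using I i by auto
  have xs: "xfrac q {i} i = const_frac q * \<xi> i" "\<And>b. b \<in> ?C \<Longrightarrow> xfrac q {i} b = \<xi> b" "\<And>a. a \<in> ?I \<Longrightarrow> xfrac q {i} a = \<xi> a"
    "xfrac q I i = const_frac q * \<xi> i" "\<And>a. a \<in> ?I \<Longrightarrow> xfrac q I a = const_frac q * \<xi> a" "\<And>b. b \<in> ?C \<Longrightarrow> xfrac q I b = \<xi> b"
    using i by (auto intro!: xfrac_in xfrac_out)
  have split: "{1..n} - {i} = ?I \<union> ?C" "?I \<inter> ?C = {}" "finite ?I" "finite ?C" using I i finI by auto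
  have sp: "(\<Prod>b\<in>{1..n}-{i}. f b) = (\<Prod>b\<in>?I. f b) * (\<Prod>b\<in>?C. f b)" for f :: "nat \<Rightarrow> xseries fract"
    unfolding split(1) by (rule prod.union_disjoint[OF split(3,4,2)])
  have ps: "(\<Prod>a\<in>{i}. f a) = f i" for f :: "nat \<Rightarrow> xseries fract" by simp
  have si: "(\<Prod>a\<in>I. f a) = f i * (\<Prod>a\<in>?I. f a)" for f :: "nat \<Rightarrow> xseries fract"
    using finI i by (rule prod.remove)
  have "to_fract (mac_coeff t n {i} * qshift_set q {i} (mac_coeff t n I)) =
    (\<Prod>b\<in>?I. W (\<xi> i) (\<xi> b)) * (\<Prod>b\<in>?C. W (\<xi> i) (\<xi> b)) *
    ((\<Prod>b\<in>?C. W (const_frac q * \<xi> i) (\<xi> b)) * (\<Prod>a\<in>?I. \<Prod>b\<in>?C. W (\<xi> a) (\<xi> b)))"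
  proof -
    have "(\<Prod>b\<in>?C. W (xfrac q {i} i) (xfrac q {i} b)) = (\<Prod>b\<in>?C. W (const_frac q * \<xi> i) (\<xi> b))"
      by (intro prod.cong refl) (simp only: xs)
    moreover have "(\<Prod>a\<in>?I. \<Prod>b\<in>?C. W (xfrac q {i} a) (xfrac q {i} b)) = (\<Prod>a\<in>?I. \<Prod>b\<in>?C. W (\<xi> a) (\<xi> b))"
      by (intro prod.cong refl) (simp only: xs)
    ultimately show ?thesis
      unfolding to_fract_mult to_fract_mac_coeff_0 to_fract_mac_coeff[OF q finite.insertI[OF finite.emptyI] S(1)] ps sp si
      by (simp only:)
  qed
  moreover have "to_fract (mac_coeff t n I * qshift_set q I (mac_coeff t n {i})) =
    (\<Prod>b\<in>?C. W (\<xi> i) (\<xi> b)) * (\<Prod>a\<in>?I. \<Prod>b\<in>?C. W (\<xi> a) (\<xi> b)) *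
    ((\<Prod>b\<in>?I. W (\<xi> i) (\<xi> b)) * (\<Prod>b\<in>?C. W (const_frac q * \<xi> i) (\<xi> b)))"
  proof -
    have "(\<Prod>b\<in>?I. W (xfrac q I i) (xfrac q I b)) = (\<Prod>b\<in>?I. W (\<xi> i) (\<xi> b))"
      by (intro prod.cong refl) (simp only: xs mac_weight_scale[OF const_frac_nz(1)])
    moreover have "(\<Prod>b\<in>?C. W (xfrac q I i) (xfrac q I b)) = (\<Prod>b\<in>?C. W (const_frac q * \<xi> i) (\<xi> b))"
      by (intro prod.cong refl) (simp only: xs)
    ultimately show ?thesis
      unfolding to_fract_mult to_fract_mac_coeff_0 to_fract_mac_coeff[OF q finI S(2)] ps sp si
      by (simp only:)
  qed
  ultimately have "to_fract (mac_coeff t n {i} * qshift_set q {i} (mac_coeff t n I)) = to_fract (mac_coeff t n I * qshift_set q I (mac_coeff t n {i}))"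
    by (simp only: mult_ac)
  then show ?thesis by (simp only: to_fract_eq_iff qshift_set_singleton)
qed

text \<open>For i outside I the orders agree only after summation over all ways to obtain K by
  adding i to I. The factors between K and its complement are common to these terms; what remains is
  \<open>mac_weight_identity\<close> for the variables of K.\<close>

lemma mac_coeff_commute_out:
  assumes K: "K \<subseteq> {1..n}"
  shows "(\<Sum>i\<in>K. mac_coeff t n {i} * qshift q i (mac_coeff t n (K - {i}))) =
    (\<Sum>i\<in>K. mac_coeff t n (K - {i}) * qshift_set q (K - {i}) (mac_coeff t n {i}))"
proof -
  let ?C = "{1..n} - K"
  have finK: "finite K" using K finite_subset by blast
  define B where "B = (\<Prod>a\<in>K. \<Prod>b\<in>?C. W (\<xi> a) (\<xi> b))"
  have L: "to_fract (mac_coeff t n {i} * qshift_set q {i} (mac_coeff t n (K - {i}))) =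
      B * (\<Prod>y\<in>K-{i}. W (\<xi> i) (\<xi> y) * W (\<xi> y) (const_frac q * \<xi> i))"
    and R: "to_fract (mac_coeff t n (K - {i}) * qshift_set q (K - {i}) (mac_coeff t n {i})) =
      B * (\<Prod>y\<in>K-{i}. W (\<xi> y) (\<xi> i) * W (\<xi> i) (const_frac q * \<xi> y))" if i: "i \<in> K" for i
  proof -
    let ?I = "K - {i}"
    have S: "{i} \<subseteq> {1..}" "?I \<subseteq> {1..}" "finite ?I" using K i finK by auto
    have xs: "xfrac q {i} i = const_frac q * \<xi> i" "\<And>b. b \<in> ?C \<Longrightarrow> xfrac q {i} b = \<xi> b" "\<And>a. a \<in> ?I \<Longrightarrow> xfrac q {i} a = \<xi> a"
      "xfrac q ?I i = \<xi> i" "\<And>a. a \<in> ?I \<Longrightarrow> xfrac q ?I a = const_frac q * \<xi> a" "\<And>b. b \<in> ?C \<Longrightarrow> xfrac q ?I b = \<xi> b"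
      using i by (auto intro!: xfrac_in xfrac_out)
    have split: "{1..n} - {i} = ?I \<union> ?C" "?I \<inter> ?C = {}" "finite ?I" "finite ?C" using K i finK by auto
    have sp: "(\<Prod>b\<in>{1..n}-{i}. f b) = (\<Prod>b\<in>?I. f b) * (\<Prod>b\<in>?C. f b)" for f :: "nat \<Rightarrow> xseries fract"
      unfolding split(1) by (rule prod.union_disjoint[OF split(3,4,2)])
    have ps: "(\<Prod>a\<in>{i}. f a) = f i" for f :: "nat \<Rightarrow> xseries fract" by simp
    have c: "{1..n} - ?I = insert i ?C" "i \<notin> ?C" "finite ?C" using K i by auto
    have sc: "(\<Prod>b\<in>{1..n} - ?I. f b) = f i * (\<Prod>b\<in>?C. f b)" for f :: "nat \<Rightarrow> xseries fract"
      unfolding c(1) by (rule prod.insert[OF c(3,2)])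
    have B: "B = (\<Prod>b\<in>?C. W (\<xi> i) (\<xi> b)) * (\<Prod>a\<in>?I. \<Prod>b\<in>?C. W (\<xi> a) (\<xi> b))"
      unfolding B_def using finK i by (rule prod.remove)
    have x1: "(\<Prod>a\<in>?I. W (xfrac q {i} a) (xfrac q {i} i)) = (\<Prod>a\<in>?I. W (\<xi> a) (const_frac q * \<xi> i))"
      by (intro prod.cong refl) (simp only: xs)
    have x2: "(\<Prod>a\<in>?I. \<Prod>b\<in>?C. W (xfrac q {i} a) (xfrac q {i} b)) = (\<Prod>a\<in>?I. \<Prod>b\<in>?C. W (\<xi> a) (\<xi> b))"
      by (intro prod.cong refl) (simp only: xs)
    have x3: "(\<Prod>b\<in>?I. W (xfrac q ?I i) (xfrac q ?I b)) = (\<Prod>b\<in>?I. W (\<xi> i) (const_frac q * \<xi> b))"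
      by (intro prod.cong refl) (simp only: xs)
    have x4: "(\<Prod>b\<in>?C. W (xfrac q ?I i) (xfrac q ?I b)) = (\<Prod>b\<in>?C. W (\<xi> i) (\<xi> b))"
      by (intro prod.cong refl) (simp only: xs)
    have "to_fract (mac_coeff t n {i} * qshift_set q {i} (mac_coeff t n ?I)) =
      (\<Prod>b\<in>?I. W (\<xi> i) (\<xi> b)) * (\<Prod>b\<in>?C. W (\<xi> i) (\<xi> b)) *
      ((\<Prod>a\<in>?I. W (\<xi> a) (const_frac q * \<xi> i)) * (\<Prod>a\<in>?I. \<Prod>b\<in>?C. W (\<xi> a) (\<xi> b)))"
      unfolding to_fract_mult to_fract_mac_coeff_0 to_fract_mac_coeff[OF q finite.insertI[OF finite.emptyI] S(1)] sc prod.distrib x1 x2 ps sp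
      by (simp only:)
    then show "to_fract (mac_coeff t n {i} * qshift_set q {i} (mac_coeff t n ?I)) =
      B * (\<Prod>y\<in>?I. W (\<xi> i) (\<xi> y) * W (\<xi> y) (const_frac q * \<xi> i))"
      unfolding B prod.distrib by (simp only: mult_ac)
    have "to_fract (mac_coeff t n ?I * qshift_set q ?I (mac_coeff t n {i})) =
      (\<Prod>a\<in>?I. W (\<xi> a) (\<xi> i)) * (\<Prod>a\<in>?I. \<Prod>b\<in>?C. W (\<xi> a) (\<xi> b)) *
      ((\<Prod>b\<in>?I. W (\<xi> i) (const_frac q * \<xi> b)) * (\<Prod>b\<in>?C. W (\<xi> i) (\<xi> b)))"
      unfolding to_fract_mult to_fract_mac_coeff_0 to_fract_mac_coeff[OF q S(3,2)] sc prod.distrib ps sp x3 x4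
      by (simp only:)
    then show "to_fract (mac_coeff t n ?I * qshift_set q ?I (mac_coeff t n {i})) =
      B * (\<Prod>y\<in>?I. W (\<xi> y) (\<xi> i) * W (\<xi> i) (const_frac q * \<xi> y))"
      unfolding B prod.distrib by (simp only: mult_ac)
  qed
  have iff: "\<xi> a = \<xi> b \<longleftrightarrow> a = b" for a b by (metis \<xi>_neq(2))
  have inj: "inj_on \<xi> A" for A by (rule inj_onI) (simp only: iff)
  have re: "(\<Sum>x\<in>\<xi> ` K. \<Prod>y\<in>\<xi> ` K - {x}. f x y) = (\<Sum>i\<in>K. \<Prod>j\<in>K-{i}. f (\<xi> i) (\<xi> j))" for f :: "_ \<Rightarrow> _ \<Rightarrow> xseries fract"
  proof -
    have "\<xi> ` K - {\<xi> i} = \<xi> ` (K - {i})" if "i \<in> K" for i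
      by (auto simp: iff)
    then show ?thesis
      by (simp only: sum.reindex[OF inj] prod.reindex[OF inj] o_def cong: sum.cong)
  qed
  have "(\<Sum>i\<in>K. \<Prod>y\<in>K-{i}. W (\<xi> i) (\<xi> y) * W (\<xi> y) (const_frac q * \<xi> i)) =
     (\<Sum>i\<in>K. \<Prod>y\<in>K-{i}. W (\<xi> y) (\<xi> i) * W (\<xi> i) (const_frac q * \<xi> y))"
    unfolding re[symmetric, of "\<lambda>x y. W x y * W y (const_frac q * x)"] re[symmetric, of "\<lambda>x y. W y x * W x (const_frac q * y)"]
    by (rule mac_weight_identity) (use const_frac_nz \<xi>_neq finK in auto)
  then have "to_fract (\<Sum>i\<in>K. mac_coeff t n {i} * qshift_set q {i} (mac_coeff t n (K - {i}))) =
    to_fract (\<Sum>i\<in>K. mac_coeff t n (K - {i}) * qshift_set q (K - {i}) (mac_coeff t n {i}))"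
    unfolding to_fract_sum by (simp add: L R sum_distrib_left[symmetric] del: to_fract_mult cong: sum.cong)
  then show ?thesis by (simp only: to_fract_eq_iff qshift_set_singleton)
qed

theorem macd1_mac_op_commute: "macd1 q t n sv (mac_op q t n r f) = mac_op q t n r (macd1 q t n sv f)"
proof -
  let ?S = "\<lambda>r. {I. I \<subseteq> {1..n} \<and> card I = r}"
  have finS: "finite (?S r)" for r by (rule finite_subset[of _ "Pow {1..n}"]) auto
  have finI: "finite I" if "I \<in> ?S r" for I r using that finite_subset[of I "{1..n}"] by auto
  define c where "c = mac_scalar t n"
  define A where "A = mac_coeff t n"
  define M where "M i I = mfps_const (c {i} * c I) * qshift q i (qshift_set q I f)" for i I
  have "macd1 q t n sv (mac_op q t n r f) = (\<Sum>i\<in>{1..n}. \<Sum>I\<in>?S r. A {i} * qshift q i (A I) * M i I)"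
    unfolding macd1_eq mac_op_def qshift_sum qshift_mult[OF q] sum_distrib_left M_def A_def c_def
    by (intro sum.cong refl) (simp add: mfps_const_mult mult_ac)
  also have "\<dots> = (\<Sum>I\<in>?S r. \<Sum>i\<in>{1..n}. A {i} * qshift q i (A I) * M i I)" by (rule sum.swap)
  finally have L: "macd1 q t n sv (mac_op q t n r f) = \<dots>" .
  have R: "mac_op q t n r (macd1 q t n sv f) = (\<Sum>I\<in>?S r. \<Sum>i\<in>{1..n}. A I * qshift_set q I (A {i}) * M i I)"
    unfolding mac_op_def
  proof (intro sum.cong refl)
    fix I assume I: "I \<in> ?S r"
    show "mac_coeff t n I * (mfps_const (mac_scalar t n I) * qshift_set q I (macd1 q t n sv f)) =
      (\<Sum>i\<in>{1..n}. A I * qshift_set q I (A {i}) * M i I)"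
      unfolding macd1_eq qshift_set_sum[OF finI[OF I]] qshift_set_mult[OF finI[OF I] q] sum_distrib_left M_def A_def c_def
      using finI[OF I] by (intro sum.cong refl) (simp add: mfps_const_mult qshift_commute_set mult_ac)
  qed
  \<comment> \<open>For i outside I the shift and the scalar depend only on
    \<open>insert i I\<close>, so these terms are grouped by that set. \<open>G\<close> is arbitrary
    because both orders are split in this way.\<close>
  have split: "(\<Sum>I\<in>?S r. \<Sum>i\<in>{1..n}. G i I * M i I) = (\<Sum>I\<in>?S r. \<Sum>i\<in>I. G i I * M i I) +
      (\<Sum>K\<in>?S (Suc r). (\<Sum>i\<in>K. G i (K - {i})) * (mfps_const (c K) * qshift_set q K f))" for G
  proof -
    have "(\<Sum>I\<in>?S r. \<Sum>i\<in>{1..n}. G i I * M i I) = (\<Sum>I\<in>?S r. (\<Sum>i\<in>I. G i I * M i I) + (\<Sum>i\<in>{1..n}-I. G i I * M i I))"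
      by (intro sum.cong refl) (auto simp: sum.subset_diff add.commute)
    also have "\<dots> = (\<Sum>I\<in>?S r. \<Sum>i\<in>I. G i I * M i I) + (\<Sum>I\<in>?S r. \<Sum>i\<in>{1..n}-I. G i I * M i I)"
      by (rule sum.distrib)
    also have "(\<Sum>I\<in>?S r. \<Sum>i\<in>{1..n}-I. G i I * M i I) = (\<Sum>(I, i)\<in>Sigma (?S r) (\<lambda>I. {1..n} - I). G i I * M i I)"
      using finS by (intro sum.Sigma) auto
    also have "\<dots> = (\<Sum>(K, i)\<in>Sigma (?S (Suc r)) (\<lambda>K. K). G i (K - {i}) * M i (K - {i}))"
    proof (rule sum.reindex_bij_witness[of _ "\<lambda>(K, i). (K - {i}, i)" "\<lambda>(I, i). (insert i I, i)"])
      fix p assume "p \<in> Sigma (?S r) (\<lambda>I. {1..n} - I)"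
      then obtain I i where p: "p = (I, i)" "I \<subseteq> {1..n}" "card I = r" "i \<in> {1..n}" "i \<notin> I" by auto
      then have fI: "finite I" using finite_subset by auto
      show "(case case p of (I, i) \<Rightarrow> (insert i I, i) of (K, i) \<Rightarrow> (K - {i}, i)) = p" using p by auto
      show "(case p of (I, i) \<Rightarrow> (insert i I, i)) \<in> Sigma (?S (Suc r)) (\<lambda>K. K)" using p fI by auto
      show "(case case p of (I, i) \<Rightarrow> (insert i I, i) of (K, i) \<Rightarrow> G i (K - {i}) * M i (K - {i})) = (case p of (I, i) \<Rightarrow> G i I * M i I)"
        using p by simp
    next
      fix p assume "p \<in> Sigma (?S (Suc r)) (\<lambda>K. K)"
      then obtain K i where p: "p = (K, i)" "K \<subseteq> {1..n}" "card K = Suc r" "i \<in> K" by auto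
      then have fK: "finite K" using finite_subset by auto
      show "(case case p of (K, i) \<Rightarrow> (K - {i}, i) of (I, i) \<Rightarrow> (insert i I, i)) = p" using p by auto
      show "(case p of (K, i) \<Rightarrow> (K - {i}, i)) \<in> Sigma (?S r) (\<lambda>I. {1..n} - I)" using p fK by auto
    qed
    also have "\<dots> = (\<Sum>K\<in>?S (Suc r). \<Sum>i\<in>K. G i (K - {i}) * M i (K - {i}))"
      by (rule sum.Sigma[OF finS ballI[OF finI], symmetric])
    also have "\<dots> = (\<Sum>K\<in>?S (Suc r). (\<Sum>i\<in>K. G i (K - {i})) * (mfps_const (c K) * qshift_set q K f))"
      unfolding sum_distrib_right
    proof (intro sum.cong refl)
      fix K i assume K: "K \<in> ?S (Suc r)" "i \<in> K"
      have fK: "finite K" by (rule finI[OF K(1)])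
      then have fK': "finite (K - {i})" by simp
      have "c K = c {i} * c (K - {i})" unfolding c_def mac_scalar_def using fK K(2) by (simp only: prod.remove[of K i] prod.insert finite.emptyI empty_iff not_False_eq_True prod.empty mult_1_right)
      moreover have "qshift_set q K f = qshift q i (qshift_set q (K - {i}) f)"
        using qshift_set_insert[OF fK', of i q f] K(2) by (simp only: insert_Diff Diff_iff singletonI simp_thms)
      ultimately show "G i (K - {i}) * M i (K - {i}) = G i (K - {i}) * (mfps_const (c K) * qshift_set q K f)"
        by (simp only: M_def)
    qed
    finally show ?thesis .
  qed
  have "(\<Sum>I\<in>?S r. \<Sum>i\<in>I. A {i} * qshift q i (A I) * M i I) = (\<Sum>I\<in>?S r. \<Sum>i\<in>I. A I * qshift_set q I (A {i}) * M i I)"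
    unfolding A_def by (intro sum.cong refl) (simp add: mac_coeff_commute_in)
  moreover have "(\<Sum>K\<in>?S (Suc r). (\<Sum>i\<in>K. A {i} * qshift q i (A (K - {i}))) * (mfps_const (c K) * qshift_set q K f)) =
    (\<Sum>K\<in>?S (Suc r). (\<Sum>i\<in>K. A (K - {i}) * qshift_set q (K - {i}) (A {i})) * (mfps_const (c K) * qshift_set q K f))"
    unfolding A_def
    by (rule sum.cong[OF refl], rule arg_cong2[of _ _ _ _ "(*)", OF mac_coeff_commute_out refl]) blast
  ultimately show ?thesis
    unfolding L R split[of "\<lambda>i I. A {i} * qshift q i (A I)"] split[of "\<lambda>i I. A I * qshift_set q I (A {i})"]
    by (simp only:)
qed

end

section \<open>Uniqueness of the eigenfunction\<close>

lemma splits_0: "splits 0 = {(0, 0)}"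
proof -
  have "a = 0 \<and> b = 0" if "a + b = (0 :: 'a \<Rightarrow>\<^sub>0 nat)" for a b
  proof -
    have "Poly_Mapping.lookup a v + Poly_Mapping.lookup b v = Poly_Mapping.lookup 0 v" for v
      unfolding lookup_add[symmetric] that ..
    then have 0: "Poly_Mapping.lookup a v = 0" "Poly_Mapping.lookup b v = 0" for v by simp_all
    have "a = 0" by (rule poly_mapping_eqI) (simp add: 0)
    moreover have "b = 0" by (rule poly_mapping_eqI) (simp add: 0)
    ultimately show ?thesis ..
  qed
  then have "splits 0 \<subseteq> {(0, 0 :: 'a \<Rightarrow>\<^sub>0 nat)}" unfolding splits_def by blast
  then show ?thesis by (force simp: splits_def)
qed

section \<open>Constant terms\<close>

lemma mfps_nth_mult_0: "mfps_nth (f * g) 0 = mfps_nth f 0 * mfps_nth g 0"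
  by (simp add: mfps_nth_times splits_0)

lemma mfps_nth_prod_0: "mfps_nth (\<Prod>x\<in>A. F x) 0 = (\<Prod>x\<in>A. mfps_nth (F x) 0)"
  by (induction A rule: infinite_finite_induct) (auto simp: mfps_nth_mult_0)

lemma xratio_nth_0: "i < j \<Longrightarrow> mfps_nth (xratio i j) 0 = 0"
proof -
  assume ij: "i < j"
  have "(\<Sum>a=i..<j. Poly_Mapping.single a (1::nat)) \<noteq> 0"
    using ij lookup_sum_single[of "{i..<j}" i] by auto
  then show ?thesis by (auto simp: xratio_monom mfps_nth_monom)
qed

lemma D_factor_nth_0: "i \<noteq> j \<Longrightarrow> mfps_nth (D_factor t i j) 0 = (if i < j then rc t else 1)"
proof -
  assume ij: "i \<noteq> j"
  have g: "mfps_nth (mfps_geom (xratio i j)) 0 = 1" if "i < j" for i j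
  proof -
    have "mfps_nth ((1 - xratio i j) * mfps_geom (xratio i j)) 0 = 1" by (simp add: mfps_geom_inverse[OF that])
    then show ?thesis by (simp add: mfps_nth_mult_0 xratio_nth_0[OF that])
  qed
  show ?thesis
  proof (cases "i < j")
    case True
    then show ?thesis by (simp add: D_factor_def mfps_nth_mult_0 g xratio_nth_0 mfps_const_nth)
  next
    case False
    then have "j < i" using ij by simp
    then show ?thesis using False by (simp add: D_factor_def mfps_nth_mult_0 g xratio_nth_0)
  qed
qed

lemma pairs_Sigma: "pairs n = Sigma {1..n} (\<lambda>i. {i<..n})"
  by (auto simp: pairs_def)

text \<open>At the constant term a factor becomes t for i < j and 1 for i > j. With t^(card I choose
  2) supplying the pairs inside I, each i in I collects t^(n-i), which cancels the t^(i-n) of the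
  scalar.\<close>

lemma mac_coeff_constant_term:
  assumes t: "t \<noteq> 0" and I: "I \<subseteq> {1..n}"
  shows "rc (t ^ (card I choose 2)) * (mfps_nth (mac_coeff t n I) 0 * mac_scalar t n I) = (\<Prod>i\<in>I. sv i)"
proof -
  have finI: "finite I" using I finite_atLeastAtMost by (rule finite_subset)
  have "mfps_nth (mac_coeff t n I) 0 = (\<Prod>(i, j)\<in>I \<times> ({1..n} - I). if i < j then rc t else 1)"
    unfolding mac_coeff_def mfps_nth_prod_0
  proof (rule prod.cong[OF refl])
    fix p assume p: "p \<in> I \<times> ({1..n} - I)"
    obtain i j where ij: "p = (i, j)" by (rule prod.exhaust)
    with p have "i \<noteq> j" by blast
    then show "mfps_nth (case p of (i, j) \<Rightarrow> D_factor t i j) 0 = (case p of (i, j) \<Rightarrow> if i < j then rc t else 1)"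
      unfolding ij case_prod_conv by (rule D_factor_nth_0)
  qed
  also have "\<dots> = (\<Prod>(i, j)\<in>pairs n. if i \<in> I \<and> j \<notin> I then rc t else 1)"
  proof (rule prod.mono_neutral_cong)
    show "finite (pairs n)" by (rule finite_pairs)
    show "finite (I \<times> ({1..n} - I))" by (intro finite_cartesian_product finI finite_Diff finite_atLeastAtMost)
    have in_pairs: "(i, j) \<in> pairs n" if "i \<in> I" "j \<in> {1..n} - I" "i < j" for i j
      using that I by (auto simp: pairs_def)
    show "(case p of (i, j) \<Rightarrow> if i < j then rc t else 1) = 1" if "p \<in> I \<times> ({1..n} - I) - pairs n" for p
    proof -
      obtain i j where p: "p = (i, j)" by (rule prod.exhaust)
      have "\<not> i < j"
      proof
        assume "i < j"
        then have "(i, j) \<in> pairs n" using in_pairs[of i j] that unfolding p by blast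
        then show False using that unfolding p by blast
      qed
      then show ?thesis by (simp add: p)
    qed
    show "(case p of (i, j) \<Rightarrow> if i \<in> I \<and> j \<notin> I then rc t else 1) = 1" if "p \<in> pairs n - I \<times> ({1..n} - I)" for p
      using that by (cases p) (auto simp: pairs_def)
    show "(case p of (i, j) \<Rightarrow> if i < j then rc t else 1) = (case p of (i, j) \<Rightarrow> if i \<in> I \<and> j \<notin> I then rc t else 1)"
      if "p \<in> I \<times> ({1..n} - I) \<inter> pairs n" for p
      using that by (cases p) (simp add: pairs_def)
  qed
  finally have "rc t ^ (card I choose 2) * mfps_nth (mac_coeff t n I) 0 =
     (\<Prod>p\<in>pairs n. (case p of (i, j) \<Rightarrow> if i \<in> I \<and> j \<in> I then rc t else 1) * (case p of (i, j) \<Rightarrow> if i \<in> I \<and> j \<notin> I then rc t else 1))"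
    by (simp only: power_choose_2_eq_prod[OF I] prod.distrib)
  also have "\<dots> = (\<Prod>(i, j)\<in>pairs n. if i \<in> I then rc t else 1)"
    by (intro prod.cong refl) auto
  also have "\<dots> = (\<Prod>i\<in>{1..n}. \<Prod>j\<in>{i<..n}. if i \<in> I then rc t else 1)"
    unfolding pairs_Sigma by (rule prod.Sigma[symmetric]) auto
  also have "\<dots> = (\<Prod>i\<in>{1..n}. if i \<in> I then rc t ^ (n - i) else 1)"
    by (intro prod.cong refl) auto
  also have "\<dots> = (\<Prod>i\<in>I. rc t ^ (n - i))" by (rule prod_subset_if[OF I finite_atLeastAtMost, symmetric])
  finally have "rc (t ^ (card I choose 2)) * (mfps_nth (mac_coeff t n I) 0 * mac_scalar t n I) =
     (\<Prod>i\<in>I. rc t ^ (n - i) * (sv i * rc (t powi (int i - int n))))"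
    by (simp only: rc_power mac_scalar_def prod.distrib mult.assoc[symmetric])
  also have "\<dots> = (\<Prod>i\<in>I. sv i)"
  proof (intro prod.cong refl)
    fix i assume "i \<in> I"
    then have "i \<le> n" using I by (meson atLeastAtMost_iff subsetD)
    then have "int i - int n = - int (n - i)" by (simp only: of_nat_diff minus_diff_eq)
    then have "t powi (int i - int n) = inverse (t ^ (n - i))" by (simp only: power_int_minus power_int_of_nat)
    then have "t ^ (n - i) * t powi (int i - int n) = 1" using t by simp
    then have 1: "rc t ^ (n - i) * rc (t powi (int i - int n)) = 1"
      by (simp only: rc_mult[symmetric] rc_power[symmetric] rc_1)
    have "rc t ^ (n - i) * (sv i * rc (t powi (int i - int n))) = sv i * (rc t ^ (n - i) * rc (t powi (int i - int n)))"
      by (simp only: mult_ac)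
    then show "rc t ^ (n - i) * (sv i * rc (t powi (int i - int n))) = sv i" by (simp only: 1 mult_1_right)
  qed
  finally show ?thesis .
qed

lemma sv_independent:
  assumes "finite A" "(\<Sum>i\<in>A. rc (c i) * sv i) = 0" "i \<in> A"
  shows "c i = 0"
proof -
  have e: "(\<Sum>i\<in>B. rc (c i) * sv i) = Fract (\<Sum>i\<in>B. Poly_Mapping.single (Poly_Mapping.single i 1) (c i)) 1" for B
    by (induction B rule: infinite_finite_induct) (auto simp: Zero_fract_def rc_def sv_def mult_single)
  have "(\<Sum>i\<in>A. Poly_Mapping.single (Poly_Mapping.single i (1::nat)) (c i)) = 0"
    using assms(2) unfolding e by (simp add: Zero_fract_def eq_fract)
  then have "0 = Poly_Mapping.lookup (\<Sum>i\<in>A. Poly_Mapping.single (Poly_Mapping.single i (1::nat)) (c i)) (Poly_Mapping.single i 1)"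
    by simp
  also have "\<dots> = (\<Sum>j\<in>A. if j = i then c i else 0)"
    unfolding lookup_sum
  proof (intro sum.cong refl)
    fix j
    have "Poly_Mapping.single j (1::nat) = Poly_Mapping.single i 1 \<longleftrightarrow> j = i"
      by (metis lookup_single_eq lookup_single_not_eq zero_neq_one)
    then show "Poly_Mapping.lookup (Poly_Mapping.single (Poly_Mapping.single j (1::nat)) (c j)) (Poly_Mapping.single i 1) = (if j = i then c i else 0)"
      by (simp add: lookup_single when_def)
  qed
  also have "\<dots> = c i" using assms by simp
  finally show ?thesis ..
qed

section \<open>Supports of the operators, and normalisation of the series\<close>

lemma supported_geom: "supported V z \<Longrightarrow> supported V (mfps_geom z)"
  unfolding mfps_geom_def by (intro supported_mfps_sum supported_power)

lemma supported_D_factor: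
  assumes "i \<in> {1..n}" "j \<in> {1..n}" "i \<noteq> j"
  shows "supported {1..<n} (D_factor t i j)"
proof -
  have x: "supported {1..<n} (xratio a b)" if "a \<in> {1..n}" "b \<in> {1..n}" for a b
    by (rule supported_mono[OF supported_xratio]) (use that in auto)
  show ?thesis unfolding D_factor_def using x assms
    by (auto intro!: supported_mult supported_diff supported_geom)
qed

lemma supported_mac_coeff: "I \<subseteq> {1..n} \<Longrightarrow> supported {1..<n} (mac_coeff t n I)"
  unfolding mac_coeff_def
proof (intro supported_prod)
  fix p assume I: "I \<subseteq> {1..n}" and p: "p \<in> I \<times> ({1..n} - I)"
  obtain i j where ij: "p = (i, j)" by force
  have "i \<in> {1..n}" "j \<in> {1..n}" "i \<noteq> j" using I p ij by auto
  then show "supported {1..<n} (case p of (i, j) \<Rightarrow> D_factor t i j)"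
    unfolding ij case_prod_conv by (rule supported_D_factor)
qed

lemma supported_qshift_set: "supported V f \<Longrightarrow> supported V (qshift_set q I f)"
  by (auto simp: supported_def qshift_set_nth)

lemma supported_mac_op: "supported {1..<n} f \<Longrightarrow> supported {1..<n} (mac_op q t n r f)"
  unfolding mac_op_def
  by (intro supported_sum supported_mult supported_qshift_set supported_mac_coeff supported_const) auto

lemma branch_coeff_0: "branch_coeff q t N \<sigma> (\<lambda>_. 0) = 1"
  by (simp add: branch_coeff_def coupling_def coupling2_def self_coupling_def case_prod_beta)

lemma last_sum_nth_0: "mfps_nth (last_sum N g) 0 = mfps_nth (g (\<lambda>_. 0)) 0"
proof -
  have "mfps_nth (last_sum N g) 0 = (\<Sum>\<mu>\<in>{\<lambda>_. 0}. mfps_nth (last_monom N \<mu> * g \<mu>) 0)"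
    unfolding last_sum_def
  proof (rule mfps_nth_mfps_sum)
    show "{\<mu> \<in> compositions N. mfps_nth (last_monom N \<mu> * g \<mu>) 0 \<noteq> 0} \<subseteq> {\<lambda>_. 0}"
    proof clarify
      fix \<mu> assume \<mu>: "\<mu> \<in> compositions N" and nz: "mfps_nth (last_monom N \<mu> * g \<mu>) 0 \<noteq> 0"
      obtain e where e: "last_monom N \<mu> = mfps_monom e 1" "Poly_Mapping.lookup e N = (\<Sum>i\<in>{1..N}. \<mu> i)"
        by (rule last_monom_monom)
      from nz have "e = 0" by (auto simp: mfps_nth_mult_0 e(1) mfps_nth_monom split: if_splits)
      then have "(\<Sum>i\<in>{1..N}. \<mu> i) = 0" using e(2) by simp
      then have z: "\<forall>i\<in>{1..N}. \<mu> i = 0" by (simp add: sum_eq_0_iff)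
      show "\<mu> = (\<lambda>_. 0)"
      proof
        fix i show "\<mu> i = 0" using z \<mu> by (cases "i \<in> {1..N}") (auto simp: compositions_def)
      qed
    qed
  qed (auto simp: compositions_def)
  then show ?thesis by (simp add: last_monom_def)
qed

lemma branch_series_nth_0: "mfps_nth (branch_series q t N \<sigma>) 0 = 1"
  by (induction N arbitrary: \<sigma>) (simp_all add: last_sum_nth_0 branch_coeff_0)

lemma macd1_diff: "macd1 q t n \<sigma> (f - g) = macd1 q t n \<sigma> f - macd1 q t n \<sigma> g"
  by (simp add: macd1_def qshift_diff right_diff_distrib sum_subtractf)

lemma macd1_const_mult: "macd1 q t n \<sigma> (mfps_const c * f) = mfps_const c * macd1 q t n \<sigma> f"
  unfolding macd1_def sum_distrib_left qshift_const_mult by (intro sum.cong refl) (simp only: mult_ac)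

lemma mac_op_const_mult: "mac_op q t n r (mfps_const c * f) = mfps_const c * mac_op q t n r f"
proof -
  have "qshift_set q I (mfps_const c * f) = mfps_const c * qshift_set q I f" for I
    by (rule mfps_eqI) (simp add: qshift_set_nth)
  then show ?thesis unfolding mac_op_def sum_distrib_left by (intro sum.cong refl) (simp only: mult_ac)
qed

lemma elementary_symmetric_generating:
  fixes s :: "nat \<Rightarrow> 'a::comm_ring_1"
  shows "(\<Sum>r=0..n. (- u) ^ r * (\<Sum>I | I \<subseteq> {1..n} \<and> card I = r. \<Prod>i\<in>I. s i)) = (\<Prod>i=1..n. 1 - u * s i)"
proof -
  have "(\<Prod>i=1..n. 1 - u * s i) = (\<Prod>i=1..n. (- u) * s i + 1)" by (simp add: algebra_simps)
  also have "\<dots> = (\<Sum>I\<in>Pow {1..n}. (\<Prod>i\<in>I. (- u) * s i) * (\<Prod>i\<in>{1..n}-I. 1))"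
    by (rule prod_add) simp
  also have "\<dots> = (\<Sum>I\<in>Pow {1..n}. (- u) ^ card I * (\<Prod>i\<in>I. s i))"
    by (intro sum.cong refl) (simp only: prod.distrib prod_constant prod.neutral_const power_one mult_1_right)
  also have "\<dots> = (\<Sum>r=0..n. \<Sum>I\<in>{I \<in> Pow {1..n}. card I = r}. (- u) ^ card I * (\<Prod>i\<in>I. s i))"
  proof (rule sum.group[symmetric])
    show "card ` Pow {1..n} \<subseteq> {0..n}" using card_mono[of "{1..n}"] by fastforce
  qed auto
  finally show ?thesis by (simp add: sum_distrib_left)
qed

context generic_params begin

lemma q_powi_eq_1: "q powi k = 1 \<Longrightarrow> k = 0"
proof (rule ccontr)
  assume 1: "q powi k = 1" and k: "k \<noteq> 0"
  have "k = int (Suc (nat \<bar>k\<bar> - 1)) \<or> k = - int (Suc (nat \<bar>k\<bar> - 1))" using k by linarith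
  then obtain a where "k = int (Suc a) \<or> k = - int (Suc a)" by blast
  then have "q ^ Suc a = 1"
  proof
    assume "k = - int (Suc a)"
    then have "inverse (q ^ Suc a) = 1" using 1 by (simp only: power_int_minus power_int_of_nat)
    then show ?thesis by (metis inverse_1 inverse_inverse_eq)
  qed (use 1 in \<open>simp only: power_int_of_nat\<close>)
  then show False using q_gen by blast
qed

text \<open>
  On a monomial of least degree in \<open>f\<close> the operator acts by its constant terms, hence by
  \<open>\<Sum> s\<^sub>i q\<^bsup>m\<^sub>i\<^esup>\<close>; since the \<open>s\<^sub>i\<close> are linearly independent over \<open>\<complex>\<close>, all \<open>q\<^bsup>m\<^sub>i\<^esup>\<close> are \<open>1\<close>.
\<close>

lemma macd1_eigen_unique:
  assumes f: "supported {1..<n} f" and f0: "mfps_nth f 0 = 0"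
    and eig: "macd1 q t n sv f = mfps_const (\<Sum>i\<in>{1..n}. sv i) * f"
  shows "f = 0"
proof (rule ccontr)
  assume "f \<noteq> 0"
  then have ex: "\<exists>m. mfps_nth f m \<noteq> 0" using mfps_eqI[of f 0] by auto
  define deg where "deg m = (\<Sum>v\<in>{1..<n}. Poly_Mapping.lookup m v)" for m :: "nat \<Rightarrow>\<^sub>0 nat"
  obtain m where m: "mfps_nth f m \<noteq> 0" and least: "\<And>m'. mfps_nth f m' \<noteq> 0 \<Longrightarrow> deg m \<le> deg m'"
    using ex_has_least_nat[of "\<lambda>m. mfps_nth f m \<noteq> 0" _ deg] ex by metis
  have keys_m: "Poly_Mapping.keys m \<subseteq> {1..<n}" using f m by (auto simp: supported_def)
  have summand: "mfps_nth (mac_coeff t n {i} * (mfps_const (mac_scalar t n {i}) * qshift q i f)) m =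
      mfps_nth (mac_coeff t n {i}) 0 * mac_scalar t n {i} * (rc (shift_weight q i m) * mfps_nth f m)" for i
  proof -
    let ?g = "\<lambda>p. mfps_nth (mac_coeff t n {i}) (fst p) * (mac_scalar t n {i} * (rc (shift_weight q i (snd p)) * mfps_nth f (snd p)))"
    have "mfps_nth (mac_coeff t n {i} * (mfps_const (mac_scalar t n {i}) * qshift q i f)) m = (\<Sum>p\<in>splits m. ?g p)"
      unfolding mfps_nth_times[of "mac_coeff t n {i}"] by (simp add: case_prod_beta qshift_nth)
    also have "\<dots> = (\<Sum>p\<in>splits m. if p = (0, m) then ?g (0, m) else 0)"
    proof (intro sum.cong refl)
      fix p assume p: "p \<in> splits m"
      obtain a b where ab: "p = (a, b)" by force
      with p have m_ab: "a + b = m" by (simp add: splits_def)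
      have "mfps_nth f b = 0" if "p \<noteq> (0, m)"
      proof (rule ccontr)
        assume "mfps_nth f b \<noteq> 0"
        then have "deg m \<le> deg b" by (rule least)
        moreover have "deg m = deg a + deg b" unfolding m_ab[symmetric] by (simp add: deg_def lookup_add sum.distrib)
        ultimately have "deg a = 0" by simp
        then have a0: "Poly_Mapping.lookup a v = 0" if "v \<in> {1..<n}" for v using that by (simp add: deg_def)
        have "a = 0"
        proof (rule poly_mapping_eqI)
          fix v
          show "Poly_Mapping.lookup a v = Poly_Mapping.lookup 0 v"
          proof (cases "v \<in> {1..<n}")
            case False
            then have "v \<notin> Poly_Mapping.keys (a + b)" using keys_m m_ab by auto
            then show ?thesis by (simp add: in_keys_iff lookup_add)
          qed (simp add: a0)
        qed
        then show False using that m_ab ab by simp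
      qed
      then show "?g p = (if p = (0, m) then ?g (0, m) else 0)" using ab by auto
    qed
    also have "\<dots> = ?g (0, m)" by (subst sum.delta[OF finite_splits]) (simp add: splits_def)
    finally show ?thesis by (simp add: mult.assoc)
  qed
  have "mfps_nth (mac_coeff t n {i}) 0 * mac_scalar t n {i} = sv i" if "i \<in> {1..n}" for i
    using mac_coeff_constant_term[OF t, of "{i}" n] that by (simp add: rc_1 binomial_eq_0)
  then have "mfps_nth (macd1 q t n sv f) m = (\<Sum>i\<in>{1..n}. sv i * (rc (shift_weight q i m) * mfps_nth f m))"
    unfolding macd1_eq mfps_nth_sum summand by (intro sum.cong refl) simp
  moreover have "mfps_nth (macd1 q t n sv f) m = (\<Sum>i\<in>{1..n}. sv i * mfps_nth f m)"
    unfolding eig by (simp add: sum_distrib_right)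
  ultimately have "(\<Sum>i\<in>{1..n}. sv i * (rc (shift_weight q i m) * mfps_nth f m)) - (\<Sum>i\<in>{1..n}. sv i * mfps_nth f m) = 0"
    by simp
  then have "(\<Sum>i\<in>{1..n}. rc (shift_weight q i m - 1) * sv i) * mfps_nth f m = 0"
    unfolding sum_subtractf[symmetric] sum_distrib_right by (simp add: rc_diff rc_1 algebra_simps)
  then have "(\<Sum>i\<in>{1..n}. rc (shift_weight q i m - 1) * sv i) = 0" using m by simp
  then have "shift_weight q i m = 1" if "i \<in> {1..n}" for i
    using sv_independent[OF finite_atLeastAtMost _ that, of "\<lambda>i. shift_weight q i m - 1"] by simp
  then have step: "Poly_Mapping.lookup m (i - 1) = Poly_Mapping.lookup m i" if "i \<in> {1..n}" for i
    using q_powi_eq_1[of "int (Poly_Mapping.lookup m (i - 1)) - int (Poly_Mapping.lookup m i)"] that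
    unfolding shift_weight_def by simp
  \<comment> \<open>Consecutive exponents of m are equal, and the chain starts at the variable 0,
    which does not occur in f; so all of them vanish.\<close>
  have m0: "Poly_Mapping.lookup m 0 = 0" using keys_m by (auto simp: in_keys_iff subset_iff)
  have m_zero: "i \<le> n \<Longrightarrow> Poly_Mapping.lookup m i = 0" for i
  proof (induction i)
    case (Suc i)
    then show ?case using step[of "Suc i"] by simp
  qed (simp add: m0)
  have "Poly_Mapping.keys m = {}"
  proof (rule equals0I)
    fix v assume v: "v \<in> Poly_Mapping.keys m"
    then have "v \<le> n" using keys_m by auto
    from m_zero[OF this] v show False by (simp add: in_keys_iff)
  qed
  then have "m = 0" by simp
  then show False using m f0 by simp
qed

theorem D_op_branch_series:
  "D_op n q t r (branch_series q t n sv) =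
     mfps_const (\<Sum>I | I \<subseteq> {1..n} \<and> card I = r. \<Prod>i\<in>I. sv i) * branch_series q t n sv"
proof -
  define p where "p = branch_series q t n sv"
  define e where "e = (\<Sum>I | I \<subseteq> {1..n} \<and> card I = r. \<Prod>i\<in>I. sv i)"
  define k where "k = rc (t ^ (r choose 2))"
  define f where "f = mfps_const k * mac_op q t n r p - mfps_const e * p"
  have eig: "macd1 q t n sv p = mfps_const (\<Sum>i\<in>{1..n}. sv i) * p"
    unfolding p_def by (rule macd1_branch_series[OF scaled_indets_sv])
  have "supported {1..<n} p" unfolding p_def by (rule supported_branch_series)
  then have "supported {1..<n} f"
    unfolding f_def by (intro supported_diff supported_mult supported_const supported_mac_op)
  moreover have "mfps_nth f 0 = 0"
  proof -
    have "k * mfps_nth (mac_op q t n r p) 0 = e"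
      unfolding mac_op_def mfps_nth_sum sum_distrib_left e_def
    proof (intro sum.cong refl)
      fix I assume I: "I \<in> {I. I \<subseteq> {1..n} \<and> card I = r}"
      show "k * mfps_nth (mac_coeff t n I * (mfps_const (mac_scalar t n I) * qshift_set q I p)) 0 = (\<Prod>i\<in>I. sv i)"
        using mac_coeff_constant_term[OF t, of I n] I
        by (simp add: mfps_nth_mult_0 k_def qshift_set_nth p_def branch_series_nth_0 rc_1 mfps_const_nth)
    qed
    then show ?thesis by (simp add: f_def p_def branch_series_nth_0)
  qed
  moreover have "macd1 q t n sv f = mfps_const (\<Sum>i\<in>{1..n}. sv i) * f"
    unfolding f_def macd1_diff macd1_const_mult macd1_mac_op_commute eig mac_op_const_mult
    by (simp add: algebra_simps)
  ultimately have "f = 0" by (rule macd1_eigen_unique)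
  then show ?thesis by (simp add: f_def D_op_eq k_def e_def p_def)
qed

theorem D_gen_branch_series:
  "D_gen n q t u (branch_series q t n sv) = branch_series q t n sv * mfps_const (\<Prod>i=1..n. 1 - u * sv i)"
proof -
  have "D_gen n q t u (branch_series q t n sv) =
    mfps_const (\<Sum>r=0..n. (- u) ^ r * (\<Sum>I | I \<subseteq> {1..n} \<and> card I = r. \<Prod>i\<in>I. sv i)) * branch_series q t n sv"
    unfolding D_gen_def D_op_branch_series mfps_const_sum[of _ "{0..n}"] sum_distrib_right[of _ "{0..n}"] mfps_const_mult
    by (simp only: mult.assoc)
  then show ?thesis unfolding elementary_symmetric_generating by (simp only: mult.commute)
qed

end

section \<open>The series $p_n$ as an iterated sum\<close>

text \<open>c_n column by column: N stands for the column N + 1, whose spectrum is divided by q to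
  the row sums of the later columns. The column 1 contributes 1.\<close>

definition series_coeff :: "'a::field \<Rightarrow> 'a \<Rightarrow> nat \<Rightarrow> (nat \<Rightarrow> 'a) \<Rightarrow> (nat \<Rightarrow> nat \<Rightarrow> nat) \<Rightarrow> 'a" where
  "series_coeff q t n \<sigma> \<theta> =
     (\<Prod>N<n. branch_coeff q t N (\<lambda>i. \<sigma> i / q ^ (\<Sum>a=Suc (Suc N)..n. \<theta> i a)) (\<lambda>i. \<theta> i (Suc N)))"

lemma series_coeff_Suc:
  "series_coeff q t (Suc n) \<sigma> \<theta> =
     branch_coeff q t n \<sigma> (\<lambda>i. \<theta> i (Suc n)) * series_coeff q t n (\<lambda>i. \<sigma> i / q ^ \<theta> i (Suc n)) \<theta>"
proof -
  have "(\<Sum>a=Suc (Suc N)..Suc n. \<theta> i a) = (\<Sum>a=Suc (Suc N)..n. \<theta> i a) + \<theta> i (Suc n)" if "N < n" for N i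
    using that by simp
  then have "\<sigma> i / q ^ (\<Sum>a=Suc (Suc N)..Suc n. \<theta> i a) = \<sigma> i / q ^ \<theta> i (Suc n) / q ^ (\<Sum>a=Suc (Suc N)..n. \<theta> i a)"
    if "N < n" for N i
    using that by (simp only: power_add) (simp only: divide_divide_eq_left mult.commute)
  then have "(\<Prod>N<n. branch_coeff q t N (\<lambda>i. \<sigma> i / q ^ (\<Sum>a=Suc (Suc N)..Suc n. \<theta> i a)) (\<lambda>i. \<theta> i (Suc N))) =
    series_coeff q t n (\<lambda>i. \<sigma> i / q ^ \<theta> i (Suc n)) \<theta>"
    unfolding series_coeff_def by (intro prod.cong refl) (simp only: lessThan_iff)
  then show ?thesis unfolding series_coeff_def[of q t "Suc n"] prod.lessThan_Suc by (simp add: mult.commute)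
qed

lemma series_coeff_cong:
  assumes "\<And>i j. (i, j) \<in> pairs n \<Longrightarrow> \<theta> i j = \<eta> i j"
  shows "series_coeff q t n \<sigma> \<theta> = series_coeff q t n \<sigma> \<eta>"
  unfolding series_coeff_def
proof (intro prod.cong refl branch_coeff_cong)
  fix N i assume "N \<in> {..<n}" "i \<in> {1..Suc N}"
  then have "(\<Sum>a=Suc (Suc N)..n. \<theta> i a) = (\<Sum>a=Suc (Suc N)..n. \<eta> i a)"
    by (intro sum.cong refl assms) (auto simp: pairs_def)
  then show "\<sigma> i / q ^ (\<Sum>a=Suc (Suc N)..n. \<theta> i a) = \<sigma> i / q ^ (\<Sum>a=Suc (Suc N)..n. \<eta> i a)" by simp
qed (auto intro!: assms simp: pairs_def)

text \<open>The powers of q in c_n are ratios of the rescaled parameters \<open>\<tau>\<close>. The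
  pairs (i, k) of the first product become the couplings to the last parameter, and the diagonal of
  the second becomes the self-coupling.\<close>

lemma c_coeff_eq_series_coeff:
  assumes q: "q \<noteq> 0"
  shows "c_coeff n q t \<theta> = series_coeff (rc q) (rc t) n sv \<theta>"
proof -
  define \<tau> where "\<tau> N i = sv i / rc q ^ (\<Sum>a=Suc (Suc N)..n. \<theta> i a)" for N i
  have R: "rc (q powi theta_diff n \<theta> (Suc N) i j) * (sv j / sv i) = \<tau> N j / \<tau> N i" for N i j
  proof -
    have "theta_diff n \<theta> (Suc N) i j = int (\<Sum>a=Suc (Suc N)..n. \<theta> i a) - int (\<Sum>a=Suc (Suc N)..n. \<theta> j a)"
      by (simp only: theta_diff_def sum_subtractf of_nat_sum Suc_eq_plus1)
    then have "q powi theta_diff n \<theta> (Suc N) i j = q ^ (\<Sum>a=Suc (Suc N)..n. \<theta> i a) / q ^ (\<Sum>a=Suc (Suc N)..n. \<theta> j a)"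
      using q by (simp only: power_int_diff power_int_of_nat not_False_eq_True simp_thms)
    then show ?thesis by (simp only: \<tau>_def rc_divide rc_power) (simp add: field_simps)
  qed
  have A: "qpoch (rc q) (rc (q powi theta_diff n \<theta> (Suc N) i j * t) * sv j / sv i) (\<theta> i (Suc N)) /
        qpoch (rc q) (rc (q powi theta_diff n \<theta> (Suc N) i j * q) * sv j / sv i) (\<theta> i (Suc N)) =
      coupling (rc q) (rc t) (\<tau> N j / \<tau> N i) (\<theta> i (Suc N))" for N i j
    unfolding coupling_def R[symmetric] by (simp add: rc_mult mult_ac)
  have B: "qpoch (rc q) (rc (q powi (- int (\<theta> j (Suc N)) + theta_diff n \<theta> (Suc N) i j) * q / t) * sv j / sv i) (\<theta> i (Suc N)) /
        qpoch (rc q) (rc (q powi (- int (\<theta> j (Suc N)) + theta_diff n \<theta> (Suc N) i j)) * sv j / sv i) (\<theta> i (Suc N)) =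
      coupling2 (rc q) (rc t) (\<tau> N j / \<tau> N i) (\<theta> i (Suc N)) (\<theta> j (Suc N))" for N i j
  proof -
    have "q powi (- int (\<theta> j (Suc N)) + theta_diff n \<theta> (Suc N) i j) = q powi theta_diff n \<theta> (Suc N) i j / q ^ \<theta> j (Suc N)"
      by (simp only: power_int_add[OF disjI1[OF q]] power_int_minus power_int_of_nat divide_inverse mult.commute)
    then show ?thesis unfolding coupling2_def R[symmetric] by (simp add: rc_mult rc_divide rc_power mult_ac)
  qed
  have \<tau>_nz: "\<tau> N i \<noteq> 0" for N i using q by (simp add: \<tau>_def)
  have S: "coupling2 (rc q) (rc t) 1 a a = self_coupling (rc q) (rc t) a" for a
    by (simp add: coupling2_def self_coupling_def)
  have pairs_le: "{(i, j). 1 \<le> i \<and> i \<le> j \<and> j < Suc N} = pairs N \<union> (\<lambda>i. (i, i)) ` {1..N}" for N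
    by (auto simp: pairs_def)
  have D: "(\<Prod>(i, j) \<in> {(i, j). 1 \<le> i \<and> i \<le> j \<and> j < Suc N}. coupling2 (rc q) (rc t) (\<tau> N j / \<tau> N i) (\<theta> i (Suc N)) (\<theta> j (Suc N))) =
    (\<Prod>(i, j)\<in>pairs N. coupling2 (rc q) (rc t) (\<tau> N j / \<tau> N i) (\<theta> i (Suc N)) (\<theta> j (Suc N))) *
    (\<Prod>i\<in>{1..N}. self_coupling (rc q) (rc t) (\<theta> i (Suc N)))" for N
  proof -
    have "pairs N \<inter> (\<lambda>i. (i, i)) ` {1..N} = {}" by (auto simp: pairs_def)
    moreover have "inj_on (\<lambda>i. (i, i)) {1..N}" by (auto simp: inj_on_def)
    ultimately show ?thesis unfolding pairs_le
      by (simp add: prod.union_disjoint prod.reindex S \<tau>_nz)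
  qed
  have "c_coeff n q t \<theta> = (\<Prod>k=2..n. branch_coeff (rc q) (rc t) (k - 1) (\<tau> (k - 1)) (\<lambda>i. \<theta> i k))"
    unfolding c_coeff_def prod.distrib[symmetric]
  proof (intro prod.cong refl)
    fix k assume "k \<in> {2..n}"
    then obtain N where k: "k = Suc N" by (cases k) auto
    show "(\<Prod>(i, j) \<in> {(i, j). 1 \<le> i \<and> i < j \<and> j \<le> k}.
        qpoch (rc q) (rc (q powi theta_diff n \<theta> k i j * t) * sv j / sv i) (\<theta> i k) /
        qpoch (rc q) (rc (q powi theta_diff n \<theta> k i j * q) * sv j / sv i) (\<theta> i k)) *
     (\<Prod>(i, j) \<in> {(i, j). 1 \<le> i \<and> i \<le> j \<and> j < k}.
        qpoch (rc q) (rc (q powi (- int (\<theta> j k) + theta_diff n \<theta> k i j) * q / t) * sv j / sv i) (\<theta> i k) /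
        qpoch (rc q) (rc (q powi (- int (\<theta> j k) + theta_diff n \<theta> k i j)) * sv j / sv i) (\<theta> i k)) =
     branch_coeff (rc q) (rc t) (k - 1) (\<tau> (k - 1)) (\<lambda>i. \<theta> i k)"
      unfolding k A B D pairs_def[symmetric] diff_Suc_1 branch_coeff_def
      by (simp only: prod_pairs_Suc case_prod_unfold fst_conv snd_conv prod.distrib mult_ac)
  qed
  also have "\<dots> = (\<Prod>k=1..n. branch_coeff (rc q) (rc t) (k - 1) (\<tau> (k - 1)) (\<lambda>i. \<theta> i k))"
  proof (rule prod.mono_neutral_left)
    show "\<forall>k\<in>{1..n} - {2..n}. branch_coeff (rc q) (rc t) (k - 1) (\<tau> (k - 1)) (\<lambda>i. \<theta> i k) = 1"
    proof
      fix k assume "k \<in> {1..n} - {2..n}"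
      then have "k - 1 = 0" by auto
      then show "branch_coeff (rc q) (rc t) (k - 1) (\<tau> (k - 1)) (\<lambda>i. \<theta> i k) = 1"
        by (simp add: branch_coeff_def pairs_def case_prod_beta prod.neutral)
    qed
  qed auto
  also have "\<dots> = (\<Prod>N<n. branch_coeff (rc q) (rc t) N (\<tau> N) (\<lambda>i. \<theta> i (Suc N)))"
    by (rule prod.reindex_bij_witness[of _ Suc "\<lambda>k. k - 1"]) auto
  finally show ?thesis unfolding series_coeff_def \<tau>_def[abs_def] .
qed

section \<open>Splitting off the last column\<close>

definition add_column :: "nat \<Rightarrow> (nat \<Rightarrow> nat) \<times> (nat \<Rightarrow> nat \<Rightarrow> nat) \<Rightarrow> nat \<Rightarrow> nat \<Rightarrow> nat" where
  "add_column n p i j = (if j = Suc n then fst p i else snd p i j)"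

lemma add_column_simps: "add_column n p i (Suc n) = fst p i" "j \<le> n \<Longrightarrow> add_column n p i j = snd p i j"
  by (simp_all add: add_column_def)

lemma inj_on_add_column: "inj_on (add_column n) (compositions n \<times> Mtheta n)"
proof (rule inj_onI)
  fix p p' assume p: "p \<in> compositions n \<times> Mtheta n" "p' \<in> compositions n \<times> Mtheta n" and eq: "add_column n p = add_column n p'"
  have "fst p i = fst p' i" for i using fun_cong[OF fun_cong[OF eq], of i "Suc n"] by (simp only: add_column_simps)
  moreover have "snd p i j = snd p' i j" for i j
  proof (cases "j \<le> n")
    case True
    then show ?thesis using fun_cong[OF fun_cong[OF eq], of i j] by (simp only: add_column_simps)
  next
    case False
    then show ?thesis using p by (auto simp: Mtheta_def)
  qed
  ultimately show "p = p'" by (intro prod_eqI ext)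
qed

lemma add_column_image: "add_column n ` (compositions n \<times> Mtheta n) = Mtheta (Suc n)"
proof
  show "add_column n ` (compositions n \<times> Mtheta n) \<subseteq> Mtheta (Suc n)"
    by (auto simp: Mtheta_def compositions_def add_column_def)
  show "Mtheta (Suc n) \<subseteq> add_column n ` (compositions n \<times> Mtheta n)"
  proof
    fix \<theta> assume \<theta>: "\<theta> \<in> Mtheta (Suc n)"
    let ?p = "(\<lambda>i. \<theta> i (Suc n), \<lambda>i j. if j \<le> n then \<theta> i j else 0)"
    have "\<theta> = add_column n ?p"
      using \<theta> by (intro ext) (auto simp: add_column_def Mtheta_def)
    moreover have "?p \<in> compositions n \<times> Mtheta n" using \<theta> by (auto simp: Mtheta_def compositions_def)
    ultimately show "\<theta> \<in> add_column n ` (compositions n \<times> Mtheta n)" by (rule image_eqI)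
  qed
qed

lemma xmonom_add_column: "xmonom (Suc n) (add_column n p) = last_monom n (fst p) * xmonom n (snd p)"
proof -
  have "(\<Prod>(i, j)\<in>pairs n. xratio i j ^ add_column n p i j) = (\<Prod>(i, j)\<in>pairs n. xratio i j ^ snd p i j)"
    by (intro prod.cong refl) (auto simp: pairs_def add_column_simps)
  then show ?thesis
    unfolding xmonom_def pairs_def[symmetric] last_monom_def prod_pairs_Suc
    by (simp only: case_prod_conv add_column_simps mult.commute)
qed

lemma series_coeff_add_column:
  "series_coeff q t (Suc n) \<sigma> (add_column n p) =
     branch_coeff q t n \<sigma> (fst p) * series_coeff q t n (\<lambda>i. \<sigma> i / q ^ fst p i) (snd p)"
  unfolding series_coeff_Suc add_column_simps
  by (intro arg_cong2[of _ _ _ _ "(*)"] series_coeff_cong refl) (auto simp: pairs_def add_column_simps)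

text \<open>A matrix is its last column together with a smaller matrix. The iterated sum equals the
  sum over pairs because every monomial receives only finitely many contributions.\<close>

lemma branch_series_eq_sum:
  "branch_series q t n \<sigma> = mfps_sum (\<lambda>\<theta>. mfps_const (series_coeff (rc q) (rc t) n \<sigma> \<theta>) * xmonom n \<theta>) (Mtheta n)"
proof (induction n arbitrary: \<sigma>)
  case 0
  have "Mtheta 0 = {\<lambda>_ _. 0}" by (auto simp: Mtheta_def)
  moreover have "xmonom 0 \<theta> = 1" for \<theta> unfolding xmonom_def by (rule prod.neutral) auto
  ultimately have "mfps_sum (\<lambda>\<theta>. mfps_const (series_coeff (rc q) (rc t) 0 \<sigma> \<theta>) * xmonom 0 \<theta>) (Mtheta 0) = mfps_sum (\<lambda>_ :: nat \<Rightarrow> nat \<Rightarrow> nat. 1 :: xseries) {\<lambda>_ _. 0}"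
    by (simp add: series_coeff_def)
  also have "\<dots> = 1" by (rule mfps_eqI) (subst mfps_nth_mfps_sum[of "{\<lambda>_ _. 0}"], auto)
  finally show ?case by simp
next
  case (Suc n)
  define F where "F \<theta> = mfps_const (series_coeff (rc q) (rc t) (Suc n) \<sigma> \<theta>) * xmonom (Suc n) \<theta>" for \<theta>
  have F: "F (add_column n (\<mu>, \<theta>)) = last_monom n \<mu> * (mfps_const (branch_coeff (rc q) (rc t) n \<sigma> \<mu>) *
      (mfps_const (series_coeff (rc q) (rc t) n (\<lambda>i. \<sigma> i / rc q ^ \<mu> i) \<theta>) * xmonom n \<theta>))" for \<mu> \<theta>
    unfolding F_def series_coeff_add_column xmonom_add_column fst_conv snd_conv mfps_const_mult by (simp only: mult_ac)
  have summable: "mfps_summable (\<lambda>\<theta>. mfps_const (c \<theta>) * xmonom n \<theta>) (Mtheta n)" for c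
    unfolding mfps_summable_def using finite_p_series by blast
  have "branch_series q t (Suc n) \<sigma> = mfps_sum (\<lambda>\<mu>. mfps_sum (\<lambda>\<theta>. F (add_column n (\<mu>, \<theta>))) (Mtheta n)) (compositions n)"
    unfolding branch_series.simps last_sum_def Suc.IH F
    unfolding mfps_sum_mult[OF mfps_summable_mult[OF mfps_summable_mult[OF summable]], symmetric]
      mfps_sum_mult[OF mfps_summable_mult[OF summable], symmetric] mfps_sum_mult[OF summable, symmetric] ..
  also have "\<dots> = mfps_sum (\<lambda>p. F (add_column n (fst p, snd p))) (compositions n \<times> Mtheta n)"
  proof (rule mfps_sum_Times[symmetric])
    fix m
    have "finite {\<theta> \<in> Mtheta (Suc n). mfps_nth (F \<theta>) m \<noteq> 0}" unfolding F_def by (rule finite_p_series)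
    moreover have "add_column n ` {p \<in> compositions n \<times> Mtheta n. mfps_nth (F (add_column n (fst p, snd p))) m \<noteq> 0} \<subseteq>
        {\<theta> \<in> Mtheta (Suc n). mfps_nth (F \<theta>) m \<noteq> 0}"
      unfolding add_column_image[symmetric] by auto
    ultimately have "finite (add_column n ` {p \<in> compositions n \<times> Mtheta n. mfps_nth (F (add_column n (fst p, snd p))) m \<noteq> 0})"
      by (rule rev_finite_subset)
    then show "finite {p \<in> compositions n \<times> Mtheta n. mfps_nth (F (add_column n (fst p, snd p))) m \<noteq> 0}"
      by (rule finite_imageD) (rule inj_on_subset[OF inj_on_add_column], blast)
  qed
  also have "\<dots> = mfps_sum F (Mtheta (Suc n))"
    unfolding add_column_image[symmetric] mfps_sum_reindex[OF inj_on_add_column] prod.collapse ..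
  finally show ?case unfolding F_def[abs_def] .
qed

lemma p_series_eq_branch_series: "q \<noteq> 0 \<Longrightarrow> p_series n q t = branch_series q t n sv"
  unfolding p_series_def branch_series_eq_sum by (intro mfps_sum_cong) (simp add: c_coeff_eq_series_coeff)

lemma xmonom_monom: obtains e where "xmonom n \<theta> = mfps_monom e 1" "Poly_Mapping.keys e \<subseteq> {1..<n}"
proof
  let ?e = "\<Sum>(i, j)\<in>pairs n. \<Sum>_<\<theta> i j. \<Sum>a = i..<j. Poly_Mapping.single a (1::nat)"
  show mon: "xmonom n \<theta> = mfps_monom ?e 1"
    by (simp add: xmonom_def xratio_monom mfps_power_monom mfps_prod_monom case_prod_beta pairs_def)
  have "supported {1..<n} (xmonom n \<theta>)"
    unfolding xmonom_def
  proof (intro supported_prod)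
    fix p assume p: "p \<in> {(i, j). 1 \<le> i \<and> i < j \<and> j \<le> n}"
    obtain i j where ij: "p = (i, j)" by (rule prod.exhaust)
    have "{i..<j} \<subseteq> {1..<n}" using p unfolding ij by auto
    then show "supported {1..<n} (case p of (i, j) \<Rightarrow> xratio i j ^ \<theta> i j)"
      unfolding ij case_prod_conv by (intro supported_power supported_mono[OF supported_xratio])
  qed
  then show "Poly_Mapping.keys ?e \<subseteq> {1..<n}" unfolding mon by (simp add: supported_def mfps_nth_monom)
qed

text \<open>The index set is selected by the monomials and not by the nonzero coefficients, hence is
  the same for all t; the specialisation of t relies on this.\<close>

lemma
  shows finite_xmonom: "finite {\<theta> \<in> Mtheta n. mfps_nth (xmonom n \<theta>) m \<noteq> 0}"
    and mfps_nth_p_series: "mfps_nth (p_series n q t) m =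
      (\<Sum>\<theta> | \<theta> \<in> Mtheta n \<and> mfps_nth (xmonom n \<theta>) m \<noteq> 0. c_coeff n q t \<theta> * mfps_nth (xmonom n \<theta>) m)"
proof -
  show fin: "finite {\<theta> \<in> Mtheta n. mfps_nth (xmonom n \<theta>) m \<noteq> 0}"
    using finite_p_series[of n "\<lambda>_. 1" m] by simp
  show "mfps_nth (p_series n q t) m =
      (\<Sum>\<theta> | \<theta> \<in> Mtheta n \<and> mfps_nth (xmonom n \<theta>) m \<noteq> 0. c_coeff n q t \<theta> * mfps_nth (xmonom n \<theta>) m)"
    unfolding p_series_def by (subst mfps_nth_mfps_sum[OF fin]) auto
qed

section \<open>Coefficients of $p_n$\<close>

lemma ratfun_Q_prod: "(\<And>x. x \<in> A \<Longrightarrow> f x \<in> ratfun_Q n) \<Longrightarrow> (\<Prod>x\<in>A. f x) \<in> ratfun_Q n"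
  using ratfun_Q.const[of 1 n]
  by (induction A rule: infinite_finite_induct) (auto simp: rc_1 intro: ratfun_Q.mult)

lemma ratfun_Q_sum: "(\<And>x. x \<in> A \<Longrightarrow> f x \<in> ratfun_Q n) \<Longrightarrow> (\<Sum>x\<in>A. f x) \<in> ratfun_Q n"
  using ratfun_Q.const[of 0 n]
  by (induction A rule: infinite_finite_induct) (auto simp: rc_0 intro: ratfun_Q.add)

lemma ratfun_Q_divide: "f \<in> ratfun_Q n \<Longrightarrow> g \<in> ratfun_Q n \<Longrightarrow> f / g \<in> ratfun_Q n"
  unfolding divide_inverse by (intro ratfun_Q.mult ratfun_Q.inverse)

lemma ratfun_Q_sv:
  assumes "1 \<le> i" "i \<le> j" "j \<le> n"
  shows "sv j / sv i \<in> ratfun_Q n"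
  using assms(2,3)
proof (induction j rule: dec_induct)
  case base
  then show ?case using ratfun_Q.const[of 1 n] by (simp add: rc_1)
next
  case (step k)
  have "sv (k + 1) / sv k * (sv k / sv i) \<in> ratfun_Q n"
    using assms(1) step by (intro ratfun_Q.mult ratfun_Q.gen) auto
  then show ?case by simp
qed

lemma ratfun_Q_qpoch: "z \<in> ratfun_Q n \<Longrightarrow> qpoch (rc q) z k \<in> ratfun_Q n"
  unfolding qpoch_def
proof (rule ratfun_Q_prod)
  fix l assume z: "z \<in> ratfun_Q n"
  have "rc 1 + rc (- (q ^ l)) * z \<in> ratfun_Q n" by (intro ratfun_Q.add ratfun_Q.mult ratfun_Q.const z)
  then show "1 - rc q ^ l * z \<in> ratfun_Q n" by (simp add: rc_1 rc_uminus rc_power)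
qed

lemma ratfun_Q_c_coeff: "c_coeff n q t \<theta> \<in> ratfun_Q n"
proof -
  have "qpoch (rc q) (rc c * sv j / sv i) a \<in> ratfun_Q n" if "1 \<le> i" "i \<le> j" "j \<le> n" for c i j a
    unfolding times_divide_eq_right[symmetric]
    by (intro ratfun_Q_qpoch ratfun_Q.mult ratfun_Q.const ratfun_Q_sv that)
  then show ?thesis
    unfolding c_coeff_def case_prod_beta
    by (intro ratfun_Q.mult ratfun_Q_prod ratfun_Q_divide) auto
qed

lemma p_series_in_xseries_Q: "p_series n q t \<in> xseries_Q n"
  unfolding xseries_Q_def
proof (intro CollectI allI conjI impI)
  fix m
  have one: "mfps_nth (xmonom n \<theta>) m = 1" if "mfps_nth (xmonom n \<theta>) m \<noteq> 0" for \<theta>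
    using that by (rule_tac xmonom_monom[of n \<theta>]) (auto simp: mfps_nth_monom split: if_splits)
  show "mfps_nth (p_series n q t) m \<in> ratfun_Q n"
    unfolding mfps_nth_p_series by (intro ratfun_Q_sum) (simp add: one ratfun_Q_c_coeff)
  assume "mfps_nth (p_series n q t) m \<noteq> 0"
  then obtain \<theta> where "mfps_nth (xmonom n \<theta>) m \<noteq> 0"
    unfolding mfps_nth_p_series using sum.not_neutral_contains_not_neutral by force
  then show "Poly_Mapping.keys m \<subseteq> {1..<n}"
    by (rule_tac xmonom_monom[of n \<theta>]) (auto simp: mfps_nth_monom split: if_splits)
qed

section \<open>Specialisation of $t$\<close>

text \<open>Laurent polynomials in t, as functions of nonzero complex t. The polynomial is evaluated
  at \<open>rc t\<close>, so that its coefficients may contain the s_i.\<close>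

definition laurent :: "(complex \<Rightarrow> ratfun) \<Rightarrow> bool" where
  "laurent f \<longleftrightarrow> (\<exists>p k. \<forall>t. t \<noteq> 0 \<longrightarrow> f t * rc t ^ k = poly p (rc t))"

lemma laurent_const: "laurent (\<lambda>_. c)"
  unfolding laurent_def by (intro exI[of _ "[:c:]"] exI[of _ 0]) simp

lemma laurent_rc: "laurent rc"
  unfolding laurent_def by (intro exI[of _ "[:0, 1:]"] exI[of _ 0]) simp

lemma laurent_inverse_rc: "laurent (\<lambda>t. inverse (rc t))"
  unfolding laurent_def by (intro exI[of _ 1] exI[of _ 1]) simp

lemma laurent_mult: "laurent f \<Longrightarrow> laurent g \<Longrightarrow> laurent (\<lambda>t. f t * g t)"
proof -
  assume "laurent f" "laurent g"
  then obtain p k p' k' where pk: "\<And>t. t \<noteq> 0 \<Longrightarrow> f t * rc t ^ k = poly p (rc t)" "\<And>t. t \<noteq> 0 \<Longrightarrow> g t * rc t ^ k' = poly p' (rc t)"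
    unfolding laurent_def by blast
  have "f t * g t * rc t ^ (k + k') = poly (p * p') (rc t)" if "t \<noteq> 0" for t
    unfolding poly_mult power_add pk[OF that, symmetric] by (simp only: mult_ac)
  then show ?thesis unfolding laurent_def by blast
qed

lemma laurent_add: "laurent f \<Longrightarrow> laurent g \<Longrightarrow> laurent (\<lambda>t. f t + g t)"
proof -
  assume "laurent f" "laurent g"
  then obtain p k p' k' where pk: "\<And>t. t \<noteq> 0 \<Longrightarrow> f t * rc t ^ k = poly p (rc t)" "\<And>t. t \<noteq> 0 \<Longrightarrow> g t * rc t ^ k' = poly p' (rc t)"
    unfolding laurent_def by blast
  have "(f t + g t) * rc t ^ (k + k') = poly (p * monom 1 k' + p' * monom 1 k) (rc t)" if "t \<noteq> 0" for t
  proof -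
    have "(f t + g t) * rc t ^ (k + k') = (f t * rc t ^ k) * rc t ^ k' + (g t * rc t ^ k') * rc t ^ k"
      unfolding power_add distrib_right by (simp only: mult_ac)
    then show ?thesis unfolding pk[OF that] by (simp add: poly_monom)
  qed
  then show ?thesis unfolding laurent_def by blast
qed

lemma laurent_diff: "laurent f \<Longrightarrow> laurent g \<Longrightarrow> laurent (\<lambda>t. f t - g t)"
  using laurent_add[OF _ laurent_mult[OF laurent_const[of "-1"]], of f g] by simp

lemma laurent_power: "laurent f \<Longrightarrow> laurent (\<lambda>t. f t ^ k)"
  by (induction k) (simp_all add: laurent_const laurent_mult)

lemma laurent_prod: "(\<And>x. x \<in> A \<Longrightarrow> laurent (f x)) \<Longrightarrow> laurent (\<lambda>t. \<Prod>x\<in>A. f x t)"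
  by (induction A rule: infinite_finite_induct) (simp_all add: laurent_const laurent_mult)

lemma laurent_sum: "(\<And>x. x \<in> A \<Longrightarrow> laurent (f x)) \<Longrightarrow> laurent (\<lambda>t. \<Sum>x\<in>A. f x t)"
  by (induction A rule: infinite_finite_induct) (simp_all add: laurent_const laurent_add)

lemma laurent_powi: "laurent f \<Longrightarrow> laurent (\<lambda>t. inverse (f t)) \<Longrightarrow> laurent (\<lambda>t. f t powi k)"
  unfolding power_int_def by (cases "k \<ge> 0") (simp_all add: laurent_power)

lemma laurent_qpoch: "laurent f \<Longrightarrow> laurent (\<lambda>t. qpoch c (f t) k)"
  unfolding qpoch_def by (intro laurent_prod laurent_diff laurent_mult laurent_const)

text \<open>After multiplication by a power of t the difference is a polynomial over a field, with
  infinitely many roots because \<open>rc\<close> is injective.\<close>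

lemma laurent_eqI:
  assumes fg: "laurent f" "laurent g" and S: "infinite S" "\<And>t. t \<in> S \<Longrightarrow> f t = g t" and t: "t \<noteq> 0"
  shows "f t = g t"
proof -
  obtain p k where pk: "\<And>t. t \<noteq> 0 \<Longrightarrow> (f t - g t) * rc t ^ k = poly p (rc t)"
    using laurent_diff[OF fg] unfolding laurent_def by blast
  have "poly p (rc t) = 0" if "t \<in> S - {0}" for t using pk[of t] S(2) that by simp
  then have "rc ` (S - {0}) \<subseteq> {x. poly p x = 0}" by blast
  moreover have "infinite (rc ` (S - {0}))"
    using S(1) by (subst finite_image_iff) (auto simp: inj_on_def rc_eq_iff)
  ultimately have "p = 0" using poly_roots_finite finite_subset by blast
  then show ?thesis using pk[OF t] t by simp
qed

section \<open>Series with Laurent polynomials in t as coefficients\<close>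

definition laurent_series :: "(complex \<Rightarrow> xseries) \<Rightarrow> bool" where
  "laurent_series F \<longleftrightarrow> (\<forall>m. laurent (\<lambda>t. mfps_nth (F t) m))"

lemma laurent_series_constant: "laurent_series (\<lambda>_. f)"
  by (simp add: laurent_series_def laurent_const)

lemma laurent_series_const: "laurent f \<Longrightarrow> laurent_series (\<lambda>t. mfps_const (f t))"
  unfolding laurent_series_def mfps_const_nth by (intro allI, case_tac "m = 0") (simp_all add: laurent_const)

lemma laurent_series_mult: "laurent_series F \<Longrightarrow> laurent_series G \<Longrightarrow> laurent_series (\<lambda>t. F t * G t)"
  unfolding laurent_series_def mfps_nth_times case_prod_beta by (intro allI laurent_sum laurent_mult) simp_all

lemma laurent_series_diff: "laurent_series F \<Longrightarrow> laurent_series G \<Longrightarrow> laurent_series (\<lambda>t. F t - G t)"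
  by (simp add: laurent_series_def laurent_diff)

lemma laurent_series_sum: "(\<And>x. x \<in> A \<Longrightarrow> laurent_series (F x)) \<Longrightarrow> laurent_series (\<lambda>t. \<Sum>x\<in>A. F x t)"
  by (simp add: laurent_series_def mfps_nth_sum laurent_sum)

lemma laurent_series_prod: "(\<And>x. x \<in> A \<Longrightarrow> laurent_series (F x)) \<Longrightarrow> laurent_series (\<lambda>t. \<Prod>x\<in>A. F x t)"
  by (induction A rule: infinite_finite_induct) (simp_all add: laurent_series_constant laurent_series_mult)

lemma laurent_series_qshift_set: "laurent_series F \<Longrightarrow> laurent_series (\<lambda>t. qshift_set q I (F t))"
  by (simp add: laurent_series_def qshift_set_nth laurent_mult laurent_const)

text \<open>The denominators of c_n do not involve t, and its numerators are polynomial in t and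
  1/t; so t = 0 is the only possible singularity.\<close>

lemma laurent_c_coeff: "laurent (\<lambda>t. c_coeff n q t \<theta>)"
  unfolding c_coeff_def case_prod_beta divide_inverse rc_mult rc_inverse
  by (intro laurent_mult laurent_prod laurent_qpoch laurent_const laurent_rc laurent_inverse_rc)

lemma laurent_p_series: "laurent_series (\<lambda>t. p_series n q t)"
  unfolding laurent_series_def mfps_nth_p_series
  by (intro allI laurent_sum laurent_mult laurent_c_coeff laurent_const)

lemma laurent_D_gen: "laurent_series F \<Longrightarrow> laurent_series (\<lambda>t. D_gen n q t u (F t))"
proof -
  assume F: "laurent_series F"
  have D: "laurent_series (\<lambda>t. D_factor t i j)" for i j
    unfolding D_factor_def by (cases "i < j")
      (simp_all add: laurent_series_mult laurent_series_diff laurent_series_constant laurent_series_const laurent_rc)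
  show ?thesis
    unfolding D_gen_def D_op_eq mac_op_def mac_coeff_def mac_scalar_def case_prod_beta rc_powi rc_power
    by (intro laurent_series_sum laurent_series_mult laurent_series_const laurent_series_prod
        laurent_series_qshift_set laurent_const laurent_power laurent_rc laurent_prod laurent_mult laurent_powi laurent_inverse_rc D F)
qed

text \<open>The excluded values, 0 and the integral powers of q, are countable in number, whereas
  the complex numbers are not.\<close>

lemma infinite_generic_parameters:
  assumes q: "q \<noteq> (0 :: complex)"
  shows "infinite {t. t \<noteq> 0 \<and> (\<forall>a b. t * q ^ a \<noteq> q ^ b)}"
proof
  assume "finite {t. t \<noteq> 0 \<and> (\<forall>a b. t * q ^ a \<noteq> q ^ b)}" (is "finite ?S")
  moreover have "countable ({0} \<union> range (\<lambda>(a, b). q ^ b / q ^ a))" (is "countable ?C") by simp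
  moreover have "UNIV \<subseteq> ?S \<union> ?C"
  proof
    fix t :: complex
    show "t \<in> ?S \<union> ?C"
    proof (cases "\<exists>a b. t * q ^ a = q ^ b")
      case True
      then obtain a b where "t * q ^ a = q ^ b" by blast
      then have "t = (case (a, b) of (a, b) \<Rightarrow> q ^ b / q ^ a)" using q by (simp add: eq_divide_eq)
      then show ?thesis by blast
    qed blast
  qed
  ultimately have "countable (UNIV :: complex set)"
    using countable_subset[OF _ countable_Un[OF countable_finite]] by blast
  then show False using uncountable_UNIV_complex by contradiction
qed

theorem theorem1p3:
  fixes q t :: complex and n :: nat and u :: ratfun
  assumes "q \<noteq> 0" and "t \<noteq> 0" and "norm q < 1" and "n \<ge> 1"
  shows "p_series n q t \<in> xseries_Q n \<and>
    D_gen n q t u (p_series n q t) = p_series n q t * mfps_const (\<Prod>i = 1..n. 1 - u * sv i)"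
proof
  have q_gen: "q ^ Suc a \<noteq> 1" for a
  proof
    assume "q ^ Suc a = 1"
    then have "norm q ^ Suc a = 1" by (metis norm_one norm_power)
    then show False using assms(1,3) power_Suc_less_one[of "norm q" a] by simp
  qed
  \<comment> \<open>The t of this statement shadows the given one: the equation is obtained for all
    generic t and then carried over to the given t, one coefficient at a time.\<close>
  have generic: "D_gen n q t u (p_series n q t) = p_series n q t * mfps_const (\<Prod>i = 1..n. 1 - u * sv i)"
    if "t \<noteq> 0 \<and> (\<forall>a b. t * q ^ a \<noteq> q ^ b)" for t
  proof -
    interpret generic_params q t using assms(1) q_gen that by unfold_locales auto
    show ?thesis unfolding p_series_eq_branch_series[OF assms(1)] by (rule D_gen_branch_series)
  qed
  show "D_gen n q t u (p_series n q t) = p_series n q t * mfps_const (\<Prod>i = 1..n. 1 - u * sv i)"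
  proof (rule mfps_eqI)
    fix m
    show "mfps_nth (D_gen n q t u (p_series n q t)) m = mfps_nth (p_series n q t * mfps_const (\<Prod>i = 1..n. 1 - u * sv i)) m"
    proof (rule laurent_eqI[OF _ _ infinite_generic_parameters[OF assms(1)] _ assms(2)])
      show "laurent (\<lambda>t. mfps_nth (D_gen n q t u (p_series n q t)) m)"
        using laurent_D_gen[OF laurent_p_series] unfolding laurent_series_def by blast
      show "laurent (\<lambda>t. mfps_nth (p_series n q t * mfps_const (\<Prod>i = 1..n. 1 - u * sv i)) m)"
        using laurent_series_mult[OF laurent_p_series laurent_series_constant] unfolding laurent_series_def by blast
      show "mfps_nth (D_gen n q t u (p_series n q t)) m = mfps_nth (p_series n q t * mfps_const (\<Prod>i = 1..n. 1 - u * sv i)) m"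
        if "t \<in> {t. t \<noteq> 0 \<and> (\<forall>a b. t * q ^ a \<noteq> q ^ b)}" for t
        by (simp only: generic[OF that[unfolded mem_Collect_eq]])
    qed
  qed
qed (rule p_series_in_xseries_Q)

end
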